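(* (Family $(0,0,1)$, Painlevé V.) Let $\theta_0,\theta_1,\theta_\infty\in\mathbb{C}$ be fixed, $t\in\mathbb{C}^*$, $p\in\mathbb{C}$, $q\in\mathbb{C}\setminus\{0,1\}$. Put $w=p+\frac12q(qt-t+\theta_\infty)$, $v=p+\frac12(q-1)(qt+\theta_\infty)$, $$A_0=\begin{pmatrix}-w&\frac{(q-1)(w^2-\theta_0^2/4)}{q}\\-\frac{q}{q-1}&w\end{pmatrix},\quad A_1=\begin{pmatrix}v&\frac{\theta_1^2}{4}-v^2\\1&-v\end{pmatrix},\quad A_\infty=\begin{pmatrix}-\frac t2&0\\0&\frac t2\end{pmatrix},$$ and consider the family of connections $\nabla_{d/dz}=\frac{d}{dz}+\frac{A_0}{z}+\frac{A_1}{z-1}+A_\infty$. For an isomonodromic family in it (so that $p,q$ are functions of $t$), the operator $\frac{d}{dt}+B$ commuting with $\nabla_{d/dz}$ is given by $$B=z\begin{pmatrix}-\frac12&0\\0&\frac12\end{pmatrix}+\frac1t\begin{pmatrix}\epsilon&f\\-\frac1{q-1}&-\epsilon\end{pmatrix},\qquad \epsilon=-\frac p{q-1}-\frac12(q-1)t-\frac{\theta_\infty}2,$$ $$f=-\frac1q\Big[\big(p+\tfrac12(q-1)qt\big)^2-\tfrac{\theta_1^2}4+(q-1)\big(\tfrac{\theta_0^2}4-\tfrac{\theta_1^2}4-\tfrac{q\theta_\infty^2}4\big)\Big].$$ From $[\frac{d}{dt}+B,\nabla_{d/dz}]=0$ one deduces the system $$\frac{dq}{dt}=\frac{2p}{t},\qquad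 \frac{dp}{dt}=\frac{(2q-1)p^2}{(q-1)qt}+\frac{\theta_0^2(q-1)^2-\theta_1^2q^2}{4q(q-1)t}+\frac14(q-1)q(2qt-t+2\theta_\infty-2),$$ which describes the isomonodromic families. This system is equivalent to the second order differential equation for $q$ $$q''=\frac{(2q-1)(q')^2}{2(q-1)q}-\frac{q'}t+\frac{(q-1)q(2qt-t+2\theta_\infty-2)}{2t}+\frac{\theta_0^2}{2qt^2}+\frac{\theta_1^2}{2(q-1)t^2}.$$ The system is the Hamiltonian system $\frac{dp}{dt}=q(q-1)\frac{\partial H}{\partial q}$, $\frac{dq}{dt}=-q(q-1)\frac{\partial H}{\partial p}$ with $$H=-\frac{p^2}{(q-1)qt}-\frac{\theta_0^2}{4qt}+\frac{\theta_1^2}{4(q-1)t}+\frac14q(qt-t+2\theta_\infty-2);$$ equivalently, the foliation given by the 2-form $\frac{dp\wedge dq}{q(q-1)}-dH\wedge dt$ coincides with the foliation given by isomonodromy.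
   Context: The connections have regular singularities at $z=0,1$ with local exponents $\pm\frac{\theta_0}2$, $\pm\frac{\theta_1}2$ and an irregular singularity of Katz invariant $1$ at $z=\infty$ with generalized local exponents $\pm(\frac t2z+\frac{\theta_\infty}2)$. Here $q$ is the unique zero of the lower left entry of $z(z-1)\big(\frac{A_0}z+\frac{A_1}{z-1}+A_\infty\big)$, and $p$ is the value at $z=q$ of its upper left entry. An isomonodromic family is a family parametrized by $t$, with $\theta_0,\theta_1,\theta_\infty$ fixed, along which the analytic data (monodromy, Stokes matrices and links between solution spaces) are constant; for it there is a trace zero matrix $B(z,t)$, rational in $z$, such that $\frac{d}{dt}+B$ commutes with $\nabla_{d/dz}=\frac{d}{dz}+A$, i.e. $\frac{\partial A}{\partial t}=\frac{\partial B}{\partial z}+BA-AB$ when read with the opposite sign convention for the commutator, or explicitly: $\frac{\partial A}{\partial t}-\frac{\partial B}{\partial z}+BA-AB=0$ identically in $z,t$ as the vanishing of $(\frac{d}{dt}+B)(\frac{d}{dz}+A)-(\frac{d}{dz}+A)(\frac{d}{dt}+B)$. In the Hamiltonian equations $H=H(p,q,t)$, with partial derivatives in the independent variables $p,q,t$; $'$ denotes $\frac{d}{dt}$. The foliation given by a 2-form $\Omega$ is the one given by the vector field $\frac{\partial}{\partial t}+v_p\frac{\partial}{\partial p}+v_q\frac{\partial}{\partial q}$ whose contraction with $\Omega$ is zero.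
   Formalization: Last two terms of the q'' equation corrected to θ0²(q-1)/(2qt²) - θ1²q/(2(q-1)t²); the 2-form has +dH∧dt; local solution spaces at 0,1 include the lattice, and a general commuting B has no pole at 0 (at 1) if θ0 (θ1) is a nonzero integer. *)

theory Defs
  imports "HOL-Analysis.Analysis" "HOL-Computational_Algebra.Polynomial"
begin

type_synonym mat2 = "complex^2^2"

definition mat22 :: "complex \<Rightarrow> complex \<Rightarrow> complex \<Rightarrow> complex \<Rightarrow> mat2" where
  "mat22 a b c d = vector [vector [a, b], vector [c, d]]"

definition cscale :: "complex \<Rightarrow> mat2 \<Rightarrow> mat2" where
  "cscale c M = (\<chi> i j. c * M $ i $ j)"

definition mderiv :: "(complex \<Rightarrow> mat2) \<Rightarrow> complex \<Rightarrow> mat2" where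
  "mderiv F x = (\<chi> i j. deriv (\<lambda>y. F y $ i $ j) x)"

(* Holomorphic on the product U x D of two open sets: separately holomorphic and continuous. *)
definition holomorphic2_on :: "(complex \<Rightarrow> complex \<Rightarrow> mat2) \<Rightarrow> complex set \<Rightarrow> complex set \<Rightarrow> bool" where
  "holomorphic2_on F U D \<longleftrightarrow>
     continuous_on (U \<times> D) (\<lambda>(z, t). F z t) \<and>
     (\<forall>t\<in>D. \<forall>i j. (\<lambda>z. F z t $ i $ j) holomorphic_on U) \<and>
     (\<forall>z\<in>U. \<forall>i j. (\<lambda>t. F z t $ i $ j) holomorphic_on D)"


section \<open>The family of connections\<close>

definition residue0 :: "complex \<Rightarrow> complex \<Rightarrow> complex \<Rightarrow> complex \<Rightarrow> complex \<Rightarrow> mat2" where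
  "residue0 \<theta>0 \<theta>i p q t =
     (let w = p + 1/2 * q * (q * t - t + \<theta>i)
      in mat22 (- w) ((q - 1) * (w^2 - \<theta>0^2 / 4) / q) (- q / (q - 1)) w)"

definition residue1 :: "complex \<Rightarrow> complex \<Rightarrow> complex \<Rightarrow> complex \<Rightarrow> complex \<Rightarrow> mat2" where
  "residue1 \<theta>1 \<theta>i p q t =
     (let v = p + 1/2 * (q - 1) * (q * t + \<theta>i)
      in mat22 v (\<theta>1^2 / 4 - v^2) 1 (- v))"

definition leading_inf :: "complex \<Rightarrow> mat2" where
  "leading_inf t = mat22 (- t / 2) 0 0 (t / 2)"

definition connection_matrix ::
  "complex \<Rightarrow> complex \<Rightarrow> complex \<Rightarrow> (complex \<Rightarrow> complex) \<Rightarrow> (complex \<Rightarrow> complex) \<Rightarrow>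
   complex \<Rightarrow> complex \<Rightarrow> mat2" where
  "connection_matrix \<theta>0 \<theta>1 \<theta>i p q z t =
     cscale (1 / z) (residue0 \<theta>0 \<theta>i (p t) (q t) t) +
     cscale (1 / (z - 1)) (residue1 \<theta>1 \<theta>i (p t) (q t) t) + leading_inf t"


section \<open>Isomonodromic families\<close>

text \<open>
  A family of fundamental matrices: the columns of \<open>Y z t\<close> are a basis of the space of
  solutions on \<open>U\<close> of the connection d/dz + A with parameter \<open>t\<close>.
\<close>

definition fundamental_family ::
  "(complex \<Rightarrow> complex \<Rightarrow> mat2) \<Rightarrow> complex set \<Rightarrow> complex set \<Rightarrow> (complex \<Rightarrow> complex \<Rightarrow> mat2) \<Rightarrow> bool" where
  "fundamental_family A U D Y \<longleftrightarrow>
     holomorphic2_on Y U D \<and>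
     (\<forall>t\<in>D. \<forall>z\<in>U. det (Y z t) \<noteq> 0 \<and> mderiv (\<lambda>x. Y x t) z = - (A z t ** Y z t))"

definition ordinary_discs :: "complex set set" where
  "ordinary_discs = {ball c \<rho> | c \<rho>. 0 \<notin> ball c \<rho> \<and> 1 \<notin> ball c \<rho>}"

definition slit_disc :: "complex \<Rightarrow> complex set" where
  "slit_disc s = {z \<in> ball s 1. z - s \<notin> \<real>\<^sub>\<le>\<^sub>0}"

text \<open>
  The sector at infinity with bisecting direction \<open>u\<close> whose half opening angle is
  \<open>\<pi>/2 + arcsin \<delta>\<close>.  For \<open>u = \<plusminus>\<i>/t\<close> the exponentials exp(tz/2) and exp(-tz/2)
  exchange dominance along its bisector only, so a solution basis with prescribed leading
  asymptotics there is unique (the canonical, or Stokes, solution).  The sectors for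
  \<open>\<i>/t\<close> and \<open>-\<i>/t\<close> cover a neighbourhood of infinity and overlap in two components,
  which carry the two Stokes matrices (one of them combined with the formal monodromy).
\<close>

definition sector :: "real \<Rightarrow> real \<Rightarrow> complex \<Rightarrow> complex set" where
  "sector \<delta> R u = {z. cmod z > R \<and> Re (z / sgn u) > - \<delta> * cmod z}"

definition sector_log :: "complex \<Rightarrow> complex \<Rightarrow> complex" where
  "sector_log u z = Ln (z / u) + Ln u"

text \<open>The formal solution at infinity is (D(t) + O(1/z)) times this diagonal matrix.\<close>

definition formal_exponent :: "complex \<Rightarrow> complex \<Rightarrow> complex \<Rightarrow> complex \<Rightarrow> complex" where
  "formal_exponent \<theta>i u z t = t / 2 * z + \<theta>i / 2 * sector_log u z"

definition exp_diag :: "complex \<Rightarrow> mat2" where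
  "exp_diag x = mat22 (exp x) 0 0 (exp (- x))"

text \<open>
  A local basis of solutions at the regular singular point \<open>s\<close>: a frame \<open>G\<close>, holomorphic
  and invertible at \<open>s\<close> as well, times a multivalued normal form \<open>W\<close> that does not involve \<open>t\<close>.
  For exponents \<open>\<plusminus>\<theta>/2\<close> with \<open>\<theta>\<close> not an integer one may take
  W(z) = diag((z-s) powr (\<theta>/2), (z-s) powr (-\<theta>/2)); keeping \<open>W\<close> general covers the
  resonant and logarithmic cases uniformly.
\<close>

definition regular_singular_basis ::
  "complex \<Rightarrow> complex set \<Rightarrow> (complex \<Rightarrow> complex \<Rightarrow> mat2) \<Rightarrow> bool" where
  "regular_singular_basis s D Y \<longleftrightarrow>
     (\<exists>G W. holomorphic2_on G (ball s 1) D \<and>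
            (\<forall>t\<in>D. \<forall>z\<in>ball s 1. det (G z t) \<noteq> 0) \<and>
            (\<forall>t\<in>D. \<forall>z\<in>slit_disc s. Y z t = G z t ** W z))"

text \<open>
  Bases of the two canonical solution spaces at infinity.  The formal solutions are only
  determined up to constants, so the leading coefficient is an invertible diagonal matrix
  depending on \<open>t\<close>, the same for both sectors.
\<close>

definition canonical_bases_at_infinity ::
  "complex \<Rightarrow> real \<Rightarrow> real \<Rightarrow> complex set \<Rightarrow> complex set \<Rightarrow>
   (complex set \<Rightarrow> complex \<Rightarrow> complex \<Rightarrow> mat2) \<Rightarrow> bool" where
  "canonical_bases_at_infinity \<theta>i \<delta> R us D Y \<longleftrightarrow>
     (\<exists>c d. (\<forall>t\<in>D. c t \<noteq> 0 \<and> d t \<noteq> 0) \<and>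
        (\<forall>u\<in>us. uniform_limit D
           (\<lambda>z t. Y (sector \<delta> R u) z t ** exp_diag (- formal_exponent \<theta>i u z t))
           (\<lambda>t. mat22 (c t) 0 0 (d t))
           (inf at_infinity (principal (sector \<delta> R u)))))"

text \<open>
  The analytic data are constant for \<open>t\<close> in \<open>D\<close> (a neighbourhood of \<open>t0\<close>).  The local
  solution spaces are those on discs of ordinary points, the ones at the singular points 0
  and 1, and the two canonical ones at infinity.  The matrices comparing two of these bases
  at a common point are the links; composing them along chains of regions gives the analytic
  continuation along paths, in particular monodromy, and those for the two sectors at
  infinity are the Stokes matrices.  All are required to be independent of \<open>t\<close>.
\<close>

definition constant_analytic_data ::
  "complex \<Rightarrow> (complex \<Rightarrow> complex \<Rightarrow> mat2) \<Rightarrow> complex \<Rightarrow> complex set \<Rightarrow> bool" where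
  "constant_analytic_data \<theta>i A t0 D \<longleftrightarrow>
     (\<exists>\<delta> R Y. 0 < \<delta> \<and> \<delta> < 1 \<and> 1 \<le> R \<and>
       (let us = {\<i> / t0, - \<i> / t0};
            regions = ordinary_discs \<union> {slit_disc 0, slit_disc 1} \<union> sector \<delta> R ` us
        in (\<forall>U\<in>regions. fundamental_family A U D (Y U)) \<and>
           regular_singular_basis 0 D (Y (slit_disc 0)) \<and>
           regular_singular_basis 1 D (Y (slit_disc 1)) \<and>
           canonical_bases_at_infinity \<theta>i \<delta> R us D Y \<and>
           (\<forall>U\<in>regions. \<forall>V\<in>regions. \<forall>z\<in>U \<inter> V. \<forall>t\<in>D.
              matrix_inv (Y U z t) ** Y V z t = matrix_inv (Y U z t0) ** Y V z t0)))"

definition isomonodromic ::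
  "complex \<Rightarrow> complex \<Rightarrow> complex \<Rightarrow> complex set \<Rightarrow> (complex \<Rightarrow> complex) \<Rightarrow> (complex \<Rightarrow> complex) \<Rightarrow> bool" where
  "isomonodromic \<theta>0 \<theta>1 \<theta>i T p q \<longleftrightarrow>
     (\<forall>t0\<in>T. \<exists>r>0. ball t0 r \<subseteq> T \<and>
        constant_analytic_data \<theta>i (connection_matrix \<theta>0 \<theta>1 \<theta>i p q) t0 (ball t0 r))"


section \<open>The commuting operator\<close>

text \<open>
  (d/dt + B)(d/dz + A) - (d/dz + A)(d/dt + B) = 0, as an identity between rational
  functions of \<open>z\<close>.
\<close>

definition commutes ::
  "complex set \<Rightarrow> (complex \<Rightarrow> complex \<Rightarrow> mat2) \<Rightarrow> (complex \<Rightarrow> complex \<Rightarrow> mat2) \<Rightarrow> bool" where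
  "commutes T A B \<longleftrightarrow>
     (\<forall>t\<in>T. \<exists>F. finite F \<and> (\<forall>z\<in>- F.
        mderiv (\<lambda>s. A z s) t - mderiv (\<lambda>x. B x t) z + B z t ** A z t - A z t ** B z t = 0))"

definition rational_without_poles_in :: "complex set \<Rightarrow> (complex \<Rightarrow> complex) \<Rightarrow> bool" where
  "rational_without_poles_in S f \<longleftrightarrow>
     (\<exists>n d :: complex poly. d \<noteq> 0 \<and> coprime n d \<and> (\<forall>s\<in>S. poly d s \<noteq> 0) \<and>
        f = (\<lambda>z. poly n z / poly d z))"

text \<open>
  If \<open>\<theta>0\<close> is a nonzero integer and the local monodromy at 0 is scalar, the connection may
  admit rational infinitesimal gauge transformations with a pole at 0; these keep the
  connection over the rational functions but change its lattice at 0, and are no deformations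
  of the local solution space there.  Similarly at 1.  For other exponents
  regularity of B at 0 and 1 follows from the commutation relation.
\<close>

definition resonant_points :: "complex \<Rightarrow> complex \<Rightarrow> complex set" where
  "resonant_points \<theta>0 \<theta>1 = {s. s = 0 \<and> \<theta>0 \<in> \<int> - {0} \<or> s = 1 \<and> \<theta>1 \<in> \<int> - {0}}"

definition rational_tracefree ::
  "complex \<Rightarrow> complex \<Rightarrow> complex set \<Rightarrow> (complex \<Rightarrow> complex \<Rightarrow> mat2) \<Rightarrow> bool" where
  "rational_tracefree \<theta>0 \<theta>1 T B \<longleftrightarrow>
     (\<forall>t\<in>T. (\<forall>i j. rational_without_poles_in (resonant_points \<theta>0 \<theta>1) (\<lambda>z. B z t $ i $ j)) \<and>
            (\<forall>z. trace (B z t) = 0))"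

definition B_eps :: "complex \<Rightarrow> complex \<Rightarrow> complex \<Rightarrow> complex \<Rightarrow> complex" where
  "B_eps \<theta>i p q t = - p / (q - 1) - 1/2 * (q - 1) * t - \<theta>i / 2"

definition B_f :: "complex \<Rightarrow> complex \<Rightarrow> complex \<Rightarrow> complex \<Rightarrow> complex \<Rightarrow> complex \<Rightarrow> complex" where
  "B_f \<theta>0 \<theta>1 \<theta>i p q t =
     - (1 / q) * ((p + 1/2 * (q - 1) * q * t)^2 - \<theta>1^2 / 4
                  + (q - 1) * (\<theta>0^2 / 4 - \<theta>1^2 / 4 - q * \<theta>i^2 / 4))"

definition B_matrix ::
  "complex \<Rightarrow> complex \<Rightarrow> complex \<Rightarrow> (complex \<Rightarrow> complex) \<Rightarrow> (complex \<Rightarrow> complex) \<Rightarrow>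
   complex \<Rightarrow> complex \<Rightarrow> mat2" where
  "B_matrix \<theta>0 \<theta>1 \<theta>i p q z t =
     cscale z (mat22 (- 1/2) 0 0 (1/2)) +
     cscale (1 / t) (mat22 (B_eps \<theta>i (p t) (q t) t) (B_f \<theta>0 \<theta>1 \<theta>i (p t) (q t) t)
                           (- (1 / (q t - 1))) (- B_eps \<theta>i (p t) (q t) t))"


section \<open>The Painleve V equation\<close>

definition rhs_q :: "complex \<Rightarrow> complex \<Rightarrow> complex \<Rightarrow> complex" where
  "rhs_q p q t = 2 * p / t"

definition rhs_p :: "complex \<Rightarrow> complex \<Rightarrow> complex \<Rightarrow> complex \<Rightarrow> complex \<Rightarrow> complex \<Rightarrow> complex" where
  "rhs_p \<theta>0 \<theta>1 \<theta>i p q t =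
     (2 * q - 1) * p^2 / ((q - 1) * q * t)
     + (\<theta>0^2 * (q - 1)^2 - \<theta>1^2 * q^2) / (4 * q * (q - 1) * t)
     + 1/4 * (q - 1) * q * (2 * q * t - t + 2 * \<theta>i - 2)"

definition painleve_system ::
  "complex \<Rightarrow> complex \<Rightarrow> complex \<Rightarrow> complex set \<Rightarrow> (complex \<Rightarrow> complex) \<Rightarrow> (complex \<Rightarrow> complex) \<Rightarrow> bool" where
  "painleve_system \<theta>0 \<theta>1 \<theta>i T p q \<longleftrightarrow>
     (\<forall>t\<in>T. deriv q t = rhs_q (p t) (q t) t \<and> deriv p t = rhs_p \<theta>0 \<theta>1 \<theta>i (p t) (q t) t)"

text \<open>
  The last two terms are what elimination of p = t q'/2 from the system yields,
  namely 2/t times the second summand of \<open>rhs_p\<close>.  The published equation has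
  \<open>\<theta>0^2 / (2 * q * t^2) + \<theta>1^2 / (2 * (q - 1) * t^2)\<close> in their place, which is a
  misprint: already for \<open>\<theta>1 = 0\<close> it would need (q - 2) times the square of \<open>\<theta>0\<close> to vanish.
\<close>

definition painleve_second_order ::
  "complex \<Rightarrow> complex \<Rightarrow> complex \<Rightarrow> complex set \<Rightarrow> (complex \<Rightarrow> complex) \<Rightarrow> bool" where
  "painleve_second_order \<theta>0 \<theta>1 \<theta>i T q \<longleftrightarrow>
     (\<forall>t\<in>T. deriv (deriv q) t =
        (2 * q t - 1) * (deriv q t)^2 / (2 * (q t - 1) * q t) - deriv q t / t
        + (q t - 1) * q t * (2 * q t * t - t + 2 * \<theta>i - 2) / (2 * t)
        + \<theta>0^2 * (q t - 1) / (2 * q t * t^2) - \<theta>1^2 * q t / (2 * (q t - 1) * t^2))"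

definition hamiltonian ::
  "complex \<Rightarrow> complex \<Rightarrow> complex \<Rightarrow> complex \<Rightarrow> complex \<Rightarrow> complex \<Rightarrow> complex" where
  "hamiltonian \<theta>0 \<theta>1 \<theta>i p q t =
     - (p^2 / ((q - 1) * q * t)) - \<theta>0^2 / (4 * q * t) + \<theta>1^2 / (4 * (q - 1) * t)
     + 1/4 * q * (q * t - t + 2 * \<theta>i - 2)"

definition partial_p :: "(complex \<Rightarrow> complex \<Rightarrow> complex \<Rightarrow> complex) \<Rightarrow> complex \<Rightarrow> complex \<Rightarrow> complex \<Rightarrow> complex" where
  "partial_p H p q t = deriv (\<lambda>x. H x q t) p"

definition partial_q :: "(complex \<Rightarrow> complex \<Rightarrow> complex \<Rightarrow> complex) \<Rightarrow> complex \<Rightarrow> complex \<Rightarrow> complex \<Rightarrow> complex" where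
  "partial_q H p q t = deriv (\<lambda>x. H p x t) q"

definition partial_t :: "(complex \<Rightarrow> complex \<Rightarrow> complex \<Rightarrow> complex) \<Rightarrow> complex \<Rightarrow> complex \<Rightarrow> complex \<Rightarrow> complex" where
  "partial_t H p q t = deriv (\<lambda>x. H p q x) t"

definition hamiltonian_system ::
  "complex \<Rightarrow> complex \<Rightarrow> complex \<Rightarrow> complex set \<Rightarrow> (complex \<Rightarrow> complex) \<Rightarrow> (complex \<Rightarrow> complex) \<Rightarrow> bool" where
  "hamiltonian_system \<theta>0 \<theta>1 \<theta>i T p q \<longleftrightarrow>
     (\<forall>t\<in>T. deriv p t = q t * (q t - 1) * partial_q (hamiltonian \<theta>0 \<theta>1 \<theta>i) (p t) (q t) t \<and>
            deriv q t = - (q t * (q t - 1)) * partial_p (hamiltonian \<theta>0 \<theta>1 \<theta>i) (p t) (q t) t)"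


section \<open>The 2-form on the space with coordinates p, q, t\<close>

text \<open>The triple (a, b, c) is the tangent vector a d/dp + b d/dq + c d/dt.\<close>

type_synonym tangent = "complex \<times> complex \<times> complex"
type_synonym form1 = "tangent \<Rightarrow> complex"
type_synonym form2 = "tangent \<Rightarrow> tangent \<Rightarrow> complex"

definition dp :: form1 where "dp = (\<lambda>(a, b, c). a)"
definition dq :: form1 where "dq = (\<lambda>(a, b, c). b)"
definition dt :: form1 where "dt = (\<lambda>(a, b, c). c)"

definition differential ::
  "(complex \<Rightarrow> complex \<Rightarrow> complex \<Rightarrow> complex) \<Rightarrow> complex \<Rightarrow> complex \<Rightarrow> complex \<Rightarrow> form1" where
  "differential H p q t X =
     partial_p H p q t * dp X + partial_q H p q t * dq X + partial_t H p q t * dt X"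

definition wedge :: "form1 \<Rightarrow> form1 \<Rightarrow> form2" where
  "wedge \<alpha> \<beta> X Y = \<alpha> X * \<beta> Y - \<alpha> Y * \<beta> X"

text \<open>
  The published form has a minus sign before dH \<open>\<and>\<close> dt.  With that sign the contraction
  gives p' = - q (q - 1) H_q and q' = q (q - 1) H_p, opposite to the Hamiltonian system above
  (which agrees with the isomonodromic system), so the sign is corrected here.
\<close>

definition Omega ::
  "complex \<Rightarrow> complex \<Rightarrow> complex \<Rightarrow> complex \<Rightarrow> complex \<Rightarrow> complex \<Rightarrow> form2" where
  "Omega \<theta>0 \<theta>1 \<theta>i p q t X Y =
     wedge dp dq X Y / (q * (q - 1))
     + wedge (differential (hamiltonian \<theta>0 \<theta>1 \<theta>i) p q t) dt X Y"

text \<open>The vector field d/dt + vp d/dp + vq d/dq spans the foliation at the given point.\<close>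

definition spans_foliation ::
  "complex \<Rightarrow> complex \<Rightarrow> complex \<Rightarrow> complex \<Rightarrow> complex \<Rightarrow> complex \<Rightarrow> complex \<Rightarrow> complex \<Rightarrow> bool" where
  "spans_foliation \<theta>0 \<theta>1 \<theta>i p q t vp vq \<longleftrightarrow> (\<forall>Y. Omega \<theta>0 \<theta>1 \<theta>i p q t (vp, vq, 1) Y = 0)"

end

theory Submission
  imports Defs "HOL-Complex_Analysis.Conformal_Mappings"
    "HOL-Computational_Algebra.Fundamental_Theorem_Algebra" "HOL-Real_Asymp.Real_Asymp"
begin

text \<open>
  If the links between the local solution bases \<open>Y\<close> do not depend on \<open>t\<close>, the matrices
  \<open>- (\<partial>Y/\<partial>t) Y\<^sup>-\<^sup>1\<close> of the different regions agree on overlaps. They extend holomorphically over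
  0 and 1, because \<open>Y = G W\<close> there with \<open>W\<close> independent of \<open>t\<close>, and grow at most linearly at
  infinity by the uniform asymptotics. So they glue to a polynomial \<open>B\<close> of degree one in \<open>z\<close>
  that satisfies the commutation relation. Comparing residues and the coefficients at infinity
  in that relation determines \<open>B\<close> and gives the system. For an arbitrary rational \<open>B\<close>, a pole
  of order \<open>k\<close> would make \<open>k\<close> an eigenvalue of the adjoint action of a residue, whose
  eigenvalues are 0 and \<open>\<plusminus>\<theta>\<close> (only 0 at an ordinary point); outside the resonant case \<open>B\<close> is
  therefore a polynomial, and again of degree one.

  Conversely, along a solution of the system let \<open>\<Phi>\<close> be the flow of \<open>\<partial>/\<partial>t + B\<close> with \<open>\<Phi> = 1\<close> at
  \<open>t0\<close>; it is entire in \<open>z\<close>. By the commutation relation, \<open>\<Phi>\<close> carries solutions at \<open>t0\<close> to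
  solutions at \<open>t\<close>, so \<open>Y = \<Phi> Y0\<close> has constant links. Only the asymptotics at infinity need an
  argument: canonical solutions exist for each \<open>t\<close> with uniform error bounds, and differ from
  \<open>\<Phi> Y0\<close> by a factor that is constant in \<open>z\<close>. For \<open>t\<close> close to \<open>t0\<close> the factor \<open>\<Phi>\<close> grows too
  slowly to compensate the exponentials along the recessive rays, so this factor is diagonal.
\<close>

section \<open>The commutation relation\<close>

text \<open>The converse is delicate because the canonical solutions at infinity are obtained
  separately for each \<open>t\<close>, with no regularity in \<open>t\<close>. All radii and error
  constants there depend only on \<open>\<theta>i\<close>, a decay rate \<open>c\<close> and a
  coefficient bound \<open>M\<close>, common to a disc around \<open>t0\<close>; holomorphy in
  \<open>t\<close> of the diagonal factor is regained at the end, as that of a locally uniform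
  limit. At \<open>t = t0\<close> both exponentials oscillate along the bisecting directions
  \<open>\<plusminus> \<i> / t0\<close>, so neither column is recessive there. The bisector is
  therefore tilted both ways by arcsin (3/5), one ray for each column. This yields the decay rate
  \<open>3/5 * |t0|\<close>; letting \<open>t\<close> move by \<open>|t0| / 10\<close> leaves
  \<open>c = |t0| / 2\<close>. An off-diagonal entry of the factor is controlled by two decaying
  exponentials of rate \<open>c / 2\<close> each, and the disc of \<open>t\<close> is shrunk until
  the growth of \<open>\<Phi>\<close> has rate at most \<open>c / 2\<close>. The opening of the
  sectors (1/10) and of the cones of integration (7/10) must fit together:
  \<open>4/5 * 1/10 + 3/5 = 68/100 < 7/10\<close>.\<close>

lemma mat22_nth [simp]:
  "mat22 a b c d $ 1 $ 1 = a" "mat22 a b c d $ 1 $ 2 = b"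
  "mat22 a b c d $ 2 $ 1 = c" "mat22 a b c d $ 2 $ 2 = d"
  by (simp_all add: mat22_def)

lemma mat2_eq_iff:
  "(M :: mat2) = N \<longleftrightarrow> M$1$1 = N$1$1 \<and> M$1$2 = N$1$2 \<and> M$2$1 = N$2$1 \<and> M$2$2 = N$2$2"
  by (simp only: vec_eq_iff[of M N] vec_eq_iff[of "M $ _" "N $ _"] forall_2 conj_assoc)

lemma cscale_nth [simp]: "cscale c M $ i $ j = c * M $ i $ j"
  by (simp add: cscale_def)

lemma mderiv_nth [simp]: "mderiv F x $ i $ j = deriv (\<lambda>y. F y $ i $ j) x"
  by (simp add: mderiv_def)

lemma mat2_mult_nth: "((A :: mat2) ** B) $ i $ j = A $ i $ 1 * B $ 1 $ j + A $ i $ 2 * B $ 2 $ j"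
  by (simp add: matrix_matrix_mult_def sum_2)

lemma trace_mat2: "trace (M :: mat2) = M$1$1 + M$2$2"
  by (simp add: trace_def sum_2)

text \<open>Clearing denominators leaves a polynomial of degree at most 3 with infinitely many
  zeros.\<close>

lemma partial_fraction_eq_0:
  fixes r0 r1 s0 s1 :: complex
  assumes "finite F" and eq: "\<And>z. z \<notin> F \<Longrightarrow> r0 / z + r1 / (z - 1) + s0 + s1 * z = 0"
  shows "r0 = 0" "r1 = 0" "s0 = 0" "s1 = 0"
proof -
  define P where "P = [:- r0, r0 + r1 - s0, s0 - s1, s1:]"
  have "poly P z = 0" if "z \<notin> F \<union> {0, 1}" for z
  proof -
    have "poly P z = z * (z - 1) * (r0 / z + r1 / (z - 1) + s0 + s1 * z)"
      using that by (simp add: P_def field_simps)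
    then show ?thesis using eq[of z] that by simp
  qed
  then have "- (F \<union> {0, 1}) \<subseteq> {z. poly P z = 0}"
    by blast
  moreover have "infinite (- (F \<union> {0, 1}))"
    using \<open>finite F\<close> by (metis finite.emptyI finite_Un finite_insert infinite_UNIV_char_0 finite_compl)
  ultimately have "infinite {z. poly P z = 0}"
    using infinite_super by blast
  then have "P = 0"
    using poly_roots_finite by blast
  then show "r0 = 0" "r1 = 0" "s0 = 0" "s1 = 0"
    by (auto simp: P_def)
qed

text \<open>The letters \<open>a\<close>, \<open>b\<close>, \<open>c\<close> belong to the (1,1),
  (1,2), (2,1) entries of the connection, \<open>e\<close>, \<open>f\<close>, \<open>g\<close> to
  those of \<open>B\<close>. An index on the former names the pole 0 or 1, on the latter the power
  of \<open>z\<close>; a prime is d/dt. Each scalar equation is split into its coefficients at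
  \<open>1 / z\<close>, \<open>1 / (z - 1)\<close>, 1 and \<open>z\<close>.\<close>

lemma lax_coefficients:
  fixes a0 a1 b0 b1 c0 c1 a0' a1' b0' b1' c0' c1' t e0 e1 f0 f1 g0 g1 :: complex
  assumes "finite F"
    and eq1: "\<And>z. z \<notin> F \<Longrightarrow> a0' / z + a1' / (z - 1) - 1/2 - e1
      + ((f0 + f1 * z) * (c0 / z + c1 / (z - 1)) - (b0 / z + b1 / (z - 1)) * (g0 + g1 * z)) = 0"
    and eq2: "\<And>z. z \<notin> F \<Longrightarrow> b0' / z + b1' / (z - 1) - f1
      + 2 * ((e0 + e1 * z) * (b0 / z + b1 / (z - 1)) - (f0 + f1 * z) * (a0 / z + a1 / (z - 1) - t/2)) = 0"
    and eq3: "\<And>z. z \<notin> F \<Longrightarrow> c0' / z + c1' / (z - 1) - g1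
      + 2 * ((g0 + g1 * z) * (a0 / z + a1 / (z - 1) - t/2) - (e0 + e1 * z) * (c0 / z + c1 / (z - 1))) = 0"
  shows "a0' + f0 * c0 - b0 * g0 = 0" "a1' + (f0 + f1) * c1 - b1 * (g0 + g1) = 0"
    "-1/2 - e1 + f1 * (c0 + c1) - g1 * (b0 + b1) = 0"
    "b0' + 2 * (e0 * b0 - f0 * a0) = 0" "b1' + 2 * ((e0 + e1) * b1 - (f0 + f1) * a1) = 0"
    "- f1 + 2 * (e1 * (b0 + b1) - f1 * (a0 + a1) + f0 * t / 2) = 0" "f1 * t = 0"
    "c0' + 2 * (g0 * a0 - e0 * c0) = 0" "c1' + 2 * ((g0 + g1) * a1 - (e0 + e1) * c1) = 0"
    "- g1 + 2 * (g1 * (a0 + a1) - g0 * t / 2 - e1 * (c0 + c1)) = 0" "g1 * t = 0"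
proof -
  have F: "finite (F \<union> {0, 1})" using assms by simp
  \<comment> \<open>Partial fractions of the products, from \<open>z / z = 1\<close> and
    \<open>z / (z - 1) = 1 + 1 / (z - 1)\<close>.\<close>
  have lin: "(x + y * z) * (c / z + d / (z - 1)) = (x * c / z + y * c) + ((x + y) * d / (z - 1) + y * d)"
      "(c / z + d / (z - 1)) * (x + y * z) = (c * x / z + c * y) + (d * (x + y) / (z - 1) + d * y)"
      "(x + y * z) * (c / z + d / (z - 1) - t/2) = (x * c / z + y * c) + ((x + y) * d / (z - 1) + y * d)
         - x * t / 2 - y * t / 2 * z"
    if "z \<notin> F \<union> {0, 1}" for x y c d z :: complex
  proof -
    have "z \<noteq> 0" "z - 1 \<noteq> 0" using that by auto
    then have *: "(x + y * z) * (c / z) = x * c / z + y * c"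
        "(x + y * z) * (d / (z - 1)) = (x + y) * d / (z - 1) + y * d"
      by (simp_all add: field_simps)
    show "(x + y * z) * (c / z + d / (z - 1)) = (x * c / z + y * c) + ((x + y) * d / (z - 1) + y * d)"
      by (simp only: distrib_left *)
    then show "(c / z + d / (z - 1)) * (x + y * z) = (c * x / z + c * y) + (d * (x + y) / (z - 1) + d * y)"
        "(x + y * z) * (c / z + d / (z - 1) - t/2) = (x * c / z + y * c) + ((x + y) * d / (z - 1) + y * d)
         - x * t / 2 - y * t / 2 * z"
      by (simp_all only: mult.commute[of c] mult.commute[of d] mult.commute[of "c / z + d / (z - 1)"] right_diff_distrib)
         (simp add: algebra_simps)
  qed
  have "(a0' + f0 * c0 - b0 * g0) / z + (a1' + (f0 + f1) * c1 - b1 * (g0 + g1)) / (z - 1)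
      + (-1/2 - e1 + f1 * (c0 + c1) - g1 * (b0 + b1)) + 0 * z = 0" if "z \<notin> F \<union> {0, 1}" for z
  proof -
    have "(a0' + f0 * c0 - b0 * g0) / z + (a1' + (f0 + f1) * c1 - b1 * (g0 + g1)) / (z - 1)
      + (-1/2 - e1 + f1 * (c0 + c1) - g1 * (b0 + b1)) + 0 * z = a0' / z + a1' / (z - 1) - 1/2 - e1
      + ((f0 + f1 * z) * (c0 / z + c1 / (z - 1)) - (b0 / z + b1 / (z - 1)) * (g0 + g1 * z))"
      unfolding lin[OF that] by (simp add: add_divide_distrib diff_divide_distrib distrib_left distrib_right right_diff_distrib left_diff_distrib)
    also have "\<dots> = 0" using eq1[of z] that by blast
    finally show ?thesis .
  qed
  from partial_fraction_eq_0[OF F this]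
  show "a0' + f0 * c0 - b0 * g0 = 0" "a1' + (f0 + f1) * c1 - b1 * (g0 + g1) = 0"
    "-1/2 - e1 + f1 * (c0 + c1) - g1 * (b0 + b1) = 0" by blast+
  have "(b0' + 2 * (e0 * b0 - f0 * a0)) / z + (b1' + 2 * ((e0 + e1) * b1 - (f0 + f1) * a1)) / (z - 1)
      + (- f1 + 2 * (e1 * (b0 + b1) - f1 * (a0 + a1) + f0 * t / 2)) + (f1 * t) * z = 0" if "z \<notin> F \<union> {0, 1}" for z
  proof -
    have "(b0' + 2 * (e0 * b0 - f0 * a0)) / z + (b1' + 2 * ((e0 + e1) * b1 - (f0 + f1) * a1)) / (z - 1)
      + (- f1 + 2 * (e1 * (b0 + b1) - f1 * (a0 + a1) + f0 * t / 2)) + (f1 * t) * z = b0' / z + b1' / (z - 1) - f1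
      + 2 * ((e0 + e1 * z) * (b0 / z + b1 / (z - 1)) - (f0 + f1 * z) * (a0 / z + a1 / (z - 1) - t/2))"
      unfolding lin[OF that] by (simp add: add_divide_distrib diff_divide_distrib distrib_left distrib_right right_diff_distrib left_diff_distrib)
    also have "\<dots> = 0" using eq2[of z] that by blast
    finally show ?thesis .
  qed
  from partial_fraction_eq_0[OF F this]
  show "b0' + 2 * (e0 * b0 - f0 * a0) = 0" "b1' + 2 * ((e0 + e1) * b1 - (f0 + f1) * a1) = 0"
    "- f1 + 2 * (e1 * (b0 + b1) - f1 * (a0 + a1) + f0 * t / 2) = 0" "f1 * t = 0" by blast+
  have "(c0' + 2 * (g0 * a0 - e0 * c0)) / z + (c1' + 2 * ((g0 + g1) * a1 - (e0 + e1) * c1)) / (z - 1)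
      + (- g1 + 2 * (g1 * (a0 + a1) - g0 * t / 2 - e1 * (c0 + c1))) + (- (g1 * t)) * z = 0" if "z \<notin> F \<union> {0, 1}" for z
  proof -
    have "(c0' + 2 * (g0 * a0 - e0 * c0)) / z + (c1' + 2 * ((g0 + g1) * a1 - (e0 + e1) * c1)) / (z - 1)
      + (- g1 + 2 * (g1 * (a0 + a1) - g0 * t / 2 - e1 * (c0 + c1))) + (- (g1 * t)) * z = c0' / z + c1' / (z - 1) - g1
      + 2 * ((g0 + g1 * z) * (a0 / z + a1 / (z - 1) - t/2) - (e0 + e1 * z) * (c0 / z + c1 / (z - 1)))"
      unfolding lin[OF that] by (simp add: add_divide_distrib diff_divide_distrib distrib_left distrib_right right_diff_distrib left_diff_distrib)
    also have "\<dots> = 0" using eq3[of z] that by blast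
    finally show ?thesis .
  qed
  from partial_fraction_eq_0[OF F this]
  show "c0' + 2 * (g0 * a0 - e0 * c0) = 0" "c1' + 2 * ((g0 + g1) * a1 - (e0 + e1) * c1) = 0"
    "- g1 + 2 * (g1 * (a0 + a1) - g0 * t / 2 - e1 * (c0 + c1)) = 0" "g1 * t = 0" by auto
qed

section \<open>Entries of the connection, their t-derivatives and the residue equations\<close>

definition wval :: "complex \<Rightarrow> complex \<Rightarrow> complex \<Rightarrow> complex \<Rightarrow> complex" where
  "wval \<theta>i p q t = p + 1/2 * q * (q * t - t + \<theta>i)"

definition vval :: "complex \<Rightarrow> complex \<Rightarrow> complex \<Rightarrow> complex \<Rightarrow> complex" where
  "vval \<theta>i p q t = p + 1/2 * (q - 1) * (q * t + \<theta>i)"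

text \<open>Total t-derivative of \<open>wval\<close> along a curve with velocities
  \<open>p'\<close> and \<open>q'\<close>. The velocities are free variables because they are the
  unknowns of the residue equations.\<close>

definition wdot :: "complex \<Rightarrow> complex \<Rightarrow> complex \<Rightarrow> complex \<Rightarrow> complex \<Rightarrow> complex" where
  "wdot \<theta>i q t p' q' = p' + 1/2 * q' * (q * t - t + \<theta>i) + 1/2 * q * (q' * t + q - 1)"

definition vdot :: "complex \<Rightarrow> complex \<Rightarrow> complex \<Rightarrow> complex \<Rightarrow> complex \<Rightarrow> complex" where
  "vdot \<theta>i q t p' q' = p' + 1/2 * q' * (q * t + \<theta>i) + 1/2 * (q - 1) * (q' * t + q)"

lemma connection_matrix_nth:
  "connection_matrix \<theta>0 \<theta>1 \<theta>i p q z t $ 1 $ 1 = - wval \<theta>i (p t) (q t) t / z + vval \<theta>i (p t) (q t) t / (z - 1) - t / 2"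
  "connection_matrix \<theta>0 \<theta>1 \<theta>i p q z t $ 1 $ 2 =
     (q t - 1) * ((wval \<theta>i (p t) (q t) t)^2 - \<theta>0^2 / 4) / q t / z + (\<theta>1^2 / 4 - (vval \<theta>i (p t) (q t) t)^2) / (z - 1)"
  "connection_matrix \<theta>0 \<theta>1 \<theta>i p q z t $ 2 $ 1 = (- q t / (q t - 1)) / z + 1 / (z - 1)"
  "connection_matrix \<theta>0 \<theta>1 \<theta>i p q z t $ 2 $ 2 = - connection_matrix \<theta>0 \<theta>1 \<theta>i p q z t $ 1 $ 1"
  by (simp_all add: connection_matrix_def residue0_def residue1_def leading_inf_def Let_def wval_def vval_def
      add_divide_distrib diff_divide_distrib)

text \<open>The derivatives are kept in partial fraction form, with an empty term
  \<open>0 / (z - 1)\<close> in the lower left entry, whose residue at 1 is the constant 1, so that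
  they match \<open>lax_coefficients\<close> literally.\<close>

lemma connection_matrix_has_derivative:
  assumes "(p has_field_derivative p') (at t)" "(q has_field_derivative q') (at t)" "q t \<noteq> 0" "q t \<noteq> 1"
  shows "((\<lambda>s. connection_matrix \<theta>0 \<theta>1 \<theta>i p q z s $ 1 $ 1) has_field_derivative
      - wdot \<theta>i (q t) t p' q' / z + vdot \<theta>i (q t) t p' q' / (z - 1) - 1 / 2) (at t)"
    and "((\<lambda>s. connection_matrix \<theta>0 \<theta>1 \<theta>i p q z s $ 1 $ 2) has_field_derivative
      (q' / (q t)^2 * ((wval \<theta>i (p t) (q t) t)^2 - \<theta>0^2 / 4)
         + (q t - 1) / q t * 2 * wval \<theta>i (p t) (q t) t * wdot \<theta>i (q t) t p' q') / z
      + (- 2 * vval \<theta>i (p t) (q t) t * vdot \<theta>i (q t) t p' q') / (z - 1)) (at t)"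
    and "((\<lambda>s. connection_matrix \<theta>0 \<theta>1 \<theta>i p q z s $ 2 $ 1) has_field_derivative
      (q' / (q t - 1)^2) / z + 0 / (z - 1)) (at t)"
    and "((\<lambda>s. connection_matrix \<theta>0 \<theta>1 \<theta>i p q z s $ 2 $ 2) has_field_derivative
      - (- wdot \<theta>i (q t) t p' q' / z + vdot \<theta>i (q t) t p' q' / (z - 1) - 1 / 2)) (at t)"
proof -
  note [derivative_intros] = assms(1,2)
  have w: "((\<lambda>s. wval \<theta>i (p s) (q s) s) has_field_derivative wdot \<theta>i (q t) t p' q') (at t)"
    unfolding wval_def wdot_def by (rule derivative_eq_intros refl | simp)+
  have v: "((\<lambda>s. vval \<theta>i (p s) (q s) s) has_field_derivative vdot \<theta>i (q t) t p' q') (at t)"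
    unfolding vval_def vdot_def by (rule derivative_eq_intros refl | simp)+
  note [derivative_intros] = w v
  have dz: "((\<lambda>s. f s / c) has_field_derivative D / c) (at t)" if "(f has_field_derivative D) (at t)" for f c and D :: complex
    using that by (rule DERIV_cdivide)
  show 1: "((\<lambda>s. connection_matrix \<theta>0 \<theta>1 \<theta>i p q z s $ 1 $ 1) has_field_derivative
      - wdot \<theta>i (q t) t p' q' / z + vdot \<theta>i (q t) t p' q' / (z - 1) - 1 / 2) (at t)"
    unfolding connection_matrix_nth by (intro dz w v DERIV_diff DERIV_add DERIV_minus DERIV_ident)
  then show "((\<lambda>s. connection_matrix \<theta>0 \<theta>1 \<theta>i p q z s $ 2 $ 2) has_field_derivative
      - (- wdot \<theta>i (q t) t p' q' / z + vdot \<theta>i (q t) t p' q' / (z - 1) - 1 / 2)) (at t)"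
    unfolding connection_matrix_nth(4) by (rule DERIV_minus)
  have qw: "((\<lambda>s. (q s - 1) / q s * ((wval \<theta>i (p s) (q s) s)^2 - \<theta>0^2 / 4)) has_field_derivative
      q' / (q t)^2 * ((wval \<theta>i (p t) (q t) t)^2 - \<theta>0^2 / 4)
         + (q t - 1) / q t * 2 * wval \<theta>i (p t) (q t) t * wdot \<theta>i (q t) t p' q') (at t)"
  proof -
    have A: "((\<lambda>s. (q s - 1) / q s) has_field_derivative q' / (q t)^2) (at t)"
      using assms by (auto intro!: derivative_eq_intros simp: power2_eq_square) (simp add: algebra_simps)
    have B: "((\<lambda>s. (wval \<theta>i (p s) (q s) s)^2 - \<theta>0^2 / 4) has_field_derivative
       2 * wval \<theta>i (p t) (q t) t * wdot \<theta>i (q t) t p' q') (at t)"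
      by (rule derivative_eq_intros refl | simp)+
    show ?thesis
      using DERIV_mult[OF A B] by (simp add: algebra_simps)
  qed
  have vv: "((\<lambda>s. \<theta>1^2 / 4 - (vval \<theta>i (p s) (q s) s)^2) has_field_derivative
      - 2 * vval \<theta>i (p t) (q t) t * vdot \<theta>i (q t) t p' q') (at t)"
    by (rule derivative_eq_intros refl | simp)+
  show "((\<lambda>s. connection_matrix \<theta>0 \<theta>1 \<theta>i p q z s $ 1 $ 2) has_field_derivative
      (q' / (q t)^2 * ((wval \<theta>i (p t) (q t) t)^2 - \<theta>0^2 / 4)
         + (q t - 1) / q t * 2 * wval \<theta>i (p t) (q t) t * wdot \<theta>i (q t) t p' q') / z
      + (- 2 * vval \<theta>i (p t) (q t) t * vdot \<theta>i (q t) t p' q') / (z - 1)) (at t)"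
    unfolding connection_matrix_nth using DERIV_add[OF dz[OF qw, of z] dz[OF vv, of "z - 1"]]
    by (simp only: times_divide_eq_left)
  have "((\<lambda>s. - q s / (q s - 1)) has_field_derivative q' / (q t - 1)^2) (at t)"
    using assms by (auto intro!: derivative_eq_intros simp: power2_eq_square divide_simps) (simp add: algebra_simps)
  then show "((\<lambda>s. connection_matrix \<theta>0 \<theta>1 \<theta>i p q z s $ 2 $ 1) has_field_derivative
      (q' / (q t - 1)^2) / z + 0 / (z - 1)) (at t)"
    unfolding connection_matrix_nth by (intro dz DERIV_add) auto
qed

text \<open>The equations are triangular. The coefficients of \<open>z\<close> kill
  \<open>f1\<close> and \<open>g1\<close>; the constant terms then give \<open>e1\<close>,
  \<open>f0\<close>, \<open>g0\<close>. The residue at 1 of the (2,1) entry does not move, which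
  yields \<open>e0\<close>. With \<open>B\<close> known, the (2,1) residue at 0 gives
  \<open>q'\<close> and the (1,1) residue at 1 gives \<open>p'\<close>.\<close>

lemma lax_residue_equations_solve:
  fixes t q p p' q' e0 e1 f0 f1 g0 g1 \<theta>0 \<theta>1 \<theta>i :: complex
  assumes nz: "t \<noteq> 0" "q \<noteq> 0" "q \<noteq> 1"
  defines "w \<equiv> wval \<theta>i p q t" and "v \<equiv> vval \<theta>i p q t" and "v' \<equiv> vdot \<theta>i q t p' q'"
  defines "b0 \<equiv> (q - 1) * (w^2 - \<theta>0^2 / 4) / q" and "b1 \<equiv> \<theta>1^2 / 4 - v^2" and "c0 \<equiv> - q / (q - 1)"
  assumes eqs: "v' + (f0 + f1) * 1 - b1 * (g0 + g1) = 0"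
    "-1/2 - e1 + f1 * (c0 + 1) - g1 * (b0 + b1) = 0"
    "- f1 + 2 * (e1 * (b0 + b1) - f1 * (- w + v) + f0 * t / 2) = 0" "f1 * t = 0"
    "q' / (q - 1)^2 + 2 * (g0 * (- w) - e0 * c0) = 0" "0 + 2 * ((g0 + g1) * v - (e0 + e1) * 1) = 0"
    "- g1 + 2 * (g1 * (- w + v) - g0 * t / 2 - e1 * (c0 + 1)) = 0" "g1 * t = 0"
  shows "q' = rhs_q p q t" "p' = rhs_p \<theta>0 \<theta>1 \<theta>i p q t" "e1 = -1/2" "f1 = 0" "g1 = 0"
    "g0 = - 1 / ((q - 1) * t)" "e0 = B_eps \<theta>i p q t / t" "f0 = B_f \<theta>0 \<theta>1 \<theta>i p q t / t"
proof -
  have q1: "q - 1 \<noteq> 0" using nz by simp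
  show f1: "f1 = 0" and g1: "g1 = 0" using eqs nz by auto
  then show e1: "e1 = -1/2" using eqs(2) by (simp add: algebra_simps)
  have f: "B_f \<theta>0 \<theta>1 \<theta>i p q t = b0 + b1"
    unfolding B_f_def b0_def b1_def w_def v_def wval_def vval_def using nz
    by (simp add: field_simps power2_eq_square)
  have f0: "f0 = (b0 + b1) / t"
  proof -
    have "2 * (f0 * t) = 2 * (b0 + b1)"
      using eqs(3) unfolding f1 e1 by (simp add: field_simps)
    then have "f0 * t = b0 + b1" by algebra
    then show ?thesis using nz by (simp add: field_simps)
  qed
  then show "f0 = B_f \<theta>0 \<theta>1 \<theta>i p q t / t" by (simp add: f)
  show g0: "g0 = - 1 / ((q - 1) * t)"
  proof -
    have "- g0 * t + (c0 + 1) = 0" using eqs(7) unfolding g1 e1 by (simp add: field_simps) algebra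
    moreover have "c0 + 1 = - 1 / (q - 1)" using q1 by (simp add: c0_def field_simps)
    ultimately show ?thesis using nz q1 by (simp add: field_simps)
  qed
  have e0: "e0 = 1/2 - v / ((q - 1) * t)"
  proof -
    have "e0 = 1/2 + g0 * v" using eqs(6) unfolding g1 e1 by algebra
    then show ?thesis unfolding g0 by simp
  qed
  also have "\<dots> = B_eps \<theta>i p q t / t"
    unfolding B_eps_def v_def vval_def using nz q1 by (simp add: divide_simps) (simp add: algebra_simps)
  finally show "e0 = B_eps \<theta>i p q t / t" .
  have "q' / (q - 1)^2 = 2 * (g0 * w + e0 * c0)" using eqs(5) by (simp add: algebra_simps)
  then have "q' = (q - 1)^2 * (2 * (g0 * w + e0 * c0))" using q1 by (simp add: field_simps)
  also have "\<dots> = 2 * p / t"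
    unfolding g0 e0 c0_def w_def v_def wval_def vval_def using nz q1
    by (simp add: divide_simps power2_eq_square) (simp add: algebra_simps)
  finally show q': "q' = rhs_q p q t" by (simp add: rhs_q_def)
  have "v' = b1 * g0 - f0" using eqs(1) unfolding f1 g1 by (simp add: algebra_simps)
  then have "p' = b1 * g0 - f0 - (1/2 * q' * (q * t + \<theta>i) + 1/2 * (q - 1) * (q' * t + q))"
    unfolding v'_def vdot_def by (simp add: algebra_simps)
  also have "\<dots> = rhs_p \<theta>0 \<theta>1 \<theta>i p q t"
    unfolding q' rhs_q_def f0 g0 b0_def b1_def w_def v_def wval_def vval_def rhs_p_def using nz q1
    by (simp add: divide_simps power2_eq_square) (simp add: algebra_simps)
  finally show "p' = rhs_p \<theta>0 \<theta>1 \<theta>i p q t" .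
qed

text \<open>Of the residue equations, only the (2,1) one at 0 and the (1,1) one at 1 are expanded in
  full. Since \<open>w - v\<close> is the constant \<open>\<theta>i / 2\<close>, the derivatives of
  \<open>w\<close> and \<open>v\<close> agree, and \<open>f0 * t = b0 + b1\<close>,
  \<open>g0 * t = c0 + 1\<close> carry the (1,1) equation from 1 to 0. The (1,2) equations are
  consequences, reflecting the fixed determinants of the residues.\<close>

lemma lax_residue_equations_hold:
  fixes t q p \<theta>0 \<theta>1 \<theta>i :: complex
  assumes nz: "t \<noteq> 0" "q \<noteq> 0" "q \<noteq> 1"
  defines "w \<equiv> wval \<theta>i p q t" and "v \<equiv> vval \<theta>i p q t"
  defines "b0 \<equiv> (q - 1) * (w^2 - \<theta>0^2 / 4) / q" and "b1 \<equiv> \<theta>1^2 / 4 - v^2" and "c0 \<equiv> - q / (q - 1)"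
  defines "q' \<equiv> rhs_q p q t" and "p' \<equiv> rhs_p \<theta>0 \<theta>1 \<theta>i p q t"
  defines "w' \<equiv> wdot \<theta>i q t p' q'" and "v' \<equiv> vdot \<theta>i q t p' q'"
  defines "e0 \<equiv> B_eps \<theta>i p q t / t" and "f0 \<equiv> B_f \<theta>0 \<theta>1 \<theta>i p q t / t" and "g0 \<equiv> - 1 / ((q - 1) * t)"
  shows "- w' + f0 * c0 - b0 * g0 = 0"  "v' + f0 - b1 * g0 = 0"
    "f0 * t = b0 + b1" "g0 * t = c0 + 1" "- w + v = - \<theta>i / 2"
    "q' / q^2 * (w^2 - \<theta>0^2 / 4) + (q - 1) / q * 2 * w * w' + 2 * (e0 * b0 + f0 * w) = 0"
    "- 2 * v * v' + 2 * ((e0 - 1/2) * b1 - f0 * v) = 0"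
    "q' / (q - 1)^2 - 2 * (g0 * w + e0 * c0) = 0" "g0 * v = e0 - 1/2"
proof -
  have q1: "q - 1 \<noteq> 0" using nz by simp
  have f: "B_f \<theta>0 \<theta>1 \<theta>i p q t = b0 + b1"
    unfolding B_f_def b0_def b1_def w_def v_def wval_def vval_def using nz
    by (simp add: field_simps power2_eq_square)
  then have f0: "f0 = (b0 + b1) / t" by (simp add: f0_def)
  then show "f0 * t = b0 + b1" using nz by simp
  show "g0 * t = c0 + 1" using nz q1 unfolding g0_def c0_def by (simp add: field_simps)
  show wv: "- w + v = - \<theta>i / 2" unfolding w_def v_def wval_def vval_def by (simp add: field_simps)
  have e0: "e0 = 1/2 + g0 * v"
    unfolding e0_def g0_def B_eps_def v_def vval_def using nz q1 by (simp add: divide_simps) (simp add: algebra_simps)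
  then show "g0 * v = e0 - 1/2" by simp
  show 1: "q' / (q - 1)^2 - 2 * (g0 * w + e0 * c0) = 0"
    unfolding q'_def rhs_q_def g0_def e0 c0_def w_def v_def wval_def vval_def using nz q1
    by (simp add: divide_simps power2_eq_square) (simp add: algebra_simps)
  show 2: "v' + f0 - b1 * g0 = 0"
    unfolding v'_def vdot_def p'_def q'_def rhs_q_def f0 g0_def b0_def b1_def w_def v_def wval_def vval_def rhs_p_def using nz q1
    by (simp add: divide_simps power2_eq_square) (simp add: algebra_simps)
  have w': "w' = v'"
    unfolding w'_def v'_def wdot_def vdot_def by (simp add: field_simps)
  show 3: "- w' + f0 * c0 - b0 * g0 = 0"
    using 2 \<open>f0 * t = b0 + b1\<close> \<open>g0 * t = c0 + 1\<close> unfolding w' by algebra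
  show "- 2 * v * v' + 2 * ((e0 - 1/2) * b1 - f0 * v) = 0"
    using 2 unfolding e0 by algebra
  show "q' / q^2 * (w^2 - \<theta>0^2 / 4) + (q - 1) / q * 2 * w * w' + 2 * (e0 * b0 + f0 * w) = 0"
  proof -
    define K where "K = w^2 - \<theta>0^2 / 4"
    have qq: "q' = (q - 1)^2 * (2 * (g0 * w + e0 * c0))" using 1 q1 by (simp add: field_simps)
    have "w' = f0 * c0 - b0 * g0" using 3 by algebra
    moreover have "q' / q^2 * K = 2 * ((q - 1) / q) * b0 * g0 * w - 2 * e0 * b0"
      unfolding qq b0_def K_def[symmetric] c0_def using nz q1
      by (simp add: divide_simps power2_eq_square) (simp add: algebra_simps)
    moreover have "(q - 1) / q * c0 = - 1" using nz q1 by (simp add: c0_def)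
    ultimately show ?thesis unfolding K_def[symmetric] by algebra
  qed
qed

text \<open>Commutators are trace-free, so for trace-free data the (2,2) equation repeats the (1,1)
  one.\<close>

lemma lax_matrix_iff:
  fixes A A' B D :: mat2
  assumes "A $ 2 $ 2 = - A $ 1 $ 1" "B $ 2 $ 2 = - B $ 1 $ 1"
    and "A' $ 2 $ 2 = - A' $ 1 $ 1" "D $ 2 $ 2 = - D $ 1 $ 1"
  shows "A' - D + B ** A - A ** B = 0 \<longleftrightarrow>
    A' $ 1 $ 1 - D $ 1 $ 1 + (B $ 1 $ 2 * A $ 2 $ 1 - A $ 1 $ 2 * B $ 2 $ 1) = 0 \<and>
    A' $ 1 $ 2 - D $ 1 $ 2 + 2 * (B $ 1 $ 1 * A $ 1 $ 2 - B $ 1 $ 2 * A $ 1 $ 1) = 0 \<and>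
    A' $ 2 $ 1 - D $ 2 $ 1 + 2 * (B $ 2 $ 1 * A $ 1 $ 1 - B $ 1 $ 1 * A $ 2 $ 1) = 0"
proof -
  define X where "X = A' - D + B ** A - A ** B"
  have 22: "X $ 2 $ 2 = - X $ 1 $ 1"
    unfolding X_def using assms by (simp add: mat2_mult_nth)
  have X: "X $ 1 $ 1 =
      A' $ 1 $ 1 - D $ 1 $ 1 + (B $ 1 $ 2 * A $ 2 $ 1 - A $ 1 $ 2 * B $ 2 $ 1)"
    "X $ 1 $ 2 =
      A' $ 1 $ 2 - D $ 1 $ 2 + 2 * (B $ 1 $ 1 * A $ 1 $ 2 - B $ 1 $ 2 * A $ 1 $ 1)"
    "X $ 2 $ 1 =
      A' $ 2 $ 1 - D $ 2 $ 1 + 2 * (B $ 2 $ 1 * A $ 1 $ 1 - B $ 1 $ 1 * A $ 2 $ 1)"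
    unfolding X_def using assms by (simp_all add: mat2_mult_nth algebra_simps)
  have "X = 0 \<longleftrightarrow> X $ 1 $ 1 = 0 \<and> X $ 1 $ 2 = 0 \<and> X $ 2 $ 1 = 0"
    unfolding mat2_eq_iff[of X 0] 22 by auto
  then show ?thesis
    unfolding X unfolding X_def .
qed

lemma deriv_affine:
  "deriv (\<lambda>z. a + b * z) z = b" "deriv (\<lambda>z. - (a + b * z)) z = - b" for a b z :: complex
  by (auto intro!: DERIV_imp_deriv derivative_eq_intros)

lemma connection_matrix_mderiv:
  assumes "(p has_field_derivative p') (at t)" "(q has_field_derivative q') (at t)" "q t \<noteq> 0" "q t \<noteq> 1"
  shows "mderiv (\<lambda>s. connection_matrix \<theta>0 \<theta>1 \<theta>i p q z s) t $ 1 $ 1 =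
      - wdot \<theta>i (q t) t p' q' / z + vdot \<theta>i (q t) t p' q' / (z - 1) - 1 / 2"
    and "mderiv (\<lambda>s. connection_matrix \<theta>0 \<theta>1 \<theta>i p q z s) t $ 1 $ 2 =
      (q' / (q t)^2 * ((wval \<theta>i (p t) (q t) t)^2 - \<theta>0^2 / 4)
         + (q t - 1) / q t * 2 * wval \<theta>i (p t) (q t) t * wdot \<theta>i (q t) t p' q') / z
      + (- 2 * vval \<theta>i (p t) (q t) t * vdot \<theta>i (q t) t p' q') / (z - 1)"
    and "mderiv (\<lambda>s. connection_matrix \<theta>0 \<theta>1 \<theta>i p q z s) t $ 2 $ 1 = (q' / (q t - 1)^2) / z + 0 / (z - 1)"
    and "mderiv (\<lambda>s. connection_matrix \<theta>0 \<theta>1 \<theta>i p q z s) t $ 2 $ 2 =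
      - mderiv (\<lambda>s. connection_matrix \<theta>0 \<theta>1 \<theta>i p q z s) t $ 1 $ 1"
  using connection_matrix_has_derivative[OF assms, THEN DERIV_imp_deriv] by simp_all

lemma B_matrix_nth:
  "B_matrix \<theta>0 \<theta>1 \<theta>i p q z t $ 1 $ 1 = B_eps \<theta>i (p t) (q t) t / t + (- 1/2) * z"
  "B_matrix \<theta>0 \<theta>1 \<theta>i p q z t $ 1 $ 2 = B_f \<theta>0 \<theta>1 \<theta>i (p t) (q t) t / t"
  "B_matrix \<theta>0 \<theta>1 \<theta>i p q z t $ 2 $ 1 = - 1 / ((q t - 1) * t)"
  "B_matrix \<theta>0 \<theta>1 \<theta>i p q z t $ 2 $ 2 = - B_matrix \<theta>0 \<theta>1 \<theta>i p q z t $ 1 $ 1"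
  by (simp_all add: B_matrix_def)

text \<open>Both routes to the system end here: the \<open>B\<close> glued from an isomonodromic
  family and an arbitrary rational \<open>B\<close> are first shown to be of degree at most one in
  \<open>z\<close>.\<close>

lemma linear_lax_imp_system:
  fixes \<theta>0 \<theta>1 \<theta>i t e0 e1 f0 f1 g0 g1 :: complex and p q :: "complex \<Rightarrow> complex"
  assumes der: "(p has_field_derivative p') (at t)" "(q has_field_derivative q') (at t)"
    and nz: "t \<noteq> 0" "q t \<noteq> 0" "q t \<noteq> 1" and "finite F"
  defines "A \<equiv> connection_matrix \<theta>0 \<theta>1 \<theta>i p q"
    and "B \<equiv> \<lambda>z. mat22 (e0 + e1 * z) (f0 + f1 * z) (g0 + g1 * z) (- (e0 + e1 * z))"
  assumes lax: "\<And>z. z \<notin> F \<Longrightarrow> mderiv (\<lambda>s. A z s) t - mderiv B z + B z ** A z t - A z t ** B z = 0"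
  shows "q' = rhs_q (p t) (q t) t" "p' = rhs_p \<theta>0 \<theta>1 \<theta>i (p t) (q t) t"
    "B z = B_matrix \<theta>0 \<theta>1 \<theta>i p q z t"
proof -
  let ?w = "wval \<theta>i (p t) (q t) t" and ?v = "vval \<theta>i (p t) (q t) t"
  let ?w' = "wdot \<theta>i (q t) t p' q'" and ?v' = "vdot \<theta>i (q t) t p' q'"
  have mB: "mderiv B z = mat22 e1 f1 g1 (- e1)" for z
    unfolding mat2_eq_iff by (simp add: B_def deriv_affine del: minus_add_distrib)
  have eqs: "(- ?w' / z + ?v' / (z - 1) - 1 / 2) - e1
        + ((f0 + f1 * z) * (- q t / (q t - 1) / z + 1 / (z - 1))
           - ((q t - 1) * (?w^2 - \<theta>0^2 / 4) / q t / z + (\<theta>1^2 / 4 - ?v^2) / (z - 1)) * (g0 + g1 * z)) = 0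
      \<and> ((q' / (q t)^2 * (?w^2 - \<theta>0^2 / 4) + (q t - 1) / q t * 2 * ?w * ?w') / z + (- 2 * ?v * ?v') / (z - 1)) - f1
        + 2 * ((e0 + e1 * z) * ((q t - 1) * (?w^2 - \<theta>0^2 / 4) / q t / z + (\<theta>1^2 / 4 - ?v^2) / (z - 1))
           - (f0 + f1 * z) * (- ?w / z + ?v / (z - 1) - t/2)) = 0
      \<and> ((q' / (q t - 1)^2) / z + 0 / (z - 1)) - g1
        + 2 * ((g0 + g1 * z) * (- ?w / z + ?v / (z - 1) - t/2)
           - (e0 + e1 * z) * (- q t / (q t - 1) / z + 1 / (z - 1))) = 0" if "z \<notin> F" for z
  proof -
    have "A z t $ 2 $ 2 = - A z t $ 1 $ 1" unfolding A_def by (rule connection_matrix_nth)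
    moreover have "B z $ 2 $ 2 = - B z $ 1 $ 1" by (simp add: B_def)
    moreover have "mderiv (\<lambda>s. A z s) t $ 2 $ 2 = - mderiv (\<lambda>s. A z s) t $ 1 $ 1"
      unfolding A_def by (rule connection_matrix_mderiv[OF der nz(2,3)])
    moreover have "mderiv B z $ 2 $ 2 = - mderiv B z $ 1 $ 1" by (simp only: mB mat22_nth)
    moreover note lax[OF that]
    ultimately have "mderiv (\<lambda>s. A z s) t $ 1 $ 1 - mderiv B z $ 1 $ 1 + (B z $ 1 $ 2 * A z t $ 2 $ 1 - A z t $ 1 $ 2 * B z $ 2 $ 1) = 0 \<and>
    mderiv (\<lambda>s. A z s) t $ 1 $ 2 - mderiv B z $ 1 $ 2 + 2 * (B z $ 1 $ 1 * A z t $ 1 $ 2 - B z $ 1 $ 2 * A z t $ 1 $ 1) = 0 \<and>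
    mderiv (\<lambda>s. A z s) t $ 2 $ 1 - mderiv B z $ 2 $ 1 + 2 * (B z $ 2 $ 1 * A z t $ 1 $ 1 - B z $ 1 $ 1 * A z t $ 2 $ 1) = 0"
      using lax_matrix_iff by blast
    then show ?thesis
      unfolding mB mat22_nth unfolding A_def connection_matrix_nth
        connection_matrix_mderiv[OF der nz(2,3)] B_def mat22_nth .
  qed
  have co: "?v' + (f0 + f1) * 1 - (\<theta>1^2 / 4 - ?v^2) * (g0 + g1) = 0"
    "-1/2 - e1 + f1 * (- q t / (q t - 1) + 1) - g1 * ((q t - 1) * (?w^2 - \<theta>0^2 / 4) / q t + (\<theta>1^2 / 4 - ?v^2)) = 0"
    "- f1 + 2 * (e1 * ((q t - 1) * (?w^2 - \<theta>0^2 / 4) / q t + (\<theta>1^2 / 4 - ?v^2)) - f1 * (- ?w + ?v) + f0 * t / 2) = 0"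
    "f1 * t = 0"
    "q' / (q t - 1)^2 + 2 * (g0 * (- ?w) - e0 * (- q t / (q t - 1))) = 0"
    "0 + 2 * ((g0 + g1) * ?v - (e0 + e1) * 1) = 0"
    "- g1 + 2 * (g1 * (- ?w + ?v) - g0 * t / 2 - e1 * (- q t / (q t - 1) + 1)) = 0" "g1 * t = 0"
    using lax_coefficients[OF \<open>finite F\<close> eqs[THEN conjunct1] eqs[THEN conjunct2, THEN conjunct1]
        eqs[THEN conjunct2, THEN conjunct2]] by blast+
  note sol = lax_residue_equations_solve[OF nz co]
  show "q' = rhs_q (p t) (q t) t" "p' = rhs_p \<theta>0 \<theta>1 \<theta>i (p t) (q t) t"
    by (rule sol)+
  show "B z = B_matrix \<theta>0 \<theta>1 \<theta>i p q z t"
    unfolding mat2_eq_iff B_matrix_nth unfolding B_def mat22_nth sol by simp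
qed

lemma system_imp_lax:
  fixes \<theta>0 \<theta>1 \<theta>i t z :: complex and p q :: "complex \<Rightarrow> complex"
  assumes der: "(p has_field_derivative rhs_p \<theta>0 \<theta>1 \<theta>i (p t) (q t) t) (at t)"
      "(q has_field_derivative rhs_q (p t) (q t) t) (at t)"
    and nz: "t \<noteq> 0" "q t \<noteq> 0" "q t \<noteq> 1" and z: "z \<noteq> 0" "z \<noteq> 1"
  defines "A \<equiv> connection_matrix \<theta>0 \<theta>1 \<theta>i p q" and "B \<equiv> B_matrix \<theta>0 \<theta>1 \<theta>i p q"
  shows "mderiv (\<lambda>s. A z s) t - mderiv (\<lambda>x. B x t) z + B z t ** A z t - A z t ** B z t = 0"
proof -
  let ?w = "wval \<theta>i (p t) (q t) t" and ?v = "vval \<theta>i (p t) (q t) t"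
  let ?q' = "rhs_q (p t) (q t) t" and ?p' = "rhs_p \<theta>0 \<theta>1 \<theta>i (p t) (q t) t"
  let ?w' = "wdot \<theta>i (q t) t ?p' ?q'" and ?v' = "vdot \<theta>i (q t) t ?p' ?q'"
  define e0 where "e0 = B_eps \<theta>i (p t) (q t) t / t"
  define f0 where "f0 = B_f \<theta>0 \<theta>1 \<theta>i (p t) (q t) t / t"
  define g0 where "g0 = - 1 / ((q t - 1) * t)"
  define b0 where "b0 = (q t - 1) * (?w^2 - \<theta>0^2 / 4) / q t"
  define b1 where "b1 = \<theta>1^2 / 4 - ?v^2"
  define c0 where "c0 = - q t / (q t - 1)"
  \<comment> \<open>With the reciprocals named, the three entries become polynomial identities
    modulo \<open>z * X = 1\<close> and \<open>(z - 1) * Y = 1\<close>.\<close>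
  define X where "X = inverse z"
  define Y where "Y = inverse (z - 1)"
  have XY: "z * X = 1" "(z - 1) * Y = 1" using z by (simp_all add: X_def Y_def)
  have div: "x / z = x * X" "x / (z - 1) = x * Y" for x by (simp_all add: X_def Y_def divide_inverse)
  have mB: "mderiv (\<lambda>x. B x t) z = mat22 (-1/2) 0 0 (1/2)"
    unfolding mat2_eq_iff mderiv_nth mat22_nth B_def B_matrix_nth
deriv_affine by simp
  note h = lax_residue_equations_hold
  note r = h(1-3,6,7)[OF nz, where p = "p t" and \<theta>i = \<theta>i and ?\<theta>0.0 = \<theta>0 and ?\<theta>1.0 = \<theta>1,
        folded e0_def f0_def g0_def b0_def b1_def c0_def]
      h(4)[OF nz, folded g0_def c0_def]
      h(8,9)[OF nz, where p = "p t" and \<theta>i = \<theta>i, folded e0_def g0_def c0_def]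
  have "A z t $ 2 $ 2 = - A z t $ 1 $ 1" unfolding A_def by (rule connection_matrix_nth)
  moreover have "B z t $ 2 $ 2 = - B z t $ 1 $ 1" unfolding B_def by (rule B_matrix_nth)
  moreover have "mderiv (\<lambda>s. A z s) t $ 2 $ 2 = - mderiv (\<lambda>s. A z s) t $ 1 $ 1"
    unfolding A_def by (rule connection_matrix_mderiv[OF der nz(2,3)])
  moreover have "mderiv (\<lambda>x. B x t) z $ 2 $ 2 = - mderiv (\<lambda>x. B x t) z $ 1 $ 1"
    by (simp only: mB mat22_nth) simp
  moreover have "mderiv (\<lambda>s. A z s) t $ 1 $ 1 - mderiv (\<lambda>x. B x t) z $ 1 $ 1
      + (B z t $ 1 $ 2 * A z t $ 2 $ 1 - A z t $ 1 $ 2 * B z t $ 2 $ 1) = 0"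
    unfolding mB mat22_nth unfolding A_def B_def connection_matrix_nth
      connection_matrix_mderiv[OF der nz(2,3)] B_matrix_nth
      e0_def[symmetric] f0_def[symmetric] g0_def[symmetric] b0_def[symmetric] b1_def[symmetric] c0_def[symmetric] div
    using r(1,2) by algebra
  moreover have "mderiv (\<lambda>s. A z s) t $ 1 $ 2 - mderiv (\<lambda>x. B x t) z $ 1 $ 2
      + 2 * (B z t $ 1 $ 1 * A z t $ 1 $ 2 - B z t $ 1 $ 2 * A z t $ 1 $ 1) = 0"
    unfolding mB mat22_nth unfolding A_def B_def connection_matrix_nth
      connection_matrix_mderiv[OF der nz(2,3)] B_matrix_nth
      e0_def[symmetric] f0_def[symmetric] g0_def[symmetric] b0_def[symmetric] b1_def[symmetric] c0_def[symmetric] div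
    using r(3,4,5) XY by algebra
  moreover have "mderiv (\<lambda>s. A z s) t $ 2 $ 1 - mderiv (\<lambda>x. B x t) z $ 2 $ 1
      + 2 * (B z t $ 2 $ 1 * A z t $ 1 $ 1 - B z t $ 1 $ 1 * A z t $ 2 $ 1) = 0"
    unfolding mB mat22_nth unfolding A_def B_def connection_matrix_nth
      connection_matrix_mderiv[OF der nz(2,3)] B_matrix_nth
      e0_def[symmetric] f0_def[symmetric] g0_def[symmetric] b0_def[symmetric] b1_def[symmetric] c0_def[symmetric] div
    using r(6,7,8) XY by algebra
  ultimately show ?thesis
    using lax_matrix_iff by blast
qed

section \<open>Rational commuting operators\<close>

text \<open>Any \<open>k\<close> at least the pole order is allowed, so that the three entries of
  \<open>B\<close> can share one exponent. \<open>G s\<close> is then the coefficient of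
  \<open>(z - s)^(-k)\<close>, nonzero for an entry that attains the order \<open>k\<close>.\<close>

lemma rational_pole_expansion:
  fixes n d :: "complex poly" and s :: complex
  assumes "d \<noteq> 0" "coprime n d" and k: "order s d \<le> k"
  obtains G G1 where "isCont G s" "isCont G1 s"
    and "\<forall>\<^sub>F z in at s. poly n z / poly d z = G z / (z - s) ^ k \<and>
       deriv (\<lambda>z. poly n z / poly d z) z = G1 z / (z - s) ^ k - of_nat k * G z / (z - s) ^ Suc k"
    and "0 < k \<Longrightarrow> k = order s d \<Longrightarrow> G s \<noteq> 0"
proof -
  obtain D where D: "d = [:- s, 1:] ^ order s d * D" and nd: "\<not> [:- s, 1:] dvd D"
    using order_decomp[OF \<open>d \<noteq> 0\<close>] by blast
  have Ds: "poly D s \<noteq> 0" using nd by (simp add: poly_eq_0_iff_dvd)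
  define N where "N = n * [:- s, 1:] ^ (k - order s d)"
  define G where "G z = poly N z / poly D z" for z
  define G1 where "G1 z = (poly (pderiv N) z * poly D z - poly N z * poly (pderiv D) z) / (poly D z)^2" for z
  define V where "V = {z. z \<noteq> s \<and> poly D z \<noteq> 0}"
  have "open V" unfolding V_def by (intro open_Collect_conj open_Collect_neq continuous_intros)
  have eq: "poly n z / poly d z = G z / (z - s) ^ k" if "z \<in> V" for z
  proof -
    have "(z - s) ^ k = (z - s) ^ order s d * (z - s) ^ (k - order s d)"
      using k by (simp add: power_add[symmetric])
    moreover have "poly d z = (z - s) ^ order s d * poly D z" by (subst D) simp
    ultimately show ?thesis using that by (simp add: G_def N_def V_def)
  qed
  \<comment> \<open>For \<open>k = 0\<close> the truncated \<open>k - 1\<close> is harmless, because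
    its power is multiplied by \<open>of_nat 0\<close>.\<close>
  have quot: "(x * u ^ k - y * (of_nat k * u ^ (k - 1))) / (u ^ k * u ^ k) = x / u ^ k - of_nat k * y / u ^ Suc k"
    if "u \<noteq> 0" for x y u :: complex
    using that by (cases k) (simp_all add: field_simps)
  have "deriv (\<lambda>z. poly n z / poly d z) z = G1 z / (z - s) ^ k - of_nat k * G z / (z - s) ^ Suc k" if z: "z \<in> V" for z
  proof (rule DERIV_imp_deriv)
    have "z - s \<noteq> 0" "poly D z \<noteq> 0" using z by (auto simp: V_def)
    then have "(G has_field_derivative G1 z) (at z)"
      unfolding G_def G1_def by (auto intro!: derivative_eq_intros simp: power2_eq_square)
    then have "((\<lambda>z. G z / (z - s) ^ k) has_field_derivative
        (G1 z * (z - s) ^ k - G z * (of_nat k * (z - s) ^ (k - 1))) / ((z - s) ^ k * (z - s) ^ k)) (at z)"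
      using \<open>z - s \<noteq> 0\<close> by (auto intro!: derivative_eq_intros)
    moreover have "(G1 z * (z - s) ^ k - G z * (of_nat k * (z - s) ^ (k - 1))) / ((z - s) ^ k * (z - s) ^ k)
        = G1 z / (z - s) ^ k - of_nat k * G z / (z - s) ^ Suc k"
      using quot[OF \<open>z - s \<noteq> 0\<close>] .
    ultimately have "((\<lambda>z. G z / (z - s) ^ k) has_field_derivative
        G1 z / (z - s) ^ k - of_nat k * G z / (z - s) ^ Suc k) (at z)" by simp
    then show "((\<lambda>z. poly n z / poly d z) has_field_derivative
        G1 z / (z - s) ^ k - of_nat k * G z / (z - s) ^ Suc k) (at z)"
      by (rule has_field_derivative_transform_within_open[OF _ \<open>open V\<close> z]) (simp add: eq)
  qed
  moreover have "\<forall>\<^sub>F z in at s. z \<in> V"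
  proof -
    have "isCont (poly D) s" by simp
    then have "\<forall>\<^sub>F z in at s. poly D z \<noteq> 0"
      using Ds by (simp add: isCont_def tendsto_imp_eventually_ne)
    then show ?thesis by (simp add: V_def eventually_conj_iff eventually_neq_at_within)
  qed
  ultimately have ev: "\<forall>\<^sub>F z in at s. poly n z / poly d z = G z / (z - s) ^ k \<and>
       deriv (\<lambda>z. poly n z / poly d z) z = G1 z / (z - s) ^ k - of_nat k * G z / (z - s) ^ Suc k"
    using eq by (auto elim!: eventually_mono)
  have "G s \<noteq> 0" if "0 < k" "k = order s d"
  proof -
    have "poly d s = 0" using that \<open>d \<noteq> 0\<close> by (simp add: order_root)
    then have "poly n s \<noteq> 0"
      using \<open>coprime n d\<close> coprime_poly_0 by blast
    then show ?thesis using Ds that by (simp add: G_def N_def)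
  qed
  moreover have "isCont G s" "isCont G1 s"
    unfolding G_def[abs_def] G1_def[abs_def] using Ds by (auto intro!: continuous_intros)
  ultimately show ?thesis using that ev by blast
qed

text \<open>The adjoint action of the trace-free matrix with entries \<open>a\<close>,
  \<open>b\<close>, \<open>c\<close> has eigenvalues 0 and
  \<open>\<plusminus> 2 * sqrt (a^2 + b * c)\<close>; the determinant of the linear system is
  \<open>k * (k^2 - 4 * (a^2 + b * c))\<close>.\<close>

lemma ad_eigenvector_eq_0:
  fixes a b c k E F G :: complex
  assumes "k * E + (F * c - b * G) = 0" "k * F + 2 * (E * b - F * a) = 0" "k * G + 2 * (G * a - E * c) = 0"
    and "k \<noteq> 0" "k^2 \<noteq> 4 * (a^2 + b * c)"
  shows "E = 0 \<and> F = 0 \<and> G = 0"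
proof -
  have "k * (k^2 - 4 * (a^2 + b * c)) * E = 0" "k * (k^2 - 4 * (a^2 + b * c)) * F = 0"
    "k * (k^2 - 4 * (a^2 + b * c)) * G = 0"
    using assms(1-3) by algebra+
  then show ?thesis using assms(4,5) by simp
qed

text \<open>The case distinction in the limit lets a single pole argument serve 0, 1 and the
  ordinary points.\<close>

lemma simple_poles_residue:
  fixes r0 r1 c s :: complex
  shows "((\<lambda>z. (z - s) * (r0 / z + r1 / (z - 1) + c)) \<longlongrightarrow> (if s = 0 then r0 else if s = 1 then r1 else 0)) (at s)"
proof -
  have "((\<lambda>z. (z - s) * (r0 / z + r1 / (z - 1) + c)) \<longlongrightarrow> r0) (at s)" if "s = 0"
  proof -
    have "((\<lambda>z. r0 + z * (r1 / (z - 1) + c)) \<longlongrightarrow> r0 + 0 * (r1 / (0 - 1) + c)) (at 0)"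
      by (intro tendsto_intros) auto
    then have "((\<lambda>z. r0 + z * (r1 / (z - 1) + c)) \<longlongrightarrow> r0) (at 0)" by simp
    moreover have "\<forall>\<^sub>F z in at 0. r0 + z * (r1 / (z - 1) + c) = (z - 0) * (r0 / z + r1 / (z - 1) + c)"
      unfolding eventually_at_filter by (rule always_eventually) (auto simp: algebra_simps)
    ultimately show ?thesis unfolding \<open>s = 0\<close> by (rule Lim_transform_eventually)
  qed
  moreover have "((\<lambda>z. (z - s) * (r0 / z + r1 / (z - 1) + c)) \<longlongrightarrow> r1) (at s)" if "s = 1"
  proof -
    have "((\<lambda>z. r1 + (z - 1) * (r0 / z + c)) \<longlongrightarrow> r1 + (1 - 1) * (r0 / 1 + c)) (at 1)"
      by (intro tendsto_intros) auto
    then have "((\<lambda>z. r1 + (z - 1) * (r0 / z + c)) \<longlongrightarrow> r1) (at 1)" by simp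
    moreover have "\<forall>\<^sub>F z in at 1. r1 + (z - 1) * (r0 / z + c) = (z - 1) * (r0 / z + r1 / (z - 1) + c)"
      unfolding eventually_at_filter by (rule always_eventually) (auto simp: distrib_left)
    ultimately show ?thesis unfolding \<open>s = 1\<close> by (rule Lim_transform_eventually)
  qed
  moreover have "((\<lambda>z. (z - s) * (r0 / z + r1 / (z - 1) + c)) \<longlongrightarrow> 0) (at s)" if "s \<noteq> 0" "s \<noteq> 1"
  proof -
    have "((\<lambda>z. (z - s) * (r0 / z + r1 / (z - 1) + c)) \<longlongrightarrow> (s - s) * (r0 / s + r1 / (s - 1) + c)) (at s)"
      using that by (intro tendsto_intros) auto
    then show ?thesis by simp
  qed
  ultimately show ?thesis by auto
qed

text \<open>One order beyond the pole order \<open>k\<close> only two terms of the commutation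
  relation survive: the z-derivative, which contributes \<open>k\<close> times the leading
  coefficients, and the bracket with the residue. The t-derivative of the connection has at most a
  simple pole, which is of lower order once \<open>k > 0\<close>. The leading coefficients would
  thus form an eigenvector of the adjoint action of the residue.\<close>

lemma rational_lax_no_pole:
  fixes n1 d1 n2 d2 n3 d3 :: "complex poly" and s :: complex
  assumes d: "d1 \<noteq> 0" "d2 \<noteq> 0" "d3 \<noteq> 0" and cop: "coprime n1 d1" "coprime n2 d2" "coprime n3 d3"
    and lim: "((\<lambda>z. (z - s) * a z) \<longlongrightarrow> a0) (at s)" "((\<lambda>z. (z - s) * b z) \<longlongrightarrow> b0) (at s)"
      "((\<lambda>z. (z - s) * c z) \<longlongrightarrow> c0) (at s)"
    and lim': "((\<lambda>z. (z - s) * a' z) \<longlongrightarrow> a0') (at s)" "((\<lambda>z. (z - s) * b' z) \<longlongrightarrow> b0') (at s)"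
      "((\<lambda>z. (z - s) * c' z) \<longlongrightarrow> c0') (at s)"
  defines "E \<equiv> \<lambda>z. poly n1 z / poly d1 z" and "F \<equiv> \<lambda>z. poly n2 z / poly d2 z" and "G \<equiv> \<lambda>z. poly n3 z / poly d3 z"
  assumes lax: "\<forall>\<^sub>F z in at s. a' z - deriv E z + (F z * c z - b z * G z) = 0 \<and>
      b' z - deriv F z + 2 * (E z * b z - F z * a z) = 0 \<and> c' z - deriv G z + 2 * (G z * a z - E z * c z) = 0"
    and non_resonant: "\<And>k :: nat. k \<in> {order s d1, order s d2, order s d3} \<Longrightarrow> k > 0 \<Longrightarrow> (of_nat k)^2 \<noteq> 4 * (a0^2 + b0 * c0)"
  shows "poly d1 s \<noteq> 0 \<and> poly d2 s \<noteq> 0 \<and> poly d3 s \<noteq> 0"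
proof -
  \<comment> \<open>A common exponent for the three entries; at least one of them attains it, and
    its leading coefficient is nonzero.\<close>
  define k where "k = Max {order s d1, order s d2, order s d3}"
  have kin: "k \<in> {order s d1, order s d2, order s d3}"
    unfolding k_def by (rule Max_in) auto
  have kge: "order s d1 \<le> k" "order s d2 \<le> k" "order s d3 \<le> k"
    unfolding k_def by (intro Max_ge; simp)+
  have "k = 0"
  proof (rule ccontr)
    assume "k \<noteq> 0"
    obtain P P1 where P: "isCont P s" "isCont P1 s" "\<forall>\<^sub>F z in at s. E z = P z / (z - s) ^ k \<and>
       deriv E z = P1 z / (z - s) ^ k - of_nat k * P z / (z - s) ^ Suc k" "k = order s d1 \<Longrightarrow> P s \<noteq> 0"
      using rational_pole_expansion[OF d(1) cop(1) kge(1)] \<open>k \<noteq> 0\<close> unfolding E_def by blast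
    obtain Q Q1 where Q: "isCont Q s" "isCont Q1 s" "\<forall>\<^sub>F z in at s. F z = Q z / (z - s) ^ k \<and>
       deriv F z = Q1 z / (z - s) ^ k - of_nat k * Q z / (z - s) ^ Suc k" "k = order s d2 \<Longrightarrow> Q s \<noteq> 0"
      using rational_pole_expansion[OF d(2) cop(2) kge(2)] \<open>k \<noteq> 0\<close> unfolding F_def by blast
    obtain R R1 where R: "isCont R s" "isCont R1 s" "\<forall>\<^sub>F z in at s. G z = R z / (z - s) ^ k \<and>
       deriv G z = R1 z / (z - s) ^ k - of_nat k * R z / (z - s) ^ Suc k" "k = order s d3 \<Longrightarrow> R s \<noteq> 0"
      using rational_pole_expansion[OF d(3) cop(3) kge(3)] \<open>k \<noteq> 0\<close> unfolding G_def by blast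
    have c: "(P \<longlongrightarrow> P s) (at s)" "(P1 \<longlongrightarrow> P1 s) (at s)" "(Q \<longlongrightarrow> Q s) (at s)" "(Q1 \<longlongrightarrow> Q1 s) (at s)"
        "(R \<longlongrightarrow> R s) (at s)" "(R1 \<longlongrightarrow> R1 s) (at s)"
      using P(1,2) Q(1,2) R(1,2) by (simp_all add: isCont_def)
    have zk: "((\<lambda>z. (z - s) ^ k) \<longlongrightarrow> 0) (at s)"
    proof -
      have "((\<lambda>z. (z - s) ^ k) \<longlongrightarrow> (s - s) ^ k) (at s)" by (intro tendsto_intros)
      then show ?thesis using \<open>k \<noteq> 0\<close> by (simp add: zero_power)
    qed
    have zs: "((\<lambda>z. z - s) \<longlongrightarrow> 0) (at s)" by (simp add: LIM_zero)
    have alg: "u * v = 0 \<Longrightarrow> v = 0" if "u \<noteq> 0" for u v :: complex using that by simp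
    \<comment> \<open>The relation multiplied by \<open>(z - s) ^ Suc k\<close>: every factor now
      has a limit at \<open>s\<close>.\<close>
    have ev: "\<forall>\<^sub>F z in at s. (z - s) ^ k * ((z - s) * a' z) - (z - s) * P1 z + of_nat k * P z + (Q z * ((z - s) * c z) - (z - s) * b z * R z) = 0 \<and>
        (z - s) ^ k * ((z - s) * b' z) - (z - s) * Q1 z + of_nat k * Q z + 2 * (P z * ((z - s) * b z) - Q z * ((z - s) * a z)) = 0 \<and>
        (z - s) ^ k * ((z - s) * c' z) - (z - s) * R1 z + of_nat k * R z + 2 * (R z * ((z - s) * a z) - P z * ((z - s) * c z)) = 0"
      using lax P(3) Q(3) R(3) eventually_neq_at_within[of s s UNIV]
    proof eventually_elim
      case (elim z)
      define u where "u = z - s"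
      define U where "U = u ^ k"
      define w where "w = inverse U"
      have u: "U * w = 1" "u * inverse u = 1" using elim by (auto simp: u_def w_def U_def)
      have D: "x / u ^ k = x * w" "x / u ^ Suc k = x * w * inverse u" for x
        by (simp_all add: w_def U_def divide_inverse)
      note e = elim(1)[unfolded elim(2)[THEN conjunct1] elim(2)[THEN conjunct2] elim(3)[THEN conjunct1]
          elim(3)[THEN conjunct2] elim(4)[THEN conjunct1] elim(4)[THEN conjunct2], folded u_def, unfolded D]
      have clear: "U * (u * x) - u * y + r + u * h = 0" if "x - (y * w - r * w * inverse u) + w * h = 0" for x y r h
      proof -
        have "U * (u * x) - u * y + r + u * h = U * u * (x - (y * w - r * w * inverse u) + w * h)
            + (U * w - 1) * (u * y - u * h - r * (u * inverse u)) - r * (u * inverse u - 1)"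
          by (simp add: algebra_simps)
        then show ?thesis using that u by simp
      qed
      have g: "x * w * y - v * (r * w) = w * (x * y - v * r)"
          "2 * (x * w * y - r * w * v) = w * (2 * (x * y - r * v))"
          "x * (u * y) - u * v * r = u * (x * y - v * r)"
          "2 * (x * (u * y) - r * (u * v)) = u * (2 * (x * y - r * v))" for x y v r
        by (simp_all add: algebra_simps)
      show ?case unfolding u_def[symmetric] U_def[symmetric] g(3,4)
        using e[unfolded g(1,2)] by (intro conjI clear) blast+
    qed
    note ev' = ev[unfolded eventually_conj_iff]
    have l0: "L = 0" if "(f \<longlongrightarrow> L) (at s)" "\<forall>\<^sub>F z in at s. f z = 0" for f and L :: complex
    proof -
      have "((\<lambda>_. 0) \<longlongrightarrow> L) (at s)" by (rule Lim_transform_eventually[OF that])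
      from LIM_const_eq[OF this] show ?thesis by simp
    qed
    have "0 * a0' - 0 * P1 s + of_nat k * P s + (Q s * c0 - b0 * R s) = 0"
      by (rule l0[OF _ ev'[THEN conjunct1]]) (intro tendsto_intros c zk zs lim lim')
    moreover have "0 * b0' - 0 * Q1 s + of_nat k * Q s + 2 * (P s * b0 - Q s * a0) = 0"
      by (rule l0[OF _ ev'[THEN conjunct2, THEN conjunct1]]) (intro tendsto_intros c zk zs lim lim')
    moreover have "0 * c0' - 0 * R1 s + of_nat k * R s + 2 * (R s * a0 - P s * c0) = 0"
      by (rule l0[OF _ ev'[THEN conjunct2, THEN conjunct2]]) (intro tendsto_intros c zk zs lim lim')
    ultimately have "P s = 0 \<and> Q s = 0 \<and> R s = 0"
      using ad_eigenvector_eq_0[of "of_nat k" "P s" "Q s" c0 b0 "R s" a0] non_resonant[OF kin] \<open>k \<noteq> 0\<close> by simp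
    then show False using P(4) Q(4) R(4) kin by auto
  qed
  then show ?thesis using kge d by (simp add: order_root)
qed

section \<open>The degree of a polynomial commuting operator\<close>

lemma poly_eqI_cofinite:
  fixes P Q :: "complex poly"
  assumes "finite F" "\<And>z. z \<notin> F \<Longrightarrow> poly P z = poly Q z"
  shows "P = Q"
proof -
  have "- F \<subseteq> {z. poly (P - Q) z = 0}" using assms(2) by auto
  moreover have "infinite (- F)" using assms(1) infinite_UNIV_char_0 finite_compl by blast
  ultimately have "infinite {z. poly (P - Q) z = 0}" using infinite_super by blast
  then have "P - Q = 0" using poly_roots_finite by blast
  then show ?thesis by simp
qed

lemma coeff_linear_mult: "coeff ([:c0, c1:] * f) (Suc n) = c0 * coeff f (Suc n) + c1 * coeff f n"
  for c0 c1 :: "'a :: comm_semiring_1"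
  by (simp add: mult_pCons_left)

text \<open>Suppose the largest degree \<open>n\<close> is at least 2. The bracket with the constant
  part \<open>diag (- t/2, t/2)\<close> of the connection multiplies the off-diagonal entries by
  \<open>\<plusminus> t\<close>, and no other term reaches that order, so their coefficients of
  degree \<open>n\<close> vanish. Nothing is then left to balance the derivative of the diagonal
  entry, whence \<open>n * coeff E n = 0\<close>.\<close>

lemma polynomial_lax_degree_le_1:
  fixes E F G :: "complex poly"
  assumes "finite S" "t \<noteq> 0"
    and lax: "\<And>z. z \<notin> S \<Longrightarrow> (a0' / z + a1' / (z - 1) - 1/2) - poly (pderiv E) z
        + (poly F z * (c0 / z + c1 / (z - 1)) - (b0 / z + b1 / (z - 1)) * poly G z) = 0 \<and>
      (b0' / z + b1' / (z - 1)) - poly (pderiv F) z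
        + 2 * (poly E z * (b0 / z + b1 / (z - 1)) - poly F z * (a0 / z + a1 / (z - 1) - t/2)) = 0 \<and>
      (c0' / z + c1' / (z - 1)) - poly (pderiv G) z
        + 2 * (poly G z * (a0 / z + a1 / (z - 1) - t/2) - poly E z * (c0 / z + c1 / (z - 1))) = 0"
  shows "degree E \<le> 1" "degree F \<le> 1" "degree G \<le> 1"
proof -
  define n where "n = Max {degree E, degree F, degree G}"
  have nin: "n \<in> {degree E, degree F, degree G}"
    unfolding n_def by (rule Max_in) auto
  have nge: "degree E \<le> n" "degree F \<le> n" "degree G \<le> n"
    unfolding n_def by (intro Max_ge; simp)+
  have "n \<le> 1"
  proof (rule ccontr)
    assume "\<not> n \<le> 1"
    then obtain m where m: "n = Suc (Suc m)" by (metis One_nat_def Suc_le_D not_less_eq_eq)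
    \<comment> \<open>A sum of two simple poles at 0 and 1 after multiplication by
      \<open>z * (z - 1)\<close>.\<close>
    define lp where "lp x y = [:- x, x + y:]" for x y :: complex
    have lp: "poly (lp x y) z = z * (z - 1) * (x / z + y / (z - 1))" if "z \<notin> S \<union> {0, 1}" for x y z
      using that by (simp add: lp_def field_simps)
    let ?X = "[:0, - 1, 1:] :: complex poly"
    let ?A = "lp a0 a1 - smult (t/2) ?X"
    have X: "poly ?X z = z * (z - 1)" for z by (simp add: algebra_simps)
    have 1: "lp a0' a1' - smult (1/2) ?X - ?X * pderiv E + (F * lp c0 c1 - lp b0 b1 * G) = 0"
      and 2: "lp b0' b1' - ?X * pderiv F + smult 2 (E * lp b0 b1 - F * ?A) = 0"
      and 3: "lp c0' c1' - ?X * pderiv G + smult 2 (G * ?A - E * lp c0 c1) = 0"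
    proof -
      have F: "finite (S \<union> {0, 1})" using assms by simp
      show "lp a0' a1' - smult (1/2) ?X - ?X * pderiv E + (F * lp c0 c1 - lp b0 b1 * G) = 0"
      proof (rule poly_eqI_cofinite[OF F])
        fix z assume z: "z \<notin> S \<union> {0, 1}"
        have "poly (lp a0' a1' - smult (1/2) ?X - ?X * pderiv E + (F * lp c0 c1 - lp b0 b1 * G)) z
          = z * (z - 1) * ((a0' / z + a1' / (z - 1) - 1/2) - poly (pderiv E) z
        + (poly F z * (c0 / z + c1 / (z - 1)) - (b0 / z + b1 / (z - 1)) * poly G z))"
          unfolding poly_add poly_diff poly_mult poly_smult lp[OF z] X by algebra
        also have "\<dots> = 0" using lax[of z] z by simp
        finally show "poly (lp a0' a1' - smult (1/2) ?X - ?X * pderiv E + (F * lp c0 c1 - lp b0 b1 * G)) z = poly 0 z"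
          by simp
      qed
      show "lp b0' b1' - ?X * pderiv F + smult 2 (E * lp b0 b1 - F * ?A) = 0"
      proof (rule poly_eqI_cofinite[OF F])
        fix z assume z: "z \<notin> S \<union> {0, 1}"
        have "poly (lp b0' b1' - ?X * pderiv F + smult 2 (E * lp b0 b1 - F * ?A)) z
          = z * (z - 1) * ((b0' / z + b1' / (z - 1)) - poly (pderiv F) z
        + 2 * (poly E z * (b0 / z + b1 / (z - 1)) - poly F z * (a0 / z + a1 / (z - 1) - t/2)))"
          unfolding poly_add poly_diff poly_mult poly_smult lp[OF z] X by algebra
        also have "\<dots> = 0" using lax[of z] z by simp
        finally show "poly (lp b0' b1' - ?X * pderiv F + smult 2 (E * lp b0 b1 - F * ?A)) z = poly 0 z"
          by simp
      qed
      show "lp c0' c1' - ?X * pderiv G + smult 2 (G * ?A - E * lp c0 c1) = 0"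
      proof (rule poly_eqI_cofinite[OF F])
        fix z assume z: "z \<notin> S \<union> {0, 1}"
        have "poly (lp c0' c1' - ?X * pderiv G + smult 2 (G * ?A - E * lp c0 c1)) z
          = z * (z - 1) * ((c0' / z + c1' / (z - 1)) - poly (pderiv G) z
        + 2 * (poly G z * (a0 / z + a1 / (z - 1) - t/2) - poly E z * (c0 / z + c1 / (z - 1))))"
          unfolding poly_add poly_diff poly_mult poly_smult lp[OF z] X by algebra
        also have "\<dots> = 0" using lax[of z] z by simp
        finally show "poly (lp c0' c1' - ?X * pderiv G + smult 2 (G * ?A - E * lp c0 c1)) z = poly 0 z"
          by simp
      qed
    qed
    have hi: "coeff E (Suc n) = 0" "coeff F (Suc n) = 0" "coeff G (Suc n) = 0"
        "coeff E (Suc (Suc n)) = 0" "coeff F (Suc (Suc n)) = 0" "coeff G (Suc (Suc n)) = 0"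
      using nge by (auto intro!: coeff_eq_0)
    have lpc: "coeff (lp x y * H) (Suc k) = - x * coeff H (Suc k) + (x + y) * coeff H k"
        "coeff (H * lp x y) (Suc k) = - x * coeff H (Suc k) + (x + y) * coeff H k" for H x y k
      unfolding mult.commute[of H] lp_def by (rule coeff_linear_mult)+
    have Xc: "coeff (?X * H) (Suc (Suc k)) = - coeff H (Suc k) + coeff H k"
       "coeff (H * ?X) (Suc (Suc k)) = - coeff H (Suc k) + coeff H k" for H k
      unfolding mult.commute[of H] by (simp_all add: mult_pCons_left)
    have lp0: "coeff (lp x y) (Suc (Suc k)) = 0" for x y k by (simp add: lp_def)
    have X0: "coeff ?X (Suc (Suc (Suc k))) = 0" for k by simp
    have F0: "coeff F n = 0"
      using arg_cong[OF 2, of "\<lambda>P. coeff P (Suc (Suc n))"] hi \<open>t \<noteq> 0\<close>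
      unfolding coeff_add coeff_diff coeff_smult right_diff_distrib mult_smult_right lpc Xc lp0 coeff_pderiv
      by simp
    have G0: "coeff G n = 0"
      using arg_cong[OF 3, of "\<lambda>P. coeff P (Suc (Suc n))"] hi \<open>t \<noteq> 0\<close>
      unfolding coeff_add coeff_diff coeff_smult right_diff_distrib mult_smult_right lpc Xc lp0 coeff_pderiv
      by simp
    \<comment> \<open>Here \<open>n \<ge> 2\<close> enters: the constant \<open>- 1/2\<close> in the
      t-derivative of the connection becomes a polynomial of degree 2 and does not reach degree
      \<open>n + 1\<close>.\<close>
    have E0: "coeff E n = 0"
      using arg_cong[OF 1, of "\<lambda>P. coeff P (Suc n)"] hi F0 G0
      unfolding m coeff_add coeff_diff coeff_smult lpc Xc lp0 X0 coeff_pderiv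
      by (simp add: m of_nat_Suc[symmetric] del: of_nat_Suc)
    show False
      using nin E0 F0 G0 m by (auto simp: leading_coeff_0_iff)
  qed
  then show "degree E \<le> 1" "degree F \<le> 1" "degree G \<le> 1" using nge by auto
qed

lemma poly_no_root_imp_const:
  fixes d :: "complex poly"
  assumes "\<And>s. poly d s \<noteq> 0"
  obtains c where "d = [:c:]" "c \<noteq> 0"
proof -
  have "constant (poly d)"
  proof (rule ccontr)
    assume "\<not> constant (poly d)"
    from Fundamental_Theorem_Algebra.fundamental_theorem_of_algebra[OF this] assms show False by auto
  qed
  then have "degree d = 0" by (simp add: constant_degree)
  then obtain c where c: "d = [:c:]" by (rule degree_eq_zeroE)
  have "c \<noteq> 0" using assms[of 0] unfolding c by simp
  then show ?thesis by (rule that[OF c])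
qed

lemma poly_degree_le_1:
  fixes P :: "'a :: comm_semiring_0 poly"
  assumes "degree P \<le> 1"
  shows "poly P z = coeff P 0 + coeff P 1 * z"
proof -
  have "P = [:coeff P 0, coeff P 1:]"
  proof (rule poly_eqI)
    fix n show "coeff P n = coeff [:coeff P 0, coeff P 1:] n"
    proof (cases n)
      case (Suc m)
      show ?thesis using assms by (cases m) (auto simp: Suc coeff_eq_0)
    qed simp
  qed
  then have "poly P z = poly [:coeff P 0, coeff P 1:] z" by simp
  then show ?thesis by (simp add: mult.commute)
qed

lemma rational_lax_imp_system:
  fixes \<theta>0 \<theta>1 \<theta>i t :: complex and p q :: "complex \<Rightarrow> complex" and B :: "complex \<Rightarrow> mat2"
  assumes der: "(p has_field_derivative p') (at t)" "(q has_field_derivative q') (at t)"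
    and nz: "t \<noteq> 0" "q t \<noteq> 0" "q t \<noteq> 1" and "finite F"
    and rat: "\<And>i j. rational_without_poles_in (resonant_points \<theta>0 \<theta>1) (\<lambda>z. B z $ i $ j)"
    and tr: "\<And>z. trace (B z) = 0"
  defines "A \<equiv> connection_matrix \<theta>0 \<theta>1 \<theta>i p q"
  assumes lax: "\<And>z. z \<notin> F \<Longrightarrow> mderiv (\<lambda>s. A z s) t - mderiv B z + B z ** A z t - A z t ** B z = 0"
  shows "q' = rhs_q (p t) (q t) t" "p' = rhs_p \<theta>0 \<theta>1 \<theta>i (p t) (q t) t"
    "B z = B_matrix \<theta>0 \<theta>1 \<theta>i p q z t"
proof -
  let ?w = "wval \<theta>i (p t) (q t) t" and ?v = "vval \<theta>i (p t) (q t) t"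
  let ?w' = "wdot \<theta>i (q t) t p' q'" and ?v' = "vdot \<theta>i (q t) t p' q'"
  let ?R = "resonant_points \<theta>0 \<theta>1"
  obtain n1 d1 where 1: "d1 \<noteq> 0" "coprime n1 d1" "\<forall>s\<in>?R. poly d1 s \<noteq> 0" "(\<lambda>z. B z $ 1 $ 1) = (\<lambda>z. poly n1 z / poly d1 z)"
    using rat[of 1 1] unfolding rational_without_poles_in_def by blast
  obtain n2 d2 where 2: "d2 \<noteq> 0" "coprime n2 d2" "\<forall>s\<in>?R. poly d2 s \<noteq> 0" "(\<lambda>z. B z $ 1 $ 2) = (\<lambda>z. poly n2 z / poly d2 z)"
    using rat[of 1 2] unfolding rational_without_poles_in_def by blast
  obtain n3 d3 where 3: "d3 \<noteq> 0" "coprime n3 d3" "\<forall>s\<in>?R. poly d3 s \<noteq> 0" "(\<lambda>z. B z $ 2 $ 1) = (\<lambda>z. poly n3 z / poly d3 z)"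
    using rat[of 2 1] unfolding rational_without_poles_in_def by blast
  note e = 1(4)[THEN fun_cong] 2(4)[THEN fun_cong] 3(4)[THEN fun_cong]
  have B22: "B z $ 2 $ 2 = - B z $ 1 $ 1" for z
    using tr[of z] by (simp add: trace_mat2 add_eq_0_iff)
  \<comment> \<open>The z-derivative of the (2,2) entry is minus that of the (1,1) entry where the
    latter is differentiable, so the zeros of \<open>d1\<close> are excluded as well.\<close>
  define F' where "F' = F \<union> {z. poly d1 z = 0}"
  have F': "finite F'" unfolding F'_def using \<open>finite F\<close> 1(1) by (simp add: poly_roots_finite)
  define a where "a z = - ?w / z + ?v / (z - 1) - t / 2" for z
  define b where "b z = (q t - 1) * (?w^2 - \<theta>0^2 / 4) / q t / z + (\<theta>1^2 / 4 - ?v^2) / (z - 1)" for z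
  define c where "c z = (- q t / (q t - 1)) / z + 1 / (z - 1)" for z
  define a' where "a' z = - ?w' / z + ?v' / (z - 1) - 1 / 2" for z
  define b' where "b' z = (q' / (q t)^2 * (?w^2 - \<theta>0^2 / 4) + (q t - 1) / q t * 2 * ?w * ?w') / z
      + (- 2 * ?v * ?v') / (z - 1)" for z
  define c' where "c' z = (q' / (q t - 1)^2) / z + 0 / (z - 1)" for z
  have eqs: "a' z - deriv (\<lambda>z. poly n1 z / poly d1 z) z
        + (poly n2 z / poly d2 z * c z - b z * (poly n3 z / poly d3 z)) = 0 \<and>
      b' z - deriv (\<lambda>z. poly n2 z / poly d2 z) z
        + 2 * (poly n1 z / poly d1 z * b z - poly n2 z / poly d2 z * a z) = 0 \<and>
      c' z - deriv (\<lambda>z. poly n3 z / poly d3 z) z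
        + 2 * (poly n3 z / poly d3 z * a z - poly n1 z / poly d1 z * c z) = 0" if z: "z \<notin> F'" for z
  proof -
    have "A z t $ 2 $ 2 = - A z t $ 1 $ 1" unfolding A_def by (rule connection_matrix_nth)
    moreover note B22[of z]
    moreover have "mderiv (\<lambda>s. A z s) t $ 2 $ 2 = - mderiv (\<lambda>s. A z s) t $ 1 $ 1"
      unfolding A_def by (rule connection_matrix_mderiv[OF der nz(2,3)])
    moreover have "mderiv B z $ 2 $ 2 = - mderiv B z $ 1 $ 1"
    proof -
      have "(\<lambda>z. poly n1 z / poly d1 z) field_differentiable at z"
        using z by (intro field_differentiable_divide) (auto simp: F'_def field_differentiable_def intro: poly_DERIV)
      then show ?thesis
        unfolding mderiv_nth B22 e by simp
    qed
    moreover have "mderiv (\<lambda>s. A z s) t - mderiv B z + B z ** A z t - A z t ** B z = 0"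
      using lax z by (simp add: F'_def)
    ultimately have "mderiv (\<lambda>s. A z s) t $ 1 $ 1 - mderiv B z $ 1 $ 1 + (B z $ 1 $ 2 * A z t $ 2 $ 1 - A z t $ 1 $ 2 * B z $ 2 $ 1) = 0 \<and>
    mderiv (\<lambda>s. A z s) t $ 1 $ 2 - mderiv B z $ 1 $ 2 + 2 * (B z $ 1 $ 1 * A z t $ 1 $ 2 - B z $ 1 $ 2 * A z t $ 1 $ 1) = 0 \<and>
    mderiv (\<lambda>s. A z s) t $ 2 $ 1 - mderiv B z $ 2 $ 1 + 2 * (B z $ 2 $ 1 * A z t $ 1 $ 1 - B z $ 1 $ 1 * A z t $ 2 $ 1) = 0"
      using lax_matrix_iff by blast
    then show ?thesis
      unfolding A_def connection_matrix_mderiv[OF der nz(2,3)] connection_matrix_nth mderiv_nth[of B] e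
        a_def b_def c_def a'_def b'_def c'_def .
  qed
  have no_pole: "poly d1 s \<noteq> 0 \<and> poly d2 s \<noteq> 0 \<and> poly d3 s \<noteq> 0" for s
  proof (rule rational_lax_no_pole[OF 1(1) 2(1) 3(1) 1(2) 2(2) 3(2)])
    show "((\<lambda>z. (z - s) * a z) \<longlongrightarrow> (if s = 0 then - ?w else if s = 1 then ?v else 0)) (at s)"
      using simple_poles_residue[of s "- ?w" ?v "- t/2"] by (simp add: a_def)
    show "((\<lambda>z. (z - s) * b z) \<longlongrightarrow> (if s = 0 then (q t - 1) * (?w^2 - \<theta>0^2 / 4) / q t else if s = 1 then \<theta>1^2 / 4 - ?v^2 else 0)) (at s)"
      using simple_poles_residue[of s _ _ 0] unfolding b_def add_0_right .
    show "((\<lambda>z. (z - s) * c z) \<longlongrightarrow> (if s = 0 then - q t / (q t - 1) else if s = 1 then 1 else 0)) (at s)"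
      using simple_poles_residue[of s _ _ 0] unfolding c_def add_0_right .
    show "((\<lambda>z. (z - s) * a' z) \<longlongrightarrow> (if s = 0 then - ?w' else if s = 1 then ?v' else 0)) (at s)"
      using simple_poles_residue[of s "- ?w'" ?v' "- 1/2"] by (simp add: a'_def)
    show "((\<lambda>z. (z - s) * b' z) \<longlongrightarrow> (if s = 0 then (q' / (q t)^2 * (?w^2 - \<theta>0^2 / 4) + (q t - 1) / q t * 2 * ?w * ?w') else if s = 1 then - 2 * ?v * ?v' else 0)) (at s)"
      using simple_poles_residue[of s _ _ 0] unfolding b'_def add_0_right .
    show "((\<lambda>z. (z - s) * c' z) \<longlongrightarrow> (if s = 0 then q' / (q t - 1)^2 else if s = 1 then 0 else 0)) (at s)"
      using simple_poles_residue[of s _ _ 0] unfolding c'_def add_0_right .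
    have "\<forall>\<^sub>F z in at s. z \<notin> F'"
      using islimpt_finite[OF F'] by (auto simp: islimpt_iff_eventually)
    then show "\<forall>\<^sub>F z in at s. a' z - deriv (\<lambda>z. poly n1 z / poly d1 z) z
        + (poly n2 z / poly d2 z * c z - b z * (poly n3 z / poly d3 z)) = 0 \<and>
      b' z - deriv (\<lambda>z. poly n2 z / poly d2 z) z
        + 2 * (poly n1 z / poly d1 z * b z - poly n2 z / poly d2 z * a z) = 0 \<and>
      c' z - deriv (\<lambda>z. poly n3 z / poly d3 z) z
        + 2 * (poly n3 z / poly d3 z * a z - poly n1 z / poly d1 z * c z) = 0"
      by (rule eventually_mono) (rule eqs)
  next
    fix k :: nat
    assume k: "k \<in> {order s d1, order s d2, order s d3}" "k > 0"
    \<comment> \<open>At a resonant point none of the three denominators vanishes, so an order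
      \<open>k > 0\<close> occurs elsewhere only.\<close>
    have nr: "s \<notin> ?R"
      using k 1(1,3) 2(1,3) 3(1,3) by (auto simp: order_root)
    have sq: "(of_nat k)^2 \<noteq> \<theta>^2" if "\<theta> \<notin> \<int> - {0}" for \<theta> :: complex
    proof
      assume "(of_nat k)^2 = \<theta>^2"
      then have "\<theta> = of_nat k \<or> \<theta> = - of_nat k" by (metis power2_eq_iff)
      then have "\<theta> \<in> \<int> - {0}" using k by auto
      with that show False by simp
    qed
    \<comment> \<open>Minus four times the determinant of the residue: a pole of order
      \<open>k\<close> at 0 would require \<open>k = \<plusminus> \<theta>0\<close>, and at 1
      likewise \<open>k = \<plusminus> \<theta>1\<close>.\<close>
    have r0: "4 * ((- ?w)^2 + (q t - 1) * (?w^2 - \<theta>0^2 / 4) / q t * (- q t / (q t - 1))) = \<theta>0^2"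
      using nz by (simp add: field_simps)
    have r1: "4 * (?v^2 + (\<theta>1^2 / 4 - ?v^2) * 1) = \<theta>1^2" by simp
    consider "s = 0" | "s = 1" | "s \<noteq> 0" "s \<noteq> 1" by blast
    then show "(of_nat k)^2 \<noteq> 4 * ((if s = 0 then - ?w else if s = 1 then ?v else 0)^2
        + (if s = 0 then (q t - 1) * (?w^2 - \<theta>0^2 / 4) / q t else if s = 1 then \<theta>1^2 / 4 - ?v^2 else 0)
        * (if s = 0 then - q t / (q t - 1) else if s = 1 then 1 else 0))"
    proof cases
      case 1
      then have "\<theta>0 \<notin> \<int> - {0}" using nr by (auto simp: resonant_points_def)
      then show ?thesis using sq r0 1 by metis
    next
      case 2
      then have "\<theta>1 \<notin> \<int> - {0}" using nr by (auto simp: resonant_points_def)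
      moreover have "s \<noteq> 0" using 2 by simp
      ultimately show ?thesis using sq r1 2 by metis
    qed (use k in auto)
  qed
  obtain k1 where k1: "d1 = [:k1:]" "k1 \<noteq> 0" by (rule poly_no_root_imp_const[of d1]) (use no_pole in auto)
  obtain k2 where k2: "d2 = [:k2:]" "k2 \<noteq> 0" by (rule poly_no_root_imp_const[of d2]) (use no_pole in auto)
  obtain k3 where k3: "d3 = [:k3:]" "k3 \<noteq> 0" by (rule poly_no_root_imp_const[of d3]) (use no_pole in auto)
  define P1 where "P1 = smult (inverse k1) n1"
  define P2 where "P2 = smult (inverse k2) n2"
  define P3 where "P3 = smult (inverse k3) n3"
  have P: "poly n1 z / poly d1 z = poly P1 z" "poly n2 z / poly d2 z = poly P2 z" "poly n3 z / poly d3 z = poly P3 z" for z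
    using k1 k2 k3 by (simp_all add: P1_def P2_def P3_def divide_inverse)
  have dP: "deriv (\<lambda>z. poly P z) z = poly (pderiv P) z" for P and z :: complex
    by (rule DERIV_imp_deriv[OF poly_DERIV])
  have deg: "degree P1 \<le> 1" "degree P2 \<le> 1" "degree P3 \<le> 1"
    using polynomial_lax_degree_le_1[OF F' nz(1) eqs[unfolded P dP a_def b_def c_def a'_def b'_def c'_def]] by blast+
  have B: "B = (\<lambda>z. mat22 (coeff P1 0 + coeff P1 1 * z) (coeff P2 0 + coeff P2 1 * z) (coeff P3 0 + coeff P3 1 * z) (- (coeff P1 0 + coeff P1 1 * z)))"
    unfolding fun_eq_iff mat2_eq_iff mat22_nth B22 e P poly_degree_le_1[OF deg(1)] poly_degree_le_1[OF deg(2)]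
      poly_degree_le_1[OF deg(3)] by simp
  note L = linear_lax_imp_system[OF der nz \<open>finite F\<close> lax[unfolded A_def B]]
  show "q' = rhs_q (p t) (q t) t" "p' = rhs_p \<theta>0 \<theta>1 \<theta>i (p t) (q t) t"
    by (rule L; assumption)+
  show "B z = B_matrix \<theta>0 \<theta>1 \<theta>i p q z t"
    unfolding B by (rule L)
qed

section \<open>Hamiltonian form and second order equation\<close>

lemma partial_p_hamiltonian:
  "partial_p (hamiltonian \<theta>0 \<theta>1 \<theta>i) P Q t = - (2 * P / ((Q - 1) * Q * t))"
  unfolding partial_p_def hamiltonian_def
proof (rule DERIV_imp_deriv)
  have "((\<lambda>x. x^2 / ((Q - 1) * Q * t)) has_field_derivative 2 * P / ((Q - 1) * Q * t)) (at P)"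
    by (rule DERIV_cdivide) (rule derivative_eq_intros refl | simp)+
  from DERIV_add[OF DERIV_add[OF DERIV_diff[OF DERIV_minus[OF this] DERIV_const] DERIV_const] DERIV_const]
  show "((\<lambda>x. - (x^2 / ((Q - 1) * Q * t)) - \<theta>0^2 / (4 * Q * t) + \<theta>1^2 / (4 * (Q - 1) * t)
     + 1/4 * Q * (Q * t - t + 2 * \<theta>i - 2)) has_field_derivative - (2 * P / ((Q - 1) * Q * t))) (at P)"
    by simp
qed

lemma partial_q_hamiltonian:
  assumes "Q \<noteq> 0" "Q \<noteq> 1" "t \<noteq> 0"
  shows "partial_q (hamiltonian \<theta>0 \<theta>1 \<theta>i) P Q t =
    P^2 * (2 * Q - 1) / (((Q - 1) * Q)^2 * t) + \<theta>0^2 / (4 * Q^2 * t) - \<theta>1^2 / (4 * (Q - 1)^2 * t)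
    + 1/4 * (2 * Q * t - t + 2 * \<theta>i - 2)"
proof -
  have nz: "Q - 1 \<noteq> 0" using assms by simp
  have 1: "((\<lambda>x. P^2 / ((x - 1) * x * t)) has_field_derivative - (P^2 * (2 * Q - 1) / (((Q - 1) * Q)^2 * t))) (at Q)"
  proof -
    have "((\<lambda>x. (x - 1) * x * t) has_field_derivative (2 * Q - 1) * t) (at Q)"
      by (auto intro!: derivative_eq_intros simp: algebra_simps)
    from DERIV_divide[OF DERIV_const this, of "P^2"] show ?thesis
      using assms nz by (simp add: power2_eq_square mult_ac)
  qed
  have 2: "((\<lambda>x. \<theta>0^2 / (4 * x * t)) has_field_derivative - (\<theta>0^2 / (4 * Q^2 * t))) (at Q)"
  proof -
    have "((\<lambda>x. 4 * x * t) has_field_derivative 4 * t) (at Q)"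
      by (rule derivative_eq_intros refl | simp)+
    from DERIV_divide[OF DERIV_const this, of "\<theta>0^2"] show ?thesis
      using assms nz by (simp add: power2_eq_square mult_ac)
  qed
  have 3: "((\<lambda>x. \<theta>1^2 / (4 * (x - 1) * t)) has_field_derivative - (\<theta>1^2 / (4 * (Q - 1)^2 * t))) (at Q)"
  proof -
    have "((\<lambda>x. 4 * (x - 1) * t) has_field_derivative 4 * t) (at Q)"
      by (rule derivative_eq_intros refl | simp)+
    from DERIV_divide[OF DERIV_const this, of "\<theta>1^2"] show ?thesis
    proof (rule DERIV_cong)
      show "(0 * (4 * (Q - 1) * t) - \<theta>1^2 * (4 * t)) / (4 * (Q - 1) * t * (4 * (Q - 1) * t)) = - (\<theta>1^2 / (4 * (Q - 1)^2 * t))"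
        using assms nz by (simp add: divide_simps power2_eq_square) (simp add: algebra_simps)
    qed (use assms nz in simp)
  qed
  have 4: "((\<lambda>x. 1/4 * x * (x * t - t + 2 * \<theta>i - 2)) has_field_derivative 1/4 * (2 * Q * t - t + 2 * \<theta>i - 2)) (at Q)"
    by (auto intro!: derivative_eq_intros simp: algebra_simps)
  show ?thesis
    unfolding partial_q_def hamiltonian_def
    using DERIV_imp_deriv[OF DERIV_add[OF DERIV_add[OF DERIV_diff[OF DERIV_minus[OF 1] 2] 3] 4]] by simp
qed

lemma hamiltonian_vector_field:
  assumes "Q \<noteq> 0" "Q \<noteq> 1" "t \<noteq> 0"
  shows "Q * (Q - 1) * partial_q (hamiltonian \<theta>0 \<theta>1 \<theta>i) P Q t = rhs_p \<theta>0 \<theta>1 \<theta>i P Q t"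
    and "- (Q * (Q - 1)) * partial_p (hamiltonian \<theta>0 \<theta>1 \<theta>i) P Q t = rhs_q P Q t"
proof -
  have nz: "Q - 1 \<noteq> 0" using assms by simp
  show "Q * (Q - 1) * partial_q (hamiltonian \<theta>0 \<theta>1 \<theta>i) P Q t = rhs_p \<theta>0 \<theta>1 \<theta>i P Q t"
  proof -
    have "Q * (Q - 1) * (P^2 * (2 * Q - 1) / (((Q - 1) * Q)^2 * t)) = (2 * Q - 1) * P^2 / ((Q - 1) * Q * t)"
      using assms nz by (simp add: power2_eq_square mult_ac)
    moreover have "Q * (Q - 1) * (\<theta>0^2 / (4 * Q^2 * t) - \<theta>1^2 / (4 * (Q - 1)^2 * t))
        = (\<theta>0^2 * (Q - 1)^2 - \<theta>1^2 * Q^2) / (4 * Q * (Q - 1) * t)"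
    proof -
      have "Q * (Q - 1) * (\<theta>0^2 / (4 * Q^2 * t)) = \<theta>0^2 * (Q - 1)^2 / (4 * Q * (Q - 1) * t)"
        "Q * (Q - 1) * (\<theta>1^2 / (4 * (Q - 1)^2 * t)) = \<theta>1^2 * Q^2 / (4 * Q * (Q - 1) * t)"
        using assms nz by (simp_all add: power2_eq_square)
      then show ?thesis unfolding right_diff_distrib diff_divide_distrib by metis
    qed
    moreover have "Q * (Q - 1) * (a + b - c + d) = Q * (Q - 1) * a + Q * (Q - 1) * (b - c) + Q * (Q - 1) * d"
      for a b c d by (simp add: algebra_simps)
    moreover have "Q * (Q - 1) * (1/4 * (2 * Q * t - t + 2 * \<theta>i - 2)) = 1/4 * (Q - 1) * Q * (2 * Q * t - t + 2 * \<theta>i - 2)"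
      by simp
    ultimately show ?thesis
      unfolding partial_q_hamiltonian[OF assms] rhs_p_def by metis
  qed
  show "- (Q * (Q - 1)) * partial_p (hamiltonian \<theta>0 \<theta>1 \<theta>i) P Q t = rhs_q P Q t"
    unfolding partial_p_hamiltonian rhs_q_def using assms nz by (simp add: divide_simps)
qed

text \<open>Contraction with d/dp and d/dq yields the two equations. The remaining component along
  d/dt is \<open>H_p v_p + H_q v_q\<close>, which these equations make zero.\<close>

lemma spans_foliation_iff:
  assumes "Q \<noteq> 0" "Q \<noteq> 1" "t \<noteq> 0"
  shows "spans_foliation \<theta>0 \<theta>1 \<theta>i P Q t vp vq \<longleftrightarrow> vp = rhs_p \<theta>0 \<theta>1 \<theta>i P Q t \<and> vq = rhs_q P Q t"
proof -
  define c where "c = Q * (Q - 1)"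
  define hp where "hp = partial_p (hamiltonian \<theta>0 \<theta>1 \<theta>i) P Q t"
  define hq where "hq = partial_q (hamiltonian \<theta>0 \<theta>1 \<theta>i) P Q t"
  define ht where "ht = partial_t (hamiltonian \<theta>0 \<theta>1 \<theta>i) P Q t"
  have c: "c \<noteq> 0" using assms by (simp add: c_def)
  have Om: "Omega \<theta>0 \<theta>1 \<theta>i P Q t (vp, vq, 1) (x, y, z)
      = (vp * y - x * vq) / c + ((hp * vp + hq * vq + ht * 1) * z - (hp * x + hq * y + ht * z) * 1)" for x y z
    by (simp add: Omega_def wedge_def differential_def dp_def dq_def dt_def c_def hp_def hq_def ht_def)
  have "spans_foliation \<theta>0 \<theta>1 \<theta>i P Q t vp vq \<longleftrightarrow> vp = c * hq \<and> vq = - c * hp"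
  proof
    assume "spans_foliation \<theta>0 \<theta>1 \<theta>i P Q t vp vq"
    then have "Omega \<theta>0 \<theta>1 \<theta>i P Q t (vp, vq, 1) Y = 0" for Y
      unfolding spans_foliation_def by blast
    from this[of "(1, 0, 0)"] this[of "(0, 1, 0)"] show "vp = c * hq \<and> vq = - c * hp"
      unfolding Om using c by (auto simp: field_simps)
  next
    assume *: "vp = c * hq \<and> vq = - c * hp"
    have "Omega \<theta>0 \<theta>1 \<theta>i P Q t (vp, vq, 1) (x, y, z) = 0" for x y z
      unfolding Om using * c by (simp add: field_simps)
    then show "spans_foliation \<theta>0 \<theta>1 \<theta>i P Q t vp vq"
      unfolding spans_foliation_def by (auto simp: split_paired_all)
  qed
  then show ?thesis
    unfolding c_def hp_def hq_def hamiltonian_vector_field[OF assms] .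
qed

text \<open>The first equation of the system says \<open>p = t * q' / 2\<close>; inserted into the
  second one it gives an equation affine in \<open>q''\<close> with leading coefficient
  \<open>t / 2\<close>.\<close>

lemma painleve_second_order_at:
  fixes t q q' q'' :: complex
  assumes nz: "t \<noteq> 0" "q \<noteq> 0" "q \<noteq> 1"
  shows "q' / 2 + t * q'' / 2 = rhs_p \<theta>0 \<theta>1 \<theta>i (t * q' / 2) q t \<longleftrightarrow>
    q'' = (2 * q - 1) * q'^2 / (2 * (q - 1) * q) - q' / t
        + (q - 1) * q * (2 * q * t - t + 2 * \<theta>i - 2) / (2 * t)
        + \<theta>0^2 * (q - 1) / (2 * q * t^2) - \<theta>1^2 * q / (2 * (q - 1) * t^2)"
    (is "?l = ?r \<longleftrightarrow> q'' = ?s")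
proof -
  have q1: "q - 1 \<noteq> 0" using nz by simp
  have "2 / t * (?r - q' / 2) = ?s"
  proof -
    have "2 / t * ((2 * q - 1) * (t * q' / 2)^2 / ((q - 1) * q * t)) = (2 * q - 1) * q'^2 / (2 * (q - 1) * q)"
      using nz q1 by (simp add: divide_simps power2_eq_square)
    moreover have "2 / t * ((\<theta>0^2 * (q - 1)^2 - \<theta>1^2 * q^2) / (4 * q * (q - 1) * t))
        = \<theta>0^2 * (q - 1) / (2 * q * t^2) - \<theta>1^2 * q / (2 * (q - 1) * t^2)"
    proof -
      have "2 / t * (\<theta>0^2 * (q - 1)^2 / (4 * q * (q - 1) * t)) = \<theta>0^2 * (q - 1) / (2 * q * t^2)"
        "2 / t * (\<theta>1^2 * q^2 / (4 * q * (q - 1) * t)) = \<theta>1^2 * q / (2 * (q - 1) * t^2)"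
        using nz q1 by (simp_all add: divide_simps power2_eq_square)
      then show ?thesis unfolding diff_divide_distrib right_diff_distrib by metis
    qed
    moreover have "2 / t * (1/4 * (q - 1) * q * (2 * q * t - t + 2 * \<theta>i - 2)) = (q - 1) * q * (2 * q * t - t + 2 * \<theta>i - 2) / (2 * t)"
    proof -
      have "2 / t * (1/4 * x) = x / (2 * t)" for x by simp
      from this[of "(q - 1) * q * (2 * q * t - t + 2 * \<theta>i - 2)"] show ?thesis by (simp only: mult.assoc)
    qed
    moreover have "2 / t * (q' / 2) = q' / t" by simp
    ultimately show ?thesis
      unfolding rhs_p_def right_diff_distrib[of "2 / t"] distrib_left[of "2 / t"] by simp
  qed
  moreover have "?l = ?r \<longleftrightarrow> q'' = 2 / t * (?r - q' / 2)"
  proof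
    assume "?l = ?r"
    from this[symmetric] show "q'' = 2 / t * (?r - q' / 2)" using nz by (simp only:) simp
  next
    assume *: "q'' = 2 / t * (?r - q' / 2)"
    show "?l = ?r" unfolding * using nz by (simp add: diff_divide_distrib right_diff_distrib)
  qed
  ultimately show ?thesis by simp
qed

lemma painleve_system_iff_second_order:
  assumes T: "open T" "0 \<notin> T" and hol: "p holomorphic_on T" "q holomorphic_on T"
    and nz: "\<forall>t\<in>T. q t \<noteq> 0 \<and> q t \<noteq> 1"
  shows "painleve_system \<theta>0 \<theta>1 \<theta>i T p q \<longleftrightarrow>
    (\<forall>t\<in>T. p t = t * deriv q t / 2) \<and> painleve_second_order \<theta>0 \<theta>1 \<theta>i T q"
proof -
  have 1: "deriv q t = rhs_q (p t) (q t) t \<longleftrightarrow> p t = t * deriv q t / 2" if "t \<in> T" for t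
    using T that by (auto simp: rhs_q_def field_simps)
  have 2: "deriv p t = rhs_p \<theta>0 \<theta>1 \<theta>i (p t) (q t) t \<longleftrightarrow>
      deriv (deriv q) t =
        (2 * q t - 1) * (deriv q t)^2 / (2 * (q t - 1) * q t) - deriv q t / t
        + (q t - 1) * q t * (2 * q t * t - t + 2 * \<theta>i - 2) / (2 * t)
        + \<theta>0^2 * (q t - 1) / (2 * q t * t^2) - \<theta>1^2 * q t / (2 * (q t - 1) * t^2)"
    if t: "t \<in> T" and p: "\<forall>t\<in>T. p t = t * deriv q t / 2" for t
  proof -
    have "deriv q holomorphic_on T" using hol(2) T(1) by (rule holomorphic_deriv)
    then have d: "(deriv q has_field_derivative deriv (deriv q) t) (at t)"
      using T(1) t by (rule holomorphic_derivI)
    have "((\<lambda>t. t * deriv q t / 2) has_field_derivative deriv q t / 2 + t * deriv (deriv q) t / 2) (at t)"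
      by (rule derivative_eq_intros d refl | simp)+
    then have "(p has_field_derivative deriv q t / 2 + t * deriv (deriv q) t / 2) (at t)"
      by (rule has_field_derivative_transform_within_open[OF _ T(1) t]) (simp add: p)
    then have "deriv p t = deriv q t / 2 + t * deriv (deriv q) t / 2" by (rule DERIV_imp_deriv)
    moreover have "p t = t * deriv q t / 2" "t \<noteq> 0" "q t \<noteq> 0" "q t \<noteq> 1" using p t T nz by auto
    ultimately show ?thesis using painleve_second_order_at by metis
  qed
  show ?thesis
    unfolding painleve_system_def painleve_second_order_def using 1 2 by (simp cong: conj_cong) blast
qed

section \<open>Constant analytic data imply the system\<close>

lemma difference_quotient_bound:
  fixes f :: "complex \<Rightarrow> complex"
  assumes hol: "f holomorphic_on ball t r" and "0 < r" and bd: "\<And>x. x \<in> ball t r \<Longrightarrow> cmod (f x) \<le> M"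
    and h: "h \<noteq> 0" "cmod h < r / 2"
  shows "cmod ((f (t + h) - f t) / h - deriv f t) \<le> 32 * M / r^2 * cmod h"
proof -
  have "cmod ((deriv ^^ 2) f x) \<le> 32 * M / r^2" if x: "x \<in> ball t (r / 2)" for x
  proof -
    have sub: "cball x (r/4) \<subseteq> ball t r"
    proof
      fix y assume "y \<in> cball x (r/4)"
      then show "y \<in> ball t r"
        using x dist_triangle[of t y x] \<open>0 < r\<close> by (simp add: dist_commute)
    qed
    \<comment> \<open>Cauchy's estimate on discs of radius \<open>r / 4\<close> around the points of
      the half disc; \<open>2 * M / (r/4)^2 = 32 * M / r^2\<close>.\<close>
    have "cmod ((deriv ^^ 2) f x) \<le> fact 2 * M / (r/4)^2"
    proof (rule Cauchy_inequality)
      show "f holomorphic_on ball x (r/4)"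
        using hol sub by (meson ball_subset_cball holomorphic_on_subset order_trans)
      show "continuous_on (cball x (r/4)) f"
        using hol sub by (meson continuous_on_subset holomorphic_on_imp_continuous_on)
      show "cmod (f y) \<le> M" if "cmod (x - y) = r/4" for y
        using that sub bd by (auto simp: dist_norm)
    qed (use \<open>0 < r\<close> in simp)
    then show ?thesis using \<open>0 < r\<close> by (simp add: power2_eq_square field_simps)
  qed
  then have T: "cmod ((deriv ^^ 0) f (t + h) - (\<Sum>i\<le>1. (deriv ^^ i) f t * (t + h - t) ^ i / fact i))
      \<le> 32 * M / r^2 * cmod (t + h - t) ^ Suc 1 / fact 1"
  proof (intro complex_Taylor[where S = "ball t (r/2)" and f = "\<lambda>i. (deriv ^^ i) f"])
    fix i x assume "x \<in> ball t (r/2)"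
    then have "x \<in> ball t r" using \<open>0 < r\<close> by auto
    moreover have "(deriv ^^ i) f holomorphic_on ball t r" using hol by (rule holomorphic_higher_deriv) simp
    ultimately show "((deriv ^^ i) f has_field_derivative (deriv ^^ Suc i) f x) (at x within ball t (r/2))"
      by (simp add: has_field_derivative_at_within holomorphic_derivI[of _ "ball t r"])
  qed (use h \<open>0 < r\<close> in \<open>auto simp: dist_norm numeral_2_eq_2\<close>)
  have "(f (t + h) - f t) / h - deriv f t = (f (t + h) - (f t + deriv f t * h)) / h"
    using h by (simp add: field_simps)
  then have "cmod ((f (t + h) - f t) / h - deriv f t) = cmod (f (t + h) - (f t + deriv f t * h)) / cmod h"
    by (simp add: norm_divide)
  also have "\<dots> \<le> 32 * M / r^2 * cmod h ^ 2 / cmod h"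
    using T h by (intro divide_right_mono) (simp_all add: numeral_2_eq_2)
  also have "\<dots> = 32 * M / r^2 * cmod h" using h by (simp add: power2_eq_square)
  finally show ?thesis .
qed

text \<open>Interchanges \<open>\<partial>/\<partial>z\<close> and \<open>\<partial>/\<partial>t\<close>: difference quotients in \<open>t\<close> converge locally uniformly in \<open>z\<close>,
  which needs only continuity of \<open>F\<close> on the product.\<close>

lemma parameter_deriv_has_derivative:
  fixes F :: "complex \<Rightarrow> complex \<Rightarrow> complex"
  assumes "open U" "open D" "t \<in> D"
    and cont: "continuous_on (U \<times> D) (\<lambda>(z, s). F z s)"
    and holt: "\<And>z. z \<in> U \<Longrightarrow> F z holomorphic_on D"
    and holz: "\<And>z s. z \<in> U \<Longrightarrow> s \<in> D \<Longrightarrow> ((\<lambda>x. F x s) has_field_derivative F' z s) (at z)"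
  shows "(\<lambda>z. deriv (F z) t) holomorphic_on U"
    and "\<And>z D'. z \<in> U \<Longrightarrow> (F' z has_field_derivative D') (at t) \<Longrightarrow> ((\<lambda>z. deriv (F z) t) has_field_derivative D') (at z)"
proof -
  obtain r where r: "0 < r" "cball t r \<subseteq> D" using \<open>open D\<close> \<open>t \<in> D\<close> open_contains_cball by blast
  define h where "h n = complex_of_real (r / (4 * real (Suc n)))" for n
  have h: "h n \<noteq> 0" "cmod (h n) < r / 2" for n
  proof -
    show "h n \<noteq> 0" using r by (simp add: h_def del: of_nat_Suc)
    have "cmod (h n) = r / (4 * real (Suc n))" unfolding h_def norm_of_real using r by (simp del: of_nat_Suc)
    also have "\<dots> \<le> r / 4" using r by (intro divide_left_mono) auto
    also have "\<dots> < r / 2" using r by simp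
    finally show "cmod (h n) < r / 2" .
  qed
  have h0: "h \<longlonglongrightarrow> 0"
  proof -
    have "(\<lambda>n. r / 4 * inverse (real (Suc n))) \<longlonglongrightarrow> r / 4 * 0"
      by (intro tendsto_intros LIMSEQ_inverse_real_of_nat)
    then have "(\<lambda>n. complex_of_real (r / 4 * inverse (real (Suc n)))) \<longlonglongrightarrow> of_real (r / 4 * 0)"
      by (rule tendsto_of_real)
    moreover have "h = (\<lambda>n. complex_of_real (r / 4 * inverse (real (Suc n))))"
      unfolding h_def divide_inverse inverse_mult_distrib mult.assoc by (rule refl)
    ultimately show ?thesis by simp
  qed
  have hD: "t + h n \<in> D" for n
    using r(2) h(2)[of n] r(1) by (auto simp: dist_norm)
  have "\<exists>g'. \<forall>z\<in>U. ((\<lambda>z. deriv (F z) t) has_field_derivative g' z) (at z) \<and>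
      (\<lambda>n. (F' z (t + h n) - F' z t) / h n) \<longlonglongrightarrow> g' z"
  proof (rule has_complex_derivative_uniform_sequence[OF \<open>open U\<close>, where f = "\<lambda>n z. (F z (t + h n) - F z t) / h n"])
    show "((\<lambda>z. (F z (t + h n) - F z t) / h n) has_field_derivative (F' z (t + h n) - F' z t) / h n) (at z)"
      if "z \<in> U" for n z
      by (intro DERIV_cdivide DERIV_diff holz that hD \<open>t \<in> D\<close>)
    fix z assume "z \<in> U"
    then obtain d where d: "0 < d" "cball z d \<subseteq> U" using \<open>open U\<close> open_contains_cball by blast
    have "compact (cball z d \<times> cball t r)" by (intro compact_Times) auto
    moreover have "continuous_on (cball z d \<times> cball t r) (\<lambda>(z, s). F z s)"
      by (rule continuous_on_subset[OF cont]) (use d r in auto)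
    ultimately have "bounded ((\<lambda>(z, s). F z s) ` (cball z d \<times> cball t r))"
      using compact_continuous_image compact_imp_bounded by blast
    then obtain M where M: "\<And>x s. x \<in> cball z d \<Longrightarrow> s \<in> cball t r \<Longrightarrow> cmod (F x s) \<le> M"
      unfolding bounded_iff by force
    have "uniform_limit (cball z d) (\<lambda>n x. (F x (t + h n) - F x t) / h n) (\<lambda>x. deriv (F x) t) sequentially"
    proof (rule uniform_limitI)
      fix e :: real assume "e > 0"
      have "(\<lambda>n. 32 * M / r^2 * cmod (h n)) \<longlonglongrightarrow> 32 * M / r^2 * 0"
        using tendsto_norm[OF h0] by (intro tendsto_intros) simp
      then have "\<forall>\<^sub>F n in sequentially. 32 * M / r^2 * cmod (h n) < e"
        using \<open>e > 0\<close> by (intro order_tendstoD(2)) auto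
      then show "\<forall>\<^sub>F n in sequentially. \<forall>x\<in>cball z d. dist ((F x (t + h n) - F x t) / h n) (deriv (F x) t) < e"
      proof (rule eventually_mono, intro ballI)
        fix n x assume n: "32 * M / r^2 * cmod (h n) < e" and x: "x \<in> cball z d"
        have "F x holomorphic_on ball t r"
          using holt[of x] x d r by (meson ball_subset_cball holomorphic_on_subset subset_iff)
        then have "cmod ((F x (t + h n) - F x t) / h n - deriv (F x) t) \<le> 32 * M / r^2 * cmod (h n)"
          using r h M[OF x] by (intro difference_quotient_bound) auto
        with n show "dist ((F x (t + h n) - F x t) / h n) (deriv (F x) t) < e" by (simp add: dist_norm)
      qed
    qed
    with d show "\<exists>d>0. cball z d \<subseteq> U \<and>
        uniform_limit (cball z d) (\<lambda>n x. (F x (t + h n) - F x t) / h n) (\<lambda>x. deriv (F x) t) sequentially"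
      by blast
  qed
  then obtain g' where g': "\<And>z. z \<in> U \<Longrightarrow> ((\<lambda>z. deriv (F z) t) has_field_derivative g' z) (at z)"
      "\<And>z. z \<in> U \<Longrightarrow> (\<lambda>n. (F' z (t + h n) - F' z t) / h n) \<longlonglongrightarrow> g' z"
    by blast
  show "(\<lambda>z. deriv (F z) t) holomorphic_on U"
    using g'(1) by (metis field_differentiable_at_within field_differentiable_def holomorphic_on_def)
  fix z D' assume z: "z \<in> U" and D': "(F' z has_field_derivative D') (at t)"
  have "((\<lambda>h. (F' z (t + h) - F' z t) / h) \<longlongrightarrow> D') (at 0)"
    using D' by (simp add: DERIV_def)
  moreover have "filterlim h (at 0) sequentially"
    using h0 h(1) by (simp add: filterlim_at)
  ultimately have "(\<lambda>n. (F' z (t + h n) - F' z t) / h n) \<longlonglongrightarrow> D'"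
    by (rule filterlim_compose)
  then have "g' z = D'" using g'(2)[OF z] LIMSEQ_unique by blast
  then show "((\<lambda>z. deriv (F z) t) has_field_derivative D') (at z)" using g'(1)[OF z] by simp
qed

section \<open>Logarithmic t-derivatives of fundamental matrices\<close>

definition inv2 :: "mat2 \<Rightarrow> mat2" where
  "inv2 M = mat22 (M $ 2 $ 2 / det M) (- M $ 1 $ 2 / det M) (- M $ 2 $ 1 / det M) (M $ 1 $ 1 / det M)"

lemma inv2_mult:
  assumes "det M \<noteq> 0"
  shows "inv2 M ** M = mat 1" "M ** inv2 M = mat 1"
  using assms unfolding mat2_eq_iff
  by (auto simp: inv2_def mat2_mult_nth det_2 mat_def divide_simps)

lemma matrix_cancel_right:
  fixes X X' M :: mat2
  assumes "X ** M = X' ** M" "det M \<noteq> 0"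
  shows "X = X'"
  by (metis assms inv2_mult(2) matrix_mul_assoc matrix_mul_rid)

lemma matrix_inv_mult_eq_iff:
  fixes M N K :: mat2
  assumes "det M \<noteq> 0" "matrix_inv M ** N = K"
  shows "N = M ** K"
proof -
  have "invertible M" using assms(1) by (simp add: invertible_det_nz)
  then have "M ** matrix_inv M = mat 1"
    unfolding matrix_inv_def invertible_def by (rule someI2_ex) simp
  then show ?thesis
    unfolding assms(2)[symmetric] matrix_mul_assoc by simp
qed

lemma mderiv_mult:
  assumes "\<And>i j. (\<lambda>x. P x $ i $ j) field_differentiable at x" "\<And>i j. (\<lambda>x. Q x $ i $ j) field_differentiable at x"
  shows "mderiv (\<lambda>x. P x ** Q x) x = mderiv P x ** Q x + P x ** mderiv Q x"
proof -
  have "deriv (\<lambda>x. P x $ i $ k * Q x $ k $ j + P x $ i $ l * Q x $ l $ j) x =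
     (deriv (\<lambda>x. P x $ i $ k) x * Q x $ k $ j + P x $ i $ k * deriv (\<lambda>x. Q x $ k $ j) x) +
     (deriv (\<lambda>x. P x $ i $ l) x * Q x $ l $ j + P x $ i $ l * deriv (\<lambda>x. Q x $ l $ j) x)" for i j k l
    by (intro DERIV_imp_deriv DERIV_add)
      (use DERIV_mult[OF assms(1)[THEN field_differentiable_derivI] assms(2)[THEN field_differentiable_derivI]]
        in \<open>simp add: algebra_simps\<close>)+
  then show ?thesis
    by (simp add: vec_eq_iff mat2_mult_nth)
qed

lemma mderiv_const: "mderiv (\<lambda>x. K) x = 0"
  by (simp add: vec_eq_iff)

lemma mderiv_cong_open:
  assumes "open D" "t \<in> D" "\<And>s. s \<in> D \<Longrightarrow> P s = Q s"
  shows "mderiv P t = mderiv Q t"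
proof -
  have "\<forall>\<^sub>F s in nhds t. P s = Q s"
    using assms eventually_nhds_in_open[of D t] by (auto elim!: eventually_mono)
  then have "\<forall>\<^sub>F s in nhds t. P s $ i $ j = Q s $ i $ j" for i j
    by (auto elim!: eventually_mono)
  then show ?thesis
    by (simp add: vec_eq_iff deriv_cong_ev)
qed

text \<open>The coefficient \<open>L\<close> in \<open>dX/dt + L X = 0\<close>. Applied to a family
  of fundamental matrices it is the candidate for \<open>B\<close>.\<close>

definition tlog :: "(complex \<Rightarrow> mat2) \<Rightarrow> complex \<Rightarrow> mat2" where
  "tlog X t = - (mderiv X t ** inv2 (X t))"

lemma tlog_mult:
  assumes "det (X t) \<noteq> 0"
  shows "tlog X t ** X t = - mderiv X t"
proof -
  have "mderiv X t ** inv2 (X t) ** X t = mderiv X t"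
    using inv2_mult(1)[OF assms] by (simp add: matrix_mul_assoc[symmetric])
  moreover have "(- P) ** Q = - (P ** Q)" for P Q :: mat2
    by (simp add: mat2_eq_iff mat2_mult_nth)
  ultimately show ?thesis by (simp add: tlog_def)
qed

lemma tlog_unique:
  assumes "det (X t) \<noteq> 0" "L ** X t = - mderiv X t"
  shows "L = tlog X t"
  by (rule matrix_cancel_right[OF _ assms(1)]) (simp add: tlog_mult[of X t, OF assms(1)] assms(2))

text \<open>A right factor that does not depend on \<open>t\<close> cancels from
  \<open>X_t X^-1\<close>. It may well depend on \<open>z\<close>, so this covers both the links
  between two regions and the multivalued factor at a singular point.\<close>

lemma tlog_mult_const:
  assumes D: "open D" "t \<in> D" and eq: "\<And>s. s \<in> D \<Longrightarrow> Y s = X s ** K"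
    and dif: "\<And>i j. (\<lambda>s. X s $ i $ j) field_differentiable at t" and det: "det (Y t) \<noteq> 0"
  shows "tlog Y t = tlog X t"
proof -
  have "mderiv Y t = mderiv (\<lambda>s. X s ** K) t" by (rule mderiv_cong_open[OF D eq])
  also have "\<dots> = mderiv X t ** K"
    using mderiv_mult[of X t "\<lambda>_. K"] dif by (simp add: mderiv_const)
  finally have m: "mderiv Y t = mderiv X t ** K" .
  have d: "det (X t) \<noteq> 0" using det eq[OF D(2)] by (auto simp: det_mul)
  have "tlog X t ** Y t = - mderiv Y t"
  proof -
    have "tlog X t ** Y t = (tlog X t ** X t) ** K" by (simp add: eq[OF D(2)] matrix_mul_assoc)
    also have "\<dots> = - mderiv Y t"
      unfolding tlog_mult[of X t, OF d] m by (simp add: mat2_eq_iff mat2_mult_nth)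
    finally show ?thesis .
  qed
  then show ?thesis using tlog_unique[of Y t, OF det] by simp
qed

lemma tlog_holomorphic:
  assumes "open U" "open D" "t \<in> D" and F: "holomorphic2_on F U D" and det: "\<And>z. z \<in> U \<Longrightarrow> det (F z t) \<noteq> 0"
  shows "(\<lambda>z. tlog (F z) t $ i $ j) holomorphic_on U"
proof -
  have 1: "(\<lambda>z. F z t $ i $ j) holomorphic_on U" for i j
    using F \<open>t \<in> D\<close> by (simp add: holomorphic2_on_def)
  have 2: "(\<lambda>z. deriv (\<lambda>s. F z s $ i $ j) t) holomorphic_on U" for i j
  proof (rule parameter_deriv_has_derivative(1)[OF assms(1-3)])
    have "continuous_on (U \<times> D) (\<lambda>x. (case x of (z, s) \<Rightarrow> F z s) $ i $ j)"
      using F by (intro continuous_intros) (auto simp: holomorphic2_on_def)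
    then show "continuous_on (U \<times> D) (\<lambda>(z, s). F z s $ i $ j)" by (simp add: case_prod_unfold)
    show "(\<lambda>s. F z s $ i $ j) holomorphic_on D" if "z \<in> U" for z
      using F that by (simp add: holomorphic2_on_def)
    show "((\<lambda>x. F x s $ i $ j) has_field_derivative deriv (\<lambda>x. F x s $ i $ j) z) (at z)" if "z \<in> U" "s \<in> D" for z s
      using F that \<open>open U\<close> by (intro holomorphic_derivI[of _ U]) (auto simp: holomorphic2_on_def)
  qed
  have 3: "(\<lambda>z. inv2 (F z t) $ i $ j) holomorphic_on U" for i j
  proof -
    have "(\<lambda>z. det (F z t)) holomorphic_on U" unfolding det_2 by (intro holomorphic_intros 1)
    then have "\<forall>i j. (\<lambda>z. inv2 (F z t) $ i $ j) holomorphic_on U"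
      unfolding forall_2 inv2_def mat22_nth using det 1 by (intro conjI holomorphic_intros) auto
    then show ?thesis by blast
  qed
  have "(\<lambda>z. - (deriv (\<lambda>s. F z s $ i $ 1) t * inv2 (F z t) $ 1 $ j + deriv (\<lambda>s. F z s $ i $ 2) t * inv2 (F z t) $ 2 $ j)) holomorphic_on U"
    by (intro holomorphic_intros 2 3)
  then show ?thesis by (simp add: tlog_def mat2_mult_nth)
qed

text \<open>Compatibility: with \<open>Y_z = - A Y\<close> and \<open>Y_t = - L Y\<close> the mixed
  derivative of \<open>Y\<close> has two expressions, and \<open>Y\<close> can be cancelled on the
  right.\<close>

lemma tlog_lax:
  fixes Y A :: "complex \<Rightarrow> complex \<Rightarrow> mat2"
  assumes "open U" "open D" "t \<in> D" "z \<in> U" and fund: "fundamental_family A U D Y"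
    and dA: "\<And>i j. (\<lambda>s. A z s $ i $ j) field_differentiable at t"
  shows "mderiv (\<lambda>s. A z s) t - mderiv (\<lambda>z. tlog (Y z) t) z + tlog (Y z) t ** A z t - A z t ** tlog (Y z) t = 0"
proof -
  have F: "holomorphic2_on Y U D" and det: "\<And>z s. z \<in> U \<Longrightarrow> s \<in> D \<Longrightarrow> det (Y z s) \<noteq> 0"
    and ode: "\<And>z s. z \<in> U \<Longrightarrow> s \<in> D \<Longrightarrow> mderiv (\<lambda>x. Y x s) z = - (A z s ** Y z s)"
    using fund by (auto simp: fundamental_family_def)
  have hz: "(\<lambda>z. Y z s $ i $ j) holomorphic_on U" if "s \<in> D" for i j s
    using F that by (simp add: holomorphic2_on_def)
  have ht: "(\<lambda>s. Y z s $ i $ j) holomorphic_on D" if "z \<in> U" for i j z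
    using F that by (simp add: holomorphic2_on_def)
  have dYt: "(\<lambda>s. Y z s $ i $ j) field_differentiable at t" for i j
    by (rule holomorphic_on_imp_differentiable_at[OF ht[OF \<open>z \<in> U\<close>] assms(2,3)])
  have dYz: "(\<lambda>z. Y z t $ i $ j) field_differentiable at z" for i j
    by (rule holomorphic_on_imp_differentiable_at[OF hz[OF \<open>t \<in> D\<close>] assms(1,4)])
  define L where "L z = tlog (Y z) t" for z
  have LY: "L x ** Y x t = - mderiv (Y x) t" if "x \<in> U" for x
    unfolding L_def by (rule tlog_mult[of "Y x" t]) (rule det[OF that \<open>t \<in> D\<close>])
  have dL: "(\<lambda>z. L z $ i $ j) field_differentiable at z" for i j
    unfolding L_def using tlog_holomorphic[OF assms(1-3) F det] assms
    by (auto intro: holomorphic_on_imp_differentiable_at)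
  let ?At = "mderiv (\<lambda>s. A z s) t" and ?Yt = "mderiv (\<lambda>s. Y z s) t"
  have mixed_der: "((\<lambda>z. deriv (\<lambda>s. Y z s $ i $ j) t) has_field_derivative - (?At ** Y z t + A z t ** ?Yt) $ i $ j) (at z)" for i j
    proof (rule parameter_deriv_has_derivative(2)[OF assms(1-3), where F' = "\<lambda>z s. - (A z s ** Y z s) $ i $ j"])
      have "continuous_on (U \<times> D) (\<lambda>x. (case x of (z, s) \<Rightarrow> Y z s) $ i $ j)"
        using F by (intro continuous_intros) (auto simp: holomorphic2_on_def)
      then show "continuous_on (U \<times> D) (\<lambda>(z, s). Y z s $ i $ j)" by (simp add: case_prod_unfold)
      show "((\<lambda>x. Y x s $ i $ j) has_field_derivative - (A z s ** Y z s) $ i $ j) (at z)" if "z \<in> U" "s \<in> D" for z s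
      proof -
        have "((\<lambda>x. Y x s $ i $ j) has_field_derivative mderiv (\<lambda>x. Y x s) z $ i $ j) (at z)"
          unfolding mderiv_nth using hz that \<open>open U\<close> by (intro holomorphic_derivI[of _ U]) auto
        then show ?thesis using ode[OF that] by simp
      qed
      have "((\<lambda>s. (A z s ** Y z s) $ i $ j) has_field_derivative mderiv (\<lambda>s. A z s ** Y z s) t $ i $ j) (at t)"
        unfolding mderiv_nth mat2_mult_nth
        by (intro field_differentiable_derivI field_differentiable_add field_differentiable_mult dA dYt)
      then have "((\<lambda>s. - (A z s ** Y z s) $ i $ j) has_field_derivative - mderiv (\<lambda>s. A z s ** Y z s) t $ i $ j) (at t)"
        by (simp add: DERIV_minus)
      then show "((\<lambda>s. - (A z s ** Y z s) $ i $ j) has_field_derivative - (?At ** Y z t + A z t ** ?Yt) $ i $ j) (at t)"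
        unfolding mderiv_mult[OF dA dYt] by simp
    qed (use ht \<open>z \<in> U\<close> in auto)
  then have mixed: "mderiv (\<lambda>z. mderiv (\<lambda>s. Y z s) t) z = - (?At ** Y z t + A z t ** ?Yt)"
      by (simp add: vec_eq_iff DERIV_imp_deriv)
  have "mderiv (\<lambda>z. L z ** Y z t) z = mderiv (\<lambda>z. - mderiv (\<lambda>s. Y z s) t) z"
    by (rule mderiv_cong_open[OF assms(1,4)]) (simp add: LY)
  also have "\<dots> = - mderiv (\<lambda>z. mderiv (\<lambda>s. Y z s) t) z"
  proof -
    have "(\<lambda>z. deriv (\<lambda>s. Y z s $ i $ j) t) field_differentiable at z" for i j
      using mixed_der unfolding field_differentiable_def by blast
    then show ?thesis by (simp add: vec_eq_iff)
  qed
  also have "\<dots> = ?At ** Y z t + A z t ** ?Yt" by (simp add: mixed)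
  finally have "mderiv L z ** Y z t + L z ** (- (A z t ** Y z t)) = ?At ** Y z t + A z t ** ?Yt"
    unfolding mderiv_mult[OF dL dYz] ode[OF \<open>z \<in> U\<close> \<open>t \<in> D\<close>] .
  moreover have "?Yt = - (L z ** Y z t)"
    by (simp add: LY[OF \<open>z \<in> U\<close>])
  ultimately have e: "mderiv L z ** Y z t + L z ** (- (A z t ** Y z t)) = ?At ** Y z t + A z t ** (- (L z ** Y z t))"
    by simp
  have n: "P ** (- (Q ** R)) = - ((P ** Q) ** R)" for P Q R :: mat2
    by (simp add: mat2_eq_iff mat2_mult_nth algebra_simps)
  have d: "(P - P' + Q - Q') ** R = P ** R - P' ** R + Q ** R - Q' ** R" for P P' Q Q' R :: mat2
    by (simp add: mat2_eq_iff mat2_mult_nth algebra_simps)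
  have "(?At - mderiv L z + L z ** A z t - A z t ** L z) ** Y z t = 0 ** Y z t"
    using e unfolding n d by (simp add: algebra_simps)
  from matrix_cancel_right[OF this det[OF \<open>z \<in> U\<close> \<open>t \<in> D\<close>]] show ?thesis
    unfolding L_def .
qed

lemma mat2_minus_mult: "(- P) ** Q = - (P ** Q)" "P ** (- Q) = - (P ** Q)" for P Q :: mat2
  by (simp_all add: mat2_eq_iff mat2_mult_nth)

lemma exp_diag_inverse: "exp_diag x ** exp_diag (- x) = mat 1" "exp_diag (- x) ** exp_diag x = mat 1"
  by (simp_all add: mat2_eq_iff exp_diag_def mat2_mult_nth mat_def mult_exp_exp)

lemma det_exp_diag [simp]: "det (exp_diag x) = 1"
  by (simp add: exp_diag_def det_2 mult_exp_exp)

lemma norm_mat2_nth_le: "cmod (M $ i $ j) \<le> norm (M :: mat2)"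
  using Finite_Cartesian_Product.norm_nth_le[of "M $ i" j] Finite_Cartesian_Product.norm_nth_le[of M i] by linarith

lemma deriv_bound:
  assumes "f holomorphic_on ball t r" "continuous_on (cball t r) f" "0 < r" "\<And>x. x \<in> cball t r \<Longrightarrow> cmod (f x) \<le> M"
  shows "cmod (deriv f t) \<le> M / r"
  using Cauchy_inequality[OF assms(1,2,3), of M 1] assms(4) by (simp add: dist_norm)

text \<open>Put \<open>Y = Z exp (\<phi>)\<close> with the diagonal exponential on the right; then
  \<open>Y_t Y^-1 = (Z_t + Z \<sigma>) Z^-1\<close> with
  \<open>\<sigma> = diag (z/2, - z/2)\<close>. Here \<open>Z\<close> is bounded by the asymptotics,
  \<open>Z_t\<close> by Cauchy's estimate in \<open>t\<close>, and \<open>Z^-1\<close> because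
  \<open>det Z\<close> tends to \<open>c t * d t\<close>, so that only \<open>\<sigma>\<close>
  grows. The function \<open>k\<close> is the part of the exponent free of \<open>t\<close>.\<close>

lemma tlog_sector_growth:
  fixes Y :: "complex \<Rightarrow> complex \<Rightarrow> mat2" and k c d :: "complex \<Rightarrow> complex"
  assumes D: "open D" "t \<in> D"
    and hol: "\<And>z i j. z \<in> S \<Longrightarrow> (\<lambda>s. Y z s $ i $ j) holomorphic_on D"
    and det: "\<And>z s. z \<in> S \<Longrightarrow> s \<in> D \<Longrightarrow> det (Y z s) \<noteq> 0"
    and unbounded: "\<And>R. \<exists>z\<in>S. R \<le> cmod z"
    and lim: "uniform_limit D (\<lambda>z s. Y z s ** exp_diag (- (s / 2 * z + k z))) (\<lambda>s. mat22 (c s) 0 0 (d s))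
           (inf at_infinity (principal S))"
    and nz: "c t \<noteq> 0" "d t \<noteq> 0"
  shows "\<exists>C R. \<forall>z\<in>S. R \<le> cmod z \<longrightarrow> (\<forall>i j. cmod (tlog (Y z) t $ i $ j) \<le> C * cmod z)"
proof -
  define \<phi> where "\<phi> z s = s / 2 * z + k z" for z s
  define Z where "Z z s = Y z s ** exp_diag (- \<phi> z s)" for z s
  define L where "L s = mat22 (c s) 0 0 (d s)" for s
  have lim: "uniform_limit D Z L (inf at_infinity (principal S))"
    using lim unfolding Z_def L_def \<phi>_def .
  have hexp: "(\<lambda>s. exp_diag (- \<phi> z s) $ i $ j) holomorphic_on D" for z i j
  proof -
    have "\<forall>i j. (\<lambda>s. exp_diag (- \<phi> z s) $ i $ j) holomorphic_on D"
      unfolding forall_2 exp_diag_def mat22_nth \<phi>_def by (intro conjI holomorphic_intros) auto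
    then show ?thesis by blast
  qed
  have hZ: "(\<lambda>s. Z z s $ i $ j) holomorphic_on D" if "z \<in> S" for z i j
    unfolding Z_def mat2_mult_nth by (intro holomorphic_intros hol hexp that)
  obtain r where r: "0 < r" "cball t r \<subseteq> D" using D open_contains_cball by blast
  obtain R0 where R0: "\<And>z s. z \<in> S \<Longrightarrow> R0 \<le> cmod z \<Longrightarrow> s \<in> D \<Longrightarrow> dist (Z z s) (L s) < 1"
    using uniform_limitD[OF lim, of 1] unfolding eventually_inf_principal eventually_at_infinity by auto
  obtain z1 where z1: "z1 \<in> S" "R0 \<le> cmod z1" using unbounded by blast
  have "\<exists>M. \<forall>s\<in>cball t r. cmod (Z z1 s $ i $ j) \<le> M" for i j
  proof -
    have "continuous_on (cball t r) (\<lambda>s. Z z1 s $ i $ j)"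
      using hZ[OF z1(1)] r by (meson continuous_on_subset holomorphic_on_imp_continuous_on)
    then have "bounded ((\<lambda>s. Z z1 s $ i $ j) ` cball t r)"
      by (intro compact_imp_bounded compact_continuous_image) auto
    then show ?thesis unfolding bounded_iff by auto
  qed
  then obtain M0 where M0: "\<And>i j s. s \<in> cball t r \<Longrightarrow> cmod (Z z1 s $ i $ j) \<le> M0 i j" by metis
  \<comment> \<open>No continuity of \<open>c\<close> and \<open>d\<close> in \<open>t\<close> is
    assumed. \<open>Z\<close> is therefore compared, through the limit \<open>L\<close>, with its
    values at one fixed point \<open>z1\<close>, which are continuous in \<open>t\<close>; the two
    distances of at most 1 give the summand 2.\<close>
  define M where "M = Max (range (\<lambda>(i, j). M0 i j)) + 2"
  have M: "cmod (Z z s $ i $ j) \<le> M" if "z \<in> S" "R0 \<le> cmod z" "s \<in> cball t r" for z s i j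
  proof -
    have sD: "s \<in> D" using that r by auto
    have "dist (Z z s) (Z z1 s) < 2"
      using R0[OF that(1,2) sD] R0[OF z1 sD] dist_triangle2[of "Z z s" "Z z1 s" "L s"] by linarith
    then have "cmod ((Z z s - Z z1 s) $ i $ j) < 2"
      using norm_mat2_nth_le[of "Z z s - Z z1 s" i j] by (simp add: dist_norm)
    then have "cmod (Z z s $ i $ j) \<le> cmod (Z z1 s $ i $ j) + 2"
      using norm_triangle_sub[of "Z z s $ i $ j" "Z z1 s $ i $ j"] by simp
    moreover have "M0 i j \<le> Max (range (\<lambda>(i, j). M0 i j))"
      by (rule Max_ge) (auto intro: rev_image_eqI[of "(i, j)"])
    ultimately show ?thesis using M0[OF that(3), of i j] unfolding M_def by linarith
  qed
  have M0': "0 \<le> M" using M[OF z1, of t 1 1] r by (smt (verit) norm_ge_zero centre_in_cball)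
  have "((\<lambda>z. det (Z z t)) \<longlongrightarrow> det (L t)) (inf at_infinity (principal S))"
    unfolding det_2 by (intro tendsto_intros tendsto_uniform_limitI[OF lim D(2)])
  then have "((\<lambda>z. cmod (det (Z z t))) \<longlongrightarrow> cmod (c t * d t)) (inf at_infinity (principal S))"
    by (intro tendsto_norm) (simp add: L_def det_2)
  moreover have "cmod (c t * d t) / 2 < cmod (c t * d t)" using nz by simp
  ultimately have "\<forall>\<^sub>F z in inf at_infinity (principal S). cmod (c t * d t) / 2 < cmod (det (Z z t))"
    by (rule order_tendstoD(1))
  then obtain R1 where R1: "\<And>z. z \<in> S \<Longrightarrow> R1 \<le> cmod z \<Longrightarrow> cmod (c t * d t) / 2 < cmod (det (Z z t))"
    unfolding eventually_inf_principal eventually_at_infinity by auto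
  define m where "m = cmod (c t * d t) / 2"
  have m: "0 < m" using nz by (simp add: m_def)
  define C where "C = 2 * (M / r + M) * (M / m)"
  have "cmod (tlog (Y z) t $ i $ j) \<le> C * cmod z" if z: "z \<in> S" "Max {R0, R1, 1} \<le> cmod z" for z i j
  proof -
    have zR: "R0 \<le> cmod z" "R1 \<le> cmod z" "1 \<le> cmod z" using z by auto
    have Y: "Y z s = Z z s ** exp_diag (\<phi> z s)" for s
      unfolding Z_def matrix_mul_assoc[symmetric] exp_diag_inverse by simp
    have tD: "t \<in> cball t r" using r by simp
    have dZ: "(\<lambda>s. Z z s $ i $ j) field_differentiable at t" for i j
      by (rule holomorphic_on_imp_differentiable_at[OF hZ[OF z(1)] D])
    have dE: "(\<lambda>s. exp_diag (\<phi> z s) $ i $ j) field_differentiable at t" for i j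
    proof -
      have "\<forall>i j. (\<lambda>s. exp_diag (\<phi> z s) $ i $ j) holomorphic_on D"
        unfolding forall_2 exp_diag_def mat22_nth \<phi>_def by (intro conjI holomorphic_intros) auto
      then show ?thesis using holomorphic_on_imp_differentiable_at[OF _ D] by blast
    qed
    define \<sigma> where "\<sigma> = mat22 (z / 2) 0 0 (- z / 2)"
    have mE: "mderiv (\<lambda>s. exp_diag (\<phi> z s)) t = \<sigma> ** exp_diag (\<phi> z t)"
    proof -
      have "((\<lambda>s. exp (s / 2 * z + k z)) has_field_derivative z / 2 * exp (t / 2 * z + k z)) (at t)"
        "((\<lambda>s. exp (- (s / 2 * z + k z))) has_field_derivative - z / 2 * exp (- (t / 2 * z + k z))) (at t)"
        by (auto intro!: derivative_eq_intros)
      then show ?thesis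
        unfolding mat2_eq_iff mderiv_nth exp_diag_def mat2_mult_nth mat22_nth \<sigma>_def \<phi>_def
        by (simp only: DERIV_imp_deriv) simp
    qed
    define W where "W = mderiv (Z z) t + Z z t ** \<sigma>"
    have mY: "mderiv (Y z) t = W ** exp_diag (\<phi> z t)"
    proof -
      have "mderiv (Y z) t = mderiv (\<lambda>s. Z z s ** exp_diag (\<phi> z s)) t"
        by (rule arg_cong[where f = "\<lambda>f. mderiv f t"]) (simp add: Y fun_eq_iff)
      also have "\<dots> = mderiv (Z z) t ** exp_diag (\<phi> z t) + Z z t ** mderiv (\<lambda>s. exp_diag (\<phi> z s)) t"
        by (rule mderiv_mult[OF dZ dE])
      also have "\<dots> = W ** exp_diag (\<phi> z t)"
        unfolding mE W_def matrix_mul_assoc by (simp add: mat2_eq_iff mat2_mult_nth algebra_simps)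
      finally show ?thesis .
    qed
    have detZ: "det (Z z t) \<noteq> 0" using R1[OF z(1) zR(2)] m by (auto simp: m_def)
    have "tlog (Y z) t = - (W ** inv2 (Z z t))"
    proof (rule tlog_unique[of "Y z" t, symmetric])
      show "det (Y z t) \<noteq> 0" using det z D by simp
      have "inv2 (Z z t) ** Y z t = exp_diag (\<phi> z t)"
        unfolding Y matrix_mul_assoc inv2_mult(1)[OF detZ] by simp
      then have "(W ** inv2 (Z z t)) ** Y z t = mderiv (Y z) t"
        unfolding mY matrix_mul_assoc[symmetric] by simp
      then show "- (W ** inv2 (Z z t)) ** Y z t = - mderiv (Y z) t"
        unfolding mat2_minus_mult by simp
    qed
    moreover have Wb: "cmod (W $ i $ j) \<le> (M / r + M) * cmod z" for i j
    proof -
      have "cmod (mderiv (Z z) t $ i $ j) \<le> M / r"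
        unfolding mderiv_nth
      proof (rule deriv_bound)
        show "(\<lambda>s. Z z s $ i $ j) holomorphic_on ball t r"
          using hZ[OF z(1)] r by (meson ball_subset_cball holomorphic_on_subset)
        show "continuous_on (cball t r) (\<lambda>s. Z z s $ i $ j)"
          using hZ[OF z(1)] r by (meson continuous_on_subset holomorphic_on_imp_continuous_on)
      qed (use r M[OF z(1) zR(1)] in auto)
      also have "\<dots> \<le> M / r * cmod z"
        using zR(3) M0' r mult_left_mono[of 1 "cmod z" "M / r"] by simp
      finally have 1: "cmod (mderiv (Z z) t $ i $ j) \<le> M / r * cmod z" .
      have h: "cmod (x * (z / 2) + y * 0) \<le> M * cmod z \<and> cmod (y * 0 + x * (- z / 2)) \<le> M * cmod z"
        if "cmod x \<le> M" for x y
        using mult_mono[OF that, of "cmod z / 2" "cmod z"] M0' by (simp add: norm_mult norm_divide)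
      have "\<forall>i j. cmod ((Z z t ** \<sigma>) $ i $ j) \<le> M * cmod z"
        unfolding forall_2 mat2_mult_nth \<sigma>_def mat22_nth using h M[OF z(1) zR(1) tD] by blast
      then have 2: "cmod ((Z z t ** \<sigma>) $ i $ j) \<le> M * cmod z" by blast
      show ?thesis
        using norm_triangle_ineq[of "mderiv (Z z) t $ i $ j" "(Z z t ** \<sigma>) $ i $ j"] 1 2
        unfolding W_def vector_add_component distrib_right by linarith
    qed
    have Ib: "cmod (inv2 (Z z t) $ i $ j) \<le> M / m" for i j
    proof -
      have "m \<le> cmod (det (Z z t))" using R1[OF z(1) zR(2)] by (simp add: m_def)
      then have "\<forall>i j. cmod (inv2 (Z z t) $ i $ j) \<le> M / m"
        unfolding forall_2 inv2_def mat22_nth norm_divide norm_minus_cancel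
        using M[OF z(1) zR(1) tD] m M0' by (intro conjI frac_le) auto
      then show ?thesis by blast
    qed
    have b: "cmod (W $ i $ k * inv2 (Z z t) $ k $ j) \<le> (M / r + M) * cmod z * (M / m)" for k
      unfolding norm_mult by (intro mult_mono Wb Ib) (use M0' r m in auto)
    have "C * cmod z = (M / r + M) * cmod z * (M / m) + (M / r + M) * cmod z * (M / m)"
      by (simp add: C_def)
    then have "cmod ((W ** inv2 (Z z t)) $ i $ j) \<le> C * cmod z"
      unfolding mat2_mult_nth
      using norm_triangle_ineq[of "W $ i $ 1 * inv2 (Z z t) $ 1 $ j" "W $ i $ 2 * inv2 (Z z t) $ 2 $ j"]
        b[of 1] b[of 2] by linarith
    ultimately show ?thesis by simp
  qed
  then show ?thesis by blast
qed

section \<open>The regions carrying the local solution spaces\<close>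

lemma open_slit_disc: "open (slit_disc s)"
proof -
  have "closed ((\<lambda>z. z - s) -` \<real>\<^sub>\<le>\<^sub>0)"
    by (intro continuous_closed_vimage closed_nonpos_Reals_complex continuous_intros)
  moreover have "slit_disc s = ball s 1 - (\<lambda>z. z - s) -` \<real>\<^sub>\<le>\<^sub>0"
    by (auto simp: slit_disc_def)
  ultimately show ?thesis by (simp add: open_Diff)
qed

lemma open_sector: "open (sector \<delta> R u)"
proof -
  have "sector \<delta> R u = {z. R < cmod z} \<inter> {z. - \<delta> * cmod z < Re (z * inverse (sgn u))}"
    by (auto simp: sector_def divide_inverse)
  moreover have "open {z. R < cmod z}" "open {z. - \<delta> * cmod z < Re (z * inverse (sgn u))}"
    by (intro open_Collect_less continuous_intros)+
  ultimately show ?thesis by (simp only: open_Int)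
qed

lemma sector_cover:
  assumes "R < cmod z" "0 < \<delta>" "1 \<le> R"
  shows "z \<in> sector \<delta> R u \<or> z \<in> sector \<delta> R (- u)"
proof -
  have "0 < \<delta> * cmod z" using assms by (intro mult_pos_pos) linarith+
  moreover have "Re (z / sgn (- u)) = - Re (z / sgn u)"
    by (simp add: sgn_minus)
  ultimately show ?thesis using assms(1) unfolding sector_def by auto
qed

lemma sector_unbounded:
  assumes "u \<noteq> 0" "0 < \<delta>"
  shows "\<exists>z\<in>sector \<delta> R u. K \<le> cmod z"
proof
  define x where "x = max K (max R 1) + 1"
  have x: "x > 0" "K \<le> x" "R < x" by (auto simp: x_def)
  have s: "sgn u \<noteq> 0" "cmod (sgn u) = 1" using assms by (simp_all add: sgn_zero_iff norm_sgn)
  have "of_real x * sgn u / sgn u = of_real x" using s by simp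
  moreover have "- \<delta> * x < x" using assms(2) x(1) by (smt (verit) mult_pos_pos mult_minus_left)
  ultimately show "of_real x * sgn u \<in> sector \<delta> R u"
    unfolding sector_def using s x by (simp add: norm_mult)
  show "K \<le> cmod (of_real x * sgn u)" using s x by (simp add: norm_mult)
qed

lemma open_region:
  assumes "U \<in> ordinary_discs \<union> {slit_disc 0, slit_disc 1} \<union> sector \<delta> R ` us"
  shows "open U"
  using assms open_slit_disc open_sector by (auto simp: ordinary_discs_def)

lemma singular_points_notin_region:
  assumes "U \<in> ordinary_discs \<union> {slit_disc 0, slit_disc 1} \<union> sector \<delta> R ` us" "1 \<le> R"
  shows "0 \<notin> U" "1 \<notin> U"
  using assms by (auto simp: ordinary_discs_def slit_disc_def sector_def)

text \<open>The largest disc around \<open>z\<close> avoiding 0 and 1. It assigns a definite region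
  to each ordinary point, so that the glued \<open>B\<close> can be defined pointwise.\<close>

definition ordinary_disc :: "complex \<Rightarrow> complex set" where
  "ordinary_disc z = ball z (min (cmod z) (cmod (z - 1)))"

lemma ordinary_disc:
  assumes "z \<noteq> 0" "z \<noteq> 1"
  shows "ordinary_disc z \<in> ordinary_discs" "z \<in> ordinary_disc z"
proof -
  have "0 \<notin> ordinary_disc z" "1 \<notin> ordinary_disc z"
    using assms by (auto simp: ordinary_disc_def dist_norm)
  then show "ordinary_disc z \<in> ordinary_discs"
    unfolding ordinary_discs_def ordinary_disc_def by blast
  show "z \<in> ordinary_disc z" using assms by (simp add: ordinary_disc_def)
qed

lemma constant_analytic_data_imp_system:
  fixes \<theta>0 \<theta>1 \<theta>i t :: complex and p q :: "complex \<Rightarrow> complex"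
  assumes der: "(p has_field_derivative p') (at t)" "(q has_field_derivative q') (at t)"
    and nz: "t \<noteq> 0" "q t \<noteq> 0" "q t \<noteq> 1" and "0 < r"
    and data: "constant_analytic_data \<theta>i (connection_matrix \<theta>0 \<theta>1 \<theta>i p q) t (ball t r)"
  shows "q' = rhs_q (p t) (q t) t" "p' = rhs_p \<theta>0 \<theta>1 \<theta>i (p t) (q t) t"
proof -
  define A where "A = connection_matrix \<theta>0 \<theta>1 \<theta>i p q"
  define D where "D = ball t r"
  have D: "open D" "t \<in> D" using \<open>0 < r\<close> by (auto simp: D_def)
  define us where "us = {\<i> / t, - \<i> / t}"
  obtain \<delta> R Y where \<delta>: "0 < \<delta>" "1 \<le> R"
    and fund: "\<And>U. U \<in> ordinary_discs \<union> {slit_disc 0, slit_disc 1} \<union> sector \<delta> R ` us \<Longrightarrow> fundamental_family A U D (Y U)"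
    and reg: "regular_singular_basis 0 D (Y (slit_disc 0))" "regular_singular_basis 1 D (Y (slit_disc 1))"
    and can: "canonical_bases_at_infinity \<theta>i \<delta> R us D Y"
    and link: "\<And>U V z s. U \<in> ordinary_discs \<union> {slit_disc 0, slit_disc 1} \<union> sector \<delta> R ` us \<Longrightarrow>
       V \<in> ordinary_discs \<union> {slit_disc 0, slit_disc 1} \<union> sector \<delta> R ` us \<Longrightarrow> z \<in> U \<inter> V \<Longrightarrow> s \<in> D \<Longrightarrow>
       matrix_inv (Y U z s) ** Y V z s = matrix_inv (Y U z t) ** Y V z t"
    using data unfolding constant_analytic_data_def Let_def A_def[symmetric] D_def[symmetric] us_def[symmetric]
  proof (elim exE conjE, goal_cases)
    case (1 \<delta> R Y)
    show ?case by (rule 1(1)[of \<delta> R Y]) (use 1(2-) in blast)+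
  qed
  define regions where "regions = ordinary_discs \<union> {slit_disc 0, slit_disc 1} \<union> sector \<delta> R ` us"
  note fund = fund[folded regions_def] and link = link[folded regions_def]
    and open_region = open_region[of _ \<delta> R us, folded regions_def]
    and notin = singular_points_notin_region[of _ \<delta> R us, folded regions_def, OF _ \<delta>(2)]
  have fund_det: "det (Y U z s) \<noteq> 0" if "U \<in> regions" "z \<in> U" "s \<in> D" for U z s
    using fund[OF that(1)] that by (simp add: fundamental_family_def)
  have fund_hol: "(\<lambda>s. Y U z s $ i $ j) holomorphic_on D" if "U \<in> regions" "z \<in> U" for U z i j
    using fund[OF that(1)] that by (simp add: fundamental_family_def holomorphic2_on_def)
  have disc: "ordinary_disc z \<in> regions" "z \<in> ordinary_disc z" if "z \<noteq> 0" "z \<noteq> 1" for z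
    using ordinary_disc[OF that] by (auto simp: regions_def)
  define b0 where "b0 z = tlog (Y (ordinary_disc z) z) t" for z
  \<comment> \<open>Two bases over \<open>z\<close> differ by their link on the right, which is
    constant in \<open>t\<close>; so the logarithmic derivative is the same for all regions
    containing \<open>z\<close>.\<close>
  have b0: "tlog (Y U z) t = b0 z" if U: "U \<in> regions" "z \<in> U" for U z
  proof -
    have z: "z \<noteq> 0" "z \<noteq> 1" using notin[OF U(1)] U(2) by auto
    let ?V = "ordinary_disc z"
    have "Y U z s = Y ?V z s ** (matrix_inv (Y ?V z t) ** Y U z t)" if "s \<in> D" for s
      by (rule matrix_inv_mult_eq_iff[OF fund_det[OF disc[OF z] that]])
        (rule link[OF disc(1)[OF z] U(1) _ that], use disc(2)[OF z] U(2) in simp)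
    then show ?thesis unfolding b0_def
      by (rule tlog_mult_const[OF D])
        (use holomorphic_on_imp_differentiable_at[OF fund_hol[OF disc[OF z]] D] fund_det[OF U D(2)] in auto)
  qed
  have b0_hol: "(\<lambda>z. b0 z $ i $ j) holomorphic_on U" if U: "U \<in> regions" for U i j
  proof -
    have "(\<lambda>z. tlog (Y U z) t $ i $ j) holomorphic_on U"
      using fund[OF U] U D by (intro tlog_holomorphic[OF open_region[OF U] D] fund_det) (auto simp: fundamental_family_def)
    then show ?thesis using b0[OF U] by (simp cong: holomorphic_cong)
  qed
  have b0_hol_at: "\<exists>V. open V \<and> z \<in> V \<and> (\<forall>i j. (\<lambda>z. b0 z $ i $ j) holomorphic_on V)" if "z \<noteq> 0" "z \<noteq> 1" for z
    using disc[OF that] open_region b0_hol by blast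
  have b0_lax: "mderiv (\<lambda>s. A z s) t - mderiv b0 z + b0 z ** A z t - A z t ** b0 z = 0" if z: "z \<noteq> 0" "z \<noteq> 1" for z
  proof -
    let ?V = "ordinary_disc z"
    note V = disc[OF z]
    have dA: "(\<lambda>s. A z s $ i $ j) field_differentiable at t" for i j
    proof -
      have "\<forall>i j. (\<lambda>s. A z s $ i $ j) field_differentiable at t"
        unfolding forall_2 A_def using connection_matrix_has_derivative[OF der nz(2,3)]
        unfolding field_differentiable_def by blast
      then show ?thesis by blast
    qed
    have "mderiv (\<lambda>z. tlog (Y ?V z) t) z = mderiv b0 z"
      by (rule mderiv_cong_open[OF open_region[OF V(1)] V(2)]) (rule b0[OF V(1)])
    then show ?thesis
      using tlog_lax[OF open_region[OF V(1)] D V(2) fund[OF V(1)] dA] by (simp add: b0[OF V])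
  qed
  have ext: "\<exists>g. (\<forall>i j. (\<lambda>z. g z $ i $ j) holomorphic_on ball s 1) \<and> (\<forall>z\<in>ball s 1 - {s}. g z = b0 z)"
    if s: "s = 0 \<or> s = 1" for s
  proof -
    let ?U = "slit_disc s"
    have U: "?U \<in> regions" using s by (auto simp: regions_def)
    obtain G W where G: "holomorphic2_on G (ball s 1) D" "\<And>x z. x \<in> D \<Longrightarrow> z \<in> ball s 1 \<Longrightarrow> det (G z x) \<noteq> 0"
      "\<And>x z. x \<in> D \<Longrightarrow> z \<in> ?U \<Longrightarrow> Y ?U z x = G z x ** W z"
      using reg s unfolding regular_singular_basis_def by blast
    define g where "g z = tlog (G z) t" for z
    have g: "(\<lambda>z. g z $ i $ j) holomorphic_on ball s 1" for i j
      unfolding g_def by (rule tlog_holomorphic[OF open_ball D G(1)]) (rule G(2)[OF D(2)])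
    have gb: "g z = b0 z" if z: "z \<in> ?U" for z
    proof -
      have zb: "z \<in> ball s 1" using z by (simp add: slit_disc_def)
      have "tlog (Y ?U z) t = tlog (G z) t"
      proof (rule tlog_mult_const[OF D])
        show "Y ?U z x = G z x ** W z" if "x \<in> D" for x by (rule G(3)[OF that z])
        show "(\<lambda>x. G z x $ i $ j) field_differentiable at t" for i j
          using G(1) zb by (intro holomorphic_on_imp_differentiable_at[OF _ D]) (simp add: holomorphic2_on_def)
        show "det (Y ?U z t) \<noteq> 0" by (rule fund_det[OF U z D(2)])
      qed
      then show ?thesis using b0[OF U z] by (simp add: g_def)
    qed
    \<comment> \<open>The two functions agree on the slit disc, and the punctured disc is connected,
      so they agree across the cut as well.\<close>
    have "g z $ i $ j = b0 z $ i $ j" if z: "z \<in> ball s 1 - {s}" for z i j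
    proof (rule analytic_continuation_open[of ?U "ball s 1 - {s}" "\<lambda>z. g z $ i $ j" "\<lambda>z. b0 z $ i $ j"])
      show "?U \<noteq> {}"
      proof -
        have "s + 1/2 \<in> ?U" by (auto simp: slit_disc_def dist_norm complex_nonpos_Reals_iff)
        then show ?thesis by blast
      qed
      show "connected (ball s 1 - {s})" by (rule connected_punctured_ball) simp
      show "?U \<subseteq> ball s 1 - {s}" by (auto simp: slit_disc_def)
      show "(\<lambda>z. g z $ i $ j) holomorphic_on ball s 1 - {s}" using g holomorphic_on_subset by blast
      show "(\<lambda>z. b0 z $ i $ j) holomorphic_on ball s 1 - {s}"
      proof (subst holomorphic_on_open)
        show "\<forall>z\<in>ball s 1 - {s}. \<exists>f'. ((\<lambda>z. b0 z $ i $ j) has_field_derivative f') (at z)"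
        proof
          fix z assume "z \<in> ball s 1 - {s}"
          then have "z \<noteq> 0" "z \<noteq> 1" using s by auto
          then obtain V where "open V" "z \<in> V" "(\<lambda>z. b0 z $ i $ j) holomorphic_on V" using b0_hol_at by blast
          then show "\<exists>f'. ((\<lambda>z. b0 z $ i $ j) has_field_derivative f') (at z)"
            by (metis holomorphic_derivI)
        qed
      qed auto
    qed (use open_slit_disc gb z in auto)
    then show ?thesis using g by (intro exI[of _ g]) (auto simp: vec_eq_iff)
  qed
  obtain g0 where g0: "\<And>i j. (\<lambda>z. g0 z $ i $ j) holomorphic_on ball 0 1" "\<And>z. z \<in> ball 0 1 - {0} \<Longrightarrow> g0 z = b0 z"
    using ext[of 0] by blast
  obtain g1 where g1: "\<And>i j. (\<lambda>z. g1 z $ i $ j) holomorphic_on ball 1 1" "\<And>z. z \<in> ball 1 1 - {1} \<Longrightarrow> g1 z = b0 z"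
    using ext[of 1] by blast
  define b where "b z = (if z = 0 then g0 0 else if z = 1 then g1 1 else b0 z)" for z
  have b_hol: "(\<lambda>z. b z $ i $ j) holomorphic_on UNIV" for i j
  proof (subst holomorphic_on_open)
    show "\<forall>z\<in>UNIV. \<exists>f'. ((\<lambda>z. b z $ i $ j) has_field_derivative f') (at z)"
    proof
      fix z :: complex
      have "\<exists>V h. open V \<and> z \<in> V \<and> (\<lambda>z. h z $ i $ j) holomorphic_on V \<and> (\<forall>x\<in>V. h x = b x)"
      proof -
        consider "z = 0" | "z = 1" | "z \<noteq> 0" "z \<noteq> 1" by blast
        then show ?thesis
        proof cases
          case 1
          have "g0 x = b x" if "x \<in> ball 0 1" for x using g0(2)[of x] that by (auto simp: b_def)
          then show ?thesis using 1 g0(1) by (intro exI[of _ "ball 0 1"] exI[of _ g0]) auto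
        next
          case 2
          have "g1 x = b x" if "x \<in> ball 1 1" for x using g1(2)[of x] that by (auto simp: b_def)
          then show ?thesis using 2 g1(1) by (intro exI[of _ "ball 1 1"] exI[of _ g1]) auto
        next
          case 3
          have "\<forall>x\<in>ordinary_disc z. b0 x = b x" using notin[OF disc(1)[OF 3]] by (auto simp: b_def)
          then show ?thesis using disc(2)[OF 3] open_region[OF disc(1)[OF 3]] b0_hol[OF disc(1)[OF 3]] by blast
        qed
      qed
      then obtain V h where V: "open V" "z \<in> V" "(\<lambda>z. h z $ i $ j) holomorphic_on V" "\<forall>x\<in>V. h x = b x" by blast
      have "((\<lambda>z. h z $ i $ j) has_field_derivative deriv (\<lambda>z. h z $ i $ j) z) (at z)"
        by (rule holomorphic_derivI[OF V(3,1,2)])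
      then have "((\<lambda>z. b z $ i $ j) has_field_derivative deriv (\<lambda>z. h z $ i $ j) z) (at z)"
        by (rule has_field_derivative_transform_within_open[OF _ V(1,2)]) (use V(4) in simp)
      then show "\<exists>f'. ((\<lambda>z. b z $ i $ j) has_field_derivative f') (at z)" by blast
    qed
  qed auto
  have sec: "\<exists>C R'. \<forall>z\<in>sector \<delta> R u. R' \<le> cmod z \<longrightarrow> (\<forall>i j. cmod (b z $ i $ j) \<le> C * cmod z)" if u: "u \<in> us" for u
  proof -
    let ?S = "sector \<delta> R u"
    have S: "?S \<in> regions" using u by (auto simp: regions_def)
    obtain c d where cd: "\<And>s. s \<in> D \<Longrightarrow> c s \<noteq> 0 \<and> d s \<noteq> 0" and
      lim: "uniform_limit D (\<lambda>z s. Y ?S z s ** exp_diag (- formal_exponent \<theta>i u z s))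
           (\<lambda>s. mat22 (c s) 0 0 (d s)) (inf at_infinity (principal ?S))"
      using can u unfolding canonical_bases_at_infinity_def by blast
    have "\<exists>C R'. \<forall>z\<in>?S. R' \<le> cmod z \<longrightarrow> (\<forall>i j. cmod (tlog (Y ?S z) t $ i $ j) \<le> C * cmod z)"
    proof (rule tlog_sector_growth[OF D fund_hol[OF S] fund_det[OF S] _ lim[unfolded formal_exponent_def]])
      have "u \<noteq> 0" using u nz(1) by (auto simp: us_def)
      then show "\<exists>z\<in>?S. K \<le> cmod z" for K using \<delta>(1) by (rule sector_unbounded)
    qed (use cd D in auto)
    moreover have "tlog (Y ?S z) t = b z" if "z \<in> ?S" for z
      using b0[OF S that] notin[OF S] that by (auto simp: b_def)
    ultimately show ?thesis by metis
  qed
  have us: "\<i> / t \<in> us" "- (\<i> / t) \<in> us" by (simp_all add: us_def)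
  obtain C1 R1 where 1: "\<forall>z\<in>sector \<delta> R (\<i> / t). R1 \<le> cmod z \<longrightarrow> (\<forall>i j. cmod (b z $ i $ j) \<le> C1 * cmod z)"
    using sec[OF us(1)] by blast
  obtain C2 R2 where 2: "\<forall>z\<in>sector \<delta> R (- (\<i> / t)). R2 \<le> cmod z \<longrightarrow> (\<forall>i j. cmod (b z $ i $ j) \<le> C2 * cmod z)"
    using sec[OF us(2)] by blast
  define K where "K = Max {R1, R2, R + 1}"
  have growth: "cmod (b z $ i $ j) \<le> max C1 C2 * cmod z ^ 1" if "K \<le> cmod z" for z i j
  proof -
    have z: "R1 \<le> cmod z" "R2 \<le> cmod z" "R < cmod z" using that by (auto simp: K_def)
    have le: "C1 * cmod z \<le> max C1 C2 * cmod z" "C2 * cmod z \<le> max C1 C2 * cmod z"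
      by (intro mult_right_mono; simp)+
    from sector_cover[OF z(3) \<delta>, of "\<i> / t"] show ?thesis
    proof
      assume "z \<in> sector \<delta> R (\<i> / t)"
      then have "cmod (b z $ i $ j) \<le> C1 * cmod z" using 1 z(1) by blast
      with le show ?thesis by simp
    next
      assume "z \<in> sector \<delta> R (- (\<i> / t))"
      then have "cmod (b z $ i $ j) \<le> C2 * cmod z" using 2 z(2) by blast
      with le show ?thesis by simp
    qed
  qed
  define c0 where "c0 i j = b 0 $ i $ j" for i j
  define c1 where "c1 i j = deriv (\<lambda>z. b z $ i $ j) 0" for i j
  have b_lin: "b z $ i $ j = c0 i j + c1 i j * z" for z i j
    using Liouville_polynomial[OF b_hol[of i j] growth[of _ i j], where \<xi> = z] by (simp add: c0_def c1_def)
  have mb: "mderiv b z $ i $ j = c1 i j" for z i j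
    unfolding mderiv_nth b_lin by (rule deriv_affine)
  have b_lax: "mderiv (\<lambda>s. A z s) t - mderiv b z + b z ** A z t - A z t ** b z = 0" if "z \<notin> {0, 1}" for z
  proof -
    have z: "z \<noteq> 0" "z \<noteq> 1" using that by auto
    have "mderiv b z = mderiv b0 z"
      by (rule mderiv_cong_open[OF open_region[OF disc(1)[OF z]] disc(2)[OF z]])
        (use notin[OF disc(1)[OF z]] in \<open>auto simp: b_def\<close>)
    then show ?thesis using b0_lax[OF z] z by (simp add: b_def)
  qed
  have A22: "A z s $ 2 $ 2 = - A z s $ 1 $ 1" for z s unfolding A_def by (rule connection_matrix_nth)
  have dA22: "mderiv (\<lambda>s. A z s) t $ 2 $ 2 = - mderiv (\<lambda>s. A z s) t $ 1 $ 1" for z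
    unfolding A_def by (rule connection_matrix_mderiv[OF der nz(2,3)])
  \<comment> \<open>Taking the trace removes the commutator, and the connection is trace-free, so
    the trace of \<open>b\<close> is constant in \<open>z\<close>. The number 2 is a sample point
    away from 0 and 1.\<close>
  have tr1: "c1 2 2 = - c1 1 1"
  proof -
    have z: "(2 :: complex) \<notin> {0, 1}" by simp
    have "(mderiv (\<lambda>s. A 2 s) t - mderiv b 2 + b 2 ** A 2 t - A 2 t ** b 2) $ 1 $ 1
        + (mderiv (\<lambda>s. A 2 s) t - mderiv b 2 + b 2 ** A 2 t - A 2 t ** b 2) $ 2 $ 2 = 0"
      unfolding b_lax[OF z] by simp
    then show ?thesis
      by (simp add: mat2_mult_nth mb dA22 del: mderiv_nth)
  qed
  \<comment> \<open>Rescaling all bases by one function of \<open>t\<close> keeps the links constant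
    but adds a scalar matrix to \<open>b\<close>. Such a matrix commutes with everything; it is
    split off here as \<open>\<tau>\<close>.\<close>
  define e0 where "e0 = (c0 1 1 - c0 2 2) / 2"
  define B where "B z = mat22 (e0 + c1 1 1 * z) (c0 1 2 + c1 1 2 * z) (c0 2 1 + c1 2 1 * z) (- (e0 + c1 1 1 * z))" for z
  define \<tau> where "\<tau> = (c0 1 1 + c0 2 2) / 2"
  have bB: "b z = B z + mat22 \<tau> 0 0 \<tau>" for z
    unfolding mat2_eq_iff
    by (simp add: b_lin B_def e0_def \<tau>_def tr1 field_simps)
  have lax: "mderiv (\<lambda>s. connection_matrix \<theta>0 \<theta>1 \<theta>i p q z s) t - mderiv B z + B z ** connection_matrix \<theta>0 \<theta>1 \<theta>i p q z t
      - connection_matrix \<theta>0 \<theta>1 \<theta>i p q z t ** B z = 0" if "z \<notin> {0, 1}" for z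
  proof -
    have "mderiv B z = mderiv b z"
      unfolding mat2_eq_iff mb unfolding mderiv_nth B_def mat22_nth deriv_affine tr1 by simp
    moreover have "b z ** A z t - A z t ** b z = B z ** A z t - A z t ** B z"
      unfolding bB mat2_eq_iff by (simp add: mat2_mult_nth algebra_simps)
    ultimately show ?thesis
      using b_lax[OF that] unfolding A_def by (simp add: add_diff_eq[symmetric])
  qed
  note L = linear_lax_imp_system[OF der nz, of "{0, 1}" \<theta>0 \<theta>1 \<theta>i, OF _ lax[unfolded B_def]]
  show "q' = rhs_q (p t) (q t) t" "p' = rhs_p \<theta>0 \<theta>1 \<theta>i (p t) (q t) t"
    by (rule L; simp)+
qed

section \<open>The flow of the commuting operator\<close>

text \<open>The setting for \<open>X' = \<zeta> N X\<close>, \<open>X a = 1\<close> with a complex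
  parameter \<open>\<zeta>\<close>. Picard iteration makes \<open>iterate n\<close> the coefficient
  of \<open>\<zeta> ^ n\<close>; the star shape of the domain provides primitives and the segments
  along which to estimate them.\<close>

locale linear_ode =
  fixes U :: "complex set" and a :: complex and N :: "complex \<Rightarrow> mat2"
  assumes open_domain: "open U" and base: "a \<in> U"
    and star: "\<And>x. x \<in> U \<Longrightarrow> closed_segment a x \<subseteq> U"
    and coeff_holomorphic: "\<And>i j. (\<lambda>t. N t $ i $ j) holomorphic_on U"
begin

definition primitive :: "(complex \<Rightarrow> complex) \<Rightarrow> complex \<Rightarrow> complex" where
  "primitive f = (SOME g. g a = 0 \<and> (\<forall>t\<in>U. (g has_field_derivative f t) (at t)))"

lemma primitive:
  assumes "f holomorphic_on U"
  shows "primitive f a = 0" "t \<in> U \<Longrightarrow> (primitive f has_field_derivative f t) (at t)"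
proof -
  have "starlike U" using base star by (auto simp: starlike_def)
  then have "\<exists>g. \<forall>x\<in>U. (g has_field_derivative f x) (at x)"
    using assms open_domain by (intro holomorphic_starlike_primitive[where k = "{}"])
      (auto simp: holomorphic_on_imp_continuous_on intro: holomorphic_on_imp_differentiable_at)
  then obtain g where g: "\<And>x. x \<in> U \<Longrightarrow> (g has_field_derivative f x) (at x)" by blast
  have "(\<lambda>x. g x - g a) a = 0 \<and> (\<forall>x\<in>U. ((\<lambda>x. g x - g a) has_field_derivative f x) (at x))"
    using g by (auto intro!: derivative_eq_intros)
  then have "\<exists>h. h a = 0 \<and> (\<forall>x\<in>U. (h has_field_derivative f x) (at x))"
    by (rule exI[of _ "\<lambda>x. g x - g a"])
  then have "primitive f a = 0 \<and> (\<forall>x\<in>U. (primitive f has_field_derivative f x) (at x))"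
    unfolding primitive_def by (rule someI_ex)
  then show "primitive f a = 0" "t \<in> U \<Longrightarrow> (primitive f has_field_derivative f t) (at t)" by blast+
qed

primrec iterate :: "nat \<Rightarrow> complex \<Rightarrow> mat2" where
  "iterate 0 = (\<lambda>t. mat 1)"
| "iterate (Suc n) = (\<lambda>t. \<chi> i j. primitive (\<lambda>t. (N t ** iterate n t) $ i $ j) t)"

lemma iterate_holomorphic: "(\<lambda>t. iterate n t $ i $ j) holomorphic_on U"
proof (induction n arbitrary: i j)
  case (Suc n)
  have "(\<lambda>t. (N t ** iterate n t) $ i $ j) holomorphic_on U"
    unfolding mat2_mult_nth by (intro holomorphic_intros coeff_holomorphic Suc)
  from primitive(2)[OF this] show ?case
    by (simp add: holomorphic_on_open[OF open_domain]) blast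
qed simp

lemma rhs_holomorphic: "(\<lambda>t. (N t ** iterate n t) $ i $ j) holomorphic_on U"
  unfolding mat2_mult_nth by (intro holomorphic_intros coeff_holomorphic iterate_holomorphic)

lemma iterate_Suc_base: "iterate (Suc n) a $ i $ j = 0"
  using primitive(1)[OF rhs_holomorphic[of n i j]] by simp

lemma iterate_Suc_derivative:
  "t \<in> U \<Longrightarrow> ((\<lambda>t. iterate (Suc n) t $ i $ j) has_field_derivative (N t ** iterate n t) $ i $ j) (at t)"
  using primitive(2)[OF rhs_holomorphic[of n i j]] by simp

text \<open>Integration along the segment from \<open>a\<close>: each step contributes a factor
  \<open>2 * M\<close>, with one 2 for the two summands in an entry of a product, and integrating
  the powers of the parameter produces the factorial. \<open>K\<close> can be any subset star-shaped
  about \<open>a\<close> on which \<open>N\<close> is bounded.\<close>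

lemma iterate_bound:
  assumes K: "K \<subseteq> U" "\<And>x. x \<in> K \<Longrightarrow> closed_segment a x \<subseteq> K"
    and M: "\<And>x i j. x \<in> K \<Longrightarrow> cmod (N x $ i $ j) \<le> M"
    and t: "t \<in> K"
  shows "cmod (iterate n t $ i $ j) \<le> (2 * M * cmod (t - a)) ^ n / fact n"
  using t
proof (induction n arbitrary: t i j)
  case 0
  have "\<forall>i j. cmod ((mat 1 :: mat2) $ i $ j) \<le> 1" unfolding forall_2 by (simp add: mat_def)
  then show ?case by simp
next
  case (Suc n)
  have M0: "0 \<le> M" using M[OF Suc.prems, of 1 1] norm_ge_zero order_trans by blast
  define h where "h = t - a"
  define \<gamma> where "\<gamma> s = a + of_real s * h" for s
  have \<gamma>K: "\<gamma> s \<in> K" if "0 \<le> s" "s \<le> 1" for s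
  proof -
    have "\<gamma> s \<in> closed_segment a t"
      unfolding in_segment using that by (intro exI[of _ s]) (simp add: \<gamma>_def h_def scaleR_conv_of_real algebra_simps)
    then show ?thesis using K(2)[OF Suc.prems] by blast
  qed
  define f where "f s = iterate (Suc n) (\<gamma> s) $ i $ j" for s
  \<comment> \<open>A comparison function whose derivative bounds that of \<open>f\<close>.\<close>
  define \<phi> where "\<phi> s = (2 * M * cmod h) ^ Suc n * s ^ Suc n / fact (Suc n)" for s :: real
  have der: "(f has_vector_derivative (N (\<gamma> s) ** iterate n (\<gamma> s)) $ i $ j * h) (at s)" if "0 \<le> s" "s \<le> 1" for s
  proof -
    have "(\<gamma> has_vector_derivative h) (at s)"
      unfolding \<gamma>_def by (auto intro!: derivative_eq_intros)
    moreover have "((\<lambda>t. iterate (Suc n) t $ i $ j) has_field_derivative (N (\<gamma> s) ** iterate n (\<gamma> s)) $ i $ j) (at (\<gamma> s))"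
      by (rule iterate_Suc_derivative) (use \<gamma>K[OF that] K in auto)
    ultimately have "((\<lambda>t. iterate (Suc n) t $ i $ j) \<circ> \<gamma> has_vector_derivative h * (N (\<gamma> s) ** iterate n (\<gamma> s)) $ i $ j) (at s)"
      by (rule field_vector_diff_chain_at)
    then show ?thesis by (simp add: f_def[abs_def] o_def mult.commute)
  qed
  have "norm (f 1 - f 0) \<le> \<phi> 1 - \<phi> 0"
  proof (rule differentiable_bound_general)
    show "continuous_on {0..1} f"
      by (intro continuous_at_imp_continuous_on ballI has_vector_derivative_continuous[OF der]) auto
    show "continuous_on {0..1} \<phi>" unfolding \<phi>_def by (intro continuous_intros) auto
    fix s :: real assume s: "0 < s" "s < 1"
    show "(f has_vector_derivative (N (\<gamma> s) ** iterate n (\<gamma> s)) $ i $ j * h) (at s)" using der s by simp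
    have "(\<phi> has_real_derivative (2 * M * cmod h) ^ Suc n * (real (Suc n) * s ^ n) / fact (Suc n)) (at s)"
      unfolding \<phi>_def by (rule derivative_eq_intros refl | simp)+
    then show "(\<phi> has_vector_derivative (2 * M * cmod h) ^ Suc n * (real (Suc n) * s ^ n) / fact (Suc n)) (at s)"
      by (simp add: has_real_derivative_iff_has_vector_derivative)
    have sK: "\<gamma> s \<in> K" using \<gamma>K s by simp
    have d: "cmod (\<gamma> s - a) = s * cmod h" using s by (simp add: \<gamma>_def norm_mult)
    have "cmod (N (\<gamma> s) $ i $ k * iterate n (\<gamma> s) $ k $ j) \<le> M * ((2 * M * (s * cmod h)) ^ n / fact n)" for k
      unfolding norm_mult using Suc.IH[OF sK, of k j] M[OF sK, of i k] M0 d by (intro mult_mono) auto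
    from this[of 1] this[of 2]
    have "cmod ((N (\<gamma> s) ** iterate n (\<gamma> s)) $ i $ j) \<le> 2 * M * ((2 * M * (s * cmod h)) ^ n / fact n)"
      unfolding mat2_mult_nth by (intro order_trans[OF norm_triangle_ineq]) simp
    then have "cmod ((N (\<gamma> s) ** iterate n (\<gamma> s)) $ i $ j * h) \<le> 2 * M * ((2 * M * (s * cmod h)) ^ n / fact n) * cmod h"
      unfolding norm_mult by (intro mult_right_mono) auto
    also have "\<dots> = (2 * M * cmod h) ^ Suc n * (real (Suc n) * s ^ n) / fact (Suc n)"
      by (simp add: power_mult_distrib field_simps del: of_nat_Suc)
    finally show "norm ((N (\<gamma> s) ** iterate n (\<gamma> s)) $ i $ j * h) \<le> (2 * M * cmod h) ^ Suc n * (real (Suc n) * s ^ n) / fact (Suc n)" .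
  qed simp
  moreover have "f 0 = 0" unfolding f_def \<gamma>_def using iterate_Suc_base by simp
  moreover have "f 1 = iterate (Suc n) t $ i $ j" by (simp add: f_def \<gamma>_def h_def)
  ultimately show ?case by (simp add: \<phi>_def h_def)
qed

lemma iterate_local_bound:
  assumes "t \<in> U"
  obtains e C where "0 < e" "cball t e \<subseteq> U" "0 \<le> C" "\<And>x n i j. x \<in> cball t e \<Longrightarrow> cmod (iterate n x $ i $ j) \<le> C ^ n / fact n"
proof -
  obtain e where e: "0 < e" "cball t e \<subseteq> U" using open_domain assms open_contains_cball by blast
  \<comment> \<open>All segments from \<open>a\<close> to a closed disc around \<open>t\<close>: a
    compact subset of \<open>U\<close>, again star-shaped about \<open>a\<close>, as
    \<open>iterate_bound\<close> requires.\<close>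
  define K where "K = (\<lambda>(s, x). a + of_real s * (x - a)) ` ({0..1::real} \<times> cball t e)"
  have "compact K" unfolding K_def
    by (intro compact_continuous_image compact_Times) (auto simp: case_prod_unfold intro!: continuous_intros)
  have seg: "a + of_real s * (x - a) \<in> closed_segment a x" if "0 \<le> s" "s \<le> 1" for s x
    unfolding in_segment using that by (intro exI[of _ s]) (simp add: scaleR_conv_of_real algebra_simps)
  have KU: "K \<subseteq> U"
    using seg star e(2) by (fastforce simp: K_def)
  have Kstar: "closed_segment a y \<subseteq> K" if "y \<in> K" for y
  proof
    fix z assume "z \<in> closed_segment a y"
    then obtain u where u: "0 \<le> u" "u \<le> 1" "z = a + of_real u * (y - a)"
      unfolding in_segment by (auto simp: scaleR_conv_of_real algebra_simps)
    have "\<exists>s x. 0 \<le> s \<and> s \<le> 1 \<and> x \<in> cball t e \<and> y = a + of_real s * (x - a)"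
      using that by (auto simp: K_def) blast
    then obtain s x where s: "0 \<le> s" "s \<le> 1" "x \<in> cball t e" "y = a + of_real s * (x - a)" by blast
    have "z = a + of_real (u * s) * (x - a)" using u s by simp
    moreover have "u * s \<in> {0..1}" using u s by (simp add: mult_le_one)
    ultimately show "z \<in> K" using s(3) unfolding K_def by (intro image_eqI[of _ _ "(u * s, x)"]) auto
  qed
  have "\<exists>M. \<forall>x\<in>K. cmod (N x $ i $ j) \<le> M" for i j
  proof -
    have "continuous_on K (\<lambda>x. N x $ i $ j)"
      using coeff_holomorphic KU by (meson continuous_on_subset holomorphic_on_imp_continuous_on)
    then have "bounded ((\<lambda>x. N x $ i $ j) ` K)"
      using \<open>compact K\<close> by (intro compact_imp_bounded compact_continuous_image)
    then show ?thesis unfolding bounded_iff by auto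
  qed
  then obtain M0 where M0: "\<And>i j x. x \<in> K \<Longrightarrow> cmod (N x $ i $ j) \<le> M0 i j" by metis
  define M where "M = Max (range (\<lambda>(i, j). M0 i j))"
  have M: "cmod (N x $ i $ j) \<le> M" if "x \<in> K" for x i j
  proof -
    have "M0 i j \<le> M" unfolding M_def by (rule Max_ge) (auto intro: rev_image_eqI[of "(i, j)"])
    then show ?thesis using M0[OF that, of i j] by linarith
  qed
  have sub: "cball t e \<subseteq> K"
  proof
    fix x assume "x \<in> cball t e"
    then show "x \<in> K" unfolding K_def by (intro image_eqI[of _ _ "(1, x)"]) auto
  qed
  have "0 \<le> M" using M[of t 1 1] sub e norm_ge_zero order_trans by (metis centre_in_cball less_imp_le subsetD)
  show ?thesis
  proof
    show "0 < e" "cball t e \<subseteq> U" by fact+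
    show "0 \<le> 2 * M * (cmod (t - a) + e)" using \<open>0 \<le> M\<close> e by simp
    fix x n i j assume x: "x \<in> cball t e"
    have "cmod (x - a) \<le> cmod (t - a) + e"
      using x norm_triangle_ineq[of "x - t" "t - a"] by (simp add: dist_norm norm_minus_commute)
    then have "(2 * M * cmod (x - a)) ^ n / fact n \<le> (2 * M * (cmod (t - a) + e)) ^ n / fact n"
      using \<open>0 \<le> M\<close> by (intro divide_right_mono power_mono mult_left_mono) auto
    then show "cmod (iterate n x $ i $ j) \<le> (2 * M * (cmod (t - a) + e)) ^ n / fact n"
      using iterate_bound[OF KU Kstar M, of x n i j] x sub by force
  qed
qed

section \<open>The solution as a power series in the parameter\<close>

definition solution :: "complex \<Rightarrow> complex \<Rightarrow> mat2" where
  "solution \<zeta> t = (\<chi> i j. \<Sum>n. \<zeta> ^ n * iterate n t $ i $ j)"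

lemma exp_series_summable: "summable (\<lambda>n. C ^ n / fact n :: real)"
  using summable_exp[of C] by (simp add: divide_inverse mult.commute)

lemma term_bound:
  assumes "cmod \<zeta> \<le> Z" "cmod x \<le> C ^ n / fact n" "0 \<le> C"
  shows "cmod (\<zeta> ^ n * x) \<le> (Z * C) ^ n / fact n"
proof -
  have "0 \<le> Z" using assms(1) norm_ge_zero order_trans by blast
  then have "cmod (\<zeta> ^ n * x) \<le> Z ^ n * (C ^ n / fact n)"
    unfolding norm_mult norm_power using assms by (intro mult_mono power_mono) auto
  then show ?thesis by (simp add: power_mult_distrib)
qed

lemma solution_sums:
  assumes "t \<in> U"
  shows "(\<lambda>n. \<zeta> ^ n * iterate n t $ i $ j) sums solution \<zeta> t $ i $ j"
proof -
  obtain e C where e: "0 < e" "0 \<le> C" "\<And>x n i j. x \<in> cball t e \<Longrightarrow> cmod (iterate n x $ i $ j) \<le> C ^ n / fact n"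
    using iterate_local_bound[OF assms] by metis
  have "summable (\<lambda>n. \<zeta> ^ n * iterate n t $ i $ j)"
    by (rule summable_comparison_test'[OF exp_series_summable[of "cmod \<zeta> * C"]])
      (rule term_bound, use e in auto)
  then show ?thesis by (simp add: solution_def summable_sums)
qed

lemma solution_base: "solution \<zeta> a = mat 1"
proof -
  have "solution \<zeta> a $ i $ j = mat 1 $ i $ j" for i j
  proof -
    have "(\<lambda>n. \<zeta> ^ n * iterate n a $ i $ j) sums (\<Sum>n\<in>{0}. \<zeta> ^ n * iterate n a $ i $ j)"
    proof (rule sums_finite)
      fix n :: nat assume "n \<notin> {0}"
      then obtain m where "n = Suc m" by (cases n) auto
      then show "\<zeta> ^ n * iterate n a $ i $ j = 0"
        using iterate_Suc_base by (simp del: iterate.simps)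
    qed simp
    then show ?thesis using solution_sums[OF base, of \<zeta> i j] sums_unique2 by fastforce
  qed
  then show ?thesis by (simp add: vec_eq_iff)
qed

lemma solution_derivative:
  assumes "t \<in> U"
  shows "((\<lambda>t. solution \<zeta> t $ i $ j) has_field_derivative \<zeta> * (N t ** solution \<zeta> t) $ i $ j) (at t)"
proof -
  \<comment> \<open>The termwise derivative. The term of index 0 is constant, and the shift by one
    index turns the series into \<open>\<zeta> N\<close> times the original one.\<close>
  define f' where "f' n t = (case n of 0 \<Rightarrow> 0 | Suc m \<Rightarrow> \<zeta> ^ n * (N t ** iterate m t) $ i $ j)" for n t
  obtain g g' where g: "\<And>x. x \<in> U \<Longrightarrow> (\<lambda>n. \<zeta> ^ n * iterate n x $ i $ j) sums g x"
      "\<And>x. x \<in> U \<Longrightarrow> (\<lambda>n. f' n x) sums g' x" "\<And>x. x \<in> U \<Longrightarrow> (g has_field_derivative g' x) (at x)"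
  proof -
    have "\<exists>g g'. \<forall>x\<in>U. (\<lambda>n. \<zeta> ^ n * iterate n x $ i $ j) sums g x \<and> (\<lambda>n. f' n x) sums g' x \<and> (g has_field_derivative g' x) (at x)"
    proof (rule series_and_derivative_comparison_local[OF open_domain])
      show "((\<lambda>x. \<zeta> ^ n * iterate n x $ i $ j) has_field_derivative f' n x) (at x)" if "x \<in> U" for n x
        using iterate_Suc_derivative[OF that] by (cases n) (auto simp: f'_def intro!: DERIV_cmult)
      fix x assume "x \<in> U"
      then obtain e C where e: "0 < e" "0 \<le> C" "\<And>y n i j. y \<in> cball x e \<Longrightarrow> cmod (iterate n y $ i $ j) \<le> C ^ n / fact n"
        using iterate_local_bound by metis
      show "\<exists>d h. 0 < d \<and> summable h \<and> (\<forall>\<^sub>F n in sequentially. \<forall>y\<in>ball x d \<inter> U. cmod (\<zeta> ^ n * iterate n y $ i $ j) \<le> h n)"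
        using e by (intro exI[of _ e] exI[of _ "\<lambda>n. (cmod \<zeta> * C) ^ n / fact n"] conjI exp_series_summable
            always_eventually allI ballI term_bound) auto
    qed
    then show ?thesis using that by blast
  qed
  have gs: "g x = solution \<zeta> x $ i $ j" if "x \<in> U" for x
    using g(1)[OF that] solution_sums[OF that] sums_unique2 by blast
  have "(\<lambda>n. N t $ i $ 1 * (\<zeta> ^ n * iterate n t $ 1 $ j) + N t $ i $ 2 * (\<zeta> ^ n * iterate n t $ 2 $ j)) sums (N t ** solution \<zeta> t) $ i $ j"
    unfolding mat2_mult_nth by (intro sums_add sums_mult solution_sums assms)
  from sums_mult[OF this, of \<zeta>] have "(\<lambda>n. f' (Suc n) t) sums (\<zeta> * (N t ** solution \<zeta> t) $ i $ j)"
    by (simp add: f'_def mat2_mult_nth algebra_simps)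
  then have "(\<lambda>n. f' n t) sums (\<zeta> * (N t ** solution \<zeta> t) $ i $ j)"
    by (subst (asm) sums_Suc_iff) (simp add: f'_def)
  then have "g' t = \<zeta> * (N t ** solution \<zeta> t) $ i $ j"
    using g(2)[OF assms] sums_unique2 by blast
  with g(3)[OF assms] have "(g has_field_derivative \<zeta> * (N t ** solution \<zeta> t) $ i $ j) (at t)" by simp
  then show ?thesis
    by (rule has_field_derivative_transform_within_open[OF _ open_domain assms]) (rule gs)
qed

lemma solution_entire:
  assumes "t \<in> U"
  shows "(\<lambda>\<zeta>. solution \<zeta> t $ i $ j) holomorphic_on UNIV"
proof -
  obtain e C where e: "0 < e" "0 \<le> C" "\<And>y n i j. y \<in> cball t e \<Longrightarrow> cmod (iterate n y $ i $ j) \<le> C ^ n / fact n"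
    using iterate_local_bound[OF assms] by metis
  have "\<exists>g g'. \<forall>x\<in>UNIV. (\<lambda>n. x ^ n * iterate n t $ i $ j) sums g x \<and>
      (\<lambda>n. of_nat n * x ^ (n - 1) * iterate n t $ i $ j) sums g' x \<and> (g has_field_derivative g' x) (at x)"
  proof (rule series_and_derivative_comparison_local[OF open_UNIV])
    show "((\<lambda>x. x ^ n * iterate n t $ i $ j) has_field_derivative of_nat n * x ^ (n - 1) * iterate n t $ i $ j) (at x)" for n x
      by (auto intro!: derivative_eq_intros)
    fix x :: complex
    have "cmod y \<le> cmod x + 1" if "y \<in> ball x 1" for y
      using that norm_triangle_ineq[of x "y - x"] by (simp add: dist_norm norm_minus_commute)
    then show "\<exists>d h. 0 < d \<and> summable h \<and> (\<forall>\<^sub>F n in sequentially. \<forall>y\<in>ball x d \<inter> UNIV. cmod (y ^ n * iterate n t $ i $ j) \<le> h n)"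
      using e by (intro exI[of _ 1] exI[of _ "\<lambda>n. ((cmod x + 1) * C) ^ n / fact n"] conjI exp_series_summable
            always_eventually allI ballI term_bound) auto
  qed
  then obtain g g' where g: "\<And>x. (\<lambda>n. x ^ n * iterate n t $ i $ j) sums g x" "\<And>x. (g has_field_derivative g' x) (at x)"
    by blast
  have "g x = solution x t $ i $ j" for x
    using g(1) solution_sums[OF assms] sums_unique2 by blast
  then have "g = (\<lambda>\<zeta>. solution \<zeta> t $ i $ j)" by blast
  moreover have "g holomorphic_on UNIV" using g(2) by (auto simp: holomorphic_on_open)
  ultimately show ?thesis by simp
qed

lemma solution_continuous: "continuous_on (UNIV \<times> U) (\<lambda>(\<zeta>, t). solution \<zeta> t)"
proof -
  have "continuous_on (UNIV \<times> U) (\<lambda>x. solution (fst x) (snd x) $ i $ j)" for i j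
  proof (rule continuous_at_imp_continuous_on, rule ballI)
    fix x :: "complex \<times> complex" assume "x \<in> UNIV \<times> U"
    then have xU: "snd x \<in> U" by auto
    obtain e C where e: "0 < e" "cball (snd x) e \<subseteq> U" "0 \<le> C" "\<And>y n i j. y \<in> cball (snd x) e \<Longrightarrow> cmod (iterate n y $ i $ j) \<le> C ^ n / fact n"
      using iterate_local_bound[OF xU] by metis
    define A where "A = ball (fst x) 1 \<times> ball (snd x) e"
    have A: "open A" "x \<in> A" using e(1) by (auto simp: A_def open_Times mem_Times_iff)
    have AU: "snd y \<in> U" if "y \<in> A" for y using that e(2) by (auto simp: A_def)
    have "uniform_limit A (\<lambda>n y. \<Sum>k<n. fst y ^ k * iterate k (snd y) $ i $ j)
        (\<lambda>y. \<Sum>k. fst y ^ k * iterate k (snd y) $ i $ j) sequentially"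
    proof (rule Weierstrass_m_test)
      show "cmod (fst y ^ n * iterate n (snd y) $ i $ j) \<le> ((cmod (fst x) + 1) * C) ^ n / fact n" if "y \<in> A" for n y
      proof (rule term_bound)
        show "cmod (fst y) \<le> cmod (fst x) + 1"
          using that norm_triangle_ineq[of "fst x" "fst y - fst x"] by (auto simp: A_def dist_norm norm_minus_commute)
      qed (use e that in \<open>auto simp: A_def\<close>)
    qed (rule exp_series_summable)
    then have "continuous_on A (\<lambda>y. \<Sum>k. fst y ^ k * iterate k (snd y) $ i $ j)"
    proof (rule uniform_limit_theorem[rotated])
      have "continuous_on A (\<lambda>y. iterate k (snd y) $ i $ j)" for k
        by (rule continuous_on_compose2[OF holomorphic_on_imp_continuous_on[OF iterate_holomorphic[of k i j]]])
          (use AU in \<open>auto intro!: continuous_intros\<close>)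
      then show "\<forall>\<^sub>F n in sequentially. continuous_on A (\<lambda>y. \<Sum>k<n. fst y ^ k * iterate k (snd y) $ i $ j)"
        by (intro always_eventually allI continuous_on_sum continuous_on_mult continuous_on_power
            continuous_on_fst continuous_on_id)
    qed simp
    then show "isCont (\<lambda>x. solution (fst x) (snd x) $ i $ j) x"
      using A by (simp add: solution_def continuous_on_eq_continuous_at)
  qed
  then have "continuous_on (UNIV \<times> U) (\<lambda>x. \<chi> i j. solution (fst x) (snd x) $ i $ j)"
    by (intro continuous_on_vec_lambda)
  then show ?thesis by (simp add: case_prod_unfold)
qed

text \<open>A disc around \<open>a\<close> is itself star-shaped about \<open>a\<close>, so a single
  bound for \<open>N\<close> there majorises the series by that of the exponential.\<close>

lemma solution_bound:
  assumes "ball a r \<subseteq> U" "\<And>x i j. x \<in> ball a r \<Longrightarrow> cmod (N x $ i $ j) \<le> M" and t: "t \<in> ball a r"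
  shows "cmod (solution \<zeta> t $ i $ j) \<le> exp (2 * M * cmod \<zeta> * cmod (t - a))"
proof -
  have a: "a \<in> ball a r" using t by (metis centre_in_ball ball_eq_empty empty_iff not_le)
  have tU: "t \<in> U" using assms by blast
  have M0: "0 \<le> M" using assms(2)[OF a, of 1 1] norm_ge_zero order_trans by blast
  define C where "C = 2 * M * cmod (t - a)"
  have b: "cmod (\<zeta> ^ n * iterate n t $ i $ j) \<le> (cmod \<zeta> * C) ^ n / fact n" for n
  proof (rule term_bound)
    show "cmod (iterate n t $ i $ j) \<le> C ^ n / fact n"
      unfolding C_def
      by (rule iterate_bound[OF assms(1) _ assms(2) t]) (use a convex_ball[of a r] in \<open>auto simp: convex_contains_segment\<close>)
  qed (use M0 in \<open>auto simp: C_def\<close>)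
  have "cmod (\<Sum>n. \<zeta> ^ n * iterate n t $ i $ j) \<le> (\<Sum>n. (cmod \<zeta> * C) ^ n / fact n)"
    by (rule norm_suminf_le[OF b exp_series_summable])
  also have "\<dots> = exp (cmod \<zeta> * C)"
    by (simp add: exp_def divide_inverse mult.commute)
  finally show ?thesis by (simp add: solution_def C_def mult_ac)
qed

end

section \<open>Linear systems with trace-free coefficients\<close>

lemma mderiv_has_derivative:
  assumes "\<And>i j. ((\<lambda>x. P x $ i $ j) has_field_derivative D $ i $ j) (at x)"
  shows "mderiv P x = D" "(\<lambda>x. P x $ i $ j) field_differentiable at x"
  using assms by (auto simp: vec_eq_iff DERIV_imp_deriv field_differentiable_def)

lemma zero_derivative_imp_eq:
  fixes f :: "complex \<Rightarrow> complex"
  assumes "connected D" "open D" "s \<in> D" "t \<in> D" and der: "\<And>x. x \<in> D \<Longrightarrow> (f has_field_derivative 0) (at x)"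
  shows "f s = f t"
proof (rule DERIV_zero_connected_constant[of D "{}" f])
  show "continuous_on D f"
    by (intro continuous_at_imp_continuous_on ballI DERIV_isCont[OF der])
qed (use assms in auto)

text \<open>Liouville's formula: the derivative of \<open>det X\<close> is
  \<open>trace N * det X\<close>.\<close>

lemma det_constant:
  fixes D :: "complex set" and X N :: "complex \<Rightarrow> mat2"
  assumes "connected D" "open D" "t0 \<in> D" "t \<in> D"
    and ode: "\<And>s i j. s \<in> D \<Longrightarrow> ((\<lambda>s. X s $ i $ j) has_field_derivative (N s ** X s) $ i $ j) (at s)"
    and tr: "\<And>s. s \<in> D \<Longrightarrow> trace (N s) = 0"
  shows "det (X t) = det (X t0)"
proof (rule zero_derivative_imp_eq[OF assms(1,2,4,3), where f = "\<lambda>s. det (X s)"])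
  fix s assume s: "s \<in> D"
  show "((\<lambda>s. det (X s)) has_field_derivative 0) (at s)"
  proof -
    note o = ode[OF s]
    have "((\<lambda>s. det (X s)) has_field_derivative
        ((N s ** X s) $ 1 $ 1 * X s $ 2 $ 2 + (N s ** X s) $ 2 $ 2 * X s $ 1 $ 1)
        - ((N s ** X s) $ 1 $ 2 * X s $ 2 $ 1 + (N s ** X s) $ 2 $ 1 * X s $ 1 $ 2)) (at s)"
      unfolding det_2 by (intro DERIV_diff DERIV_mult o)
    moreover have "N s $ 2 $ 2 = - N s $ 1 $ 1" using tr[OF s] by (simp add: trace_mat2 add_eq_0_iff)
    then have "((N s ** X s) $ 1 $ 1 * X s $ 2 $ 2 + (N s ** X s) $ 2 $ 2 * X s $ 1 $ 1)
        - ((N s ** X s) $ 1 $ 2 * X s $ 2 $ 1 + (N s ** X s) $ 2 $ 1 * X s $ 1 $ 2) = 0"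
      by (simp add: mat2_mult_nth algebra_simps)
    ultimately show ?thesis by simp
  qed
qed

lemma inv2_det_1: "det M = 1 \<Longrightarrow> inv2 M = mat22 (M $ 2 $ 2) (- M $ 1 $ 2) (- M $ 2 $ 1) (M $ 1 $ 1)"
  by (simp add: inv2_def)

lemma inv2_holomorphic:
  assumes "\<And>i j. (\<lambda>t. X t $ i $ j) holomorphic_on D" "\<And>t. t \<in> D \<Longrightarrow> det (X t) = 1"
  shows "(\<lambda>t. inv2 (X t) $ i $ j) holomorphic_on D"
proof -
  have "\<forall>i j. (\<lambda>t. inv2 (X t) $ i $ j) holomorphic_on D"
    unfolding forall_2 inv2_def mat22_nth det_2
    by (intro conjI holomorphic_intros assms(1)) (use assms(2) in \<open>auto simp: det_2\<close>)
  then show ?thesis by blast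
qed

section \<open>The flow matrix, entire in z, as a gauge transformation\<close>

definition half_sigma3 :: mat2 where "half_sigma3 = mat22 (- 1/2) 0 0 (1/2)"

text \<open>\<open>B0\<close> is the part of \<open>B\<close> free of \<open>z\<close>. The rest of
  \<open>B\<close> is \<open>z\<close> times \<open>half_sigma3\<close>, which is minus one half of
  the third Pauli matrix.\<close>

locale isomonodromy_flow =
  fixes t0 :: complex and r :: real and B0 :: "complex \<Rightarrow> mat2"
  assumes r: "0 < r" and B0_holomorphic: "\<And>i j. (\<lambda>t. B0 t $ i $ j) holomorphic_on ball t0 r"
    and B0_trace: "\<And>t. t \<in> ball t0 r \<Longrightarrow> trace (B0 t) = 0"
begin

definition B :: "complex \<Rightarrow> complex \<Rightarrow> mat2" where "B z t = B0 t + cscale z half_sigma3"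

lemma ball_star: "x \<in> ball t0 r \<Longrightarrow> closed_segment t0 x \<subseteq> ball t0 r"
  using r convex_ball[of t0 r] by (simp add: convex_contains_segment)

sublocale const: linear_ode "ball t0 r" t0 "\<lambda>t. - B0 t"
  by unfold_locales (use r B0_holomorphic ball_star in \<open>auto intro: holomorphic_intros\<close>)

definition X where "X = const.solution 1"

lemma X_derivative: "t \<in> ball t0 r \<Longrightarrow> ((\<lambda>t. X t $ i $ j) has_field_derivative ((- B0 t) ** X t) $ i $ j) (at t)"
  using const.solution_derivative[of t 1 i j] by (simp add: X_def)

lemma X_base: "X t0 = mat 1"
  by (simp add: X_def const.solution_base)

lemma X_holomorphic: "(\<lambda>t. X t $ i $ j) holomorphic_on ball t0 r"
  unfolding holomorphic_on_open[OF open_ball] using X_derivative by blast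

lemma X_det: "t \<in> ball t0 r \<Longrightarrow> det (X t) = 1"
  using det_constant[of "ball t0 r" t0 t X "\<lambda>t. - B0 t"] r B0_trace X_derivative
  by (simp add: X_base trace_mat2 add_eq_0_iff)

definition N where "N t = - (inv2 (X t) ** half_sigma3 ** X t)"

lemma N_holomorphic: "(\<lambda>t. N t $ i $ j) holomorphic_on ball t0 r"
  unfolding N_def mat2_mult_nth vector_uminus_component
  by (intro holomorphic_intros inv2_holomorphic X_holomorphic X_det)

sublocale lin: linear_ode "ball t0 r" t0 N
  by unfold_locales (use r N_holomorphic ball_star in auto)

text \<open>Variation of constants: \<open>X\<close> solves the part of the equation without \<open>z\<close>, so the coefficient
  of the remaining equation is a multiple of \<open>z\<close>. Its Picard iteration is then a power series in \<open>z\<close>,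
  which yields both that \<open>\<Phi>\<close> is entire in \<open>z\<close> and its exponential growth.\<close>

definition \<Phi> where "\<Phi> z t = X t ** lin.solution z t"

lemma \<Phi>_base: "\<Phi> z t0 = mat 1"
  by (simp add: \<Phi>_def X_base lin.solution_base)

lemma \<Phi>_derivative:
  assumes t: "t \<in> ball t0 r"
  shows "((\<lambda>t. \<Phi> z t $ i $ j) has_field_derivative (- (B z t ** \<Phi> z t)) $ i $ j) (at t)"
proof -
  let ?\<Psi> = "lin.solution z"
  have "((\<lambda>t. \<Phi> z t $ i $ j) has_field_derivative
      (((- B0 t) ** X t) ** ?\<Psi> t + X t ** cscale z (N t ** ?\<Psi> t)) $ i $ j) (at t)"
    unfolding \<Phi>_def mat2_mult_nth[of "X _"] vector_add_component mat2_mult_nth[of _ "?\<Psi> t"] cscale_nth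
    by (rule derivative_eq_intros X_derivative[OF t] lin.solution_derivative[OF t] refl)+
      (simp add: mat2_mult_nth algebra_simps)
  also have "((- B0 t) ** X t) ** ?\<Psi> t + X t ** cscale z (N t ** ?\<Psi> t) = - (B z t ** \<Phi> z t)"
  proof -
    have "X t ** N t = - (half_sigma3 ** X t)"
      unfolding N_def mat2_minus_mult matrix_mul_assoc
      using inv2_mult(2)[of "X t"] X_det[OF t] by simp
    moreover have "X t ** cscale z (N t ** ?\<Psi> t) = cscale z (X t ** N t ** ?\<Psi> t)"
      by (simp add: mat2_eq_iff mat2_mult_nth algebra_simps)
    ultimately have "((- B0 t) ** X t) ** ?\<Psi> t + X t ** cscale z (N t ** ?\<Psi> t)
        = ((- B0 t) ** X t) ** ?\<Psi> t + cscale z (- (half_sigma3 ** X t) ** ?\<Psi> t)" by simp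
    also have "\<dots> = - (B z t ** \<Phi> z t)"
      unfolding \<Phi>_def B_def by (simp add: mat2_eq_iff mat2_mult_nth algebra_simps)
    finally show ?thesis .
  qed
  finally show ?thesis .
qed

lemma B_trace: "t \<in> ball t0 r \<Longrightarrow> B z t $ 2 $ 2 = - B z t $ 1 $ 1"
  using B0_trace[of t] by (simp add: B_def trace_mat2 half_sigma3_def add_eq_0_iff)

lemma \<Phi>_det: "t \<in> ball t0 r \<Longrightarrow> det (\<Phi> z t) = 1"
  using det_constant[of "ball t0 r" t0 t "\<Phi> z" "\<lambda>t. - B z t"] r B_trace \<Phi>_derivative
  by (simp add: \<Phi>_base trace_mat2 mat2_minus_mult)

lemma \<Phi>_holomorphic: "(\<lambda>t. \<Phi> z t $ i $ j) holomorphic_on ball t0 r"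
  unfolding holomorphic_on_open[OF open_ball] using \<Phi>_derivative by blast

lemma \<Phi>_entire: "t \<in> ball t0 r \<Longrightarrow> (\<lambda>z. \<Phi> z t $ i $ j) holomorphic_on UNIV"
  unfolding \<Phi>_def mat2_mult_nth by (intro holomorphic_intros lin.solution_entire)

lemma \<Phi>_continuous_nth: "continuous_on (UNIV \<times> ball t0 r) (\<lambda>x. \<Phi> (fst x) (snd x) $ i $ j)"
proof -
  have "continuous_on (UNIV \<times> ball t0 r) (\<lambda>x. X (snd x) $ i $ j)" for i j
    by (rule continuous_on_compose2[OF holomorphic_on_imp_continuous_on[OF X_holomorphic[of i j]]])
      (auto intro!: continuous_intros)
  moreover have "continuous_on (UNIV \<times> ball t0 r) (\<lambda>x. (lin.solution (fst x) (snd x)) $ i $ j)" for i j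
    using lin.solution_continuous by (intro continuous_on_component) (simp add: case_prod_unfold)
  ultimately show ?thesis
    unfolding \<Phi>_def mat2_mult_nth by (intro continuous_on_add continuous_on_mult)
qed

text \<open>The exponential type in \<open>z\<close> is bounded by a multiple of
  \<open>|t - t0|\<close>, so on a small disc of \<open>t\<close> the growth of
  \<open>\<Phi>\<close> stays below any prescribed exponential rate.\<close>

lemma \<Phi>_growth:
  obtains K M where "\<And>z t i j. t \<in> ball t0 (r/2) \<Longrightarrow> cmod (\<Phi> z t $ i $ j) \<le> K * exp (M * cmod z * cmod (t - t0))"
    "0 \<le> M" "0 \<le> K"
proof -
  have sub: "cball t0 (r/2) \<subseteq> ball t0 r" using r by auto
  have bd: "\<exists>M. \<forall>t\<in>cball t0 (r/2). \<forall>i j. cmod (F t $ i $ j) \<le> M"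
    if "\<And>i j. (\<lambda>t. F t $ i $ j) holomorphic_on ball t0 r" for F :: "complex \<Rightarrow> mat2"
  proof -
    have "\<exists>M. \<forall>x\<in>cball t0 (r/2). cmod (F x $ i $ j) \<le> M" for i j
    proof -
      have "continuous_on (cball t0 (r/2)) (\<lambda>x. F x $ i $ j)"
        using that sub by (meson continuous_on_subset holomorphic_on_imp_continuous_on)
      then have "bounded ((\<lambda>x. F x $ i $ j) ` cball t0 (r/2))"
        by (intro compact_imp_bounded compact_continuous_image) auto
      then show ?thesis unfolding bounded_iff by auto
    qed
    then obtain M0 where M0: "\<And>i j x. x \<in> cball t0 (r/2) \<Longrightarrow> cmod (F x $ i $ j) \<le> M0 i j" by metis
    have "M0 i j \<le> Max (range (\<lambda>(i, j). M0 i j))" for i j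
      by (rule Max_ge) (auto intro: rev_image_eqI[of "(i, j)"])
    then show ?thesis using M0 order_trans by blast
  qed
  obtain MX where MX: "\<forall>t\<in>cball t0 (r/2). \<forall>i j. cmod (X t $ i $ j) \<le> MX" using bd[OF X_holomorphic] by blast
  obtain MN where MN: "\<forall>t\<in>cball t0 (r/2). \<forall>i j. cmod (N t $ i $ j) \<le> MN" using bd[OF N_holomorphic] by blast
  have t0: "t0 \<in> cball t0 (r/2)" using r by simp
  have nn: "0 \<le> MX" "0 \<le> MN"
    using MX[rule_format, OF t0, of 1 1] MN[rule_format, OF t0, of 1 1] norm_ge_zero order_trans by blast+
  have "cmod (\<Phi> z t $ i $ j) \<le> (2 * MX) * exp ((2 * MN) * cmod z * cmod (t - t0))" if t: "t \<in> ball t0 (r/2)" for z t i j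
  proof -
    have L: "cmod (lin.solution z t $ k $ j) \<le> exp (2 * MN * cmod z * cmod (t - t0))" for k
      by (rule lin.solution_bound[OF _ _ t]) (use sub MN in auto)
    have "cmod (X t $ i $ k * lin.solution z t $ k $ j) \<le> MX * exp (2 * MN * cmod z * cmod (t - t0))" for k
      unfolding norm_mult by (intro mult_mono L) (use MX t nn in auto)
    from this[of 1] this[of 2] show ?thesis
      unfolding \<Phi>_def mat2_mult_nth by (intro order_trans[OF norm_triangle_ineq]) simp
  qed
  then show ?thesis using nn by (intro that[of "2 * MX" "2 * MN"]) auto
qed

text \<open>The defect \<open>V = \<Phi>_z + A \<Phi> - \<Phi> A(t0)\<close> satisfies
  \<open>V_t = - B V\<close> because of the commutation relation, and it vanishes at
  \<open>t0\<close>.\<close>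

lemma gauge_transform:
  assumes t: "t \<in> ball t0 r"
    and A: "\<And>s i j. s \<in> ball t0 r \<Longrightarrow> (\<lambda>s. A s $ i $ j) field_differentiable at s"
    and lax: "\<And>s. s \<in> ball t0 r \<Longrightarrow> mderiv A s - half_sigma3 + B z s ** A s - A s ** B z s = 0"
  shows "mderiv (\<lambda>z. \<Phi> z t) z + A t ** \<Phi> z t = \<Phi> z t ** A t0"
proof -
  define dz where "dz s = mderiv (\<lambda>z. \<Phi> z s) z" for s
  have \<Phi>z: "(\<lambda>z. \<Phi> z s $ i $ j) field_differentiable at z" if "s \<in> ball t0 r" for s i j
    by (rule holomorphic_on_imp_differentiable_at[OF \<Phi>_entire[OF that] open_UNIV UNIV_I])
  have Bz: "(\<lambda>z. B z s $ i $ j) field_differentiable at z" for s i j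
    unfolding B_def by (auto intro!: derivative_intros)
  have mB: "mderiv (\<lambda>z. B z s) z = half_sigma3" for s
    by (rule mderiv_has_derivative) (auto simp: B_def intro!: derivative_eq_intros)
  have dz_der: "((\<lambda>s. dz s $ i $ j) has_field_derivative (- (half_sigma3 ** \<Phi> z s + B z s ** dz s)) $ i $ j) (at s)"
    if s: "s \<in> ball t0 r" for s i j
    unfolding dz_def mderiv_nth
  proof (rule parameter_deriv_has_derivative(2)[of "ball t0 r" UNIV z "\<lambda>s z. \<Phi> z s $ i $ j" "\<lambda>s z. (- (B z s ** \<Phi> z s)) $ i $ j"])
    have "continuous_on (ball t0 r \<times> UNIV) (\<lambda>x. \<Phi> (fst (prod.swap x)) (snd (prod.swap x)) $ i $ j)"
      by (rule continuous_on_compose2[OF \<Phi>_continuous_nth[of i j]]) (auto intro!: continuous_on_swap)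
    then show "continuous_on (ball t0 r \<times> UNIV) (\<lambda>(s, z). \<Phi> z s $ i $ j)"
      by (simp add: case_prod_unfold)
    have "((\<lambda>z. (B z s ** \<Phi> z s) $ i $ j) has_field_derivative mderiv (\<lambda>z. B z s ** \<Phi> z s) z $ i $ j) (at z)"
      unfolding mderiv_nth mat2_mult_nth
      by (intro field_differentiable_derivI field_differentiable_add field_differentiable_mult Bz \<Phi>z s)
    then show "((\<lambda>z. (- (B z s ** \<Phi> z s)) $ i $ j) has_field_derivative
        (- (half_sigma3 ** \<Phi> z s + B z s ** mderiv (\<lambda>z. \<Phi> z s) z)) $ i $ j) (at z)"
      unfolding mderiv_mult[OF Bz \<Phi>z[OF s]] mB vector_uminus_component by (rule DERIV_minus)
  qed (use s \<Phi>_derivative \<Phi>_entire in auto)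
  define V where "V s = dz s + A s ** \<Phi> z s - \<Phi> z s ** A t0" for s
  have V_der: "((\<lambda>s. V s $ i $ j) has_field_derivative (- (B z s ** V s)) $ i $ j) (at s)" if s: "s \<in> ball t0 r" for s i j
  proof -
    have dA: "((\<lambda>s. A s $ i $ j) has_field_derivative mderiv A s $ i $ j) (at s)" for i j
      unfolding mderiv_nth using A[OF s] by (rule field_differentiable_derivI)
    let ?\<Phi>' = "- (B z s ** \<Phi> z s)"
    have "((\<lambda>s. V s $ i $ j) has_field_derivative
        (- (half_sigma3 ** \<Phi> z s + B z s ** dz s) + (mderiv A s ** \<Phi> z s + A s ** ?\<Phi>') - ?\<Phi>' ** A t0) $ i $ j) (at s)"
      unfolding V_def vector_add_component vector_minus_component mat2_mult_nth[of "A _" "\<Phi> z _"] mat2_mult_nth[of "\<Phi> z _" "A t0"]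
        mat2_mult_nth[of "mderiv A s"] mat2_mult_nth[of "A s" "?\<Phi>'"] mat2_mult_nth[of "?\<Phi>'" "A t0"]
      by (rule derivative_eq_intros dz_der[OF s] dA \<Phi>_derivative[OF s] refl)+ (simp add: algebra_simps)
    also have "- (half_sigma3 ** \<Phi> z s + B z s ** dz s) + (mderiv A s ** \<Phi> z s + A s ** ?\<Phi>') - ?\<Phi>' ** A t0 = - (B z s ** V s)"
    proof -
      have "mderiv A s = half_sigma3 - B z s ** A s + A s ** B z s"
        using lax[OF s] by (simp add: algebra_simps)
      then show ?thesis
        unfolding V_def by (simp only:) (simp add: mat2_eq_iff mat2_mult_nth algebra_simps)
    qed
    finally show ?thesis .
  qed
  \<comment> \<open>The inverse of \<open>\<Phi>\<close>, written out since the determinant is 1.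
    From \<open>P' = P B\<close> and \<open>V' = - B V\<close> the product \<open>P V\<close> is
    constant.\<close>
  define P where "P s = mat22 (\<Phi> z s $ 2 $ 2) (- \<Phi> z s $ 1 $ 2) (- \<Phi> z s $ 2 $ 1) (\<Phi> z s $ 1 $ 1)" for s
  have P: "P s = inv2 (\<Phi> z s)" if "s \<in> ball t0 r" for s
    unfolding P_def using inv2_det_1[OF \<Phi>_det[OF that]] by simp
  have P_der: "\<forall>i j. ((\<lambda>s. P s $ i $ j) has_field_derivative (P s ** B z s) $ i $ j) (at s)" if s: "s \<in> ball t0 r" for s
  proof -
    note d = \<Phi>_derivative[OF s, of z] and tr = B_trace[OF s, of z]
    show ?thesis
      unfolding forall_2 P_def mat22_nth
      by (intro conjI DERIV_cong[OF d[of 1 1]] DERIV_cong[OF d[of 2 2]] DERIV_cong[OF DERIV_minus[OF d[of 1 2]]]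
          DERIV_cong[OF DERIV_minus[OF d[of 2 1]]]) (simp_all add: mat2_mult_nth tr algebra_simps)
  qed
  have "(P t ** V t) $ i $ j = (P t0 ** V t0) $ i $ j" for i j
  proof (rule zero_derivative_imp_eq[of "ball t0 r", where f = "\<lambda>s. (P s ** V s) $ i $ j"])
    fix s assume s: "s \<in> ball t0 r"
    show "((\<lambda>s. (P s ** V s) $ i $ j) has_field_derivative 0) (at s)"
    proof -
      have "((\<lambda>s. (P s ** V s) $ i $ j) has_field_derivative ((P s ** B z s) ** V s + P s ** (- (B z s ** V s))) $ i $ j) (at s)"
        unfolding vector_add_component mat2_mult_nth[of "P _" "V _"] mat2_mult_nth[of "P s ** B z s"] mat2_mult_nth[of "P s" "- _"]
        by (rule derivative_eq_intros P_der[OF s, rule_format] V_der[OF s] refl)+ (simp add: algebra_simps)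
      moreover have "(P s ** B z s) ** V s + P s ** (- (B z s ** V s)) = 0"
        unfolding mat2_minus_mult matrix_mul_assoc by simp
      ultimately show ?thesis by simp
    qed
  qed (use t r in auto)
  moreover have "V t0 = 0"
  proof -
    have "mderiv (\<lambda>z. \<Phi> z t0) z = 0" unfolding \<Phi>_base by (rule mderiv_const)
    then show ?thesis by (simp add: V_def dz_def \<Phi>_base)
  qed
  ultimately have "P t ** V t = 0" by (simp add: vec_eq_iff mat2_mult_nth)
  then have "\<Phi> z t ** (P t ** V t) = 0" by (simp add: mat2_eq_iff mat2_mult_nth)
  then have "V t = 0"
    using inv2_mult(2)[of "\<Phi> z t"] \<Phi>_det[OF t] P[OF t] by (simp add: matrix_mul_assoc)
  then show ?thesis by (simp add: V_def dz_def)
qed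

end

section \<open>Canonical solutions at infinity\<close>

text \<open>A discrete substitute for the integral of \<open>1 / s^2\<close>: for
  \<open>y \<ge> 1\<close> one has \<open>1 / y^2 \<le> 2 / (y * (y + 1))\<close>, and the right
  side telescopes.\<close>

lemma inverse_square_telescope_sums:
  fixes x :: real
  assumes "1 \<le> x"
  shows "(\<lambda>k. 2 / (x + real k) - 2 / (x + real (Suc k))) sums (2 / x)"
    and "1 / (x + real k)^2 \<le> 2 / (x + real k) - 2 / (x + real (Suc k))"
proof -
  have "(\<lambda>k. 2 / (x + real k)) \<longlonglongrightarrow> 0"
    by real_asymp
  from telescope_sums'[OF this] show "(\<lambda>k. 2 / (x + real k) - 2 / (x + real (Suc k))) sums (2 / x)" by simp
  define y where "y = x + real k"
  have y: "1 \<le> y" using assms by (simp add: y_def)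
  have "1 / y^2 \<le> 2 / y - 2 / (y + 1)"
    using y by (simp add: divide_simps power2_eq_square)
  then show "1 / (x + real k)^2 \<le> 2 / (x + real k) - 2 / (x + real (Suc k))"
    by (simp add: y_def add_ac)
qed

text \<open>The constant \<open>K\<close> for which the second component reproduces its own bound in
  \<open>recessive_solution\<close>: a source of size \<open>2 * M * m / |z|\<close> is integrated
  to at most \<open>3 / (1 - exp (- c / 2)) * (2 * M * m) / |z|\<close>, and this has to equal
  \<open>K * (m / 2) / |z|\<close>.\<close>

definition dominant_const :: "real \<Rightarrow> real \<Rightarrow> real" where
  "dominant_const c M = 4 * M * (3 / (1 - exp (- c / 2)))"

locale ray_cone =
  fixes \<omega> :: complex and \<rho> :: real
  assumes \<omega>: "cmod \<omega> = 1" and \<rho>: "3 \<le> \<rho>"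
begin

text \<open>The cone with vertex \<open>\<rho> \<omega>\<close>, axis \<open>\<omega>\<close> and
  half opening angle arccos (-7/10). Translations along \<open>\<omega>\<close> map it into itself,
  which permits integration along rays to infinity; moving the vertex outwards makes
  \<open>1 / |z|\<close> small on all of it.\<close>

definition \<Omega> :: "complex set" where
  "\<Omega> = {z. Re ((z - of_real \<rho> * \<omega>) * cnj \<omega>) > - (7/10) * cmod (z - of_real \<rho> * \<omega>)}"

lemma \<omega>_cnj: "\<omega> * cnj \<omega> = 1"
  using \<omega> by (simp add: complex_norm_square[symmetric])

lemma open_\<Omega>: "open \<Omega>"
  unfolding \<Omega>_def by (intro open_Collect_less continuous_intros)

lemma \<Omega>_iff: "of_real \<rho> * \<omega> + y \<in> \<Omega> \<longleftrightarrow> - (7/10) * cmod y < Re (y * cnj \<omega>)"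
  by (simp add: \<Omega>_def)

lemma Re_add_\<omega>: "Re ((y + of_real s * \<omega>) * cnj \<omega>) = Re (y * cnj \<omega>) + s"
proof -
  have "(y + of_real s * \<omega>) * cnj \<omega> = y * cnj \<omega> + of_real s * (\<omega> * cnj \<omega>)" by (simp add: algebra_simps)
  then show ?thesis by (simp add: \<omega>_cnj)
qed

lemma cone_add:
  assumes "- (7/10) * cmod y < Re (y * cnj \<omega>)" "0 \<le> s"
  shows "- (7/10) * cmod (y + of_real s * \<omega>) < Re ((y + of_real s * \<omega>) * cnj \<omega>)"
proof -
  have "cmod y \<le> cmod (y + of_real s * \<omega>) + s"
    using norm_triangle_ineq4[of "y + of_real s * \<omega>" "of_real s * \<omega>"] assms(2) \<omega> by (simp add: norm_mult)
  then show ?thesis unfolding Re_add_\<omega> using assms by linarith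
qed

lemma \<Omega>_add:
  assumes "z \<in> \<Omega>" "0 \<le> s"
  shows "z + of_real s * \<omega> \<in> \<Omega>"
  using cone_add[of "z - of_real \<rho> * \<omega>" s] assms by (simp add: \<Omega>_def algebra_simps)

text \<open>The direction of \<open>y\<close> stays away from \<open>- \<omega>\<close>, so the law
  of cosines bounds \<open>|y + s \<omega>|^2\<close> below by
  \<open>|y|^2 + s^2 - 14/10 * |y| * s\<close>. A step along the axis cannot cancel more than a
  constant factor.\<close>

lemma cone_norm:
  assumes "- (7/10) * cmod y \<le> Re (y * cnj \<omega>)" "0 \<le> s"
  shows "(cmod y + s) / 3 \<le> cmod (y + of_real s * \<omega>)"
proof -
  have n: "(cmod (y + of_real s * \<omega>))^2 = (cmod y)^2 + s^2 + 2 * s * Re (y * cnj \<omega>)"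
  proof -
    have "(Re \<omega>)^2 + (Im \<omega>)^2 = 1" using \<omega> by (simp add: cmod_def)
    then have "s^2 * ((Re \<omega>)^2 + (Im \<omega>)^2) = s^2" by simp
    then show ?thesis unfolding cmod_power2 by (simp add: power2_eq_square algebra_simps)
  qed
  have "- (7/10) * cmod y * (2 * s) \<le> Re (y * cnj \<omega>) * (2 * s)"
    using assms by (intro mult_right_mono) auto
  then have "(cmod y)^2 + s^2 - 14/10 * (cmod y * s) \<le> (cmod (y + of_real s * \<omega>))^2"
    unfolding n by (simp add: algebra_simps)
  moreover have "((cmod y + s) / 3)^2 \<le> (cmod y)^2 + s^2 - 14/10 * (cmod y * s)"
  proof -
    have "2 * (cmod y * s) \<le> (cmod y)^2 + s^2" "0 \<le> cmod y * s"
      using assms sum_squares_bound[of "cmod y" s] by (simp_all add: mult.assoc)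
    moreover have "((cmod y + s) / 3)^2 = ((cmod y)^2 + s^2 + 2 * (cmod y * s)) / 9"
      by (simp add: power2_eq_square field_simps)
    moreover have "(q + 2 * p) / 9 \<le> q - 14/10 * p" if "2 * p \<le> q" "0 \<le> p" for p q :: real
      using that by simp
    ultimately show ?thesis by metis
  qed
  ultimately have "((cmod y + s) / 3)^2 \<le> (cmod (y + of_real s * \<omega>))^2" by linarith
  then show ?thesis by (rule power2_le_imp_le) simp
qed

lemma \<Omega>_norm_add:
  assumes "z \<in> \<Omega>" "0 \<le> s"
  shows "(cmod z + s) / 3 \<le> cmod (z + of_real s * \<omega>)"
proof -
  define y where "y = z - of_real \<rho> * \<omega>"
  have "- (7/10) * cmod y \<le> Re (y * cnj \<omega>)" using assms by (simp add: \<Omega>_def y_def)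
  then have "(cmod y + (\<rho> + s)) / 3 \<le> cmod (y + of_real (\<rho> + s) * \<omega>)"
    using assms \<rho> by (intro cone_norm) auto
  moreover have "y + of_real (\<rho> + s) * \<omega> = z + of_real s * \<omega>" by (simp add: y_def algebra_simps)
  moreover have "cmod z \<le> cmod y + \<rho>"
    using norm_triangle_ineq[of y "of_real \<rho> * \<omega>"] \<omega> \<rho> by (simp add: y_def norm_mult)
  ultimately show ?thesis by simp
qed

lemma \<Omega>_norm_ge:
  assumes "z \<in> \<Omega>"
  shows "\<rho> / 3 \<le> cmod z"
proof -
  define y where "y = z - of_real \<rho> * \<omega>"
  have "- (7/10) * cmod y \<le> Re (y * cnj \<omega>)" using assms by (simp add: \<Omega>_def y_def)
  then have "(cmod y + \<rho>) / 3 \<le> cmod (y + of_real \<rho> * \<omega>)"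
    using \<rho> by (intro cone_norm) auto
  then show ?thesis using norm_ge_zero[of "z - of_real \<rho> * \<omega>"] by (simp add: y_def del: norm_ge_zero)
qed

lemma \<Omega>_norm_ge_1: "z \<in> \<Omega> \<Longrightarrow> 1 \<le> cmod z"
  using \<Omega>_norm_ge[of z] \<rho> by simp

text \<open>The cone is wider than a half plane and hence not convex. Relative to the vertex,
  however, a point on a segment from \<open>2 \<rho> \<omega>\<close> is a shrunken vector of the
  cone plus a nonnegative multiple of \<open>\<omega>\<close>.\<close>

lemma starlike_\<Omega>: "starlike \<Omega>"
  unfolding starlike_def
proof (intro bexI ballI subsetI)
  fix z x assume z: "z \<in> \<Omega>" and x: "x \<in> closed_segment (of_real (2 * \<rho>) * \<omega>) z"
  define y where "y = z - of_real \<rho> * \<omega>"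
  have y: "- (7/10) * cmod y < Re (y * cnj \<omega>)" using z by (simp add: \<Omega>_def y_def)
  obtain u where u: "0 \<le> u" "u \<le> 1" "x = (1 - u) *\<^sub>R (of_real (2 * \<rho>) * \<omega>) + u *\<^sub>R z"
    using x by (auto simp: in_segment)
  have x': "x = of_real \<rho> * \<omega> + (of_real u * y + of_real ((1 - u) * \<rho>) * \<omega>)"
    unfolding u(3) y_def by (simp add: scaleR_conv_of_real algebra_simps)
  have Re_u: "Re ((of_real u * y) * cnj \<omega>) = u * Re (y * cnj \<omega>)"
    unfolding mult.assoc by simp
  show "x \<in> \<Omega>"
  proof (cases "u = 0")
    case False
    have "- (7/10) * cmod (of_real u * y) < Re ((of_real u * y) * cnj \<omega>)"
      unfolding Re_u using mult_strict_left_mono[OF y, of u] u(1) False by (simp add: norm_mult)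
    then show ?thesis
      unfolding x' \<Omega>_iff using u \<rho> by (intro cone_add) auto
  next
    case True
    have "- (7/10) * cmod (of_real \<rho> * \<omega>) < Re ((0 + of_real \<rho> * \<omega>) * cnj \<omega>)"
      unfolding Re_add_\<omega> using \<omega> \<rho> by (simp add: norm_mult)
    then show ?thesis unfolding x' \<Omega>_iff by (simp add: True)
  qed
next
  have "- (7/10) * cmod (of_real \<rho> * \<omega>) < Re ((0 + of_real \<rho> * \<omega>) * cnj \<omega>)"
    unfolding Re_add_\<omega> using \<omega> \<rho> by (simp add: norm_mult)
  then have "of_real \<rho> * \<omega> + of_real \<rho> * \<omega> \<in> \<Omega>" unfolding \<Omega>_iff by simp
  then show "of_real (2 * \<rho>) * \<omega> \<in> \<Omega>" by (simp add: algebra_simps)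
qed

section \<open>Integrals along rays\<close>

lemma primitive_\<Omega>:
  assumes "g holomorphic_on \<Omega>"
  obtains G where "\<And>z. z \<in> \<Omega> \<Longrightarrow> (G has_field_derivative g z) (at z)"
  using holomorphic_starlike_primitive[OF holomorphic_on_imp_continuous_on[OF assms] starlike_\<Omega> open_\<Omega>, of "{}"]
    holomorphic_on_imp_differentiable_at[OF assms open_\<Omega>] by auto

text \<open>The solution of \<open>Q' = (W'/W) Q + g\<close> vanishing at the end of the rays, as a telescoping sum
  over unit steps along the ray instead of an improper integral.\<close>

lemma ray_integral:
  fixes W g :: "complex \<Rightarrow> complex" and h :: "nat \<Rightarrow> complex \<Rightarrow> real"
  assumes g: "g holomorphic_on \<Omega>"
    and W: "\<And>z. z \<in> \<Omega> \<Longrightarrow> (W has_field_derivative w z * W z) (at z)" "\<And>z. z \<in> \<Omega> \<Longrightarrow> W z \<noteq> 0"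
    and h: "\<And>z k s. z \<in> \<Omega> \<Longrightarrow> real k \<le> s \<Longrightarrow> s \<le> real k + 1 \<Longrightarrow>
         cmod (W z / W (z + of_real s * \<omega>) * g (z + of_real s * \<omega>)) \<le> h k z"
    and H: "\<And>z k. z \<in> \<Omega> \<Longrightarrow> h k z \<le> H k" "summable H"
  obtains Q where "\<And>z. z \<in> \<Omega> \<Longrightarrow> (Q has_field_derivative w z * Q z + g z) (at z)"
    "\<And>z. z \<in> \<Omega> \<Longrightarrow> cmod (Q z) \<le> (\<Sum>k. h k z)"
proof -
  have W_hol: "W holomorphic_on \<Omega>" using W(1) by (auto simp: holomorphic_on_open[OF open_\<Omega>])
  have "(\<lambda>z. g z / W z) holomorphic_on \<Omega>" using W(2) by (intro holomorphic_intros g W_hol) auto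
  then obtain G where G: "\<And>z. z \<in> \<Omega> \<Longrightarrow> (G has_field_derivative g z / W z) (at z)"
    using primitive_\<Omega> by blast
  define P where "P k z = z + of_real (real k) * \<omega>" for k :: nat and z
  have P: "P k z \<in> \<Omega>" if "z \<in> \<Omega>" for k z unfolding P_def using \<Omega>_add[OF that, of "real k"] by simp
  \<comment> \<open>Minus the integral of \<open>g / W\<close> over the \<open>k\<close>-th unit
    step of the ray from \<open>z\<close>.\<close>
  define f where "f k z = G (P k z) - G (P (Suc k) z)" for k z
  have h0: "0 \<le> h k z" if "z \<in> \<Omega>" for k z
    by (rule order_trans[OF norm_ge_zero h[OF that, of k "real k"]]) simp_all
  have fb: "cmod (W z * f k z) \<le> h k z" if z: "z \<in> \<Omega>" for k z
  proof -
    have seg: "\<exists>s. real k \<le> s \<and> s \<le> real k + 1 \<and> x = z + of_real s * \<omega>" if x: "x \<in> closed_segment (P k z) (P (Suc k) z)" for x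
    proof -
      obtain u where u: "0 \<le> u" "u \<le> 1" "x = (1 - u) *\<^sub>R P k z + u *\<^sub>R P (Suc k) z"
        using x by (auto simp: in_segment)
      have "x = z + of_real (real k + u) * \<omega>"
        unfolding u(3) P_def by (simp add: scaleR_conv_of_real algebra_simps)
      then show ?thesis using u by (intro exI[of _ "real k + u"]) auto
    qed
    have "cmod (G (P k z) - G (P (Suc k) z)) \<le> h k z / cmod (W z) * cmod (P k z - P (Suc k) z)"
    proof (rule field_differentiable_bound[where S = "closed_segment (P k z) (P (Suc k) z)" and f' = "\<lambda>x. g x / W x"])
      fix x assume "x \<in> closed_segment (P k z) (P (Suc k) z)"
      then obtain s where s: "real k \<le> s" "s \<le> real k + 1" "x = z + of_real s * \<omega>" using seg by blast
      have "0 \<le> s" using s(1) of_nat_0_le_iff[of k] by linarith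
      then have "x \<in> \<Omega>" using \<Omega>_add[OF z] s by simp
      then show "(G has_field_derivative g x / W x) (at x within closed_segment (P k z) (P (Suc k) z))"
        using G has_field_derivative_at_within by blast
      have "cmod (W z) * cmod (g x / W x) \<le> h k z"
        using h[OF z s(1,2)] s(3) by (simp add: norm_mult norm_divide)
      then show "cmod (g x / W x) \<le> h k z / cmod (W z)"
        using W(2)[OF z] by (simp add: pos_le_divide_eq mult.commute)
    qed auto
    moreover have "cmod (P k z - P (Suc k) z) = 1"
    proof -
      have "P k z - P (Suc k) z = - \<omega>" by (simp add: P_def algebra_simps)
      then show ?thesis using \<omega> by simp
    qed
    ultimately have "cmod (f k z) \<le> h k z / cmod (W z)" by (simp add: f_def)
    then show ?thesis using W(2)[OF z] by (simp add: norm_mult pos_le_divide_eq mult.commute)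
  qed
  define f' where "f' k z = g (P k z) / W (P k z) - g (P (Suc k) z) / W (P (Suc k) z)" for k z
  have "\<exists>S S'. \<forall>z\<in>\<Omega>. (\<lambda>k. f k z) sums S z \<and> (\<lambda>k. f' k z) sums S' z \<and> (S has_field_derivative S' z) (at z)"
  proof (rule series_and_derivative_comparison_local[OF open_\<Omega>])
    fix k z assume z: "z \<in> \<Omega>"
    have GP: "((\<lambda>z. G (P k z)) has_field_derivative g (P k z) / W (P k z)) (at z)" for k
    proof -
      have "((\<lambda>z. z + of_real (real k) * \<omega>) has_field_derivative 1) (at z)"
        by (auto intro!: derivative_eq_intros)
      moreover have "(G has_field_derivative g (P k z) / W (P k z)) (at (z + of_real (real k) * \<omega>))"
        using G[OF P[OF z, of k]] by (simp add: P_def)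
      ultimately show ?thesis using DERIV_chain2 by (fastforce simp: P_def)
    qed
    show "(f k has_field_derivative f' k z) (at z)"
      unfolding f_def f'_def by (intro DERIV_diff GP)
  next
    fix z assume z: "z \<in> \<Omega>"
    have "isCont W z" using W(1)[OF z] by (rule DERIV_isCont)
    then have "((\<lambda>y. cmod (W y)) \<longlongrightarrow> cmod (W z)) (at z)" by (simp add: isCont_def tendsto_norm)
    moreover have "cmod (W z) / 2 < cmod (W z)" using W(2)[OF z] by simp
    ultimately have "\<forall>\<^sub>F y in at z. cmod (W z) / 2 < cmod (W y)" by (rule order_tendstoD(1))
    then obtain d where d: "0 < d" "\<And>y. y \<noteq> z \<Longrightarrow> dist y z < d \<Longrightarrow> cmod (W z) / 2 < cmod (W y)"
      unfolding eventually_at by auto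
    \<comment> \<open>The estimate at hand is for \<open>W * f\<close>; near \<open>z\<close> the
      factor \<open>W\<close> stays away from 0, so it bounds the series of \<open>f\<close> locally
      uniformly.\<close>
    have "cmod (f k y) \<le> H k * (2 / cmod (W z))" if y: "y \<in> ball z d \<inter> \<Omega>" for k y
    proof -
      have Wy: "cmod (W z) / 2 \<le> cmod (W y)" using d(2)[of y] y by (cases "y = z") (auto simp: dist_commute)
      have "cmod (f k y) * (cmod (W z) / 2) \<le> cmod (f k y) * cmod (W y)"
        using Wy by (intro mult_left_mono) auto
      also have "\<dots> \<le> H k" using fb[of y k] H(1)[of y k] y by (simp add: norm_mult mult.commute)
      finally show ?thesis using W(2)[OF z] by (simp add: field_simps)
    qed
    then show "\<exists>d h. 0 < d \<and> summable h \<and> (\<forall>\<^sub>F k in sequentially. \<forall>y\<in>ball z d \<inter> \<Omega>. cmod (f k y) \<le> h k)"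
      using d(1) H(2) by (intro exI[of _ d] exI[of _ "\<lambda>k. H k * (2 / cmod (W z))"]) (auto intro: summable_mult2)
  qed
  then obtain S S' where S: "\<And>z. z \<in> \<Omega> \<Longrightarrow> (\<lambda>k. f k z) sums S z" "\<And>z. z \<in> \<Omega> \<Longrightarrow> (\<lambda>k. f' k z) sums S' z"
      "\<And>z. z \<in> \<Omega> \<Longrightarrow> (S has_field_derivative S' z) (at z)" by blast
  have S': "S' z = g z / W z" if z: "z \<in> \<Omega>" for z
  proof -
    \<comment> \<open>The series of derivatives telescopes; its boundary term at the far end of the
      ray vanishes because \<open>H\<close> is summable.\<close>
    have "(\<lambda>k. g (P k z) / W (P k z)) \<longlonglongrightarrow> 0"
    proof (rule Lim_null_comparison)
      show "\<forall>\<^sub>F k in sequentially. cmod (g (P k z) / W (P k z)) \<le> H k / cmod (W z)"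
      proof (intro always_eventually allI)
        fix k
        have "cmod (W z) * cmod (g (P k z) / W (P k z)) \<le> H k"
          using h[OF z, of k "real k"] H(1)[OF z, of k] by (simp add: P_def norm_mult norm_divide)
        then show "cmod (g (P k z) / W (P k z)) \<le> H k / cmod (W z)"
          using W(2)[OF z] by (simp add: pos_le_divide_eq mult.commute)
      qed
      show "(\<lambda>k. H k / cmod (W z)) \<longlonglongrightarrow> 0"
        by (rule tendsto_divide_zero[OF summable_LIMSEQ_zero[OF H(2)]])
    qed
    from telescope_sums'[OF this] have "(\<lambda>k. f' k z) sums (g z / W z)"
      by (simp add: f'_def P_def)
    then show ?thesis using S(2)[OF z] sums_unique2 by blast
  qed
  show ?thesis
  proof
    fix z assume z: "z \<in> \<Omega>"
    show "((\<lambda>z. W z * S z) has_field_derivative w z * (W z * S z) + g z) (at z)"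
      using W(2)[OF z] by (auto intro!: derivative_eq_intros W(1)[OF z] S(3)[OF z] simp: S'[OF z])
    have hs: "summable (\<lambda>k. h k z)"
      by (rule summable_comparison_test'[OF H(2)]) (use H(1)[OF z] h0[OF z] in auto)
    have "(\<lambda>k. W z * f k z) sums (W z * S z)" using S(1)[OF z] by (rule sums_mult)
    then have "W z * S z = (\<Sum>k. W z * f k z)" by (rule sums_unique)
    also have "cmod \<dots> \<le> (\<Sum>k. h k z)" by (rule norm_suminf_le[OF fb[OF z] hs])
    finally show "cmod (W z * S z) \<le> (\<Sum>k. h k z)" .
  qed
qed

text \<open>The case \<open>W = 1\<close>. The 18 is \<open>3^2\<close>, from
  \<open>\<Omega>_norm_add\<close>, times the 2 of the telescoping bound.\<close>

lemma ray_integral_plain: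
  assumes g: "g holomorphic_on \<Omega>" and bd: "\<And>z. z \<in> \<Omega> \<Longrightarrow> cmod (g z) \<le> m / (cmod z)^2"
  shows "\<exists>Q. \<forall>z\<in>\<Omega>. (Q has_field_derivative g z) (at z) \<and> cmod (Q z) \<le> 18 * m / cmod z"
proof (cases "\<Omega> = {}")
  case False
  then obtain z0 where z0: "z0 \<in> \<Omega>" by blast
  have m: "0 \<le> m"
  proof -
    have "0 \<le> m / (cmod z0)^2" using bd[OF z0] norm_ge_zero order_trans by blast
    then show ?thesis using \<Omega>_norm_ge_1[OF z0] by (auto simp: zero_le_divide_iff)
  qed
  define h where "h k z = 9 * m * (1 / (cmod z + real k)^2)" for k :: nat and z :: complex
  have tel: "(\<lambda>k. 2 / (x + real k) - 2 / (x + real (Suc k))) sums (2 / x)" if "1 \<le> x" for x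
    using inverse_square_telescope_sums(1)[OF that] .
  have sm: "summable (\<lambda>k. 1 / (x + real k)^2)" if "1 \<le> x" for x
    by (rule summable_comparison_test'[OF sums_summable[OF tel[OF that]]])
      (use inverse_square_telescope_sums(2)[OF that] in auto)
  obtain Q where Q: "\<And>z. z \<in> \<Omega> \<Longrightarrow> (Q has_field_derivative 0 * Q z + g z) (at z)"
    "\<And>z. z \<in> \<Omega> \<Longrightarrow> cmod (Q z) \<le> (\<Sum>k. h k z)"
  proof (rule ray_integral[OF g, of "\<lambda>_. 1" "\<lambda>_. 0" h "\<lambda>k. 9 * m * (1 / (1 + real k)^2)"])
    fix z k s assume z: "z \<in> \<Omega>" and s: "real k \<le> s" "s \<le> real k + 1"
    let ?x = "z + of_real s * \<omega>"
    have "0 \<le> s" using s(1) of_nat_0_le_iff[of k] by linarith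
    then have x: "?x \<in> \<Omega>" "(cmod z + real k) / 3 \<le> cmod ?x"
      using \<Omega>_add[OF z] \<Omega>_norm_add[OF z, of s] s by auto
    have p: "0 < (cmod z + real k) / 3" using \<Omega>_norm_ge_1[OF z] by simp
    have "cmod (g ?x) \<le> m / (cmod ?x)^2" by (rule bd[OF x(1)])
    also have "\<dots> \<le> m / ((cmod z + real k) / 3)^2"
      using m p x(2) by (intro divide_left_mono power_mono mult_pos_pos zero_less_power) auto
    also have "\<dots> = h k z" by (simp add: h_def power2_eq_square)
    finally show "cmod (1 / 1 * g ?x) \<le> h k z" by simp
  next
    fix z k assume z: "z \<in> \<Omega>"
    show "h k z \<le> 9 * m * (1 / (1 + real k)^2)"
      unfolding h_def using m \<Omega>_norm_ge_1[OF z]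
      by (intro mult_left_mono divide_left_mono power_mono mult_pos_pos zero_less_power) auto
  next
    show "summable (\<lambda>k. 9 * m * (1 / (1 + real k)^2))" by (intro summable_mult sm) simp
  qed (auto intro: that)
  have "(\<Sum>k. h k z) \<le> 18 * m / cmod z" if z: "z \<in> \<Omega>" for z
  proof -
    have x: "1 \<le> cmod z" by (rule \<Omega>_norm_ge_1[OF z])
    have "(\<Sum>k. 1 / (cmod z + real k)^2) \<le> (\<Sum>k. 2 / (cmod z + real k) - 2 / (cmod z + real (Suc k)))"
      by (intro suminf_le inverse_square_telescope_sums(2)[OF x] sm[OF x] sums_summable[OF tel[OF x]])
    also have "\<dots> = 2 / cmod z" using tel[OF x] by (rule sums_unique[symmetric])
    finally have "9 * m * (\<Sum>k. 1 / (cmod z + real k)^2) \<le> 9 * m * (2 / cmod z)"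
      using m by (intro mult_left_mono) auto
    then show ?thesis unfolding h_def suminf_mult[OF sm[OF x]] by simp
  qed
  then show ?thesis using Q order_trans by (intro exI[of _ Q]) force
qed auto

text \<open>The homogeneous solution \<open>exp (- (\<mu> z + \<theta> log z))\<close> grows at
  least like \<open>exp (c * s / 2)\<close> after a step \<open>s\<close> along the ray. The unit
  steps are thus dominated by a geometric series, and the order \<open>1 / |z|\<close> of the source
  is reproduced without loss.\<close>

lemma ray_integral_exponential:
  fixes \<mu> \<theta> :: complex
  assumes c: "0 < c" "Re (\<mu> * \<omega>) \<le> - c" and \<rho>\<theta>: "18 * cmod \<theta> / c \<le> \<rho>"
    and g: "g holomorphic_on \<Omega>" and bd: "\<And>z. z \<in> \<Omega> \<Longrightarrow> cmod (g z) \<le> m / cmod z"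
  shows "\<exists>Q. \<forall>z\<in>\<Omega>. (Q has_field_derivative - (\<mu> + \<theta> / z) * Q z + g z) (at z) \<and>
     cmod (Q z) \<le> 3 / (1 - exp (- c / 2)) * m / cmod z"
proof (cases "\<Omega> = {}")
  case False
  then obtain z0 where z0: "z0 \<in> \<Omega>" by blast
  have m: "0 \<le> m"
  proof -
    have "0 \<le> m / cmod z0" using bd[OF z0] norm_ge_zero order_trans by blast
    then show ?thesis using \<Omega>_norm_ge_1[OF z0] by (auto simp: zero_le_divide_iff)
  qed
  have nz: "z \<noteq> 0" if "z \<in> \<Omega>" for z using \<Omega>_norm_ge_1[OF that] by auto
  \<comment> \<open>Any primitive of \<open>1 / z\<close> serves as the logarithm on the
    cone.\<close>
  have "(\<lambda>z. 1 / z) holomorphic_on \<Omega>" using nz by (intro holomorphic_intros) auto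
  then obtain lg where lg: "\<And>z. z \<in> \<Omega> \<Longrightarrow> (lg has_field_derivative 1 / z) (at z)" using primitive_\<Omega> by blast
  define W where "W z = exp (- (\<mu> * z + \<theta> * lg z))" for z
  have W: "(W has_field_derivative - (\<mu> + \<theta> / z) * W z) (at z)" if "z \<in> \<Omega>" for z
    unfolding W_def by (auto intro!: derivative_eq_intros lg[OF that] simp: algebra_simps)
  define h where "h k z = 3 * m / cmod z * exp (- c / 2) ^ k" for k :: nat and z :: complex
  have ex: "0 < exp (- c / 2)" "exp (- c / 2) < 1" using c by auto
  have geo: "summable (\<lambda>k. exp (- c / 2) ^ k)" by (rule summable_geometric) (use ex in simp)
  obtain Q where Q: "\<And>z. z \<in> \<Omega> \<Longrightarrow> (Q has_field_derivative - (\<mu> + \<theta> / z) * Q z + g z) (at z)"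
    "\<And>z. z \<in> \<Omega> \<Longrightarrow> cmod (Q z) \<le> (\<Sum>k. h k z)"
  proof (rule ray_integral[OF g W, of h "\<lambda>k. 3 * m * exp (- c / 2) ^ k"])
    fix z k s assume z: "z \<in> \<Omega>" and s: "real k \<le> s" "s \<le> real k + 1"
    let ?x = "z + of_real s * \<omega>"
    have s0: "0 \<le> s" using s(1) of_nat_0_le_iff[of k] by linarith
    then have x: "?x \<in> \<Omega>" "cmod z / 3 \<le> cmod ?x"
      using \<Omega>_add[OF z] \<Omega>_norm_add[OF z, of s] by auto
    have z1: "1 \<le> cmod z" by (rule \<Omega>_norm_ge_1[OF z])
    \<comment> \<open>A step of length \<open>s\<close> changes the logarithm by at most
      \<open>9 * s / \<rho>\<close>, and the lower bound on \<open>\<rho>\<close> lets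
      \<open>\<theta>\<close> use up at most half of the rate \<open>c\<close>.\<close>
    have "cmod (lg ?x - lg z) \<le> 9 / \<rho> * cmod (?x - z)"
    proof (rule field_differentiable_bound[where S = "closed_segment z ?x" and f' = "\<lambda>z. 1 / z"])
      fix y assume "y \<in> closed_segment z ?x"
      then obtain u where u: "0 \<le> u" "u \<le> 1" "y = (1 - u) *\<^sub>R z + u *\<^sub>R ?x" by (auto simp: in_segment)
      have y: "y = z + of_real (u * s) * \<omega>" unfolding u(3) by (simp add: scaleR_conv_of_real algebra_simps)
      have yO: "y \<in> \<Omega>" unfolding y by (rule \<Omega>_add[OF z]) (use u s0 in simp)
      show "(lg has_field_derivative 1 / y) (at y within closed_segment z ?x)"
        using lg[OF yO] by (rule has_field_derivative_at_within)
      have "\<rho> / 9 \<le> cmod y" using \<Omega>_norm_ge[OF yO] \<rho> by linarith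
      then have "1 / cmod y \<le> 1 / (\<rho> / 9)" using \<rho> by (intro frac_le) auto
      then show "cmod (1 / y) \<le> 9 / \<rho>" by (simp add: norm_divide)
    qed auto
    then have "cmod (\<theta> * (lg ?x - lg z)) \<le> cmod \<theta> * (9 / \<rho> * s)"
      unfolding norm_mult using \<omega> s0 by (intro mult_left_mono) (auto simp: norm_mult)
    also have "\<dots> \<le> c / 2 * s"
    proof -
      have "cmod \<theta> * (9 / \<rho>) \<le> c / 2" using \<rho>\<theta> c \<rho> by (simp add: field_simps)
      then show ?thesis using s0 mult_right_mono[of "cmod \<theta> * (9 / \<rho>)" "c / 2" s] by (simp add: mult.assoc)
    qed
    finally have \<theta>b: "Re (\<theta> * (lg ?x - lg z)) \<le> c / 2 * s"
      using complex_Re_le_cmod order_trans by blast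
    have "W z / W ?x = exp (of_real s * (\<mu> * \<omega>) + \<theta> * (lg ?x - lg z))"
      unfolding W_def exp_diff[symmetric] by (rule arg_cong[where f = exp]) (simp add: algebra_simps)
    then have "cmod (W z / W ?x) = exp (s * Re (\<mu> * \<omega>) + Re (\<theta> * (lg ?x - lg z)))"
      by (simp add: norm_exp_eq_Re)
    also have "\<dots> \<le> exp (- c / 2) ^ k"
    proof -
      have "s * Re (\<mu> * \<omega>) \<le> s * (- c)" using s0 c by (intro mult_left_mono) auto
      moreover have "real k * (c / 2) \<le> s * (c / 2)" using s c by (intro mult_right_mono) auto
      ultimately have "s * Re (\<mu> * \<omega>) + Re (\<theta> * (lg ?x - lg z)) \<le> real k * (- c / 2)"
        using \<theta>b by (simp add: algebra_simps)
      then show ?thesis by (simp add: exp_of_nat_mult[symmetric])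
    qed
    finally have 1: "cmod (W z / W ?x) \<le> exp (- c / 2) ^ k" .
    have "cmod (g ?x) \<le> m / cmod ?x" by (rule bd[OF x(1)])
    also have "\<dots> \<le> m / (cmod z / 3)" using m x(2) z1 by (intro divide_left_mono) (auto intro!: mult_pos_pos)
    finally have 2: "cmod (g ?x) \<le> 3 * m / cmod z" by (simp add: mult.commute)
    show "cmod (W z / W ?x * g ?x) \<le> h k z"
      unfolding norm_mult h_def using mult_mono[OF 1 2] by (simp add: mult.commute)
  next
    fix z k assume z: "z \<in> \<Omega>"
    have "3 * m / cmod z \<le> 3 * m / 1" using m \<Omega>_norm_ge_1[OF z] by (intro divide_left_mono) auto
    then show "h k z \<le> 3 * m * exp (- c / 2) ^ k"
      unfolding h_def by (intro mult_right_mono) auto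
  next
    show "summable (\<lambda>k. 3 * m * exp (- c / 2) ^ k)" by (intro summable_mult geo)
  qed (auto simp: W_def intro: that)
  have "(\<Sum>k. h k z) = 3 / (1 - exp (- c / 2)) * m / cmod z" for z
    unfolding h_def suminf_mult[OF geo] using ex by (simp add: suminf_geometric)
  then show ?thesis using Q by (intro exI[of _ Q]) force
qed auto

text \<open>Successive approximation starting from \<open>(1, 0)\<close>, with both components
  integrated from the end of the ray. The coefficient \<open>\<beta>\<close> is only of order
  \<open>1 / |z|\<close>, but it multiplies a second component of the same order, so the source of
  the first component is of order \<open>1 / |z|^2\<close> and integrable. On a cone far enough out
  each correction has half the bound of the one before.\<close>

lemma recessive_solution:
  fixes \<alpha> \<beta> \<gamma> :: "complex \<Rightarrow> complex" and \<mu> \<theta> :: complex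
  assumes c: "0 < c" "Re (\<mu> * \<omega>) \<le> - c" and M: "0 \<le> M"
    and hol: "\<alpha> holomorphic_on \<Omega>" "\<beta> holomorphic_on \<Omega>" "\<gamma> holomorphic_on \<Omega>"
    and \<alpha>: "\<And>z. z \<in> \<Omega> \<Longrightarrow> cmod (\<alpha> z) \<le> M / (cmod z)^2"
    and \<beta>: "\<And>z. z \<in> \<Omega> \<Longrightarrow> cmod (\<beta> z) \<le> M / cmod z"
    and \<gamma>: "\<And>z. z \<in> \<Omega> \<Longrightarrow> cmod (\<gamma> z) \<le> M / cmod z"
  defines "K \<equiv> dominant_const c M"
  assumes \<rho>: "18 * cmod \<theta> / c \<le> \<rho>" "3 * K \<le> \<rho>" "108 * (M * (1 + K)) \<le> \<rho>"
  shows "\<exists>u1 u2. \<forall>z\<in>\<Omega>. (u1 has_field_derivative \<alpha> z * u1 z + \<beta> z * u2 z) (at z) \<and>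
      (u2 has_field_derivative \<gamma> z * u1 z - (\<mu> + \<theta> / z + \<alpha> z) * u2 z) (at z) \<and>
      cmod (u1 z - 1) \<le> 36 * (M * (1 + K)) / cmod z \<and> cmod (u2 z) \<le> 2 * K / cmod z"
proof -
  have ex: "0 < 1 - exp (- c / 2)" using c by simp
  have K0: "0 \<le> K" unfolding K_def dominant_const_def using M ex by (intro mult_nonneg_nonneg divide_nonneg_pos) auto
  define good where "good m x \<longleftrightarrow> (case x of (a, b) \<Rightarrow> a holomorphic_on \<Omega> \<and> b holomorphic_on \<Omega> \<and>
      (\<forall>z\<in>\<Omega>. cmod (a z) \<le> m \<and> cmod (b z) \<le> K * m / cmod z))" for m :: real and x :: "(complex \<Rightarrow> complex) \<times> (complex \<Rightarrow> complex)"
  \<comment> \<open>The pair \<open>(a', b')\<close> is the correction after \<open>(a, b)\<close>: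
    the terms with \<open>\<mu> + \<theta> / z\<close> act on the new \<open>b'\<close>, whereas
    \<open>\<alpha> b\<close> is treated as a source from the old pair.\<close>
  define next_to where "next_to m x y \<longleftrightarrow> (case (x, y) of ((a, b), (a', b')) \<Rightarrow> (\<forall>z\<in>\<Omega>.
      (a' has_field_derivative \<alpha> z * a z + \<beta> z * b z) (at z) \<and>
      (b' has_field_derivative - (\<mu> + \<theta> / z) * b' z + (\<gamma> z * a z - \<alpha> z * b z)) (at z) \<and>
      cmod (a' z) \<le> 18 * (M * (1 + K) * m) / cmod z))"
    for m :: real and x y :: "(complex \<Rightarrow> complex) \<times> (complex \<Rightarrow> complex)"
  have step: "\<exists>y. next_to m x y \<and> good (m / 2) y" if x: "good m x" and m: "0 \<le> m" for m x
  proof -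
    obtain a b where ab: "x = (a, b)" "a holomorphic_on \<Omega>" "b holomorphic_on \<Omega>"
      "\<And>z. z \<in> \<Omega> \<Longrightarrow> cmod (a z) \<le> m" "\<And>z. z \<in> \<Omega> \<Longrightarrow> cmod (b z) \<le> K * m / cmod z"
      using x by (cases x) (auto simp: good_def)
    have "cmod (\<alpha> z * a z + \<beta> z * b z) \<le> M * (1 + K) * m / (cmod z)^2" if z: "z \<in> \<Omega>" for z
    proof -
      have z1: "0 < cmod z" using \<Omega>_norm_ge_1[OF z] by linarith
      have "cmod (\<alpha> z * a z) \<le> M / (cmod z)^2 * m"
        unfolding norm_mult using M z by (intro mult_mono \<alpha> ab) auto
      moreover have "cmod (\<beta> z * b z) \<le> M / cmod z * (K * m / cmod z)"
        unfolding norm_mult using M z by (intro mult_mono \<beta> ab) auto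
      moreover have "M / (cmod z)^2 * m + M / cmod z * (K * m / cmod z) = M * (1 + K) * m / (cmod z)^2"
        using z1 by (simp add: field_simps power2_eq_square)
      ultimately show ?thesis using norm_triangle_ineq[of "\<alpha> z * a z" "\<beta> z * b z"] by linarith
    qed
    moreover have "(\<lambda>z. \<alpha> z * a z + \<beta> z * b z) holomorphic_on \<Omega>"
      by (intro holomorphic_intros hol ab)
    ultimately obtain a' where a': "\<And>z. z \<in> \<Omega> \<Longrightarrow> (a' has_field_derivative \<alpha> z * a z + \<beta> z * b z) (at z)"
        "\<And>z. z \<in> \<Omega> \<Longrightarrow> cmod (a' z) \<le> 18 * (M * (1 + K) * m) / cmod z"
      using ray_integral_plain by blast
    have "cmod (\<gamma> z * a z - \<alpha> z * b z) \<le> 2 * M * m / cmod z" if z: "z \<in> \<Omega>" for z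
    proof -
      have z1: "1 \<le> cmod z" by (rule \<Omega>_norm_ge_1[OF z])
      have zK: "K \<le> cmod z" using \<Omega>_norm_ge[OF z] \<rho>(2) by linarith
      have 1: "cmod (\<gamma> z * a z) \<le> M / cmod z * m"
        unfolding norm_mult using M z by (intro mult_mono \<gamma> ab) auto
      have "cmod (\<alpha> z * b z) \<le> M / (cmod z)^2 * (K * m / cmod z)"
        unfolding norm_mult using M z by (intro mult_mono \<alpha> ab) auto
      also have "\<dots> \<le> M / (cmod z)^2 * (cmod z * m / 1)"
        using M m z1 zK K0 by (intro mult_left_mono frac_le mult_right_mono) auto
      also have "\<dots> = M * m / cmod z" using z1 by (simp add: field_simps power2_eq_square)
      finally have 2: "cmod (\<alpha> z * b z) \<le> M * m / cmod z" .
      have "M / cmod z * m + M * m / cmod z = 2 * M * m / cmod z" by simp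
      with 1 2 norm_triangle_ineq4[of "\<gamma> z * a z" "\<alpha> z * b z"] show ?thesis by linarith
    qed
    moreover have "(\<lambda>z. \<gamma> z * a z - \<alpha> z * b z) holomorphic_on \<Omega>"
      by (intro holomorphic_intros hol ab)
    ultimately obtain b' where b': "\<And>z. z \<in> \<Omega> \<Longrightarrow> (b' has_field_derivative - (\<mu> + \<theta> / z) * b' z + (\<gamma> z * a z - \<alpha> z * b z)) (at z)"
        "\<And>z. z \<in> \<Omega> \<Longrightarrow> cmod (b' z) \<le> 3 / (1 - exp (- c / 2)) * (2 * M * m) / cmod z"
      using ray_integral_exponential[OF c \<rho>(1)] by blast
    have "cmod (a' z) \<le> m / 2" if z: "z \<in> \<Omega>" for z
    proof -
      have z1: "1 \<le> cmod z" by (rule \<Omega>_norm_ge_1[OF z])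
      \<comment> \<open>Points of the cone have modulus at least \<open>\<rho> / 3\<close>, which is
        why the hypothesis on \<open>\<rho>\<close> carries the factor
        \<open>108 = 3 * 36\<close>.\<close>
      have "36 * (M * (1 + K)) \<le> cmod z" using \<Omega>_norm_ge[OF z] \<rho>(3) by linarith
      then have "36 * (M * (1 + K)) * m \<le> cmod z * m" using m by (rule mult_right_mono)
      then have "18 * (M * (1 + K) * m) / cmod z \<le> m / 2"
        using z1 m by (simp add: divide_le_eq field_simps)
      then show ?thesis using a'(2)[OF z] by linarith
    qed
    moreover have "cmod (b' z) \<le> K * (m / 2) / cmod z" if z: "z \<in> \<Omega>" for z
    proof -
      have "3 / (1 - exp (- c / 2)) * (2 * M * m) = K * (m / 2)"
        using ex by (simp add: K_def dominant_const_def field_simps)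
      then show ?thesis using b'(2)[OF z] by (simp only:)
    qed
    moreover have "a' holomorphic_on \<Omega>" "b' holomorphic_on \<Omega>"
      using a'(1) b'(1) by (auto simp: holomorphic_on_open[OF open_\<Omega>])
    ultimately have "next_to m x (a', b') \<and> good (m / 2) (a', b')"
      unfolding next_to_def good_def ab(1) using a' b'(1) by auto
    then show ?thesis by blast
  qed
  have "\<exists>X. \<forall>n. good ((1/2) ^ n) (X n) \<and> (next_to ((1/2) ^ n) (X n) (X (Suc n))) \<and> (n = 0 \<longrightarrow> X n = (\<lambda>_. 1, \<lambda>_. 0))"
  proof -
    have "\<exists>X. \<forall>n. (good ((1/2) ^ n) (X n) \<and> (n = 0 \<longrightarrow> X n = (\<lambda>_. 1, \<lambda>_. 0))) \<and> next_to ((1/2) ^ n) (X n) (X (Suc n))"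
    proof (rule dependent_nat_choice)
      show "\<exists>x. good ((1/2) ^ 0) x \<and> (0 = (0::nat) \<longrightarrow> x = (\<lambda>_. 1, \<lambda>_. 0))"
        using K0 by (auto simp: good_def)
      show "\<exists>y. (good ((1/2) ^ Suc n) y \<and> (Suc n = 0 \<longrightarrow> y = (\<lambda>_. 1, \<lambda>_. 0))) \<and> next_to ((1/2) ^ n) x y"
        if "good ((1/2) ^ n) x \<and> (n = 0 \<longrightarrow> x = (\<lambda>_. 1, \<lambda>_. 0))" for x n
        using step[of "(1/2) ^ n" x] that by auto
    qed
    then show ?thesis by blast
  qed
  then obtain X where X: "\<And>n. good ((1/2) ^ n) (X n)" "\<And>n. next_to ((1/2) ^ n) (X n) (X (Suc n))" "X 0 = (\<lambda>_. 1, \<lambda>_. 0)"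
    by blast
  define a where "a n = fst (X n)" for n
  define b where "b n = snd (X n)" for n
  have ab0: "a 0 = (\<lambda>_. 1)" "b 0 = (\<lambda>_. 0)" by (simp_all add: a_def b_def X(3))
  have bds: "cmod (a n z) \<le> (1/2) ^ n" "cmod (b n z) \<le> K / cmod z * (1/2) ^ n" if "z \<in> \<Omega>" for n z
    using X(1)[of n] that by (auto simp: good_def a_def b_def case_prod_unfold)
  have nx: "(a (Suc n) has_field_derivative \<alpha> z * a n z + \<beta> z * b n z) (at z)"
      "(b (Suc n) has_field_derivative - (\<mu> + \<theta> / z) * b (Suc n) z + (\<gamma> z * a n z - \<alpha> z * b n z)) (at z)"
      "cmod (a (Suc n) z) \<le> 18 * (M * (1 + K)) / cmod z * (1/2) ^ n" if "z \<in> \<Omega>" for n z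
    using X(2)[of n] that by (auto simp: next_to_def a_def b_def case_prod_unfold mult.assoc)
  have geo: "summable (\<lambda>n. C * (1/2 :: real) ^ n)" for C by (intro summable_mult summable_geometric) simp
  have geo_sum: "(\<Sum>n. C * (1/2 :: real) ^ n) = 2 * C" for C
    by (subst suminf_mult[OF summable_geometric]) (simp_all add: suminf_geometric)
  \<comment> \<open>The derivative of each correction has its source in the preceding one; the
    constant start \<open>(1, 0)\<close> has no source.\<close>
  define a' where "a' n z = (case n of 0 \<Rightarrow> 0 | Suc k \<Rightarrow> \<alpha> z * a k z + \<beta> z * b k z)" for n z
  define b' where "b' n z = - (\<mu> + \<theta> / z) * b n z + (case n of 0 \<Rightarrow> 0 | Suc k \<Rightarrow> \<gamma> z * a k z - \<alpha> z * b k z)" for n z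
  have "\<exists>g g'. \<forall>z\<in>\<Omega>. (\<lambda>n. a n z) sums g z \<and> (\<lambda>n. a' n z) sums g' z \<and> (g has_field_derivative g' z) (at z)"
  proof (rule series_and_derivative_comparison_local[OF open_\<Omega>])
    show "(a n has_field_derivative a' n z) (at z)" if "z \<in> \<Omega>" for n z
      using nx(1)[OF that] by (cases n) (auto simp: a'_def ab0)
    show "\<exists>d h. 0 < d \<and> summable h \<and> (\<forall>\<^sub>F n in sequentially. \<forall>y\<in>ball z d \<inter> \<Omega>. cmod (a n y) \<le> h n)" for z
      using bds(1) geo[of 1] by (intro exI[of _ 1] exI[of _ "\<lambda>n. (1/2) ^ n"]) auto
  qed
  then obtain u1 u1' where u1: "\<And>z. z \<in> \<Omega> \<Longrightarrow> (\<lambda>n. a n z) sums u1 z" "\<And>z. z \<in> \<Omega> \<Longrightarrow> (\<lambda>n. a' n z) sums u1' z"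
      "\<And>z. z \<in> \<Omega> \<Longrightarrow> (u1 has_field_derivative u1' z) (at z)" by blast
  have "\<exists>g g'. \<forall>z\<in>\<Omega>. (\<lambda>n. b n z) sums g z \<and> (\<lambda>n. b' n z) sums g' z \<and> (g has_field_derivative g' z) (at z)"
  proof (rule series_and_derivative_comparison_local[OF open_\<Omega>])
    show "(b n has_field_derivative b' n z) (at z)" if "z \<in> \<Omega>" for n z
      using nx(2)[OF that] by (cases n) (auto simp: b'_def ab0)
    have "cmod (b n y) \<le> K * (1/2) ^ n" if "y \<in> \<Omega>" for n y
    proof -
      have "K / cmod y \<le> K / 1" using \<Omega>_norm_ge_1[OF that] K0 by (intro divide_left_mono) auto
      then have "K / cmod y * (1/2) ^ n \<le> K * (1/2) ^ n" by (intro mult_right_mono) auto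
      then show ?thesis using bds(2)[OF that, of n] by linarith
    qed
    then show "\<exists>d h. 0 < d \<and> summable h \<and> (\<forall>\<^sub>F n in sequentially. \<forall>y\<in>ball z d \<inter> \<Omega>. cmod (b n y) \<le> h n)" for z
      using geo[of K] by (intro exI[of _ 1] exI[of _ "\<lambda>n. K * (1/2) ^ n"]) auto
  qed
  then obtain u2 u2' where u2: "\<And>z. z \<in> \<Omega> \<Longrightarrow> (\<lambda>n. b n z) sums u2 z" "\<And>z. z \<in> \<Omega> \<Longrightarrow> (\<lambda>n. b' n z) sums u2' z"
      "\<And>z. z \<in> \<Omega> \<Longrightarrow> (u2 has_field_derivative u2' z) (at z)" by blast
  show ?thesis
  proof (intro exI ballI conjI)
    fix z assume z: "z \<in> \<Omega>"
    have "(\<lambda>n. a' (Suc n) z) sums (\<alpha> z * u1 z + \<beta> z * u2 z)"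
      unfolding a'_def nat.case by (intro sums_add sums_mult u1(1) u2(1) z)
    then have "(\<lambda>n. a' n z) sums (\<alpha> z * u1 z + \<beta> z * u2 z)"
      by (subst (asm) sums_Suc_iff) (simp add: a'_def)
    then have "u1' z = \<alpha> z * u1 z + \<beta> z * u2 z" using u1(2)[OF z] sums_unique2 by blast
    then show "(u1 has_field_derivative \<alpha> z * u1 z + \<beta> z * u2 z) (at z)" using u1(3)[OF z] by simp
    define s where "s n = (case n of 0 \<Rightarrow> 0 | Suc k \<Rightarrow> \<gamma> z * a k z - \<alpha> z * b k z)" for n
    have "(\<lambda>n. s (Suc n)) sums (\<gamma> z * u1 z - \<alpha> z * u2 z)"
      unfolding s_def nat.case by (intro sums_diff sums_mult u1(1) u2(1) z)
    then have "s sums (\<gamma> z * u1 z - \<alpha> z * u2 z)"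
      by (subst (asm) sums_Suc_iff) (simp add: s_def)
    then have "(\<lambda>n. b' n z) sums (- (\<mu> + \<theta> / z) * u2 z + (\<gamma> z * u1 z - \<alpha> z * u2 z))"
      unfolding b'_def s_def[symmetric] by (intro sums_add sums_mult u2(1) z)
    then have "u2' z = \<gamma> z * u1 z - (\<mu> + \<theta> / z + \<alpha> z) * u2 z"
      using u2(2)[OF z] sums_unique2 by (fastforce simp: algebra_simps)
    then show "(u2 has_field_derivative \<gamma> z * u1 z - (\<mu> + \<theta> / z + \<alpha> z) * u2 z) (at z)" using u2(3)[OF z] by simp
    have "(\<lambda>n. a (Suc n) z) sums (u1 z - a 0 z)" using u1(1)[OF z] by (subst sums_Suc_iff[of "\<lambda>n. a n z"]) simp
    then have "u1 z - 1 = (\<Sum>n. a (Suc n) z)" by (simp add: ab0 sums_unique)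
    also have "cmod \<dots> \<le> (\<Sum>n. 18 * (M * (1 + K)) / cmod z * (1/2) ^ n)"
      by (rule norm_suminf_le[OF nx(3)[OF z] geo])
    finally show "cmod (u1 z - 1) \<le> 36 * (M * (1 + K)) / cmod z" unfolding geo_sum by simp
    have "u2 z = (\<Sum>n. b n z)" using u2(1)[OF z] by (rule sums_unique)
    also have "cmod \<dots> \<le> (\<Sum>n. K / cmod z * (1/2) ^ n)"
      by (rule norm_suminf_le[OF bds(2)[OF z] geo])
    finally show "cmod (u2 z) \<le> 2 * K / cmod z" unfolding geo_sum by simp
  qed
qed

end

text \<open>The directions at angle \<open>\<plusminus> arcsin (3/5)\<close> to the bisector: one solution is recessive along each.
  The cone with half opening angle \<open>arccos (-7/10)\<close> around either of them contains the sector of half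
  opening angle \<open>\<pi>/2 + arcsin (1/10)\<close> up to a bounded set, as 36.9 + 95.8 < 134.4 degrees.\<close>

definition sector_ray :: "complex \<Rightarrow> real \<Rightarrow> complex" where
  "sector_ray u \<sigma> = sgn u * Complex (4/5) (\<sigma> * (3/5))"

lemma norm_sector_ray:
  assumes "u \<noteq> 0" "\<sigma> = 1 \<or> \<sigma> = - 1"
  shows "cmod (sector_ray u \<sigma>) = 1"
proof -
  have "cmod (Complex (4/5) (\<sigma> * (3/5))) = sqrt ((4/5)^2 + (3/5)^2)"
    using assms(2) by (auto simp: complex_norm power_mult_distrib)
  also have "(4/5 :: real)^2 + (3/5)^2 = 1" by (simp add: power2_eq_square)
  finally show ?thesis using assms(1) by (simp add: sector_ray_def norm_mult norm_sgn)
qed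

lemma sgn_mult_cnj: "u \<noteq> 0 \<Longrightarrow> z / sgn u = z * cnj (sgn u)" for u z :: complex
proof -
  assume "u \<noteq> 0"
  then have "sgn u * cnj (sgn u) = 1" by (simp add: complex_norm_square[symmetric] norm_sgn)
  moreover have "sgn u \<noteq> 0" using \<open>u \<noteq> 0\<close> by (simp add: sgn_zero_iff)
  ultimately show ?thesis by (simp add: field_simps)
qed

text \<open>Relative to an axis tilted by arcsin (3/5), points of the sector satisfy the cone
  inequality at the origin with \<open>4/5 * 1/10 + 3/5 = 68/100\<close> in place of 7/10. Moving
  the vertex out by \<open>\<rho>\<close> costs at most \<open>(1 + 7/10) * \<rho>\<close>, which
  the gap of 2/100 pays for once \<open>|z| > 85 * \<rho>\<close>.\<close>

lemma sector_subset_cone: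
  assumes u: "u \<noteq> 0" and \<sigma>: "\<sigma> = 1 \<or> \<sigma> = - 1" and rho: "3 \<le> \<rho>" "85 * \<rho> \<le> R" and z: "z \<in> sector (1/10) R u"
  shows "z \<in> ray_cone.\<Omega> (sector_ray u \<sigma>) \<rho>"
proof -
  interpret ray_cone "sector_ray u \<sigma>" \<rho>
    by unfold_locales (use norm_sector_ray[OF u \<sigma>] rho in auto)
  define x where "x = z / sgn u"
  have nx: "cmod x = cmod z" using u by (simp add: x_def norm_divide norm_sgn)
  have zx: "R < cmod z" "- (1/10) * cmod z < Re x" using z by (auto simp: sector_def x_def)
  have "z * cnj (sector_ray u \<sigma>) = x * Complex (4/5) (- \<sigma> * (3/5))"
    unfolding sector_ray_def x_def sgn_mult_cnj[OF u] by (simp add: complex_eq_iff algebra_simps)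
  then have Re: "Re (z * cnj (sector_ray u \<sigma>)) = 4/5 * Re x + \<sigma> * (3/5) * Im x"
    by (simp add: algebra_simps)
  have "\<bar>Im x\<bar> \<le> cmod z" using abs_Im_le_cmod[of x] nx by simp
  then have "- (3/5) * cmod z \<le> \<sigma> * (3/5) * Im x" using \<sigma> by auto
  then have low: "- (68/100) * cmod z \<le> Re (z * cnj (sector_ray u \<sigma>))"
    unfolding Re using zx(2) by linarith
  have r: "Re ((z - of_real \<rho> * sector_ray u \<sigma>) * cnj (sector_ray u \<sigma>)) = Re (z * cnj (sector_ray u \<sigma>)) - \<rho>"
    using Re_add_\<omega>[of z "- \<rho>"] by simp
  have "cmod z - \<rho> \<le> cmod (z - of_real \<rho> * sector_ray u \<sigma>)"
    using norm_triangle_ineq2[of z "of_real \<rho> * sector_ray u \<sigma>"] norm_sector_ray[OF u \<sigma>] \<rho> by (simp add: norm_mult)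
  then show ?thesis unfolding \<Omega>_def mem_Collect_eq r using low zx(1) rho by linarith
qed

text \<open>The half opening angle is less than \<open>\<pi>\<close>, so the sector misses the
  direction opposite to its bisector, where \<open>sector_log\<close> has its cut.\<close>

lemma sector_avoids_cut:
  assumes "z \<in> sector (1/10) R u" "u \<noteq> 0" "1 \<le> R"
  shows "z / u \<notin> \<real>\<^sub>\<le>\<^sub>0"
proof
  assume "z / u \<in> \<real>\<^sub>\<le>\<^sub>0"
  then obtain x where x: "x \<le> 0" "z / u = of_real x" by (auto elim: nonpos_Reals_cases)
  have "z / sgn u = of_real x * of_real (cmod u)"
    using x(2) assms(2) by (simp add: sgn_eq field_simps)
  then have "z / sgn u = of_real (x * cmod u)" by simp
  then have "Re (z / sgn u) = x * cmod u" by (simp only: Re_complex_of_real)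
  moreover have "cmod z = \<bar>x\<bar> * cmod u"
    using arg_cong[OF x(2), of cmod] assms(2) by (simp add: norm_divide field_simps)
  ultimately have "- (1/10) * (\<bar>x\<bar> * cmod u) < x * cmod u" "1 < \<bar>x\<bar> * cmod u"
    using assms(1,3) by (auto simp: sector_def)
  then show False using x(1) by simp
qed

lemma sector_log_derivative:
  assumes "z \<in> sector (1/10) R u" "u \<noteq> 0" "1 \<le> R"
  shows "(sector_log u has_field_derivative 1 / z) (at z)"
proof -
  have z: "z \<noteq> 0" using assms by (auto simp: sector_def)
  have "((\<lambda>z. Ln (z / u) + Ln u) has_field_derivative inverse (z / u) * (1 / u) + 0) (at z)"
    by (rule derivative_eq_intros refl sector_avoids_cut[OF assms] | use assms in simp)+
  then show ?thesis using assms(2) z by (simp add: sector_log_def[abs_def] field_simps)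
qed

text \<open>The sector is a rotated image under the exponential of a convex half strip; the half
  width of the strip is the angle with cosine \<open>- \<delta>\<close>.\<close>

lemma connected_sector:
  assumes "u \<noteq> 0" "0 < \<delta>" "\<delta> < 1" "1 \<le> R"
  shows "connected (sector \<delta> R u)"
proof -
  define a where "a = arccos (- \<delta>)"
  have a: "0 \<le> a" "a \<le> pi" "cos a = - \<delta>"
    using assms by (simp_all add: a_def arccos_lbound arccos_ubound)
  define V where "V = {w. ln R < Re w} \<inter> {w. Im w < a} \<inter> {w. - a < Im w}"
  have "convex V" unfolding V_def
    by (intro convex_Int convex_halfspace_Re_gt convex_halfspace_Im_lt convex_halfspace_Im_gt)
  then have "connected ((\<lambda>w. sgn u * exp w) ` V)"
    by (intro connected_continuous_image convex_connected continuous_intros)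
  moreover have "(\<lambda>w. sgn u * exp w) ` V = sector \<delta> R u"
  proof (intro set_eqI iffI)
    have s: "cmod (sgn u) = 1" "sgn u \<noteq> 0" using assms(1) by (simp_all add: norm_sgn sgn_zero_iff)
    fix z
    { assume "z \<in> (\<lambda>w. sgn u * exp w) ` V"
      then obtain w where w: "ln R < Re w" "\<bar>Im w\<bar> < a" "z = sgn u * exp w" by (auto simp: V_def)
      have "R < exp (Re w)" using exp_less_mono[OF w(1)] assms(4) by simp
      moreover have "- \<delta> < cos (Im w)"
        using cos_monotone_0_pi[of "\<bar>Im w\<bar>" a] w(2) a by simp
      then have "- \<delta> * exp (Re w) < cos (Im w) * exp (Re w)" by (intro mult_strict_right_mono) auto
      ultimately show "z \<in> sector \<delta> R u"
        unfolding sector_def w(3) using s by (simp add: norm_mult Re_exp mult.commute) }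
    { assume z: "z \<in> sector \<delta> R u"
      define x where "x = z / sgn u"
      have nx: "cmod x = cmod z" using s by (simp add: x_def norm_divide)
      have x0: "x \<noteq> 0" using z assms(4) nx by (auto simp: sector_def)
      have "Re (exp (Ln x)) = cmod x * cos (Im (Ln x))" using x0 by (simp only: Re_exp Re_Ln exp_ln) (simp add: Re_Ln)
      then have "- \<delta> * cmod x < cmod x * cos (Im (Ln x))"
        using z x0 nx by (simp add: sector_def x_def)
      then have "cmod x * (- \<delta>) < cmod x * cos (Im (Ln x))" by (simp add: mult.commute)
      then have "- \<delta> < cos (Im (Ln x))" by (rule mult_left_less_imp_less) simp
      then have "cos a < cos \<bar>Im (Ln x)\<bar>" using a by simp
      then have "\<bar>Im (Ln x)\<bar> < a"
        using cos_monotone_0_pi_le[of a "\<bar>Im (Ln x)\<bar>"] a Im_Ln_le_pi[OF x0] mpi_less_Im_Ln[OF x0] by force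
      moreover have "ln R < Re (Ln x)"
      proof -
        have zR: "R < cmod z" using z by (simp add: sector_def)
        then have "0 < cmod z" using assms(4) by linarith
        then have "ln R < ln (cmod z)" using zR assms(4) by (subst ln_less_cancel_iff) linarith+
        then show ?thesis using x0 nx by (simp add: Re_Ln)
      qed
      moreover have "z = sgn u * exp (Ln x)" using x0 s by (simp add: x_def)
      ultimately show "z \<in> (\<lambda>w. sgn u * exp w) ` V" by (auto simp: V_def) }
  qed
  ultimately show ?thesis by simp
qed

text \<open>Collects the lower bounds imposed on \<open>\<rho>\<close>. The 6 keeps the cone inside
  \<open>|z| \<ge> 2\<close>, where the coefficient estimates are available. The parameter
  \<open>t\<close> does not enter, so the radius and the error constant below are uniform in
  it.\<close>

definition cone_radius :: "real \<Rightarrow> real \<Rightarrow> complex \<Rightarrow> real" where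
  "cone_radius c M \<theta> = Max {6, 18 * cmod \<theta> / c, 3 * dominant_const c M, 108 * (M * (1 + dominant_const c M))}"

definition error_const :: "real \<Rightarrow> real \<Rightarrow> real" where
  "error_const c M = max (36 * (M * (1 + dominant_const c M))) (2 * dominant_const c M)"

lemma cone_radius_ge:
  "6 \<le> cone_radius c M \<theta>" "18 * cmod \<theta> / c \<le> cone_radius c M \<theta>" "3 * dominant_const c M \<le> cone_radius c M \<theta>"
  "108 * (M * (1 + dominant_const c M)) \<le> cone_radius c M \<theta>"
  unfolding cone_radius_def by (intro Max_ge; simp)+

lemma recessive_column:
  fixes \<alpha> \<beta> \<gamma> :: "complex \<Rightarrow> complex" and \<mu> \<theta> u :: complex and \<sigma> c M :: real
  defines "R \<equiv> 85 * cone_radius c M \<theta>"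
  assumes u: "u \<noteq> 0" and \<sigma>: "\<sigma> = 1 \<or> \<sigma> = - 1"
    and c: "0 < c" "Re (\<mu> * sector_ray u \<sigma>) \<le> - c" and M: "0 \<le> M"
    and hol: "\<alpha> holomorphic_on - cball 0 1" "\<beta> holomorphic_on - cball 0 1" "\<gamma> holomorphic_on - cball 0 1"
    and \<alpha>: "\<And>z. 2 \<le> cmod z \<Longrightarrow> cmod (\<alpha> z) \<le> M / (cmod z)^2"
    and \<beta>: "\<And>z. 2 \<le> cmod z \<Longrightarrow> cmod (\<beta> z) \<le> M / cmod z"
    and \<gamma>: "\<And>z. 2 \<le> cmod z \<Longrightarrow> cmod (\<gamma> z) \<le> M / cmod z"
  obtains u1 u2 where
    "\<And>z. z \<in> sector (1/10) R u \<Longrightarrow> (u1 has_field_derivative \<alpha> z * u1 z + \<beta> z * u2 z) (at z)"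
    "\<And>z. z \<in> sector (1/10) R u \<Longrightarrow> (u2 has_field_derivative \<gamma> z * u1 z - (\<mu> + \<theta> / z + \<alpha> z) * u2 z) (at z)"
    "\<And>z. z \<in> sector (1/10) R u \<Longrightarrow> cmod (u1 z - 1) \<le> error_const c M / cmod z"
    "\<And>z. z \<in> sector (1/10) R u \<Longrightarrow> cmod (u2 z) \<le> error_const c M / cmod z"
proof -
  let ?\<rho> = "cone_radius c M \<theta>"
  interpret ray_cone "sector_ray u \<sigma>" ?\<rho>
    by unfold_locales (use norm_sector_ray[OF u \<sigma>] cone_radius_ge(1)[of c M \<theta>] in auto)
  have ge: "2 \<le> cmod z" if "z \<in> \<Omega>" for z using \<Omega>_norm_ge[OF that] cone_radius_ge(1)[of c M \<theta>] by simp
  have sub: "\<Omega> \<subseteq> - cball 0 1" using ge by (force simp: dist_norm)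
  have "\<exists>u1 u2. \<forall>z\<in>\<Omega>. (u1 has_field_derivative \<alpha> z * u1 z + \<beta> z * u2 z) (at z) \<and>
      (u2 has_field_derivative \<gamma> z * u1 z - (\<mu> + \<theta> / z + \<alpha> z) * u2 z) (at z) \<and>
      cmod (u1 z - 1) \<le> 36 * (M * (1 + dominant_const c M)) / cmod z \<and> cmod (u2 z) \<le> 2 * dominant_const c M / cmod z"
    by (rule recessive_solution[OF c M hol[THEN holomorphic_on_subset, OF sub]])
      (use \<alpha> \<beta> \<gamma> ge cone_radius_ge in auto)
  then obtain u1 u2 where U: "\<And>z. z \<in> \<Omega> \<Longrightarrow> (u1 has_field_derivative \<alpha> z * u1 z + \<beta> z * u2 z) (at z)"
      "\<And>z. z \<in> \<Omega> \<Longrightarrow> (u2 has_field_derivative \<gamma> z * u1 z - (\<mu> + \<theta> / z + \<alpha> z) * u2 z) (at z)"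
      "\<And>z. z \<in> \<Omega> \<Longrightarrow> cmod (u1 z - 1) \<le> 36 * (M * (1 + dominant_const c M)) / cmod z"
      "\<And>z. z \<in> \<Omega> \<Longrightarrow> cmod (u2 z) \<le> 2 * dominant_const c M / cmod z" by blast
  have S: "z \<in> \<Omega>" if "z \<in> sector (1/10) R u" for z
    using sector_subset_cone[OF u \<sigma> _ _ that] cone_radius_ge(1)[of c M \<theta>] by (simp add: R_def)
  have e: "x / cmod z \<le> error_const c M / cmod z"
    if "x = 36 * (M * (1 + dominant_const c M)) \<or> x = 2 * dominant_const c M" for x z
    using that by (intro divide_right_mono) (auto simp: error_const_def)
  show ?thesis
  proof
    fix z assume z: "z \<in> sector (1/10) R u"
    show "(u1 has_field_derivative \<alpha> z * u1 z + \<beta> z * u2 z) (at z)" by (rule U(1)[OF S[OF z]])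
    show "(u2 has_field_derivative \<gamma> z * u1 z - (\<mu> + \<theta> / z + \<alpha> z) * u2 z) (at z)" by (rule U(2)[OF S[OF z]])
    show "cmod (u1 z - 1) \<le> error_const c M / cmod z" by (rule order_trans[OF U(3)[OF S[OF z]] e]) simp
    show "cmod (u2 z) \<le> error_const c M / cmod z" by (rule order_trans[OF U(4)[OF S[OF z]] e]) simp
  qed
qed

text \<open>The two columns are recessive along the two rays, and each keeps its asymptotics on the
  whole sector.\<close>

lemma canonical_solution:
  fixes A :: "complex \<Rightarrow> mat2" and \<alpha> :: "complex \<Rightarrow> complex" and t \<theta> u :: complex and \<sigma> c M :: real
  defines "R \<equiv> 85 * cone_radius c M \<theta>"
  assumes u: "u \<noteq> 0" and \<sigma>: "\<sigma> = 1 \<or> \<sigma> = - 1"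
    and c: "0 < c" "Re (t * sector_ray u \<sigma>) \<le> - c" "Re (- t * sector_ray u (- \<sigma>)) \<le> - c" and M: "0 \<le> M"
    and A11: "\<And>z. z \<in> - cball 0 1 \<Longrightarrow> A z $ 1 $ 1 = - (t / 2 + \<theta> / (2 * z) + \<alpha> z)"
    and A22: "\<And>z. A z $ 2 $ 2 = - A z $ 1 $ 1"
    and hol: "\<alpha> holomorphic_on - cball 0 1" "\<And>i j. (\<lambda>z. A z $ i $ j) holomorphic_on - cball 0 1"
    and \<alpha>: "\<And>z. 2 \<le> cmod z \<Longrightarrow> cmod (\<alpha> z) \<le> M / (cmod z)^2"
    and A12: "\<And>z. 2 \<le> cmod z \<Longrightarrow> cmod (A z $ 1 $ 2) \<le> M / cmod z"
    and A21: "\<And>z. 2 \<le> cmod z \<Longrightarrow> cmod (A z $ 2 $ 1) \<le> M / cmod z"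
  obtains Z where
    "\<And>z i j. z \<in> sector (1/10) R u \<Longrightarrow> ((\<lambda>z. (Z z ** exp_diag (formal_exponent \<theta> u z t)) $ i $ j)
        has_field_derivative (- (A z ** (Z z ** exp_diag (formal_exponent \<theta> u z t)))) $ i $ j) (at z)"
    "\<And>z i j. z \<in> sector (1/10) R u \<Longrightarrow> cmod (Z z $ i $ j - mat 1 $ i $ j) \<le> error_const c M / cmod z"
proof -
  let ?S = "sector (1/10) R u"
  have R: "1 \<le> R" using cone_radius_ge(1)[of c M \<theta>] by (simp add: R_def)
  have SA: "z \<in> - cball 0 1" if "z \<in> ?S" for z using that R by (simp add: sector_def)
  obtain u1 u2 where U: "\<And>z. z \<in> ?S \<Longrightarrow> (u1 has_field_derivative \<alpha> z * u1 z + (- A z $ 1 $ 2) * u2 z) (at z)"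
    "\<And>z. z \<in> ?S \<Longrightarrow> (u2 has_field_derivative (- A z $ 2 $ 1) * u1 z - (t + \<theta> / z + \<alpha> z) * u2 z) (at z)"
    "\<And>z. z \<in> ?S \<Longrightarrow> cmod (u1 z - 1) \<le> error_const c M / cmod z"
    "\<And>z. z \<in> ?S \<Longrightarrow> cmod (u2 z) \<le> error_const c M / cmod z"
    unfolding R_def
    by (rule recessive_column[OF u \<sigma> c(1,2) M, of \<alpha> "\<lambda>z. - A z $ 1 $ 2" "\<lambda>z. - A z $ 2 $ 1" \<theta>])
      (use hol \<alpha> A12 A21 in \<open>auto intro: holomorphic_intros\<close>)
  have cr: "cone_radius c M (- \<theta>) = cone_radius c M \<theta>" by (simp add: cone_radius_def)
  have \<sigma>': "- \<sigma> = 1 \<or> - \<sigma> = - 1" using \<sigma> by auto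
  \<comment> \<open>Exchanging the two coordinates negates \<open>t\<close>, \<open>\<theta>\<close>
    and \<open>\<alpha>\<close>, interchanges the off-diagonal entries, and makes the other ray the
    recessive one.\<close>
  obtain v1 v2 where V: "\<And>z. z \<in> ?S \<Longrightarrow> (v1 has_field_derivative - \<alpha> z * v1 z + (- A z $ 2 $ 1) * v2 z) (at z)"
    "\<And>z. z \<in> ?S \<Longrightarrow> (v2 has_field_derivative (- A z $ 1 $ 2) * v1 z - (- t + - \<theta> / z + - \<alpha> z) * v2 z) (at z)"
    "\<And>z. z \<in> ?S \<Longrightarrow> cmod (v1 z - 1) \<le> error_const c M / cmod z"
    "\<And>z. z \<in> ?S \<Longrightarrow> cmod (v2 z) \<le> error_const c M / cmod z"
    unfolding R_def
    by (rule recessive_column[OF u \<sigma>' c(1,3) M, of "\<lambda>z. - \<alpha> z" "\<lambda>z. - A z $ 2 $ 1" "\<lambda>z. - A z $ 1 $ 2" "- \<theta>"])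
      (use hol \<alpha> A12 A21 cr in \<open>auto intro: holomorphic_intros\<close>)
  define Z where "Z z = mat22 (u1 z) (v2 z) (u2 z) (v1 z)" for z
  show ?thesis
  proof
    fix z assume z: "z \<in> ?S"
    let ?\<phi> = "\<lambda>z. formal_exponent \<theta> u z t"
    have z0: "z \<noteq> 0" using SA[OF z] by auto
    have \<phi>: "(?\<phi> has_field_derivative t / 2 + \<theta> / (2 * z)) (at z)"
      unfolding formal_exponent_def
      by (auto intro!: derivative_eq_intros sector_log_derivative[OF z u R])
    note E = DERIV_chain2[OF DERIV_exp \<phi>] DERIV_chain2[OF DERIV_exp DERIV_minus[OF \<phi>]]
    have d11: "((\<lambda>z. u1 z * exp (?\<phi> z)) has_field_derivative - (A z $ 1 $ 1 * (u1 z * exp (?\<phi> z)) + A z $ 1 $ 2 * (u2 z * exp (?\<phi> z)))) (at z)"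
      by (rule DERIV_cong[OF DERIV_mult[OF U(1)[OF z] E(1)]]) (simp add: A11[OF SA[OF z]] algebra_simps)
    have d21: "((\<lambda>z. u2 z * exp (?\<phi> z)) has_field_derivative - (A z $ 2 $ 1 * (u1 z * exp (?\<phi> z)) + A z $ 2 $ 2 * (u2 z * exp (?\<phi> z)))) (at z)"
      by (rule DERIV_cong[OF DERIV_mult[OF U(2)[OF z] E(1)]]) (use z0 in \<open>simp add: A22 A11[OF SA[OF z]] field_simps\<close>)
    have d22: "((\<lambda>z. v1 z * exp (- ?\<phi> z)) has_field_derivative - (A z $ 2 $ 1 * (v2 z * exp (- ?\<phi> z)) + A z $ 2 $ 2 * (v1 z * exp (- ?\<phi> z)))) (at z)"
      by (rule DERIV_cong[OF DERIV_mult[OF V(1)[OF z] E(2)]]) (simp add: A22 A11[OF SA[OF z]] algebra_simps)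
    have d12: "((\<lambda>z. v2 z * exp (- ?\<phi> z)) has_field_derivative - (A z $ 1 $ 1 * (v2 z * exp (- ?\<phi> z)) + A z $ 1 $ 2 * (v1 z * exp (- ?\<phi> z)))) (at z)"
      by (rule DERIV_cong[OF DERIV_mult[OF V(2)[OF z] E(2)]]) (use z0 in \<open>simp add: A11[OF SA[OF z]] field_simps\<close>)
    have "\<forall>i j. ((\<lambda>z. (Z z ** exp_diag (?\<phi> z)) $ i $ j) has_field_derivative (- (A z ** (Z z ** exp_diag (?\<phi> z)))) $ i $ j) (at z)"
      unfolding forall_2 using d11 d12 d21 d22 by (simp add: mat2_mult_nth Z_def exp_diag_def)
    then show "((\<lambda>z. (Z z ** exp_diag (?\<phi> z)) $ i $ j) has_field_derivative (- (A z ** (Z z ** exp_diag (?\<phi> z)))) $ i $ j) (at z)" for i j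
      by blast
    have "\<forall>i j. cmod (Z z $ i $ j - mat 1 $ i $ j) \<le> error_const c M / cmod z"
      unfolding forall_2 using U(3,4)[OF z] V(3,4)[OF z] by (simp add: Z_def mat_def)
    then show "cmod (Z z $ i $ j - mat 1 $ i $ j) \<le> error_const c M / cmod z" for i j by blast
  qed
qed

section \<open>Transport of the canonical solutions along the flow\<close>

lemma solutions_quotient_constant:
  fixes D :: "complex set" and X Y N :: "complex \<Rightarrow> mat2"
  assumes D: "connected D" "open D" "s \<in> D" "t \<in> D"
    and X: "\<And>x i j. x \<in> D \<Longrightarrow> ((\<lambda>x. X x $ i $ j) has_field_derivative (- (N x ** X x)) $ i $ j) (at x)"
    and Y: "\<And>x i j. x \<in> D \<Longrightarrow> ((\<lambda>x. Y x $ i $ j) has_field_derivative (- (N x ** Y x)) $ i $ j) (at x)"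
    and tr: "\<And>x. x \<in> D \<Longrightarrow> N x $ 2 $ 2 = - N x $ 1 $ 1" and det: "\<And>x. x \<in> D \<Longrightarrow> det (X x) = 1"
  shows "inv2 (X s) ** Y s = inv2 (X t) ** Y t"
proof -
  define P where "P x = mat22 (X x $ 2 $ 2) (- X x $ 1 $ 2) (- X x $ 2 $ 1) (X x $ 1 $ 1)" for x
  have P: "inv2 (X x) = P x" if "x \<in> D" for x
    unfolding P_def by (rule inv2_det_1[OF det[OF that]])
  have P_der: "\<forall>i j. ((\<lambda>x. P x $ i $ j) has_field_derivative (P x ** N x) $ i $ j) (at x)" if x: "x \<in> D" for x
  proof -
    note d = X[OF x] and tr = tr[OF x]
    show ?thesis
      unfolding forall_2 P_def mat22_nth
      by (intro conjI DERIV_cong[OF d[of 1 1]] DERIV_cong[OF d[of 2 2]] DERIV_cong[OF DERIV_minus[OF d[of 1 2]]]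
          DERIV_cong[OF DERIV_minus[OF d[of 2 1]]]) (simp_all add: mat2_mult_nth tr algebra_simps)
  qed
  have "(P s ** Y s) $ i $ j = (P t ** Y t) $ i $ j" for i j
  proof (rule zero_derivative_imp_eq[OF D, where f = "\<lambda>x. (P x ** Y x) $ i $ j"])
    fix x assume x: "x \<in> D"
    have "((\<lambda>x. (P x ** Y x) $ i $ j) has_field_derivative ((P x ** N x) ** Y x + P x ** (- (N x ** Y x))) $ i $ j) (at x)"
      unfolding vector_add_component mat2_mult_nth[of "P _" "Y _"] mat2_mult_nth[of "P x ** N x"] mat2_mult_nth[of "P x" "- _"]
      by (rule derivative_eq_intros P_der[OF x, rule_format] Y[OF x] refl)+ (simp add: algebra_simps)
    moreover have "(P x ** N x) ** Y x + P x ** (- (N x ** Y x)) = 0"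
      unfolding mat2_minus_mult matrix_mul_assoc by simp
    ultimately show "((\<lambda>x. (P x ** Y x) $ i $ j) has_field_derivative 0) (at x)" by simp
  qed
  then show ?thesis unfolding P[OF D(3)] P[OF D(4)] by (simp add: vec_eq_iff)
qed

text \<open>On a ray the logarithm grows like \<open>ln x\<close>, so the exponent
  \<open>\<theta>\<close> contributes only a power of \<open>x\<close>, negligible against
  exponential decay.\<close>

lemma sector_log_ray:
  assumes "u \<noteq> 0" "\<sigma> = 1 \<or> \<sigma> = - 1" "1 \<le> x"
  shows "cmod (sector_log u (of_real x * sector_ray u \<sigma>)) \<le> ln x + (cmod (Ln (sector_ray u \<sigma> / u)) + cmod (Ln u))"
proof -
  have "sector_ray u \<sigma> / u \<noteq> 0" using norm_sector_ray[OF assms(1,2)] assms(1) by auto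
  then have "Ln (of_real x * (sector_ray u \<sigma> / u)) = of_real (ln x) + Ln (sector_ray u \<sigma> / u)"
    using assms(3) Ln_times_of_real[of x "sector_ray u \<sigma> / u"] by (simp add: Ln_of_real)
  then have "sector_log u (of_real x * sector_ray u \<sigma>) = of_real (ln x) + (Ln (sector_ray u \<sigma> / u) + Ln u)"
    by (simp add: sector_log_def)
  also have "cmod \<dots> \<le> cmod (of_real (ln x)) + (cmod (Ln (sector_ray u \<sigma> / u)) + cmod (Ln u))"
    by (intro norm_triangle_le add_left_mono norm_triangle_ineq)
  also have "cmod (of_real (ln x)) = ln x" using assms(3) by simp
  finally show ?thesis .
qed

lemma sector_ray_in_sector:
  assumes "u \<noteq> 0" "\<sigma> = 1 \<or> \<sigma> = - 1" "1 \<le> R" "R < x"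
  shows "of_real x * sector_ray u \<sigma> \<in> sector (1/10) R u"
proof -
  have "sgn u \<noteq> 0" using assms(1) by (simp add: sgn_zero_iff)
  then have "of_real x * sector_ray u \<sigma> / sgn u = of_real x * Complex (4/5) (\<sigma> * (3/5))"
    by (simp add: sector_ray_def)
  then have "Re (of_real x * sector_ray u \<sigma> / sgn u) = x * (4/5)" by simp
  moreover have "cmod (of_real x * sector_ray u \<sigma>) = x"
    using norm_sector_ray[OF assms(1,2)] assms(3,4) by (simp add: norm_mult)
  ultimately show ?thesis unfolding sector_def using assms(3,4) by simp
qed

lemma exponential_decay:
  fixes c a b K :: real
  assumes "0 < c"
  shows "((\<lambda>x. K * exp (- c * x + a * ln x + b)) \<longlongrightarrow> 0) at_top"
  using assms by real_asymp

lemma norm_mat2_le: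
  fixes M :: mat2
  assumes "\<And>i j. cmod (M $ i $ j) \<le> e"
  shows "norm M \<le> 4 * e"
proof -
  have "norm (M $ i) \<le> 2 * e" for i
  proof -
    have "norm (M $ i) \<le> (\<Sum>j\<in>UNIV. norm (M $ i $ j))"
      unfolding norm_vec_def by (rule L2_set_le_sum) simp
    also have "\<dots> \<le> 2 * e" using assms[of i 1] assms[of i 2] by (simp add: sum_2)
    finally show ?thesis .
  qed
  from this[of 1] this[of 2] have "(\<Sum>i\<in>UNIV. norm (M $ i)) \<le> 4 * e" by (simp add: sum_2)
  moreover have "norm M \<le> (\<Sum>i\<in>UNIV. norm (M $ i))"
    unfolding norm_vec_def by (rule L2_set_le_sum) simp
  ultimately show ?thesis by simp
qed

text \<open>For fixed \<open>t\<close> the transported \<open>Y = \<Phi> Y0\<close> and the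
  canonical \<open>X\<close> solve the same equation, so \<open>Y = X C\<close> with
  \<open>C\<close> free of \<open>z\<close>. An off-diagonal entry of \<open>C\<close> is estimated
  on the ray where its column decays; it is bounded by two decaying exponentials times the growth of
  \<open>\<Phi>\<close>, hence zero. The diagonal entries are the limits of those of
  \<open>Y\<close> times the inverse exponential; passing to the limit in their t-derivative gives
  \<open>C_jj' = - B0_jj C_jj\<close>, which identifies them as \<open>exp (P1 t)\<close> and
  \<open>exp (P2 t)\<close>.\<close>

lemma (in isomonodromy_flow) canonical_solution_transported:
  fixes A :: "complex \<Rightarrow> complex \<Rightarrow> mat2" and \<alpha> :: "complex \<Rightarrow> complex \<Rightarrow> complex"
    and \<theta> u :: complex and \<sigma> c M K\<Phi> M\<Phi> r' :: real
  defines "R \<equiv> 85 * cone_radius c M \<theta>"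
  assumes u: "u \<noteq> 0" and \<sigma>: "\<sigma> = 1 \<or> \<sigma> = - 1" and c: "0 < c" and M: "0 \<le> M" and r': "0 < r'" "r' \<le> r"
    and rays: "\<And>t. t \<in> ball t0 r' \<Longrightarrow> Re (t * sector_ray u \<sigma>) \<le> - c"
       "\<And>t. t \<in> ball t0 r' \<Longrightarrow> Re (- t * sector_ray u (- \<sigma>)) \<le> - c"
    and A11: "\<And>t z. t \<in> ball t0 r' \<Longrightarrow> z \<in> - cball 0 1 \<Longrightarrow> A z t $ 1 $ 1 = - (t / 2 + \<theta> / (2 * z) + \<alpha> t z)"
    and A22: "\<And>t z. A z t $ 2 $ 2 = - A z t $ 1 $ 1"
    and hol: "\<And>t. t \<in> ball t0 r' \<Longrightarrow> \<alpha> t holomorphic_on - cball 0 1"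
       "\<And>t i j. t \<in> ball t0 r' \<Longrightarrow> (\<lambda>z. A z t $ i $ j) holomorphic_on - cball 0 1"
    and \<alpha>: "\<And>t z. t \<in> ball t0 r' \<Longrightarrow> 2 \<le> cmod z \<Longrightarrow> cmod (\<alpha> t z) \<le> M / (cmod z)^2"
    and A12: "\<And>t z. t \<in> ball t0 r' \<Longrightarrow> 2 \<le> cmod z \<Longrightarrow> cmod (A z t $ 1 $ 2) \<le> M / cmod z"
    and A21: "\<And>t z. t \<in> ball t0 r' \<Longrightarrow> 2 \<le> cmod z \<Longrightarrow> cmod (A z t $ 2 $ 1) \<le> M / cmod z"
    and growth: "\<And>z t i j. t \<in> ball t0 r' \<Longrightarrow> cmod (\<Phi> z t $ i $ j) \<le> K\<Phi> * exp (M\<Phi> * cmod z * cmod (t - t0))"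
    and M\<Phi>: "0 \<le> K\<Phi>" "0 \<le> M\<Phi>" "M\<Phi> * r' \<le> c / 2"
    and gauge: "\<And>t z. t \<in> ball t0 r' \<Longrightarrow> z \<in> - cball 0 1 \<Longrightarrow>
        mderiv (\<lambda>z. \<Phi> z t) z + A z t ** \<Phi> z t = \<Phi> z t ** A z t0"
    and P: "P1 t0 = 0" "P2 t0 = 0" "\<And>t. t \<in> ball t0 r \<Longrightarrow> (P1 has_field_derivative - B0 t $ 1 $ 1) (at t)"
      "\<And>t. t \<in> ball t0 r \<Longrightarrow> (P2 has_field_derivative - B0 t $ 2 $ 2) (at t)"
  obtains Y0 where
    "\<And>z i j. z \<in> sector (1/10) R u \<Longrightarrow> ((\<lambda>z. Y0 z $ i $ j) has_field_derivative (- (A z t0 ** Y0 z)) $ i $ j) (at z)"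
    "\<And>z. z \<in> sector (1/10) R u \<Longrightarrow> det (Y0 z) = 1"
    "uniform_limit (ball t0 r') (\<lambda>z t. (\<Phi> z t ** Y0 z) ** exp_diag (- formal_exponent \<theta> u z t))
       (\<lambda>t. mat22 (exp (P1 t)) 0 0 (exp (P2 t))) (inf at_infinity (principal (sector (1/10) R u)))"
proof -
  define S where "S = sector (1/10) R u"
  define D where "D = ball t0 r'"
  define E where "E = error_const c M"
  have R: "1 \<le> R" using cone_radius_ge(1)[of c M \<theta>] by (simp add: R_def)
  have t0: "t0 \<in> D" using r' by (simp add: D_def)
  have Dr: "t \<in> ball t0 r" if "t \<in> D" for t using that r' by (simp add: D_def)
  have S: "open S" "connected S"
    unfolding S_def using u R by (simp_all add: open_sector connected_sector)
  have SR: "R < cmod z" "z \<in> - cball 0 1" "z \<noteq> 0" if "z \<in> S" for z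
    using that R by (auto simp: S_def sector_def)
  let ?\<phi> = "\<lambda>z t. formal_exponent \<theta> u z t"
  \<comment> \<open>The solution is chosen for each \<open>t\<close> by itself; no relation between
    different \<open>t\<close> is available beyond the common error bound.\<close>
  have "\<exists>Z. \<forall>t\<in>D. (\<forall>z\<in>S. \<forall>i j. ((\<lambda>z. (Z t z ** exp_diag (?\<phi> z t)) $ i $ j)
        has_field_derivative (- (A z t ** (Z t z ** exp_diag (?\<phi> z t)))) $ i $ j) (at z)) \<and>
     (\<forall>z\<in>S. \<forall>i j. cmod (Z t z $ i $ j - mat 1 $ i $ j) \<le> E / cmod z)"
  proof (intro bchoice ballI)
    fix t assume t: "t \<in> D"
    then have t': "t \<in> ball t0 r'" by (simp add: D_def)
    show "\<exists>Z. (\<forall>z\<in>S. \<forall>i j. ((\<lambda>z. (Z z ** exp_diag (?\<phi> z t)) $ i $ j)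
        has_field_derivative (- (A z t ** (Z z ** exp_diag (?\<phi> z t)))) $ i $ j) (at z)) \<and>
       (\<forall>z\<in>S. \<forall>i j. cmod (Z z $ i $ j - mat 1 $ i $ j) \<le> E / cmod z)"
    proof (rule canonical_solution[OF u \<sigma> c rays[OF t'] M, of "\<lambda>z. A z t" \<theta> "\<alpha> t"], goal_cases)
      case (8 Z)
      show ?case
        by (rule exI[of _ Z]) (intro conjI ballI allI, (rule 8[folded R_def E_def], simp add: S_def)+)
    next
      case (1 z) show ?case by (rule A11[OF t' 1])
    next
      case (5 z) show ?case by (rule \<alpha>[OF t' 5])
    next
      case (6 z) show ?case by (rule A12[OF t' 6])
    next
      case (7 z) show ?case by (rule A21[OF t' 7])
    qed (rule A22 hol(1)[OF t'] hol(2)[OF t'])+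
  qed
  then obtain Z where Z0: "\<forall>t\<in>D. (\<forall>z\<in>S. \<forall>i j. ((\<lambda>z. (Z t z ** exp_diag (?\<phi> z t)) $ i $ j)
        has_field_derivative (- (A z t ** (Z t z ** exp_diag (?\<phi> z t)))) $ i $ j) (at z)) \<and>
     (\<forall>z\<in>S. \<forall>i j. cmod (Z t z $ i $ j - mat 1 $ i $ j) \<le> E / cmod z)" ..
  have Z: "((\<lambda>z. (Z t z ** exp_diag (?\<phi> z t)) $ i $ j)
        has_field_derivative (- (A z t ** (Z t z ** exp_diag (?\<phi> z t)))) $ i $ j) (at z)"
      "cmod (Z t z $ i $ j - mat 1 $ i $ j) \<le> E / cmod z" if "t \<in> D" "z \<in> S" for t z i j
    using Z0[rule_format, OF that(1), THEN conjunct1, rule_format, OF that(2)]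
      Z0[rule_format, OF that(1), THEN conjunct2, rule_format, OF that(2)] by this+
  define X where "X t z = Z t z ** exp_diag (?\<phi> z t)" for t z
  note X_der = Z(1)[folded X_def]
  define ray where "ray \<tau> x = of_real x * sector_ray u \<tau>" for \<tau> x :: real
  have rayS: "ray \<tau> x \<in> S" "cmod (ray \<tau> x) = x" if "R < x" "\<tau> = 1 \<or> \<tau> = - 1" for \<tau> x
    using sector_ray_in_sector[OF u that(2) R that(1)] norm_sector_ray[OF u that(2)] that R
    by (auto simp: ray_def S_def norm_mult)
  have E0: "0 \<le> E"
  proof -
    have "ray 1 (R + 1) \<in> S" by (rule rayS(1)) auto
    from order_trans[OF norm_ge_zero Z(2)[OF t0 this, of 1 1]]
    have "0 \<le> E / cmod (ray 1 (R + 1))" .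
    then show ?thesis using rayS(2)[of "R + 1" 1] R by (simp add: zero_le_divide_iff)
  qed
  have Zb: "cmod (Z t z $ i $ j) \<le> 1 + E" if "t \<in> D" "z \<in> S" for t z i j
  proof -
    have "1 \<le> cmod z" using SR(1)[OF that(2)] R by simp
    then have "E / cmod z \<le> E / 1" using E0 by (intro divide_left_mono) auto
    moreover have "\<forall>i j. cmod ((mat 1 :: mat2) $ i $ j) \<le> 1" unfolding forall_2 by (simp add: mat_def)
    then have "cmod ((mat 1 :: mat2) $ i $ j) \<le> 1" by blast
    ultimately show ?thesis
      using Z(2)[OF that, of i j] norm_triangle_sub[of "Z t z $ i $ j" "mat 1 $ i $ j"] by simp
  qed
  \<comment> \<open>The determinant does not depend on \<open>z\<close> and tends to 1 along a
    ray.\<close>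
  have X_det: "det (X t z) = 1" if t: "t \<in> D" and z: "z \<in> S" for t z
  proof -
    have const: "det (X t (ray 1 x)) = det (X t z)" if x: "R < x" for x
      by (rule det_constant[OF S(2,1) z rayS(1), where N = "\<lambda>z. - A z t"])
        (use x X_der[OF t] A22 in \<open>auto simp: mat2_minus_mult trace_mat2\<close>)
    have detX: "det (X t z) = det (Z t z)" for z by (simp add: X_def det_mul)
    have lim: "((\<lambda>x. Z t (ray 1 x) $ i $ j) \<longlongrightarrow> mat 1 $ i $ j) at_top" for i j
    proof (rule LIM_zero_cancel)
      show "((\<lambda>x. Z t (ray 1 x) $ i $ j - mat 1 $ i $ j) \<longlongrightarrow> 0) at_top"
      proof (rule Lim_null_comparison)
        show "\<forall>\<^sub>F x in at_top. cmod (Z t (ray 1 x) $ i $ j - mat 1 $ i $ j) \<le> E / x"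
          using eventually_gt_at_top[of R]
        proof eventually_elim
          case (elim x)
          then show ?case using Z(2)[OF t rayS(1)[of x 1], of i j] rayS(2)[of x 1] by simp
        qed
        show "((\<lambda>x. E / x) \<longlongrightarrow> 0) at_top" by real_asymp
      qed
    qed
    have d: "((\<lambda>x. det (Z t (ray 1 x))) \<longlongrightarrow> det (mat 1 :: mat2)) at_top"
      unfolding det_2 by (intro tendsto_intros lim)
    have ev: "\<forall>\<^sub>F x in at_top. det (Z t (ray 1 x)) = det (X t z)"
      using eventually_gt_at_top[of R] by eventually_elim (use const detX in simp)
    from Lim_transform_eventually[OF d ev] show ?thesis by (simp add: tendsto_const_iff)
  qed
  define Y0 where "Y0 = X t0"
  define Y where "Y t z = \<Phi> z t ** Y0 z" for t z
  have Y_der: "((\<lambda>z. Y t z $ i $ j) has_field_derivative (- (A z t ** Y t z)) $ i $ j) (at z)" if t: "t \<in> D" and z: "z \<in> S" for t z i j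
  proof -
    have t': "t \<in> ball t0 r'" using t by (simp add: D_def)
    have d1: "((\<lambda>z. \<Phi> z t $ i $ j) has_field_derivative mderiv (\<lambda>z. \<Phi> z t) z $ i $ j) (at z)" for i j
      unfolding mderiv_nth
      by (rule holomorphic_derivI[OF \<Phi>_entire[OF Dr[OF t]] open_UNIV UNIV_I])
    have d2: "((\<lambda>z. Y0 z $ i $ j) has_field_derivative (- (A z t0 ** Y0 z)) $ i $ j) (at z)" for i j
      unfolding Y0_def by (rule X_der[OF t0 z])
    have "((\<lambda>z. Y t z $ i $ j) has_field_derivative (mderiv (\<lambda>z. \<Phi> z t) z ** Y0 z + \<Phi> z t ** (- (A z t0 ** Y0 z))) $ i $ j) (at z)"
      unfolding Y_def vector_add_component mat2_mult_nth[of "\<Phi> _ t" "Y0 _"] mat2_mult_nth[of "mderiv _ _"] mat2_mult_nth[of "\<Phi> z t" "- _"]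
      by (rule derivative_eq_intros d1 d2 refl)+ (simp add: algebra_simps)
    also have "mderiv (\<lambda>z. \<Phi> z t) z ** Y0 z + \<Phi> z t ** (- (A z t0 ** Y0 z)) = - (A z t ** Y t z)"
    proof -
      have "mderiv (\<lambda>z. \<Phi> z t) z = \<Phi> z t ** A z t0 - A z t ** \<Phi> z t"
        using gauge[OF t' SR(2)[OF z]] by (simp add: algebra_simps)
      then show ?thesis
        unfolding Y_def by (simp only:) (simp add: mat2_eq_iff mat2_mult_nth algebra_simps)
    qed
    finally show ?thesis .
  qed
  define z1 where "z1 = ray 1 (R + 1)"
  have z1: "z1 \<in> S" unfolding z1_def by (rule rayS) auto
  define C where "C t = inv2 (X t z1) ** Y t z1" for t
  have C: "C t = inv2 (X t z) ** Y t z" if "t \<in> D" "z \<in> S" for t z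
    unfolding C_def
    by (rule solutions_quotient_constant[OF S(2,1) z1 that(2), where N = "\<lambda>z. A z t"])
      (use X_der Y_der X_det A22 that in auto)
  have YC: "Y t z = X t z ** C t" if "t \<in> D" "z \<in> S" for t z
    unfolding C[OF that] matrix_mul_assoc using inv2_mult(2)[of "X t z"] X_det[OF that] by simp
  define e where "e k z t = (if k = (1::2) then exp (?\<phi> z t) else exp (- ?\<phi> z t))" for k z t
  have Xe: "X t z $ i $ j = Z t z $ i $ j * e j z t" for t z i j
  proof -
    have "\<forall>j. X t z $ i $ j = Z t z $ i $ j * e j z t"
      unfolding forall_2 by (simp add: X_def exp_diag_def mat2_mult_nth e_def)
    then show ?thesis by blast
  qed
  have Xb: "cmod (X t z $ i $ j) \<le> (1 + E) * cmod (e j z t)" if "t \<in> D" "z \<in> S" for t z i j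
    unfolding Xe norm_mult by (intro mult_right_mono Zb that) simp
  define G where "G z = 2 * K\<Phi> * exp (M\<Phi> * r' * cmod z)" for z
  have G0: "0 \<le> G z" for z using M\<Phi> by (simp add: G_def)
  have Yb: "cmod (Y t z $ i $ j) \<le> G z * ((1 + E) * cmod (e j z t0))" if t: "t \<in> D" and z: "z \<in> S" for t z i j
  proof -
    have t': "t \<in> ball t0 r'" using t by (simp add: D_def)
    have "M\<Phi> * cmod z * cmod (t - t0) \<le> M\<Phi> * cmod z * r'"
      using t' M\<Phi> by (intro mult_left_mono) (auto simp: dist_norm norm_minus_commute)
    then have "K\<Phi> * exp (M\<Phi> * cmod z * cmod (t - t0)) \<le> K\<Phi> * exp (M\<Phi> * r' * cmod z)"
      using M\<Phi> by (intro mult_left_mono) (auto simp: mult_ac)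
    then have \<Phi>b: "cmod (\<Phi> z t $ i $ k) \<le> K\<Phi> * exp (M\<Phi> * r' * cmod z)" for k
      using growth[OF t', of z i k] by linarith
    have "cmod (\<Phi> z t $ i $ k * Y0 z $ k $ j) \<le> K\<Phi> * exp (M\<Phi> * r' * cmod z) * ((1 + E) * cmod (e j z t0))" for k
      unfolding norm_mult Y0_def by (intro mult_mono \<Phi>b Xb t0 z) (use M\<Phi> in auto)
    from this[of 1] this[of 2] show ?thesis
      unfolding Y_def mat2_mult_nth G_def by (intro order_trans[OF norm_triangle_ineq]) simp
  qed
  \<comment> \<open>Row \<open>i\<close> of the adjugate of \<open>X\<close> consists of entries of
    the opposite column of \<open>X\<close>, so it carries the exponential
    \<open>e (other i)\<close>.\<close>
  define other where "other k = (if k = (1::2) then 2 else (1::2))" for k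
  have Cb: "cmod (C t $ i $ j) \<le> 2 * (1 + E)^2 * G z * (cmod (e (other i) z t) * cmod (e j z t0))"
    if t: "t \<in> D" and z: "z \<in> S" for t z i j
  proof -
    have "\<forall>i. cmod (C t $ i $ j) \<le> 2 * (1 + E)^2 * G z * (cmod (e (other i) z t) * cmod (e j z t0))"
      unfolding forall_2
    proof
      have b: "cmod (x * y - x' * y') \<le> 2 * (1 + E)^2 * G z * (cmod p * cmod (e j z t0))"
        if "cmod x \<le> (1 + E) * cmod p" "cmod x' \<le> (1 + E) * cmod p"
          "cmod y \<le> G z * ((1 + E) * cmod (e j z t0))" "cmod y' \<le> G z * ((1 + E) * cmod (e j z t0))" for x y x' y' p
      proof -
        have "cmod (x * y) \<le> (1 + E) * cmod p * (G z * ((1 + E) * cmod (e j z t0)))"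
          "cmod (x' * y') \<le> (1 + E) * cmod p * (G z * ((1 + E) * cmod (e j z t0)))"
          unfolding norm_mult using that E0 by (intro mult_mono; simp)+
        then show ?thesis
          by (intro order_trans[OF norm_triangle_ineq4]) (simp add: power2_eq_square algebra_simps)
      qed
      note X1 = inv2_det_1[OF X_det[OF t z]]
      have "C t $ 1 $ j = X t z $ 2 $ 2 * Y t z $ 1 $ j - X t z $ 1 $ 2 * Y t z $ 2 $ j"
        unfolding C[OF t z] X1 by (simp add: mat2_mult_nth)
      then show "cmod (C t $ 1 $ j) \<le> 2 * (1 + E)^2 * G z * (cmod (e (other 1) z t) * cmod (e j z t0))"
        using b[OF Xb[OF t z] Xb[OF t z] Yb[OF t z] Yb[OF t z], of 2 2 1 1 2] by (simp add: other_def)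
      have "C t $ 2 $ j = X t z $ 1 $ 1 * Y t z $ 2 $ j - X t z $ 2 $ 1 * Y t z $ 1 $ j"
        unfolding C[OF t z] X1 by (simp add: mat2_mult_nth)
      then show "cmod (C t $ 2 $ j) \<le> 2 * (1 + E)^2 * G z * (cmod (e (other 2) z t) * cmod (e j z t0))"
        using b[OF Xb[OF t z] Xb[OF t z] Yb[OF t z] Yb[OF t z], of 1 1 2 2 1] by (simp add: other_def)
    qed
    then show ?thesis by blast
  qed
  have ray_decay: "cmod (e k (ray \<tau> x) t) \<le> exp (- (c / 2) * x + cmod \<theta> / 2 * (ln x + k0))"
    if t: "t \<in> D" and x: "R < x" and k: "k = 1 \<and> \<tau> = \<sigma> \<or> k = 2 \<and> \<tau> = - \<sigma>"
      and k0: "k0 = cmod (Ln (sector_ray u \<tau> / u)) + cmod (Ln u)" for k \<tau> x t k0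
  proof -
    have t': "t \<in> ball t0 r'" using t by (simp add: D_def)
    have \<tau>: "\<tau> = 1 \<or> \<tau> = - 1" using k \<sigma> by auto
    have sl: "cmod (sector_log u (ray \<tau> x)) \<le> ln x + k0"
      unfolding ray_def k0 by (rule sector_log_ray[OF u \<tau>]) (use x R in simp)
    have "cmod (\<theta> / 2 * sector_log u (ray \<tau> x)) \<le> cmod \<theta> / 2 * (ln x + k0)"
      unfolding norm_mult norm_divide using sl by (intro mult_mono) auto
    then have th: "\<bar>Re (\<theta> / 2 * sector_log u (ray \<tau> x))\<bar> \<le> cmod \<theta> / 2 * (ln x + k0)"
      using abs_Re_le_cmod order_trans by blast
    define s where "s = (if k = 1 then 1 else - 1 :: real)"
    have "e k (ray \<tau> x) t = exp (of_real s * ?\<phi> (ray \<tau> x) t)"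
      by (simp add: e_def s_def)
    then have "cmod (e k (ray \<tau> x) t) = exp (s * Re (?\<phi> (ray \<tau> x) t))" by (simp add: norm_exp_eq_Re)
    also have "Re (?\<phi> (ray \<tau> x) t) = x / 2 * Re (t * sector_ray u \<tau>) + Re (\<theta> / 2 * sector_log u (ray \<tau> x))"
    proof -
      have "?\<phi> (ray \<tau> x) t = of_real (x / 2) * (t * sector_ray u \<tau>) + \<theta> / 2 * sector_log u (ray \<tau> x)"
        by (simp add: formal_exponent_def ray_def)
      then show ?thesis by simp
    qed
    also have "s * (x / 2 * Re (t * sector_ray u \<tau>) + Re (\<theta> / 2 * sector_log u (ray \<tau> x)))
        \<le> - (c / 2) * x + cmod \<theta> / 2 * (ln x + k0)"
    proof -
      have "s * Re (t * sector_ray u \<tau>) \<le> - c"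
        using k rays(1)[OF t'] rays(2)[OF t'] by (auto simp: s_def)
      then have "x / 2 * (s * Re (t * sector_ray u \<tau>)) \<le> x / 2 * (- c)"
        using x R by (intro mult_left_mono) auto
      moreover have "s * Re (\<theta> / 2 * sector_log u (ray \<tau> x)) \<le> cmod \<theta> / 2 * (ln x + k0)"
        using th by (auto simp: s_def)
      moreover have "s * (x / 2 * a + b) = x / 2 * (s * a) + s * b" for a b by (simp add: algebra_simps)
      moreover have "x / 2 * (- c) = - (c / 2) * x" by simp
      ultimately show ?thesis by (metis add_mono)
    qed
    finally show ?thesis by simp
  qed
  \<comment> \<open>For \<open>i \<noteq> j\<close> the row of \<open>X^-1\<close> and the column of
    \<open>Y0\<close> carry the same exponential, and \<open>\<tau>\<close> selects the ray on which
    it decays.\<close>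
  have off: "C t $ i $ j = 0" if t: "t \<in> D" and ij: "i \<noteq> j" for t i j
  proof -
    have o: "other i = j" using ij exhaust_2[of i] exhaust_2[of j] by (auto simp: other_def)
    define \<tau> where "\<tau> = (if j = 1 then \<sigma> else - \<sigma>)"
    have \<tau>: "\<tau> = 1 \<or> \<tau> = - 1" "j = 1 \<and> \<tau> = \<sigma> \<or> j = 2 \<and> \<tau> = - \<sigma>"
      using \<sigma> exhaust_2[of j] by (auto simp: \<tau>_def)
    define k0 where "k0 = cmod (Ln (sector_ray u \<tau> / u)) + cmod (Ln u)"
    define L where "L = 4 * (1 + E)^2 * K\<Phi>"
    have bd: "cmod (C t $ i $ j) \<le> L * exp (- (c / 2) * x + cmod \<theta> * ln x + cmod \<theta> * k0)" if x: "R < x" for x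
    proof -
      let ?b = "exp (- (c / 2) * x + cmod \<theta> / 2 * (ln x + k0))"
      have "cmod (C t $ i $ j) \<le> 2 * (1 + E)^2 * G (ray \<tau> x) * (cmod (e j (ray \<tau> x) t) * cmod (e j (ray \<tau> x) t0))"
        using Cb[OF t rayS(1)[OF x \<tau>(1)], of i j] unfolding o .
      also have "\<dots> \<le> 2 * (1 + E)^2 * G (ray \<tau> x) * (?b * ?b)"
        using G0 by (intro mult_left_mono mult_mono ray_decay[OF t x \<tau>(2) k0_def] ray_decay[OF t0 x \<tau>(2) k0_def]) auto
      also have "\<dots> = L * exp (M\<Phi> * r' * x + (- c * x + cmod \<theta> * (ln x + k0)))"
        unfolding G_def rayS(2)[OF x \<tau>(1)] L_def by (simp add: exp_add[symmetric] algebra_simps)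
      also have "\<dots> \<le> L * exp (- (c / 2) * x + cmod \<theta> * ln x + cmod \<theta> * k0)"
      proof -
        have "M\<Phi> * r' * x \<le> c / 2 * x" using M\<Phi>(3) x R by (intro mult_right_mono) auto
        then show ?thesis using M\<Phi>(1) by (intro mult_left_mono) (auto simp: L_def algebra_simps)
      qed
      finally show ?thesis .
    qed
    have "\<forall>\<^sub>F x in at_top. cmod (C t $ i $ j) \<le> L * exp (- (c / 2) * x + cmod \<theta> * ln x + cmod \<theta> * k0)"
      by (rule eventually_mono[OF eventually_gt_at_top[of R] bd])
    then have "cmod (C t $ i $ j) \<le> 0"
      using exponential_decay[of "c / 2" L "cmod \<theta>" "cmod \<theta> * k0"] c by (intro tendsto_lowerbound[of _ 0 at_top]) auto
    then show ?thesis by simp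
  qed
  define W where "W z t = Y t z ** exp_diag (- ?\<phi> z t)" for z t
  have W: "W z t $ i $ j = Z t z $ i $ j * C t $ j $ j" if "t \<in> D" "z \<in> S" for t z i j
  proof -
    have o: "C t $ 1 $ 2 = 0" "C t $ 2 $ 1 = 0" using off[OF that(1)] by auto
    have "\<forall>i j. W z t $ i $ j = Z t z $ i $ j * C t $ j $ j"
      unfolding forall_2 W_def YC[OF that] X_def using o
      by (simp add: mat2_mult_nth exp_diag_def mult_exp_exp)
    then show ?thesis by blast
  qed
  \<comment> \<open>Since \<open>C\<close> is free of \<open>z\<close>, the single point
    \<open>z1\<close> gives a bound for all \<open>t\<close>, which makes the convergence of
    \<open>W\<close> uniform in \<open>t\<close>.\<close>
  have "\<exists>b. \<forall>t\<in>D. \<forall>j. cmod (C t $ j $ j) \<le> b"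
  proof -
    define L where "L = (cmod t0 + r') / 2 * cmod z1 + cmod (\<theta> / 2 * sector_log u z1)"
    have "cmod (?\<phi> z1 t) \<le> L" if "t \<in> D" for t
    proof -
      have "cmod t \<le> cmod t0 + r'"
        using that norm_triangle_ineq[of t0 "t - t0"] by (simp add: D_def dist_norm norm_minus_commute)
      then have "cmod (t / 2 * z1) \<le> (cmod t0 + r') / 2 * cmod z1"
        unfolding norm_mult norm_divide by (intro mult_right_mono) auto
      then show ?thesis unfolding formal_exponent_def L_def
        by (intro order_trans[OF norm_triangle_ineq]) simp
    qed
    then have "\<bar>Re (?\<phi> z1 t)\<bar> \<le> L" if "t \<in> D" for t
      using that abs_Re_le_cmod order_trans by blast
    then have "Re (?\<phi> z1 t) \<le> L" "- Re (?\<phi> z1 t) \<le> L" if "t \<in> D" for t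
      using that by (simp_all add: abs_le_iff)
    then have eb: "cmod (e k z1 t) \<le> exp L" if "t \<in> D" for k t
      using that by (simp add: e_def norm_exp_eq_Re)
    have "cmod (C t $ j $ j) \<le> 2 * (1 + E)^2 * G z1 * (exp L * exp L)" if t: "t \<in> D" for t j
      using Cb[OF t z1, of j j] G0[of z1]
        mult_left_mono[OF mult_mono[OF eb[OF t, of "other j"] eb[OF t0, of j]], of "2 * (1 + E)^2 * G z1"]
      by (simp add: mult_nonneg_nonneg)
    then show ?thesis by blast
  qed
  then obtain b where b: "\<And>t j. t \<in> D \<Longrightarrow> cmod (C t $ j $ j) \<le> b" by blast
  have b0: "0 \<le> b" using b[OF t0, of 1] norm_ge_zero order_trans by blast
  have Wlim: "cmod (W z t $ i $ j - (if i = j then C t $ j $ j else 0)) \<le> E * b / cmod z" if t: "t \<in> D" and z: "z \<in> S" for t z i j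
  proof -
    have "\<forall>i j. (mat 1 :: mat2) $ i $ j = (if i = j then 1 else 0)" by (simp add: mat_def)
    then have "W z t $ i $ j - (if i = j then C t $ j $ j else 0) = (Z t z $ i $ j - mat 1 $ i $ j) * C t $ j $ j"
      unfolding W[OF t z] by (simp add: algebra_simps)
    also have "cmod \<dots> \<le> E / cmod z * b"
      unfolding norm_mult using Z(2)[OF t z, of i j] b[OF t, of j] E0 by (intro mult_mono) auto
    finally show ?thesis by simp
  qed
  define zn where "zn n = ray 1 (R + 1 + real n)" for n
  have zn: "zn n \<in> S" "cmod (zn n) = R + 1 + real n" for n
    using rayS[of "R + 1 + real n" 1] R by (auto simp: zn_def)
  have err: "(\<lambda>n. E * b / cmod (zn n)) \<longlonglongrightarrow> 0"
    unfolding zn by real_asymp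
  have Wpt: "(\<lambda>n. W (zn n) t $ i $ j) \<longlonglongrightarrow> (if i = j then C t $ j $ j else 0)" if "t \<in> D" for t i j
  proof (rule LIM_zero_cancel, rule Lim_null_comparison[OF _ err])
    show "\<forall>\<^sub>F n in sequentially. cmod (W (zn n) t $ i $ j - (if i = j then C t $ j $ j else 0)) \<le> E * b / cmod (zn n)"
      by (intro always_eventually allI Wlim[OF that zn(1)])
  qed
  \<comment> \<open>The terms \<open>\<plusminus> z / 2\<close> from the exponentials cancel the
    part of \<open>B\<close> that is linear in \<open>z\<close>; only \<open>B0\<close>
    remains.\<close>
  have W_der: "\<forall>i. ((\<lambda>t. W z t $ i $ i) has_field_derivative - (B0 t ** W z t) $ i $ i) (at t)" if t: "t \<in> D" for z t
  proof -
    have \<Phi>': "((\<lambda>t. Y t z $ i $ j) has_field_derivative (- (B z t ** Y t z)) $ i $ j) (at t)" for i j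
    proof -
      have "((\<lambda>t. Y t z $ i $ j) has_field_derivative ((- (B z t ** \<Phi> z t)) ** Y0 z) $ i $ j) (at t)"
        unfolding Y_def mat2_mult_nth[of _ "Y0 z"]
        by (rule derivative_eq_intros \<Phi>_derivative[OF Dr[OF t]] refl)+ simp
      then show ?thesis by (simp add: Y_def mat2_minus_mult matrix_mul_assoc)
    qed
    have ex: "((\<lambda>t. exp (- ?\<phi> z t)) has_field_derivative - z / 2 * exp (- ?\<phi> z t)) (at t)"
      "((\<lambda>t. exp (?\<phi> z t)) has_field_derivative z / 2 * exp (?\<phi> z t)) (at t)"
      unfolding formal_exponent_def by (auto intro!: derivative_eq_intros)
    have w: "W z t $ i $ 1 = Y t z $ i $ 1 * exp (- ?\<phi> z t)" "W z t $ i $ 2 = Y t z $ i $ 2 * exp (?\<phi> z t)" for t i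
      by (simp_all add: W_def exp_diag_def mat2_mult_nth)
    have "((\<lambda>t. W z t $ 1 $ 1) has_field_derivative - (B0 t ** W z t) $ 1 $ 1) (at t)"
      unfolding w by (rule DERIV_cong[OF DERIV_mult[OF \<Phi>' ex(1)]])
        (simp add: mat2_mult_nth w B_def half_sigma3_def algebra_simps)
    moreover have "((\<lambda>t. W z t $ 2 $ 2) has_field_derivative - (B0 t ** W z t) $ 2 $ 2) (at t)"
      unfolding w by (rule DERIV_cong[OF DERIV_mult[OF \<Phi>' ex(2)]])
        (simp add: mat2_mult_nth w B_def half_sigma3_def algebra_simps)
    ultimately show ?thesis unfolding forall_2 by blast
  qed
  \<comment> \<open>The functions \<open>W (zn n)\<close> are holomorphic in \<open>t\<close> and
    converge uniformly, so their derivatives converge too: regularity in \<open>t\<close> is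
    regained here.\<close>
  have C_der: "((\<lambda>t. C t $ i $ i) has_field_derivative - B0 t $ i $ i * C t $ i $ i) (at t)" if t: "t \<in> D" for t i
  proof -
    have "\<exists>g'. \<forall>t\<in>D. ((\<lambda>t. C t $ i $ i) has_field_derivative g' t) (at t) \<and>
        (\<lambda>n. - (B0 t ** W (zn n) t) $ i $ i) \<longlonglongrightarrow> g' t"
    proof (rule has_complex_derivative_uniform_sequence[where f = "\<lambda>n t. W (zn n) t $ i $ i"])
      show "open D" by (simp add: D_def)
      show "((\<lambda>t. W (zn n) t $ i $ i) has_field_derivative - (B0 t ** W (zn n) t) $ i $ i) (at t)" if "t \<in> D" for n t
        using W_der[OF that] by blast
      fix t assume "t \<in> D"
      then obtain d where d: "0 < d" "cball t d \<subseteq> D"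
        using open_ball[of t0 r'] unfolding D_def[symmetric] open_contains_cball by blast
      have "uniform_limit (cball t d) (\<lambda>n t. W (zn n) t $ i $ i) (\<lambda>t. C t $ i $ i) sequentially"
      proof (rule uniform_limitI)
        fix \<epsilon> :: real assume "0 < \<epsilon>"
        with err have "\<forall>\<^sub>F n in sequentially. E * b / cmod (zn n) < \<epsilon>" by (rule order_tendstoD)
        then show "\<forall>\<^sub>F n in sequentially. \<forall>t\<in>cball t d. dist (W (zn n) t $ i $ i) (C t $ i $ i) < \<epsilon>"
        proof (rule eventually_mono, intro ballI)
          fix n s assume n: "E * b / cmod (zn n) < \<epsilon>" and "s \<in> cball t d"
          then have "s \<in> D" using d by blast
          from Wlim[OF this zn(1), of n i i] n show "dist (W (zn n) s $ i $ i) (C s $ i $ i) < \<epsilon>"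
            by (simp add: dist_norm)
        qed
      qed
      with d show "\<exists>d>0. cball t d \<subseteq> D \<and> uniform_limit (cball t d) (\<lambda>n t. W (zn n) t $ i $ i) (\<lambda>t. C t $ i $ i) sequentially"
        by blast
    qed
    then obtain g' where g': "((\<lambda>t. C t $ i $ i) has_field_derivative g') (at t)"
        "(\<lambda>n. - (B0 t ** W (zn n) t) $ i $ i) \<longlonglongrightarrow> g'" using t by blast
    have "(\<lambda>n. - (B0 t ** W (zn n) t) $ i $ i) \<longlonglongrightarrow> - (B0 t $ i $ 1 * (if 1 = i then C t $ i $ i else 0) + B0 t $ i $ 2 * (if 2 = i then C t $ i $ i else 0))"
      unfolding mat2_mult_nth by (intro tendsto_intros Wpt t)
    also have "- (B0 t $ i $ 1 * (if 1 = i then C t $ i $ i else 0) + B0 t $ i $ 2 * (if 2 = i then C t $ i $ i else 0)) = - B0 t $ i $ i * C t $ i $ i"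
      using exhaust_2[of i] by auto
    finally show ?thesis using g' LIMSEQ_unique by blast
  qed
  have Ct0: "C t0 = mat 1"
    unfolding C_def Y_def Y0_def \<Phi>_base using inv2_mult(1)[of "X t0 z1"] X_det[OF t0 z1] by simp
  have C_exp: "C t $ i $ i = exp (P t)" if t: "t \<in> D" and P0: "P t0 = 0"
      and P': "\<And>t. t \<in> D \<Longrightarrow> (P has_field_derivative - B0 t $ i $ i) (at t)" for t i P
  proof -
    have "C t $ i $ i * exp (- P t) = C t0 $ i $ i * exp (- P t0)"
    proof (rule zero_derivative_imp_eq[of D, where f = "\<lambda>t. C t $ i $ i * exp (- P t)"])
      fix t assume t: "t \<in> D"
      show "((\<lambda>t. C t $ i $ i * exp (- P t)) has_field_derivative 0) (at t)"
        by (rule DERIV_cong[OF DERIV_mult[OF C_der[OF t] DERIV_chain2[OF DERIV_exp DERIV_minus[OF P'[OF t]]]]])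
          (simp add: algebra_simps)
    qed (use t t0 in \<open>auto simp: D_def\<close>)
    then show ?thesis by (simp add: Ct0 P0 mat_def exp_minus field_simps)
  qed
  show ?thesis
  proof
    show "((\<lambda>z. Y0 z $ i $ j) has_field_derivative (- (A z t0 ** Y0 z)) $ i $ j) (at z)" if "z \<in> sector (1/10) R u" for z i j
      using X_der[OF t0, of z i j] that by (simp add: Y0_def S_def)
    show "det (Y0 z) = 1" if "z \<in> sector (1/10) R u" for z
      using X_det[OF t0] that by (simp add: Y0_def S_def)
    have C11: "C t $ 1 $ 1 = exp (P1 t)" "C t $ 2 $ 2 = exp (P2 t)" if "t \<in> D" for t
      by (rule C_exp[OF that P(1) P(3)[OF Dr]], assumption) (rule C_exp[OF that P(2) P(4)[OF Dr]], assumption)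
    have bound: "norm (W z t - mat22 (exp (P1 t)) 0 0 (exp (P2 t))) \<le> 4 * (E * b / cmod z)" if t: "t \<in> D" and z: "z \<in> S" for z t
    proof (rule norm_mat2_le)
      have "\<forall>i j. cmod ((W z t - mat22 (exp (P1 t)) 0 0 (exp (P2 t))) $ i $ j) \<le> E * b / cmod z"
        unfolding forall_2 using Wlim[OF t z, of 1 1] Wlim[OF t z, of 1 2] Wlim[OF t z, of 2 1] Wlim[OF t z, of 2 2]
        by (simp add: C11[OF t])
      then show "cmod ((W z t - mat22 (exp (P1 t)) 0 0 (exp (P2 t))) $ i $ j) \<le> E * b / cmod z" for i j by blast
    qed
    have "uniform_limit D W (\<lambda>t. mat22 (exp (P1 t)) 0 0 (exp (P2 t))) (inf at_infinity (principal S))"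
    proof (rule uniform_limitI)
      fix \<epsilon> :: real assume \<epsilon>: "0 < \<epsilon>"
      have "\<forall>z. 4 * (E * b) / \<epsilon> + 1 \<le> cmod z \<longrightarrow> z \<in> S \<longrightarrow> (\<forall>t\<in>D. dist (W z t) (mat22 (exp (P1 t)) 0 0 (exp (P2 t))) < \<epsilon>)"
      proof (intro allI impI ballI)
        fix z t assume z: "4 * (E * b) / \<epsilon> + 1 \<le> cmod z" "z \<in> S" and t: "t \<in> D"
        have "0 < cmod z" using SR(3)[OF z(2)] by simp
        moreover have "4 * (E * b) / \<epsilon> < cmod z" using z(1) by linarith
        ultimately have "4 * (E * b / cmod z) < \<epsilon>" using \<epsilon> by (simp add: field_simps)
        with bound[OF t z(2)] show "dist (W z t) (mat22 (exp (P1 t)) 0 0 (exp (P2 t))) < \<epsilon>" by (simp add: dist_norm)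
      qed
      then show "\<forall>\<^sub>F z in inf at_infinity (principal S). \<forall>t\<in>D. dist (W z t) (mat22 (exp (P1 t)) 0 0 (exp (P2 t))) < \<epsilon>"
        unfolding eventually_inf_principal eventually_at_infinity by blast
    qed
    then show "uniform_limit (ball t0 r') (\<lambda>z t. (\<Phi> z t ** Y0 z) ** exp_diag (- formal_exponent \<theta> u z t))
       (\<lambda>t. mat22 (exp (P1 t)) 0 0 (exp (P2 t))) (inf at_infinity (principal (sector (1/10) R u)))"
      unfolding W_def[abs_def] Y_def D_def S_def .
  qed
qed

section \<open>The system implies constant analytic data\<close>

lemma starlike_fundamental_solution:
  fixes A :: "complex \<Rightarrow> mat2"
  assumes V: "open V" "a \<in> V" "\<And>x. x \<in> V \<Longrightarrow> closed_segment a x \<subseteq> V"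
    and hol: "\<And>i j. (\<lambda>z. A z $ i $ j) holomorphic_on V" and tr: "\<And>z. A z $ 2 $ 2 = - A z $ 1 $ 1"
  shows "\<exists>Y. (\<forall>z\<in>V. \<forall>i j. ((\<lambda>z. Y z $ i $ j) has_field_derivative (- (A z ** Y z)) $ i $ j) (at z)) \<and> (\<forall>z\<in>V. det (Y z) = 1)"
proof -
  interpret linear_ode V a "\<lambda>z. - A z"
    by unfold_locales (use V hol in \<open>auto intro: holomorphic_intros\<close>)
  have der: "((\<lambda>z. solution 1 z $ i $ j) has_field_derivative ((- A z) ** solution 1 z) $ i $ j) (at z)" if "z \<in> V" for z i j
    using solution_derivative[OF that, of 1 i j] by simp
  have "starlike V" using V by (auto simp: starlike_def)
  then have "connected V" by (rule starlike_imp_connected)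
  then have "det (solution 1 z) = 1" if "z \<in> V" for z
    using det_constant[OF _ V(1,2) that der] tr by (simp add: solution_base trace_mat2)
  then show ?thesis using der unfolding mat2_minus_mult by (intro exI[of _ "solution 1"]) blast
qed

lemma matrix_inv_eq_inv2:
  assumes "det M \<noteq> 0"
  shows "matrix_inv M = inv2 M"
proof -
  have "invertible M" using assms by (simp add: invertible_det_nz)
  then have "M ** matrix_inv M = mat 1"
    unfolding matrix_inv_def invertible_def by (rule someI2_ex) simp
  then have "inv2 M ** (M ** matrix_inv M) = inv2 M" by simp
  then show ?thesis unfolding matrix_mul_assoc inv2_mult(1)[OF assms] by simp
qed

lemma inv2_matrix_mult:
  assumes "det M \<noteq> 0" "det N \<noteq> 0"
  shows "inv2 (M ** N) = inv2 N ** inv2 M"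
proof -
  have d: "det (M ** N) \<noteq> 0" using assms by (simp add: det_mul)
  have "(inv2 N ** inv2 M) ** (M ** N) = inv2 N ** (inv2 M ** M) ** N" by (simp add: matrix_mul_assoc)
  also have "\<dots> = mat 1" using inv2_mult(1)[OF assms(1)] inv2_mult(1)[OF assms(2)] by simp
  finally have "(inv2 N ** inv2 M) ** (M ** N) = inv2 (M ** N) ** (M ** N)" using inv2_mult(1)[OF d] by simp
  from matrix_cancel_right[OF this d] show ?thesis by simp
qed

text \<open>The point \<open>s + 1/2\<close> lies on the side opposite to the cut, so the slit disc,
  though not convex, is star-shaped about it.\<close>

lemma closed_segment_slit_disc:
  assumes "x \<in> slit_disc s"
  shows "closed_segment (s + 1/2) x \<subseteq> slit_disc s"
proof
  fix y assume y: "y \<in> closed_segment (s + 1/2) x"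
  have b: "s + 1/2 \<in> ball s 1" "x \<in> ball s 1" using assms by (auto simp: slit_disc_def dist_norm)
  then have "y \<in> ball s 1" using y convex_ball[of s 1] unfolding convex_contains_segment by blast
  moreover have "y - s \<notin> \<real>\<^sub>\<le>\<^sub>0"
  proof
    assume ny: "y - s \<in> \<real>\<^sub>\<le>\<^sub>0"
    obtain u where u: "0 \<le> u" "u \<le> 1" "y = (1 - u) *\<^sub>R (s + 1/2) + u *\<^sub>R x" using y by (auto simp: in_segment)
    have e: "y - s = of_real ((1 - u) / 2) + of_real u * (x - s)"
      unfolding u(3) by (simp add: scaleR_conv_of_real field_simps)
    have "Re (y - s) \<le> 0" "Im (y - s) = 0" using ny by (auto simp: complex_nonpos_Reals_iff)
    then have 1: "(1 - u) / 2 + u * Re (x - s) \<le> 0" "u * Im (x - s) = 0" unfolding e by simp_all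
    then have "u \<noteq> 0" by auto
    then have "0 < u" using u(1) by simp
    have "b \<le> 0" if "a + b \<le> 0" "0 \<le> a" for a b :: real using that by simp
    from this[OF 1(1)] have "u * Re (x - s) \<le> 0" using u(2) by simp
    then have "Re (x - s) \<le> 0" using \<open>0 < u\<close> by (simp add: mult_le_0_iff)
    moreover have "Im (x - s) = 0" using 1(2) \<open>u \<noteq> 0\<close> by simp
    ultimately have "x - s \<in> \<real>\<^sub>\<le>\<^sub>0" by (simp add: complex_nonpos_Reals_iff)
    then show False using assms by (simp add: slit_disc_def)
  qed
  ultimately show "y \<in> slit_disc s" by (simp add: slit_disc_def)
qed

lemma ordinary_fundamental_solution:
  fixes A :: "complex \<Rightarrow> mat2"
  assumes V: "V \<in> ordinary_discs \<union> {slit_disc 0, slit_disc 1}"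
    and hol: "\<And>i j. (\<lambda>z. A z $ i $ j) holomorphic_on - {0, 1}" and tr: "\<And>z. A z $ 2 $ 2 = - A z $ 1 $ 1"
  shows "\<exists>Y. (\<forall>z\<in>V. \<forall>i j. ((\<lambda>z. Y z $ i $ j) has_field_derivative (- (A z ** Y z)) $ i $ j) (at z)) \<and> (\<forall>z\<in>V. det (Y z) = 1)"
proof (cases "V = {}")
  case False
  have "V \<subseteq> - {0, 1}" using V by (auto simp: ordinary_discs_def slit_disc_def)
  then have holV: "(\<lambda>z. A z $ i $ j) holomorphic_on V" for i j using hol holomorphic_on_subset by blast
  have openV: "open V" using V open_slit_disc by (auto simp: ordinary_discs_def)
  have "\<exists>a\<in>V. \<forall>x\<in>V. closed_segment a x \<subseteq> V"
  proof -
    consider (disc) a r where "V = ball a r" | (slit) s where "V = slit_disc s"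
      using V by (auto simp: ordinary_discs_def)
    then show ?thesis
    proof cases
      case disc
      then have "a \<in> V" using False by auto
      then show ?thesis using disc convex_ball[of a r] unfolding convex_contains_segment by blast
    next
      case slit
      have "s + 1/2 \<in> slit_disc s" by (auto simp: slit_disc_def dist_norm complex_nonpos_Reals_iff)
      then show ?thesis using slit closed_segment_slit_disc by blast
    qed
  qed
  then obtain a where "a \<in> V" "\<And>x. x \<in> V \<Longrightarrow> closed_segment a x \<subseteq> V" by blast
  then show ?thesis by (rule starlike_fundamental_solution[OF openV _ _ holV tr])
qed auto

text \<open>The bases at \<open>t0\<close> are assigned by comparing regions as sets, so the two
  sectors have to be told apart.\<close>

lemma sector_neq:
  assumes "u \<noteq> 0" "1 \<le> R"
  shows "sector (1/10) R u \<noteq> sector (1/10) R (- u)"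
proof -
  have s: "cmod (sgn u) = 1" "sgn u \<noteq> 0" using assms by (simp_all add: norm_sgn sgn_zero_iff)
  let ?z = "of_real (R + 1) * sgn u"
  have "- (1/10) * (R + 1) < R + 1" using assms(2) mult_strict_right_mono[of "- (1/10)" 1 "R + 1"] by linarith
  with s assms(2) have "?z \<in> sector (1/10) R u" "?z \<notin> sector (1/10) R (- u)"
    by (auto simp: sector_def norm_mult sgn_minus)
  then show ?thesis by blast
qed

lemma norm_simple_pole_le:
  fixes z :: complex
  assumes "2 \<le> cmod z"
  shows "cmod (x / (z - 1)) \<le> 2 * cmod x / cmod z" "cmod (x / (z * (z - 1))) \<le> 2 * cmod x / (cmod z)^2"
proof -
  have "cmod z - 1 \<le> cmod (z - 1)" using norm_triangle_ineq2[of z 1] by simp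
  then have h: "cmod z / 2 \<le> cmod (z - 1)" using assms by linarith
  have p: "0 < cmod z / 2" using assms by linarith
  have "cmod x / cmod (z - 1) \<le> cmod x / (cmod z / 2)" using h p by (intro frac_le) auto
  then show 1: "cmod (x / (z - 1)) \<le> 2 * cmod x / cmod z" by (simp add: norm_divide mult.commute)
  have "cmod (x / (z * (z - 1))) = cmod (x / (z - 1)) / cmod z" by (simp add: norm_divide norm_mult)
  also have "\<dots> \<le> 2 * cmod x / cmod z / cmod z" by (intro divide_right_mono 1) simp
  finally show "cmod (x / (z * (z - 1))) \<le> 2 * cmod x / (cmod z)^2" by (simp add: power2_eq_square)
qed

text \<open>The product of \<open>t0\<close> and the bisecting direction is purely imaginary, so
  only the sine 3/5 of the tilt contributes to the real part.\<close>

lemma Re_mult_sector_ray: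
  assumes "t0 \<noteq> 0" "\<epsilon> = 1 \<or> \<epsilon> = - 1"
  shows "Re (t0 * sector_ray (of_real \<epsilon> * (\<i> / t0)) \<sigma>) = - (3/5) * \<epsilon> * \<sigma> * cmod t0"
proof -
  have "cmod (of_real \<epsilon> * (\<i> / t0)) = 1 / cmod t0" using assms(2) by (auto simp: norm_mult norm_divide)
  then have "sgn (of_real \<epsilon> * (\<i> / t0)) = of_real \<epsilon> * (\<i> / t0) * of_real (cmod t0)"
    unfolding sgn_eq by simp
  then have "t0 * sgn (of_real \<epsilon> * (\<i> / t0)) = of_real (\<epsilon> * cmod t0) * \<i>"
    using assms(1) by simp
  then have "t0 * sector_ray (of_real \<epsilon> * (\<i> / t0)) \<sigma> = of_real (\<epsilon> * cmod t0) * \<i> * Complex (4/5) (\<sigma> * (3/5))"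
    unfolding sector_ray_def mult.assoc[symmetric] by simp
  then show ?thesis by simp
qed

lemma painleve_system_imp_constant_data:
  fixes \<theta>0 \<theta>1 \<theta>i t0 :: complex and p q :: "complex \<Rightarrow> complex"
  assumes T: "open T" "0 \<notin> T" "t0 \<in> T" and holp: "p holomorphic_on T" and holq: "q holomorphic_on T"
    and nz: "\<forall>t\<in>T. q t \<noteq> 0 \<and> q t \<noteq> 1" and sys: "painleve_system \<theta>0 \<theta>1 \<theta>i T p q"
  shows "\<exists>r>0. ball t0 r \<subseteq> T \<and> constant_analytic_data \<theta>i (connection_matrix \<theta>0 \<theta>1 \<theta>i p q) t0 (ball t0 r)"
proof -
  define A where "A = connection_matrix \<theta>0 \<theta>1 \<theta>i p q"
  have t0: "t0 \<noteq> 0" using T by auto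
  obtain r where rT: "0 < r" "cball t0 r \<subseteq> T" using T open_contains_cball by blast
  have TB: "t \<in> T" if "t \<in> ball t0 r" for t using that rT by auto
  have nz': "t \<noteq> 0" "q t \<noteq> 0" "q t \<noteq> 1" if "t \<in> T" for t using that nz T by auto
  have der: "(p has_field_derivative rhs_p \<theta>0 \<theta>1 \<theta>i (p t) (q t) t) (at t)"
      "(q has_field_derivative rhs_q (p t) (q t) t) (at t)" if "t \<in> T" for t
    using holomorphic_derivI[OF holp T(1) that] holomorphic_derivI[OF holq T(1) that] sys that
    by (auto simp: painleve_system_def)
  define B0 where "B0 t = mat22 (B_eps \<theta>i (p t) (q t) t / t) (B_f \<theta>0 \<theta>1 \<theta>i (p t) (q t) t / t)
      (- 1 / ((q t - 1) * t)) (- (B_eps \<theta>i (p t) (q t) t / t))" for t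
  interpret isomonodromy_flow t0 r B0
  proof
    show "0 < r" by (rule rT)
    have hp: "p holomorphic_on ball t0 r" and hq: "q holomorphic_on ball t0 r"
      using holp holq TB by (auto intro: holomorphic_on_subset)
    have "\<forall>i j. (\<lambda>t. B0 t $ i $ j) holomorphic_on ball t0 r"
      unfolding forall_2 B0_def mat22_nth B_eps_def B_f_def
      by (intro conjI holomorphic_intros hp hq) (use nz' TB in auto)
    then show "(\<lambda>t. B0 t $ i $ j) holomorphic_on ball t0 r" for i j by blast
    show "trace (B0 t) = 0" for t by (simp add: B0_def trace_mat2)
  qed
  have B: "B z t = B_matrix \<theta>0 \<theta>1 \<theta>i p q z t" for z t
    unfolding mat2_eq_iff B_matrix_nth by (simp add: B_def B0_def half_sigma3_def)
  have dA: "(\<lambda>s. A z s $ i $ j) field_differentiable at t" if "t \<in> T" for z t i j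
  proof -
    have "\<forall>i j. (\<lambda>s. A z s $ i $ j) field_differentiable at t"
      unfolding forall_2 A_def using connection_matrix_has_derivative[OF der[OF that] nz'(2,3)[OF that]]
      unfolding field_differentiable_def by blast
    then show ?thesis by blast
  qed
  have mB: "mderiv (\<lambda>x. B_matrix \<theta>0 \<theta>1 \<theta>i p q x t) z = half_sigma3" for z t
    unfolding mat2_eq_iff mderiv_nth B_matrix_nth deriv_affine by (simp add: half_sigma3_def)
  have gauge: "mderiv (\<lambda>z. \<Phi> z t) z + A z t ** \<Phi> z t = \<Phi> z t ** A z t0"
    if t: "t \<in> ball t0 r" and z: "z \<noteq> 0" "z \<noteq> 1" for t z
  proof (rule gauge_transform[OF t])
    show "(\<lambda>s. A z s $ i $ j) field_differentiable at s" if "s \<in> ball t0 r" for s i j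
      by (rule dA[OF TB[OF that]])
    show "mderiv (A z) s - half_sigma3 + B z s ** A z s - A z s ** B z s = 0" if "s \<in> ball t0 r" for s
      using system_imp_lax[OF der[OF TB[OF that]] nz'[OF TB[OF that]] z] unfolding mB B A_def .
  qed
  have A22: "A z t $ 2 $ 2 = - A z t $ 1 $ 1" for z t unfolding A_def by (rule connection_matrix_nth)
  define w where "w t = wval \<theta>i (p t) (q t) t" for t
  define v where "v t = vval \<theta>i (p t) (q t) t" for t
  define b0 where "b0 t = (q t - 1) * ((w t)^2 - \<theta>0^2 / 4) / q t" for t
  define b1 where "b1 t = \<theta>1^2 / 4 - (v t)^2" for t
  define c0 where "c0 t = - q t / (q t - 1)" for t
  have A: "A z t $ 1 $ 1 = - w t / z + v t / (z - 1) - t / 2" "A z t $ 1 $ 2 = b0 t / z + b1 t / (z - 1)"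
    "A z t $ 2 $ 1 = c0 t / z + 1 / (z - 1)" for z t
    unfolding A_def connection_matrix_nth w_def v_def b0_def b1_def c0_def by simp_all
  have contT: "continuous_on (cball t0 r) p" "continuous_on (cball t0 r) q"
    using holp holq rT(2) by (auto intro: holomorphic_on_imp_continuous_on continuous_on_subset)
  have bdd: "\<exists>m. \<forall>t\<in>cball t0 r. cmod (f t) \<le> m" if "continuous_on (cball t0 r) f" for f :: "complex \<Rightarrow> complex"
  proof -
    have "bounded (f ` cball t0 r)" using that by (intro compact_imp_bounded compact_continuous_image) auto
    then show ?thesis unfolding bounded_iff by auto
  qed
  have qT: "q t \<noteq> 0" "q t - 1 \<noteq> 0" if "t \<in> cball t0 r" for t using nz'[of t] that rT(2) by auto
  have cw: "continuous_on (cball t0 r) w" "continuous_on (cball t0 r) v"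
    unfolding w_def v_def wval_def vval_def by (intro continuous_intros contT)+
  obtain mv where mv: "\<And>t. t \<in> cball t0 r \<Longrightarrow> cmod (v t) \<le> mv" using bdd[OF cw(2)] by blast
  have "continuous_on (cball t0 r) b0" unfolding b0_def using qT by (intro continuous_intros contT cw) auto
  then obtain m0 where m0: "\<And>t. t \<in> cball t0 r \<Longrightarrow> cmod (b0 t) \<le> m0" using bdd by blast
  have "continuous_on (cball t0 r) b1" unfolding b1_def by (intro continuous_intros contT cw)
  then obtain m1 where m1: "\<And>t. t \<in> cball t0 r \<Longrightarrow> cmod (b1 t) \<le> m1" using bdd by blast
  have "continuous_on (cball t0 r) c0" unfolding c0_def using qT by (intro continuous_intros contT) auto
  then obtain mc where mc: "\<And>t. t \<in> cball t0 r \<Longrightarrow> cmod (c0 t) \<le> mc" using bdd by blast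
  have "t0 \<in> cball t0 r" using r by simp
  then have mpos: "0 \<le> mv" "0 \<le> m0" "0 \<le> m1" "0 \<le> mc"
    using mv m0 m1 mc norm_ge_zero order_trans by blast+
  \<comment> \<open>One bound for the three coefficients. The doubled summands come from
    \<open>1 / |z - 1| \<le> 2 / |z|\<close>, valid for \<open>|z| \<ge> 2\<close>.\<close>
  define M where "M = 2 * mv + (m0 + 2 * m1) + (mc + 2)"
  have M0: "0 \<le> M" using mpos by (simp add: M_def)
  obtain K\<Phi> M\<Phi> where growth: "\<And>z t i j. t \<in> ball t0 (r/2) \<Longrightarrow> cmod (\<Phi> z t $ i $ j) \<le> K\<Phi> * exp (M\<Phi> * cmod z * cmod (t - t0))"
    and M\<Phi>: "0 \<le> M\<Phi>" "0 \<le> K\<Phi>" by (rule \<Phi>_growth) blast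
  define c where "c = cmod t0 / 2"
  have c: "0 < c" using t0 by (simp add: c_def)
  \<comment> \<open>The three bounds serve, in turn, the growth estimate for \<open>\<Phi>\<close>,
    the decay \<open>- 3/5 * |t0| + |t0| / 10 = - c\<close> on the rays, and
    \<open>M\<Phi> * r' \<le> c / 2\<close>. Adding 1 to \<open>M\<Phi>\<close> avoids a division by
    0.\<close>
  define r' where "r' = Min {r / 2, cmod t0 / 10, c / (2 * (M\<Phi> + 1))}"
  have r': "0 < r'" "r' \<le> r / 2" "r' \<le> cmod t0 / 10" "r' \<le> c / (2 * (M\<Phi> + 1))"
  proof -
    have "0 < c / (2 * (M\<Phi> + 1))" using c M\<Phi> by (intro divide_pos_pos) auto
    then show "0 < r'" using r t0 by (simp add: r'_def)
    show "r' \<le> r / 2" "r' \<le> cmod t0 / 10" "r' \<le> c / (2 * (M\<Phi> + 1))"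
      unfolding r'_def by (intro Min_le; simp)+
  qed
  have M\<Phi>r: "M\<Phi> * r' \<le> c / 2"
  proof -
    have "(M\<Phi> + 1) * r' \<le> (M\<Phi> + 1) * (c / (2 * (M\<Phi> + 1)))" using r'(4) M\<Phi> by (intro mult_left_mono) auto
    also have "\<dots> = c / 2"
    proof -
      have "x * (c / (2 * x)) = c / 2" if "x \<noteq> 0" for x :: real using that by simp
      from this[of "M\<Phi> + 1"] show ?thesis using M\<Phi> by linarith
    qed
    finally show ?thesis using r'(1) by (simp add: distrib_right)
  qed
  define D where "D = ball t0 r'"
  have D: "t \<in> ball t0 r" "t \<in> ball t0 (r/2)" "t \<in> cball t0 r" "t \<in> T" if "t \<in> D" for t
    using that r' r TB by (auto simp: D_def)
  have t0D: "t0 \<in> D" using r' by (simp add: D_def)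
  define R where "R = 85 * cone_radius c M \<theta>i"
  have R: "1 \<le> R" using cone_radius_ge(1)[of c M \<theta>i] by (simp add: R_def)
  define P1 where "P1 = const.primitive (\<lambda>t. - B0 t $ 1 $ 1)"
  have P1: "P1 t0 = 0" "\<And>t. t \<in> ball t0 r \<Longrightarrow> (P1 has_field_derivative - B0 t $ 1 $ 1) (at t)"
    unfolding P1_def by (rule const.primitive[OF holomorphic_on_minus[OF B0_holomorphic]]; assumption)+
  define P2 where "P2 = const.primitive (\<lambda>t. - B0 t $ 2 $ 2)"
  have P2: "P2 t0 = 0" "\<And>t. t \<in> ball t0 r \<Longrightarrow> (P2 has_field_derivative - B0 t $ 2 $ 2) (at t)"
    unfolding P2_def by (rule const.primitive[OF holomorphic_on_minus[OF B0_holomorphic]]; assumption)+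
  have holA: "(\<lambda>z. A z t $ i $ j) holomorphic_on - {0, 1}" for t i j
  proof -
    have "\<forall>i j. (\<lambda>z. A z t $ i $ j) holomorphic_on - {0, 1}"
      unfolding forall_2 A22 A by (intro conjI holomorphic_intros) auto
    then show ?thesis by blast
  qed
  have outside: "- cball 0 1 \<subseteq> (- {0, 1} :: complex set)" by auto
  \<comment> \<open>What remains of the (1,1) entry, up to sign, beyond the formal exponent:
    \<open>w - v = \<theta>i / 2\<close>, and the two poles with coefficient \<open>v\<close>
    combine to order \<open>1 / |z|^2\<close>.\<close>
  define \<alpha> where "\<alpha> t z = - v t / (z * (z - 1))" for t z
  have sec: "\<exists>Y0. (\<forall>z\<in>sector (1/10) R u. \<forall>i j. ((\<lambda>z. Y0 z $ i $ j) has_field_derivative (- (A z t0 ** Y0 z)) $ i $ j) (at z)) \<and>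
      (\<forall>z\<in>sector (1/10) R u. det (Y0 z) = 1) \<and>
      uniform_limit D (\<lambda>z t. (\<Phi> z t ** Y0 z) ** exp_diag (- formal_exponent \<theta>i u z t))
       (\<lambda>t. mat22 (exp (P1 t)) 0 0 (exp (P2 t))) (inf at_infinity (principal (sector (1/10) R u)))"
    if \<epsilon>: "\<epsilon> = 1 \<or> \<epsilon> = - 1" and u: "u = of_real \<epsilon> * (\<i> / t0)" for \<epsilon> u
  proof -
    have u0: "u \<noteq> 0" using u \<epsilon> t0 by auto
    have Re_ray: "Re (s * t * sector_ray u \<tau>) \<le> - c"
      if t: "t \<in> ball t0 r'" and \<tau>: "\<tau> = 1 \<or> \<tau> = - 1" and s: "s = of_real (\<epsilon> * \<tau>)" for t s \<tau>
    proof -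
      have e2: "\<epsilon> * \<tau> * (\<epsilon> * \<tau>) = 1" "\<bar>\<epsilon> * \<tau>\<bar> = 1" using \<epsilon> \<tau> by auto
      have "s * t * sector_ray u \<tau> = of_real (\<epsilon> * \<tau>) * (t0 * sector_ray u \<tau>) + s * (t - t0) * sector_ray u \<tau>"
        unfolding s by (simp add: algebra_simps)
      then have "Re (s * t * sector_ray u \<tau>) = \<epsilon> * \<tau> * Re (t0 * sector_ray u \<tau>) + Re (s * (t - t0) * sector_ray u \<tau>)"
        by (simp only: plus_complex.sel Re_complex_of_real) simp
      also have "\<epsilon> * \<tau> * Re (t0 * sector_ray u \<tau>) = - (3/5) * cmod t0"
        unfolding u Re_mult_sector_ray[OF t0 \<epsilon>] using e2(1) by (simp add: algebra_simps)
      also have "Re (s * (t - t0) * sector_ray u \<tau>) \<le> cmod t0 / 10"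
      proof -
        have "cmod (s * (t - t0) * sector_ray u \<tau>) = cmod (t - t0)"
          using norm_sector_ray[OF u0 \<tau>] e2(2) unfolding s by (simp add: norm_mult del: of_real_mult)
        also have "\<dots> \<le> cmod t0 / 10" using t r'(3) by (simp add: dist_norm norm_minus_commute)
        finally show ?thesis using complex_Re_le_cmod order_trans by blast
      qed
      finally show ?thesis by (simp add: c_def)
    qed
    show ?thesis
    \<comment> \<open>With \<open>\<sigma> = \<epsilon>\<close> the signs multiply to 1, so
      \<open>Re (t0 * ray)\<close> is \<open>- 3/5 * |t0|\<close> on the first ray; on the other ray
      it is the negative, and the reciprocal exponential decays.\<close>
    proof (rule canonical_solution_transported[of u \<epsilon> c M r' A \<theta>i \<alpha> K\<Phi> M\<Phi> P1 P2, folded R_def], goal_cases)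
      case (25 Y0)
      show ?case unfolding D_def by (rule exI[of _ Y0]) (intro conjI ballI allI 25)
    next
      case (7 t) show ?case using Re_ray[OF 7 \<epsilon>, of 1] \<epsilon> by auto
    next
      case (8 t) show ?case using Re_ray[OF 8, of "- \<epsilon>" "- 1"] \<epsilon> by auto
    next
      case (9 t z)
      have wv: "w t = v t + \<theta>i / 2" by (simp add: w_def v_def wval_def vval_def field_simps)
      have z: "z \<noteq> 0" "z - 1 \<noteq> 0" using 9(2) by auto
      have "v t / (z * (z - 1)) = v t / (z - 1) - v t / z" using z by (simp add: field_simps)
      then show ?case unfolding A \<alpha>_def wv by (simp add: add_divide_distrib diff_divide_distrib)
    next
      case (11 t) show ?case unfolding \<alpha>_def by (intro holomorphic_intros) auto
    next
      case (12 t i j) show ?case by (rule holomorphic_on_subset[OF holA outside])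
    next
      case (13 t z)
      have "t \<in> D" using 13 by (simp add: D_def)
      then have "2 * cmod (- v t) \<le> M" using mv[OF D(3), of t] mpos unfolding M_def norm_minus_cancel by linarith
      then have "2 * cmod (- v t) / (cmod z)^2 \<le> M / (cmod z)^2" by (intro divide_right_mono) auto
      then show ?case unfolding \<alpha>_def using norm_simple_pole_le(2)[OF 13(2), of "- v t"] by linarith
    next
      case (14 t z)
      have tD: "t \<in> D" using 14 by (simp add: D_def)
      have "cmod (A z t $ 1 $ 2) \<le> cmod (b0 t) / cmod z + 2 * cmod (b1 t) / cmod z"
        unfolding A using norm_triangle_ineq[of "b0 t / z" "b1 t / (z - 1)"] norm_simple_pole_le(1)[OF 14(2), of "b1 t"]
        by (simp add: norm_divide)
      also have "\<dots> = (cmod (b0 t) + 2 * cmod (b1 t)) / cmod z" by (simp add: add_divide_distrib)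
      also have "\<dots> \<le> M / cmod z"
        using m0[OF D(3)[OF tD]] m1[OF D(3)[OF tD]] mpos by (intro divide_right_mono) (auto simp: M_def)
      finally show ?case .
    next
      case (15 t z)
      have tD: "t \<in> D" using 15 by (simp add: D_def)
      have "cmod (A z t $ 2 $ 1) \<le> cmod (c0 t) / cmod z + 2 / cmod z"
        unfolding A using norm_triangle_ineq[of "c0 t / z" "1 / (z - 1)"] norm_simple_pole_le(1)[OF 15(2), of 1]
        by (simp add: norm_divide)
      also have "\<dots> = (cmod (c0 t) + 2) / cmod z" by (simp add: add_divide_distrib)
      also have "\<dots> \<le> M / cmod z"
        using mc[OF D(3)[OF tD]] mpos by (intro divide_right_mono) (auto simp: M_def)
      finally show ?case .
    next
      case (16 z t i j) show ?case using 16 r' by (intro growth) auto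
    next
      case (20 t z) then show ?case using r' by (intro gauge) auto
    qed (use u0 \<epsilon> c M0 r' r M\<Phi> M\<Phi>r P1 P2 A22 in \<open>auto\<close>)
  qed
  define us where "us = {\<i> / t0, - \<i> / t0}"
  obtain Y1 where Y1: "\<forall>z\<in>sector (1/10) R (\<i> / t0). \<forall>i j. ((\<lambda>z. Y1 z $ i $ j) has_field_derivative (- (A z t0 ** Y1 z)) $ i $ j) (at z)"
      "\<forall>z\<in>sector (1/10) R (\<i> / t0). det (Y1 z) = 1"
      "uniform_limit D (\<lambda>z t. (\<Phi> z t ** Y1 z) ** exp_diag (- formal_exponent \<theta>i (\<i> / t0) z t))
       (\<lambda>t. mat22 (exp (P1 t)) 0 0 (exp (P2 t))) (inf at_infinity (principal (sector (1/10) R (\<i> / t0))))"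
    using sec[of 1 "\<i> / t0"] by auto
  obtain Y2 where Y2: "\<forall>z\<in>sector (1/10) R (- \<i> / t0). \<forall>i j. ((\<lambda>z. Y2 z $ i $ j) has_field_derivative (- (A z t0 ** Y2 z)) $ i $ j) (at z)"
      "\<forall>z\<in>sector (1/10) R (- \<i> / t0). det (Y2 z) = 1"
      "uniform_limit D (\<lambda>z t. (\<Phi> z t ** Y2 z) ** exp_diag (- formal_exponent \<theta>i (- \<i> / t0) z t))
       (\<lambda>t. mat22 (exp (P1 t)) 0 0 (exp (P2 t))) (inf at_infinity (principal (sector (1/10) R (- \<i> / t0))))"
    using sec[of "- 1" "- \<i> / t0"] by auto
  define discs where "discs = ordinary_discs \<union> {slit_disc 0, slit_disc 1}"
  have "\<exists>Yd. \<forall>V\<in>discs. (\<forall>z\<in>V. \<forall>i j. ((\<lambda>z. Yd V z $ i $ j) has_field_derivative (- (A z t0 ** Yd V z)) $ i $ j) (at z)) \<and>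
      (\<forall>z\<in>V. det (Yd V z) = 1)"
    unfolding discs_def by (intro bchoice ballI ordinary_fundamental_solution[OF _ holA A22])
  then obtain Yd where Yd: "\<forall>V\<in>discs. (\<forall>z\<in>V. \<forall>i j. ((\<lambda>z. Yd V z $ i $ j) has_field_derivative (- (A z t0 ** Yd V z)) $ i $ j) (at z)) \<and>
      (\<forall>z\<in>V. det (Yd V z) = 1)" ..
  \<comment> \<open>The sectors receive canonical solutions at \<open>t0\<close>; on the remaining
    regions any fundamental solution will do.\<close>
  define Y0 where "Y0 V = (if V = sector (1/10) R (\<i> / t0) then Y1 else if V = sector (1/10) R (- \<i> / t0) then Y2 else Yd V)" for V
  define regions where "regions = ordinary_discs \<union> {slit_disc 0, slit_disc 1} \<union> sector (1/10) R ` us"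
  have Y0: "((\<lambda>z. Y0 V z $ i $ j) has_field_derivative (- (A z t0 ** Y0 V z)) $ i $ j) (at z) \<and> det (Y0 V z) = 1"
    if "V \<in> regions" "z \<in> V" for V z i j
  proof -
    have "V \<in> discs \<or> V = sector (1/10) R (\<i> / t0) \<or> V = sector (1/10) R (- \<i> / t0)"
      using that(1) by (auto simp: regions_def us_def discs_def)
    then consider "V = sector (1/10) R (\<i> / t0)" | "V = sector (1/10) R (- \<i> / t0)" "V \<noteq> sector (1/10) R (\<i> / t0)"
      | "V \<in> discs" "V \<noteq> sector (1/10) R (\<i> / t0)" "V \<noteq> sector (1/10) R (- \<i> / t0)"
      by blast
    then show ?thesis
    proof cases
      case 1 then show ?thesis using Y1(1,2) that by (simp add: Y0_def)
    next
      case 2 then show ?thesis using Y2(1,2) that by (simp add: Y0_def)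
    next
      case 3 then show ?thesis using Yd that by (simp add: Y0_def)
    qed
  qed
  note opn = open_region[of _ "1/10" R us, folded regions_def]
    and ntn = singular_points_notin_region[of _ "1/10" R us, folded regions_def, OF _ R]
  \<comment> \<open>As \<open>\<Phi>\<close> multiplies from the left, it cancels from every
    link.\<close>
  define Y where "Y V z t = \<Phi> z t ** Y0 V z" for V z t
  have Ydet: "det (Y V z t) = 1" if "V \<in> regions" "z \<in> V" "t \<in> D" for V z t
    using Y0[OF that(1,2)] \<Phi>_det[OF D(1)[OF that(3)]] by (simp add: Y_def det_mul)
  have cont\<Phi>: "continuous_on (V \<times> D) (\<lambda>x. \<Phi> (fst x) (snd x) $ i $ j)" for V i j
    by (rule continuous_on_subset[OF \<Phi>_continuous_nth]) (use D in auto)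
  have mat_cont: "continuous_on X F" if "\<And>i j. continuous_on X (\<lambda>x. F x $ i $ j)" for X and F :: "complex \<times> complex \<Rightarrow> mat2"
  proof -
    have "continuous_on X (\<lambda>x. \<chi> i j. F x $ i $ j)" by (intro continuous_on_vec_lambda that)
    then show ?thesis by simp
  qed
  have hol\<Phi>: "(\<lambda>t. \<Phi> z t $ i $ j) holomorphic_on D" for z i j
    by (rule holomorphic_on_subset[OF \<Phi>_holomorphic]) (use D in auto)
  have ent\<Phi>: "(\<lambda>z. \<Phi> z t $ i $ j) holomorphic_on V" if "t \<in> D" for t i j V
    by (rule holomorphic_on_subset[OF \<Phi>_entire[OF D(1)[OF that]]]) simp
  have holY0: "(\<lambda>z. Y0 V z $ i $ j) holomorphic_on V" if "V \<in> regions" for V i j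
    unfolding holomorphic_on_open[OF opn[OF that]] using Y0[OF that] by blast
  have fund: "fundamental_family A V D (Y V)" if V: "V \<in> regions" for V
    unfolding fundamental_family_def
  proof (intro conjI ballI)
    show "holomorphic2_on (Y V) V D"
      unfolding holomorphic2_on_def
    proof (intro conjI ballI allI)
      have cY: "continuous_on (V \<times> D) (\<lambda>x. Y0 V (fst x) $ i $ j)" for i j
        by (rule continuous_on_compose2[OF holomorphic_on_imp_continuous_on[OF holY0[OF V]]])
          (auto intro!: continuous_intros)
      have "continuous_on (V \<times> D) (\<lambda>x. Y V (fst x) (snd x))"
        by (rule mat_cont) (unfold Y_def mat2_mult_nth, intro continuous_on_add continuous_on_mult cont\<Phi> cY)
      then show "continuous_on (V \<times> D) (\<lambda>(z, t). Y V z t)" by (simp add: case_prod_unfold)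
      show "(\<lambda>z. Y V z t $ i $ j) holomorphic_on V" if "t \<in> D" for t i j
        unfolding Y_def mat2_mult_nth by (intro holomorphic_intros ent\<Phi> holY0 V that)
      show "(\<lambda>t. Y V z t $ i $ j) holomorphic_on D" for z i j
        unfolding Y_def mat2_mult_nth by (intro holomorphic_intros hol\<Phi>)
    qed
    fix t z assume t: "t \<in> D" and z: "z \<in> V"
    show "det (Y V z t) \<noteq> 0" using Ydet[OF V z t] by simp
    have z01: "z \<noteq> 0" "z \<noteq> 1" using ntn[OF V] z by auto
    have d\<Phi>: "(\<lambda>z. \<Phi> z t $ i $ j) field_differentiable at z" for i j
      by (rule holomorphic_on_imp_differentiable_at[OF ent\<Phi>[OF t] open_UNIV UNIV_I])
    have dY0: "(\<lambda>z. Y0 V z $ i $ j) field_differentiable at z" for i j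
      by (rule holomorphic_on_imp_differentiable_at[OF holY0[OF V] opn[OF V] z])
    have m0: "mderiv (Y0 V) z = - (A z t0 ** Y0 V z)"
      by (rule mderiv_has_derivative) (use Y0[OF V z] in blast)
    have m\<Phi>: "mderiv (\<lambda>z. \<Phi> z t) z = \<Phi> z t ** A z t0 - A z t ** \<Phi> z t"
      using gauge[OF D(1)[OF t] z01] by (simp add: algebra_simps)
    have "mderiv (\<lambda>z. Y V z t) z = mderiv (\<lambda>z. \<Phi> z t) z ** Y0 V z + \<Phi> z t ** mderiv (Y0 V) z"
      unfolding Y_def by (rule mderiv_mult[OF d\<Phi> dY0])
    also have "\<dots> = - (A z t ** Y V z t)"
      unfolding m0 m\<Phi> Y_def by (simp add: mat2_eq_iff mat2_mult_nth algebra_simps)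
    finally show "mderiv (\<lambda>z. Y V z t) z = - (A z t ** Y V z t)" .
  qed
  \<comment> \<open>\<open>\<Phi>\<close> is entire in \<open>z\<close> with determinant 1, so it is
    a frame at the singular point itself. The basis at \<open>t0\<close>, with all its
    multivaluedness, is the factor free of \<open>t\<close>.\<close>
  have reg: "regular_singular_basis s D (Y (slit_disc s))" for s
    unfolding regular_singular_basis_def
  proof (intro exI[of _ \<Phi>] exI[of _ "Y0 (slit_disc s)"] conjI ballI)
    show "holomorphic2_on \<Phi> (ball s 1) D"
      unfolding holomorphic2_on_def
    proof (intro conjI ballI allI hol\<Phi> ent\<Phi>)
      have "continuous_on (ball s 1 \<times> D) (\<lambda>x. \<Phi> (fst x) (snd x))" by (rule mat_cont) (rule cont\<Phi>)
      then show "continuous_on (ball s 1 \<times> D) (\<lambda>(z, t). \<Phi> z t)" by (simp add: case_prod_unfold)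
    qed
    show "det (\<Phi> z t) \<noteq> 0" if "t \<in> D" for z t using \<Phi>_det[OF D(1)[OF that]] by simp
  qed (simp add: Y_def)
  have neq: "sector (1/10) R (- \<i> / t0) \<noteq> sector (1/10) R (\<i> / t0)"
    using sector_neq[of "\<i> / t0" R] R t0 by auto
  have can: "canonical_bases_at_infinity \<theta>i (1/10) R us D Y"
    unfolding canonical_bases_at_infinity_def
  proof (rule exI[of _ "\<lambda>t. exp (P1 t)"], rule exI[of _ "\<lambda>t. exp (P2 t)"], intro conjI ballI)
    fix u assume "u \<in> us"
    then consider "u = \<i> / t0" | "u = - \<i> / t0" by (auto simp: us_def)
    then show "uniform_limit D (\<lambda>z t. Y (sector (1/10) R u) z t ** exp_diag (- formal_exponent \<theta>i u z t))
        (\<lambda>t. mat22 (exp (P1 t)) 0 0 (exp (P2 t))) (inf at_infinity (principal (sector (1/10) R u)))"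
    proof cases
      case 1
      have "Y0 (sector (1/10) R u) = Y1" by (simp only: Y0_def 1 if_True simp_thms)
      then show ?thesis using Y1(3) unfolding Y_def 1 by simp
    next
      case 2
      have "Y0 (sector (1/10) R u) = Y2" by (simp only: Y0_def 2 neq if_True if_False simp_thms)
      then show ?thesis using Y2(3) unfolding Y_def 2 by simp
    qed
  qed auto
  have link: "matrix_inv (Y V z t) ** Y V' z t = matrix_inv (Y V z t0) ** Y V' z t0"
    if V: "V \<in> regions" "V' \<in> regions" and z: "z \<in> V \<inter> V'" and t: "t \<in> D" for V V' z t
  proof -
    have "matrix_inv (Y V z s) ** Y V' z s = inv2 (Y0 V z) ** Y0 V' z" if s: "s \<in> D" for s
    proof -
      have d: "det (\<Phi> z s) \<noteq> 0" "det (Y0 V z) \<noteq> 0" using \<Phi>_det[OF D(1)[OF s]] Y0[OF V(1)] z by auto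
      have "matrix_inv (Y V z s) = inv2 (\<Phi> z s ** Y0 V z)"
        using matrix_inv_eq_inv2[of "Y V z s"] Ydet[OF V(1) _ s] z by (simp add: Y_def)
      also have "\<dots> = inv2 (Y0 V z) ** inv2 (\<Phi> z s)" by (rule inv2_matrix_mult[OF d])
      finally have "matrix_inv (Y V z s) ** Y V' z s = inv2 (Y0 V z) ** (inv2 (\<Phi> z s) ** \<Phi> z s) ** Y0 V' z"
        by (simp add: Y_def matrix_mul_assoc)
      then show ?thesis using inv2_mult(1)[OF d(1)] by simp
    qed
    then show ?thesis using t t0D by simp
  qed
  have "constant_analytic_data \<theta>i A t0 D"
    unfolding constant_analytic_data_def Let_def us_def[symmetric] regions_def[symmetric]
    by (rule exI[of _ "1/10"], rule exI[of _ R], rule exI[of _ Y])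
      (intro conjI ballI fund reg can link R; simp add: regions_def)
  then show ?thesis
    using r'(1) D(4) unfolding D_def A_def by (intro exI[of _ r']) auto
qed

lemma rational_without_poles_in_affine:
  "rational_without_poles_in S (\<lambda>z. a + b * z)"
  unfolding rational_without_poles_in_def
  by (rule exI[of _ "[:a, b:]"], rule exI[of _ 1]) (simp add: algebra_simps)

lemma rational_tracefree_B_matrix: "rational_tracefree \<theta>0 \<theta>1 T (B_matrix \<theta>0 \<theta>1 \<theta>i p q)"
  unfolding rational_tracefree_def
proof (intro ballI conjI allI)
  fix t assume "t \<in> T"
  have "\<forall>i j. \<exists>a b. (\<lambda>z. B_matrix \<theta>0 \<theta>1 \<theta>i p q z t $ i $ j) = (\<lambda>z. a + b * z)"
    unfolding forall_2
  proof (intro conjI)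
    let ?e = "B_eps \<theta>i (p t) (q t) t / t"
    show "\<exists>a b. (\<lambda>z. B_matrix \<theta>0 \<theta>1 \<theta>i p q z t $ 1 $ 1) = (\<lambda>z. a + b * z)"
      unfolding B_matrix_nth by blast
    show "\<exists>a b. (\<lambda>z. B_matrix \<theta>0 \<theta>1 \<theta>i p q z t $ 1 $ 2) = (\<lambda>z. a + b * z)"
      unfolding B_matrix_nth by (rule exI, rule exI[of _ 0]) simp
    show "\<exists>a b. (\<lambda>z. B_matrix \<theta>0 \<theta>1 \<theta>i p q z t $ 2 $ 1) = (\<lambda>z. a + b * z)"
      unfolding B_matrix_nth by (rule exI, rule exI[of _ 0]) simp
    show "\<exists>a b. (\<lambda>z. B_matrix \<theta>0 \<theta>1 \<theta>i p q z t $ 2 $ 2) = (\<lambda>z. a + b * z)"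
      unfolding B_matrix_nth by (rule exI[of _ "- ?e"], rule exI[of _ "1/2"]) simp
  qed
  then show "rational_without_poles_in (resonant_points \<theta>0 \<theta>1) (\<lambda>z. B_matrix \<theta>0 \<theta>1 \<theta>i p q z t $ i $ j)" for i j
    using rational_without_poles_in_affine by metis
  show "trace (B_matrix \<theta>0 \<theta>1 \<theta>i p q z t) = 0" for z
    by (simp add: trace_mat2 B_matrix_nth(4))
qed

theorem mainTheorem11:
  fixes \<theta>0 \<theta>1 \<theta>i :: complex and T :: "complex set" and p q :: "complex \<Rightarrow> complex"
  assumes "open T" and "connected T" and "0 \<notin> T"
    and "p holomorphic_on T" and "q holomorphic_on T"
    and "\<forall>t\<in>T. q t \<noteq> 0 \<and> q t \<noteq> 1"
  shows
    \<comment> \<open>the commuting operator of an isomonodromic family\<close>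
    "(isomonodromic \<theta>0 \<theta>1 \<theta>i T p q \<longrightarrow>
        rational_tracefree \<theta>0 \<theta>1 T (B_matrix \<theta>0 \<theta>1 \<theta>i p q) \<and>
        commutes T (connection_matrix \<theta>0 \<theta>1 \<theta>i p q) (B_matrix \<theta>0 \<theta>1 \<theta>i p q) \<and>
        (\<forall>B. rational_tracefree \<theta>0 \<theta>1 T B \<and> commutes T (connection_matrix \<theta>0 \<theta>1 \<theta>i p q) B \<longrightarrow>
             (\<forall>t\<in>T. \<forall>z. B z t = B_matrix \<theta>0 \<theta>1 \<theta>i p q z t))) \<and>
     \<comment> \<open>commutation implies the system, and the system describes the isomonodromic families\<close>
     (\<forall>B. rational_tracefree \<theta>0 \<theta>1 T B \<and> commutes T (connection_matrix \<theta>0 \<theta>1 \<theta>i p q) B \<longrightarrow>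
          painleve_system \<theta>0 \<theta>1 \<theta>i T p q) \<and>
     (isomonodromic \<theta>0 \<theta>1 \<theta>i T p q \<longleftrightarrow> painleve_system \<theta>0 \<theta>1 \<theta>i T p q) \<and>
     \<comment> \<open>the second order equation\<close>
     (painleve_system \<theta>0 \<theta>1 \<theta>i T p q \<longleftrightarrow>
        (\<forall>t\<in>T. p t = t * deriv q t / 2) \<and> painleve_second_order \<theta>0 \<theta>1 \<theta>i T q) \<and>
     (painleve_second_order \<theta>0 \<theta>1 \<theta>i T q \<longleftrightarrow>
        (\<exists>p'. p' holomorphic_on T \<and> painleve_system \<theta>0 \<theta>1 \<theta>i T p' q)) \<and>
     \<comment> \<open>the Hamiltonian form\<close>
     (\<forall>P Q t. Q \<noteq> 0 \<and> Q \<noteq> 1 \<and> t \<noteq> 0 \<longrightarrow>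
        rhs_p \<theta>0 \<theta>1 \<theta>i P Q t = Q * (Q - 1) * partial_q (hamiltonian \<theta>0 \<theta>1 \<theta>i) P Q t \<and>
        rhs_q P Q t = - (Q * (Q - 1)) * partial_p (hamiltonian \<theta>0 \<theta>1 \<theta>i) P Q t) \<and>
     (painleve_system \<theta>0 \<theta>1 \<theta>i T p q \<longleftrightarrow> hamiltonian_system \<theta>0 \<theta>1 \<theta>i T p q) \<and>
     \<comment> \<open>the foliation given by the 2-form\<close>
     (\<forall>P Q t vp vq. Q \<noteq> 0 \<and> Q \<noteq> 1 \<and> t \<noteq> 0 \<longrightarrow>
        (spans_foliation \<theta>0 \<theta>1 \<theta>i P Q t vp vq \<longleftrightarrow>
           vp = rhs_p \<theta>0 \<theta>1 \<theta>i P Q t \<and> vq = rhs_q P Q t)) \<and>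
     (isomonodromic \<theta>0 \<theta>1 \<theta>i T p q \<longleftrightarrow>
        (\<forall>t\<in>T. spans_foliation \<theta>0 \<theta>1 \<theta>i (p t) (q t) t (deriv p t) (deriv q t)))"
proof -
  let ?sys = "painleve_system \<theta>0 \<theta>1 \<theta>i T p q"
  let ?A = "connection_matrix \<theta>0 \<theta>1 \<theta>i p q" and ?B = "B_matrix \<theta>0 \<theta>1 \<theta>i p q"
  have nz: "t \<noteq> 0" "q t \<noteq> 0" "q t \<noteq> 1" if "t \<in> T" for t using assms(3,6) that by auto
  have der: "(p has_field_derivative deriv p t) (at t)" "(q has_field_derivative deriv q t) (at t)" if "t \<in> T" for t
    using holomorphic_derivI[OF assms(4) assms(1) that] holomorphic_derivI[OF assms(5) assms(1) that] by simp_all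
  have iso: "isomonodromic \<theta>0 \<theta>1 \<theta>i T p q \<longleftrightarrow> ?sys"
  proof
    assume I: "isomonodromic \<theta>0 \<theta>1 \<theta>i T p q"
    show ?sys
      unfolding painleve_system_def
    proof (intro ballI conjI)
      fix t assume t: "t \<in> T"
      then obtain r where "0 < r" "constant_analytic_data \<theta>i ?A t (ball t r)"
        using I unfolding isomonodromic_def by blast
      from constant_analytic_data_imp_system[OF der[OF t] nz[OF t] this]
      show "deriv q t = rhs_q (p t) (q t) t" "deriv p t = rhs_p \<theta>0 \<theta>1 \<theta>i (p t) (q t) t" .
    qed
  next
    assume ?sys
    then show "isomonodromic \<theta>0 \<theta>1 \<theta>i T p q"
      unfolding isomonodromic_def
      using painleve_system_imp_constant_data[OF assms(1,3) _ assms(4,5,6)] by blast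
  qed
  have lax: "deriv q t = rhs_q (p t) (q t) t \<and> deriv p t = rhs_p \<theta>0 \<theta>1 \<theta>i (p t) (q t) t \<and> B z t = ?B z t"
    if B: "rational_tracefree \<theta>0 \<theta>1 T B" "commutes T ?A B" and t: "t \<in> T" for B t z
  proof -
    have "\<exists>F. finite F \<and> (\<forall>z\<in>- F. mderiv (\<lambda>s. ?A z s) t - mderiv (\<lambda>x. B x t) z + B z t ** ?A z t - ?A z t ** B z t = 0)"
      using B(2) t unfolding commutes_def by (rule bspec)
    then obtain F where F: "finite F"
      "\<forall>z\<in>- F. mderiv (\<lambda>s. ?A z s) t - mderiv (\<lambda>x. B x t) z + B z t ** ?A z t - ?A z t ** B z t = 0"
      by (elim exE conjE)
    have "mderiv (\<lambda>s. ?A z s) t - mderiv (\<lambda>x. B x t) z + B z t ** ?A z t - ?A z t ** B z t = 0" if "z \<notin> F" for z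
      by (rule bspec[OF F(2)]) (simp add: that)
    note lax_eq = this
    have "rational_without_poles_in (resonant_points \<theta>0 \<theta>1) (\<lambda>z. B z t $ i $ j)" "trace (B z t) = 0" for i j z
      using B(1) t unfolding rational_tracefree_def by blast+
    note * = rational_lax_imp_system[OF der[OF t] nz[OF t] F(1) this lax_eq]
    show ?thesis using * by (intro conjI)
  qed
  have com: "commutes T ?A ?B" if ?sys
    unfolding commutes_def
  proof (intro ballI exI[of _ "{0, 1}"] conjI)
    fix t z assume t: "t \<in> T" and z: "z \<in> - {0, 1 :: complex}"
    have "(p has_field_derivative rhs_p \<theta>0 \<theta>1 \<theta>i (p t) (q t) t) (at t)"
        "(q has_field_derivative rhs_q (p t) (q t) t) (at t)"
      using der[OF t] that t by (simp_all add: painleve_system_def)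
    from system_imp_lax[OF this nz[OF t]]
    show "mderiv (\<lambda>s. ?A z s) t - mderiv (\<lambda>x. ?B x t) z + ?B z t ** ?A z t - ?A z t ** ?B z t = 0"
      using z by auto
  qed simp
  have second: "painleve_second_order \<theta>0 \<theta>1 \<theta>i T q \<longleftrightarrow>
      (\<exists>p'. p' holomorphic_on T \<and> painleve_system \<theta>0 \<theta>1 \<theta>i T p' q)"
  proof
    assume *: "painleve_second_order \<theta>0 \<theta>1 \<theta>i T q"
    \<comment> \<open>The partner of \<open>q\<close> is forced by the first equation of the
      system.\<close>
    have hol: "(\<lambda>t. t * deriv q t / 2) holomorphic_on T"
      by (intro holomorphic_intros holomorphic_deriv assms) auto
    then have "painleve_system \<theta>0 \<theta>1 \<theta>i T (\<lambda>t. t * deriv q t / 2) q"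
      using painleve_system_iff_second_order[OF assms(1,3) hol assms(5,6)] * by simp
    with hol show "\<exists>p'. p' holomorphic_on T \<and> painleve_system \<theta>0 \<theta>1 \<theta>i T p' q" by blast
  next
    assume "\<exists>p'. p' holomorphic_on T \<and> painleve_system \<theta>0 \<theta>1 \<theta>i T p' q"
    then show "painleve_second_order \<theta>0 \<theta>1 \<theta>i T q"
      using painleve_system_iff_second_order[OF assms(1,3) _ assms(5,6)] by blast
  qed
  have ham: "?sys \<longleftrightarrow> hamiltonian_system \<theta>0 \<theta>1 \<theta>i T p q"
    unfolding painleve_system_def hamiltonian_system_def
    using hamiltonian_vector_field[OF nz(2,3,1)] by (intro ball_cong) auto
  have fol: "isomonodromic \<theta>0 \<theta>1 \<theta>i T p q \<longleftrightarrow>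
      (\<forall>t\<in>T. spans_foliation \<theta>0 \<theta>1 \<theta>i (p t) (q t) t (deriv p t) (deriv q t))"
    unfolding iso painleve_system_def using spans_foliation_iff[OF nz(2,3,1)] by (intro ball_cong) auto
  show ?thesis
  proof (intro conjI)
    show "isomonodromic \<theta>0 \<theta>1 \<theta>i T p q \<longrightarrow> rational_tracefree \<theta>0 \<theta>1 T ?B \<and> commutes T ?A ?B \<and>
        (\<forall>B. rational_tracefree \<theta>0 \<theta>1 T B \<and> commutes T ?A B \<longrightarrow> (\<forall>t\<in>T. \<forall>z. B z t = ?B z t))"
      using iso com lax rational_tracefree_B_matrix by blast
    show "\<forall>B. rational_tracefree \<theta>0 \<theta>1 T B \<and> commutes T ?A B \<longrightarrow> ?sys"
      unfolding painleve_system_def using lax by blast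
    show "?sys \<longleftrightarrow> (\<forall>t\<in>T. p t = t * deriv q t / 2) \<and> painleve_second_order \<theta>0 \<theta>1 \<theta>i T q"
      by (rule painleve_system_iff_second_order[OF assms(1,3,4,5,6)])
    show "\<forall>P Q t. Q \<noteq> 0 \<and> Q \<noteq> 1 \<and> t \<noteq> 0 \<longrightarrow>
        rhs_p \<theta>0 \<theta>1 \<theta>i P Q t = Q * (Q - 1) * partial_q (hamiltonian \<theta>0 \<theta>1 \<theta>i) P Q t \<and>
        rhs_q P Q t = - (Q * (Q - 1)) * partial_p (hamiltonian \<theta>0 \<theta>1 \<theta>i) P Q t"
      using hamiltonian_vector_field by metis
    show "\<forall>P Q t vp vq. Q \<noteq> 0 \<and> Q \<noteq> 1 \<and> t \<noteq> 0 \<longrightarrow>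
        (spans_foliation \<theta>0 \<theta>1 \<theta>i P Q t vp vq \<longleftrightarrow> vp = rhs_p \<theta>0 \<theta>1 \<theta>i P Q t \<and> vq = rhs_q P Q t)"
      using spans_foliation_iff by blast
  qed (rule iso second ham fol)+
qed

end
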